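(* Let $k,r$ be positive integers, let $p:\oplus_{i=1}^r\mathcal{O}_{\mathbb{CP}^1}(-k)\rightarrow \mathbb{CP}^1$ be the bundle projection, and let $L:=p^{*}\mathcal{O}_{\mathbb{CP}^1}(k)$ be the pull-back line bundle, with bundle projection $\Pi:L\rightarrow \oplus_{i=1}^r\mathcal{O}_{\mathbb{CP}^1}(-k)$. (I) Suppose $kr>1$, and set $h=\oplus_{i=1}^rh_{FS}^{-k}$, $\lambda=\frac{k(r+1)}{kr-1}$, $$M=\left\{v\in \oplus_{i=1}^r\mathcal{O}_{\mathbb{CP}^1}(-k): h(v,v)<1\right\}$$ and $$h_F(u,u)=\big(1-h(\Pi(u),\Pi(u))\big)^{\lambda}\,(p^{*}h_{FS}^k)(u,u),\quad u\in L|_{M}.$$ Let $g_F$ be the Kähler metric associated with the Kähler form $\omega_F:=c_1(L,h_F)$ on $M$. Then $(L|_{M},h_F)$ is a quantum line bundle over $(M,g_F)$, and the metrics $mg_F$ are balanced metrics on $M$ for all integers $m\geq r$. (II) Suppose $c>0$ and $k=r=1$, and let $M=\mathcal{O}_{\mathbb{CP}^1}(-1)$. Let $g_F$ be the Kähler metric associated with the Kähler form $\omega_F:=c_1(L,h_F)$ on $M$, where $$h_F(u,u)=e^{-c\, h_{FS}^{-1}(\Pi(u),\Pi(u))}\,(p^{*}h_{FS})(u,u),\quad u\in L.$$ Then $(L,h_F)$ is a quantum line bundle over $(M,g_F)$, and the metrics $mg_F$ are balanced metrics on $M$ for all integers $m\geq 1$.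
   Context: $\mathcal{O}_{\mathbb{CP}^1}(1)$ is the hyperplane line bundle on $\mathbb{CP}^1$, equipped with the Hermitian metric $h_{FS}$ with $c_1(\mathcal{O}_{\mathbb{CP}^1}(1),h_{FS})=\omega_{FS}$, the standard Fubini-Study form; in the standard affine trivializations ($w$ the affine coordinate, $\zeta$ the fibre coordinate) $h_{FS}=\frac{|\zeta|^2}{1+|w|^2}$ and $\omega_{FS}=\frac{\sqrt{-1}}{2\pi}\partial\bar\partial\log(1+|w|^2)$. $(\mathcal{O}_{\mathbb{CP}^1}(k),h_{FS}^k)$ is the $k$-th tensor power and $(\mathcal{O}_{\mathbb{CP}^1}(-k),h_{FS}^{-k})$ is its dual Hermitian bundle. Quantum line bundle: for a Kähler manifold $M$ with Kähler metric $g$ and Kähler form $\omega$, a quantum line bundle is a positive Hermitian holomorphic line bundle $(L,h)$ over $M$ with $c_1(L,h)=\omega$, where $c_1(L,h)=-\frac{\sqrt{-1}}{2\pi}\partial\bar\partial\log h(\sigma,\sigma)$ for any local nowhere vanishing holomorphic section $\sigma$. Bergman function and balanced metric: with $n=\dim_{\mathbb C}M$, let $\mathcal{H}_m^2(M)=\{s\in H^0(M,L^m):\|s\|^2=\int_M h^m(s,s)\frac{\omega^n}{n!}<+\infty\}$. If this space is nonzero, $\epsilon_{mg}(z)=\sum_j h^m(s_j(z),s_j(z))$ for an orthonormal basis $\{s_j\}$ of $\mathcal{H}^2_m(M)$. The metric $mg$ is balanced if $\epsilon_{mg}$ is a positive constant on $M$. *)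

theory Defs
  imports "HOL-Analysis.Analysis"
begin

section \<open>Calculus on open subsets of complex n-space\<close>

primrec Ck_on :: "nat \<Rightarrow> ('a::real_normed_vector \<Rightarrow> 'b::real_normed_vector) \<Rightarrow> 'a set \<Rightarrow> bool" where
  "Ck_on 0 f S \<longleftrightarrow> continuous_on S f"
| "Ck_on (Suc n) f S \<longleftrightarrow>
     (\<forall>x\<in>S. f differentiable at x) \<and> (\<forall>v. Ck_on n (\<lambda>x. frechet_derivative f (at x) v) S)"

definition smooth_on :: "('a::real_normed_vector \<Rightarrow> 'b::real_normed_vector) \<Rightarrow> 'a set \<Rightarrow> bool" where
  "smooth_on f S \<longleftrightarrow> (\<forall>n. Ck_on n f S)"

text \<open>Holomorphy in several variables (for open sets): real differentiability with a
  complex-linear derivative.\<close>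

definition holo_on :: "(complex ^ 'n \<Rightarrow> complex) \<Rightarrow> (complex ^ 'n) set \<Rightarrow> bool" where
  "holo_on f S \<longleftrightarrow>
     (\<forall>z\<in>S. \<exists>D. (f has_derivative D) (at z) \<and> (\<forall>c v. D (c *s v) = c * D v))"

text \<open>The Wirtinger derivatives \<open>\<partial>f/\<partial>z\<^sub>j\<close> and \<open>\<partial>f/\<partial>z\<close>-bar\<open>\<^sub>j\<close>.\<close>

definition wirt :: "'n \<Rightarrow> (complex ^ 'n \<Rightarrow> complex) \<Rightarrow> complex ^ 'n \<Rightarrow> complex" where
  "wirt j f z = (frechet_derivative f (at z) (axis j 1)
                 - \<i> * frechet_derivative f (at z) (axis j \<i>)) / 2"

definition wirt_bar :: "'n \<Rightarrow> (complex ^ 'n \<Rightarrow> complex) \<Rightarrow> complex ^ 'n \<Rightarrow> complex" where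
  "wirt_bar j f z = (frechet_derivative f (at z) (axis j 1)
                     + \<i> * frechet_derivative f (at z) (axis j \<i>)) / 2"

section \<open>Complex manifolds\<close>

text \<open>A complex manifold of dimension \<open>CARD('n)\<close> is presented by a finite atlas indexed by \<open>'i\<close>;
  bundles over it will be trivialized over the chart domains.\<close>

record ('p, 'i, 'n) cmanifold =
  points :: "'p set"
  cdom :: "'i \<Rightarrow> 'p set"
  chart :: "'i \<Rightarrow> 'p \<Rightarrow> complex ^ 'n"

definition chart_inv :: "('p, 'i, 'n::finite) cmanifold \<Rightarrow> 'i \<Rightarrow> complex ^ 'n \<Rightarrow> 'p" where
  "chart_inv M i = inv_into (cdom M i) (chart M i)"

definition manifold_topology :: "('p, 'i, 'n::finite) cmanifold \<Rightarrow> 'p topology" where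
  "manifold_topology M =
     topology (\<lambda>S. S \<subseteq> points M \<and> (\<forall>i. open (chart M i ` (S \<inter> cdom M i))))"

definition complex_manifold :: "('p, 'i::finite, 'n::finite) cmanifold \<Rightarrow> bool" where
  "complex_manifold M \<longleftrightarrow>
     points M \<noteq> {} \<and>
     points M = (\<Union>i. cdom M i) \<and>
     (\<forall>i. inj_on (chart M i) (cdom M i)) \<and>
     (\<forall>i j. open (chart M i ` (cdom M i \<inter> cdom M j))) \<and>
     (\<forall>i j a. holo_on (\<lambda>z. chart M j (chart_inv M i z) $ a)
                 (chart M i ` (cdom M i \<inter> cdom M j))) \<and>
     Hausdorff_space (manifold_topology M)"

definition submanifold :: "('p, 'i, 'n::finite) cmanifold \<Rightarrow> 'p set \<Rightarrow> ('p, 'i, 'n) cmanifold" where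
  "submanifold M S =
     \<lparr>points = points M \<inter> S, cdom = (\<lambda>i. cdom M i \<inter> S), chart = chart M\<rparr>"

section \<open>Kaehler forms and their volume\<close>

text \<open>A real (1,1)-form \<open>\<omega>\<close> is given by its coefficient matrices \<open>\<omega> i q\<close> in the charts:
  in the coordinates \<open>z\<close> of chart \<open>i\<close> the form is \<open>\<i> \<Sum>\<^sub>a\<^sub>b (\<omega> i q $ a $ b) dz\<^sub>a \<and> d(cnj z\<^sub>b)\<close>.
  The same matrices are the coefficients of the associated Kaehler metric.\<close>

type_synonym ('p, 'i, 'n) form11 = "'i \<Rightarrow> 'p \<Rightarrow> complex ^ 'n ^ 'n"

definition hermitian_form :: "('p, 'i, 'n::finite) cmanifold \<Rightarrow> ('p, 'i, 'n) form11 \<Rightarrow> bool" where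
  "hermitian_form M \<omega> \<longleftrightarrow>
     (\<forall>i. \<forall>q\<in>cdom M i. \<forall>a b. \<omega> i q $ b $ a = cnj (\<omega> i q $ a $ b))"

definition positive_form :: "('p, 'i, 'n::finite) cmanifold \<Rightarrow> ('p, 'i, 'n) form11 \<Rightarrow> bool" where
  "positive_form M \<omega> \<longleftrightarrow> hermitian_form M \<omega> \<and>
     (\<forall>i. \<forall>q\<in>cdom M i. \<forall>v. v \<noteq> 0 \<longrightarrow>
        0 < Re (\<Sum>a\<in>UNIV. \<Sum>b\<in>UNIV. \<omega> i q $ a $ b * v $ a * cnj (v $ b)))"

definition smooth_form :: "('p, 'i, 'n::finite) cmanifold \<Rightarrow> ('p, 'i, 'n) form11 \<Rightarrow> bool" where
  "smooth_form M \<omega> \<longleftrightarrow>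
     (\<forall>i a b. smooth_on (\<lambda>z. \<omega> i (chart_inv M i z) $ a $ b) (chart M i ` cdom M i)) \<and>
     (\<forall>i j. \<forall>q \<in> cdom M i \<inter> cdom M j. \<forall>a b.
        \<omega> i q $ a $ b =
          (\<Sum>c\<in>UNIV. \<Sum>d\<in>UNIV.
             wirt a (\<lambda>z. chart M j (chart_inv M i z) $ c) (chart M i q)
             * cnj (wirt b (\<lambda>z. chart M j (chart_inv M i z) $ d) (chart M i q))
             * \<omega> j q $ c $ d))"

definition closed_form :: "('p, 'i, 'n::finite) cmanifold \<Rightarrow> ('p, 'i, 'n) form11 \<Rightarrow> bool" where
  "closed_form M \<omega> \<longleftrightarrow>
     (\<forall>i. \<forall>z \<in> chart M i ` cdom M i. \<forall>a b c.
        wirt c (\<lambda>z. \<omega> i (chart_inv M i z) $ a $ b) z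
          = wirt a (\<lambda>z. \<omega> i (chart_inv M i z) $ c $ b) z \<and>
        wirt_bar c (\<lambda>z. \<omega> i (chart_inv M i z) $ a $ b) z
          = wirt_bar b (\<lambda>z. \<omega> i (chart_inv M i z) $ a $ c) z)"

definition kaehler_form :: "('p, 'i, 'n::finite) cmanifold \<Rightarrow> ('p, 'i, 'n) form11 \<Rightarrow> bool" where
  "kaehler_form M \<omega> \<longleftrightarrow> smooth_form M \<omega> \<and> closed_form M \<omega> \<and> positive_form M \<omega>"

text \<open>The density of \<open>\<omega>\<^sup>n/n!\<close> with respect to Lebesgue measure in chart \<open>i\<close>.  Expanding the
  exterior power, \<open>dz\<^sub>\<sigma>\<^sub>1 \<and> d(cnj z\<^sub>\<tau>\<^sub>1) \<and> \<dots> \<and> dz\<^sub>\<sigma>\<^sub>n \<and> d(cnj z\<^sub>\<tau>\<^sub>n)\<close> vanishes unless \<open>\<sigma>\<close> and \<open>\<tau>\<close> are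
  permutations, and then equals \<open>sign \<sigma> * sign \<tau>\<close> times
  \<open>dz\<^sub>1 \<and> d(cnj z\<^sub>1) \<and> \<dots> \<and> dz\<^sub>n \<and> d(cnj z\<^sub>n)\<close>; moreover \<open>\<i> dz \<and> d(cnj z) = 2 dx \<and> dy\<close>.\<close>

definition vol_density :: "('p, 'i, 'n::finite) form11 \<Rightarrow> 'i \<Rightarrow> 'p \<Rightarrow> real" where
  "vol_density \<omega> i q =
     2 ^ CARD('n) / fact CARD('n) *
     Re (\<Sum>\<sigma> | \<sigma> permutes (UNIV::'n set). \<Sum>\<tau> | \<tau> permutes (UNIV::'n set).
           of_int (sign \<sigma>) * of_int (sign \<tau>) * (\<Prod>a\<in>UNIV. \<omega> i q $ \<sigma> a $ \<tau> a))"

text \<open>To integrate, the manifold is cut into disjoint pieces, each inside one chart domain.\<close>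

definition piece :: "('p, 'i::linorder, 'n::finite) cmanifold \<Rightarrow> 'i \<Rightarrow> 'p set" where
  "piece M i = cdom M i - (\<Union>j\<in>{..<i}. cdom M j)"

definition vol_integrable ::
    "('p, 'i::{finite,linorder}, 'n::finite) cmanifold \<Rightarrow> ('p, 'i, 'n) form11 \<Rightarrow> ('p \<Rightarrow> complex) \<Rightarrow> bool" where
  "vol_integrable M \<omega> f \<longleftrightarrow>
     (\<forall>i. set_integrable lborel (chart M i ` piece M i)
            (\<lambda>z. of_real (vol_density \<omega> i (chart_inv M i z)) * f (chart_inv M i z)))"

definition vol_integral ::
    "('p, 'i::{finite,linorder}, 'n::finite) cmanifold \<Rightarrow> ('p, 'i, 'n) form11 \<Rightarrow> ('p \<Rightarrow> complex) \<Rightarrow> complex" where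
  "vol_integral M \<omega> f =
     (\<Sum>i\<in>UNIV. set_lebesgue_integral lborel (chart M i ` piece M i)
            (\<lambda>z. of_real (vol_density \<omega> i (chart_inv M i z)) * f (chart_inv M i z)))"

section \<open>Hermitian holomorphic line bundles\<close>

text \<open>A line bundle is given by its transition functions: a point of the fibre over \<open>q\<close> has a
  fibre coordinate \<open>\<zeta> i\<close> in every trivialization \<open>i\<close> with \<open>q\<close> in its domain (and \<open>\<zeta> i = 0\<close> for the
  other \<open>i\<close>), and \<open>\<zeta> i = g i j q * \<zeta> j\<close>.  A Hermitian metric is given by the squared norms \<open>h i\<close>
  of the holomorphic frames \<open>\<zeta> i = 1\<close>.\<close>

type_synonym ('p, 'i) line_bundle = "'i \<Rightarrow> 'i \<Rightarrow> 'p \<Rightarrow> complex"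
type_synonym ('p, 'i) metric = "'i \<Rightarrow> 'p \<Rightarrow> real"

definition holomorphic_line_bundle ::
    "('p, 'i, 'n::finite) cmanifold \<Rightarrow> ('p, 'i) line_bundle \<Rightarrow> bool" where
  "holomorphic_line_bundle M g \<longleftrightarrow>
     (\<forall>i. \<forall>q\<in>cdom M i. g i i q = 1) \<and>
     (\<forall>i j k. \<forall>q \<in> cdom M i \<inter> cdom M j \<inter> cdom M k. g i j q * g j k q = g i k q) \<and>
     (\<forall>i j. holo_on (\<lambda>z. g i j (chart_inv M i z)) (chart M i ` (cdom M i \<inter> cdom M j)))"

definition hermitian_metric ::
    "('p, 'i, 'n::finite) cmanifold \<Rightarrow> ('p, 'i) line_bundle \<Rightarrow> ('p, 'i) metric \<Rightarrow> bool" where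
  "hermitian_metric M g h \<longleftrightarrow>
     (\<forall>i. \<forall>q\<in>cdom M i. 0 < h i q) \<and>
     (\<forall>i. smooth_on (\<lambda>z. h i (chart_inv M i z)) (chart M i ` cdom M i)) \<and>
     (\<forall>i j. \<forall>q \<in> cdom M i \<inter> cdom M j. h j q = (cmod (g i j q))\<^sup>2 * h i q)"

definition fibre :: "('p, 'i, 'n::finite) cmanifold \<Rightarrow> ('p, 'i) line_bundle \<Rightarrow> 'p \<Rightarrow> ('i \<Rightarrow> complex) set" where
  "fibre M g q = {\<zeta>. (\<forall>i. q \<notin> cdom M i \<longrightarrow> \<zeta> i = 0) \<and>
     (\<forall>i j. q \<in> cdom M i \<inter> cdom M j \<longrightarrow> \<zeta> i = g i j q * \<zeta> j)}"

text \<open>The Hermitian inner product on the fibre over \<open>q\<close>; on fibre elements the choice of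
  trivialization does not matter.\<close>

definition herm ::
    "('p, 'i, 'n::finite) cmanifold \<Rightarrow> ('p, 'i) metric \<Rightarrow> 'p \<Rightarrow> ('i \<Rightarrow> complex) \<Rightarrow> ('i \<Rightarrow> complex) \<Rightarrow> complex" where
  "herm M h q \<zeta> \<eta> =
     (let i = (SOME i. q \<in> cdom M i) in of_real (h i q) * \<zeta> i * cnj (\<eta> i))"

definition bundle_power :: "('p, 'i) line_bundle \<Rightarrow> nat \<Rightarrow> ('p, 'i) line_bundle" where
  "bundle_power g m = (\<lambda>i j q. g i j q ^ m)"

definition metric_power :: "('p, 'i) metric \<Rightarrow> nat \<Rightarrow> ('p, 'i) metric" where
  "metric_power h m = (\<lambda>i q. h i q ^ m)"

definition bundle_dual :: "('p, 'i) line_bundle \<Rightarrow> ('p, 'i) line_bundle" where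
  "bundle_dual g = (\<lambda>i j q. inverse (g i j q))"

definition metric_dual :: "('p, 'i) metric \<Rightarrow> ('p, 'i) metric" where
  "metric_dual h = (\<lambda>i q. inverse (h i q))"

text \<open>Pull-back along a map for which the chart domains upstairs lie over those downstairs.\<close>

definition bundle_pullback :: "('q \<Rightarrow> 'p) \<Rightarrow> ('p, 'i) line_bundle \<Rightarrow> ('q, 'i) line_bundle" where
  "bundle_pullback f g = (\<lambda>i j q. g i j (f q))"

definition metric_pullback :: "('q \<Rightarrow> 'p) \<Rightarrow> ('p, 'i) metric \<Rightarrow> ('q, 'i) metric" where
  "metric_pullback f h = (\<lambda>i q. h i (f q))"

definition metric_scale :: "('p \<Rightarrow> real) \<Rightarrow> ('p, 'i) metric \<Rightarrow> ('p, 'i) metric" where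
  "metric_scale f h = (\<lambda>i q. f q * h i q)"

text \<open>The form \<open>- \<i>/(2\<pi>) \<partial>\<partial>bar log h(\<sigma>,\<sigma>)\<close>, with \<open>\<sigma>\<close> the frame of trivialization \<open>i\<close>.\<close>

definition chern_form ::
    "('p, 'i, 'n::finite) cmanifold \<Rightarrow> ('p, 'i) metric \<Rightarrow> ('p, 'i, 'n) form11" where
  "chern_form M h = (\<lambda>i q. \<chi> a b.
     - (1 / of_real (2 * pi)) *
       wirt a (wirt_bar b (\<lambda>z. of_real (ln (h i (chart_inv M i z))))) (chart M i q))"

definition quantum_line_bundle ::
    "('p, 'i::finite, 'n::finite) cmanifold \<Rightarrow> ('p, 'i, 'n) form11 \<Rightarrow>
     ('p, 'i) line_bundle \<Rightarrow> ('p, 'i) metric \<Rightarrow> bool" where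
  "quantum_line_bundle M \<omega> L h \<longleftrightarrow>
     complex_manifold M \<and> kaehler_form M \<omega> \<and>
     holomorphic_line_bundle M L \<and> hermitian_metric M L h \<and>
     positive_form M (chern_form M h) \<and>
     (\<forall>i. \<forall>q\<in>cdom M i. chern_form M h i q = \<omega> i q)"

section \<open>Bergman functions and balanced metrics\<close>

text \<open>Sections are zero outside the manifold, because \<open>fibre M g q\<close> contains only 0 there.\<close>

definition holomorphic_section ::
    "('p, 'i, 'n::finite) cmanifold \<Rightarrow> ('p, 'i) line_bundle \<Rightarrow> ('p \<Rightarrow> 'i \<Rightarrow> complex) \<Rightarrow> bool" where
  "holomorphic_section M g s \<longleftrightarrow>
     (\<forall>q. s q \<in> fibre M g q) \<and>
     (\<forall>i. holo_on (\<lambda>z. s (chart_inv M i z) i) (chart M i ` cdom M i))"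

definition L2_inner ::
    "('p, 'i::{finite,linorder}, 'n::finite) cmanifold \<Rightarrow> ('p, 'i, 'n) form11 \<Rightarrow> ('p, 'i) metric \<Rightarrow>
     ('p \<Rightarrow> 'i \<Rightarrow> complex) \<Rightarrow> ('p \<Rightarrow> 'i \<Rightarrow> complex) \<Rightarrow> complex" where
  "L2_inner M \<omega> h s t = vol_integral M \<omega> (\<lambda>q. herm M h q (s q) (t q))"

definition bergman_space ::
    "('p, 'i::{finite,linorder}, 'n::finite) cmanifold \<Rightarrow> ('p, 'i, 'n) form11 \<Rightarrow>
     ('p, 'i) line_bundle \<Rightarrow> ('p, 'i) metric \<Rightarrow> nat \<Rightarrow> ('p \<Rightarrow> 'i \<Rightarrow> complex) set" where
  "bergman_space M \<omega> L h m =
     {s. holomorphic_section M (bundle_power L m) s \<and>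
         vol_integrable M \<omega> (\<lambda>q. herm M (metric_power h m) q (s q) (s q))}"

text \<open>Orthonormal basis in the sense of Hilbert spaces: orthonormal with dense linear span.\<close>

definition orthonormal_basis ::
    "('p, 'i::{finite,linorder}, 'n::finite) cmanifold \<Rightarrow> ('p, 'i, 'n) form11 \<Rightarrow>
     ('p, 'i) line_bundle \<Rightarrow> ('p, 'i) metric \<Rightarrow> nat \<Rightarrow> ('p \<Rightarrow> 'i \<Rightarrow> complex) set \<Rightarrow> bool" where
  "orthonormal_basis M \<omega> L h m B \<longleftrightarrow>
     B \<subseteq> bergman_space M \<omega> L h m \<and>
     (\<forall>s\<in>B. \<forall>t\<in>B. L2_inner M \<omega> (metric_power h m) s t = (if s = t then 1 else 0)) \<and>
     (\<forall>f\<in>bergman_space M \<omega> L h m. \<forall>e>0. \<exists>F c. finite F \<and> F \<subseteq> B \<and>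
        (let d = (\<lambda>q i. f q i - (\<Sum>s\<in>F. c s * s q i))
         in Re (L2_inner M \<omega> (metric_power h m) d d) < e\<^sup>2))"

definition bergman_function ::
    "('p, 'i::{finite,linorder}, 'n::finite) cmanifold \<Rightarrow> ('p, 'i, 'n) form11 \<Rightarrow>
     ('p, 'i) line_bundle \<Rightarrow> ('p, 'i) metric \<Rightarrow> nat \<Rightarrow> 'p \<Rightarrow> real" where
  "bergman_function M \<omega> L h m q =
     (\<Sum>\<^sub>\<infinity>s\<in>(SOME B. orthonormal_basis M \<omega> L h m B). Re (herm M (metric_power h m) q (s q) (s q)))"

text \<open>The metric \<open>m g\<close> is balanced, where \<open>\<omega>\<close> is the Kaehler form of \<open>g\<close>.\<close>

definition balanced ::
    "('p, 'i::{finite,linorder}, 'n::finite) cmanifold \<Rightarrow> ('p, 'i, 'n) form11 \<Rightarrow>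
     ('p, 'i) line_bundle \<Rightarrow> ('p, 'i) metric \<Rightarrow> nat \<Rightarrow> bool" where
  "balanced M \<omega> L h m \<longleftrightarrow>
     (\<exists>s\<in>bergman_space M \<omega> L h m. \<exists>q\<in>points M. \<exists>i. s q i \<noteq> 0) \<and>
     (\<exists>C>0. \<forall>q\<in>points M. bergman_function M \<omega> L h m q = C)"

section \<open>The total space of a direct sum of line bundles\<close>

definition sum_bundle ::
    "('p, 'i, 'n::finite) cmanifold \<Rightarrow> ('r::finite \<Rightarrow> ('p, 'i) line_bundle) \<Rightarrow>
     ('p \<times> ('i \<Rightarrow> complex ^ 'r), 'i, 'n + 'r) cmanifold" where
  "sum_bundle X g =
     (let T = {(p, \<xi>). p \<in> points X \<and> (\<forall>i. p \<notin> cdom X i \<longrightarrow> \<xi> i = 0) \<and>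
               (\<forall>i j a. p \<in> cdom X i \<inter> cdom X j \<longrightarrow> \<xi> i $ a = g a i j p * \<xi> j $ a)}
      in \<lparr>points = T,
          cdom = (\<lambda>i. {v \<in> T. fst v \<in> cdom X i}),
          chart = (\<lambda>i v. \<chi> a. case a of Inl b \<Rightarrow> chart X i (fst v) $ b | Inr b \<Rightarrow> snd v i $ b)\<rparr>)"

text \<open>The squared norm of a point of the total space in the direct sum metric.\<close>

definition sum_metric ::
    "('p, 'i, 'n::finite) cmanifold \<Rightarrow> ('r::finite \<Rightarrow> ('p, 'i) metric) \<Rightarrow> 'p \<times> ('i \<Rightarrow> complex ^ 'r) \<Rightarrow> real" where
  "sum_metric X h v =
     (let i = (SOME i. fst v \<in> cdom X i)
      in \<Sum>a\<in>UNIV. h a i (fst v) * (cmod (snd v i $ a))\<^sup>2)"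

section \<open>The projective line and its hyperplane bundle\<close>

text \<open>Points are lines through the origin in \<open>complex ^ 2\<close> with homogeneous coordinates \<open>z\<^sub>0, z\<^sub>1\<close>;
  \<open>hom_rep j l $ a\<close> is the ratio \<open>z\<^sub>a / z\<^sub>j\<close> on \<open>l\<close>.  The index type 2 has the elements 0 and 1,
  so \<open>j + 1\<close> is the index other than \<open>j\<close>.\<close>

definition hom_rep :: "2 \<Rightarrow> (complex ^ 2) set \<Rightarrow> complex ^ 2" where
  "hom_rep j l = (THE v. v \<in> l \<and> v $ j = 1)"

definition CP1 :: "((complex ^ 2) set, 2, 1) cmanifold" where
  "CP1 = (let P = {l. \<exists>v. v \<noteq> 0 \<and> l = range (\<lambda>c. c *s v)}
     in \<lparr>points = P,
         cdom = (\<lambda>j. {l \<in> P. \<exists>v\<in>l. v $ j \<noteq> 0}),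
         chart = (\<lambda>j l. \<chi> a. hom_rep j l $ (j + 1))\<rparr>)"

text \<open>The frame in trivialization \<open>i\<close> is the linear form \<open>z\<^sub>i\<close>, so \<open>z\<^sub>j = (z\<^sub>j / z\<^sub>i) * z\<^sub>i\<close> gives the
  transition function, and \<open>\<bar>z\<^sub>i\<bar>\<^sup>2 / (\<bar>z\<^sub>0\<bar>\<^sup>2 + \<bar>z\<^sub>1\<bar>\<^sup>2) = 1 / (1 + \<bar>w\<bar>\<^sup>2)\<close> is its squared norm.\<close>

definition hyperplane_bundle :: "((complex ^ 2) set, 2) line_bundle" where
  "hyperplane_bundle = (\<lambda>i j l. hom_rep i l $ j)"

definition h_FS :: "((complex ^ 2) set, 2) metric" where
  "h_FS = (\<lambda>i l. 1 / (1 + (cmod (hom_rep i l $ (i + 1)))\<^sup>2))"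

end

theory Submission
  imports Defs "HOL-Complex_Analysis.Cauchy_Integral_Formula"
begin

text \<open>In the chart with base coordinate \<open>w\<close> and fibre coordinates \<open>\<xi>\<close> the metric of \<open>L\<close> is
  \<open>exp (- \<Phi>)\<close> with \<open>\<Phi> = k * ln (1 + \<bar>w\<bar>\<^sup>2) + f u\<close>, where \<open>u = \<bar>\<xi>\<bar>\<^sup>2 * (1 + \<bar>w\<bar>\<^sup>2) ^ k\<close> is the squared
  norm, and \<open>f u = - \<lambda> * ln (1 - u)\<close> or \<open>f u = c * u\<close>.  The Hessian of \<open>\<Phi>\<close> and the volume density are
  explicit and depend only on the moduli of the coordinates.  Hence the monomials are orthogonal in
  the Bergman space, and since the chart domain is a complete Reinhardt domain, holomorphic sections
  have convergent power series there, Parseval's identity holds, and the normalized monomials form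
  an orthonormal basis.  Their norms are Dirichlet, Beta and (in the fibre radius) one-dimensional
  moments, and summing the kernel over the base exponent (a binomial sum), over the fibre exponents
  of fixed degree (a multinomial sum) and over the degree (a binomial or exponential series) gives
  exactly a constant multiple of \<open>exp (m * \<Phi>)\<close>.  The value of the kernel on the diagonal does not
  depend on the orthonormal basis, being the squared norm of the evaluation functional.\<close>

section \<open>Power series in several complex variables\<close>

text \<open>The constants are dictated by the last summation. Summing over the base exponent for
  fibre degree \<open>d\<close> produces a factor \<open>k * (m + d) + 1\<close>, so the kernel
  closes up if the fibre moment \<open>I d\<close> carries a factor proportional to it. For the disc
  bundle the moment carries \<open>\<lambda> * (m + d + r) - (r + 1)\<close>, and proportionality
  for all \<open>d\<close> forces \<open>\<lambda> * (k * r - 1) = k * (r + 1)\<close>. For the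
  exponential metric it carries \<open>m + d + 1\<close>, which fits \<open>k = 1\<close>. The bound
  \<open>m \<ge> r\<close> makes the Beta exponent \<open>q = \<lambda> * m - r - 1\<close>
  positive, because \<open>\<lambda> * r > r + 1\<close>. The obstacle is that
  \<open>bergman_function\<close> is formed from an arbitrarily chosen orthonormal basis. So
  evaluation is first bounded by the explicit kernel, through Cauchy-Schwarz and Parseval, and any
  other basis is then compared with the monomials through finite sums and approximation. Parseval's
  identity is stated in the extended nonnegative reals: a monomial of infinite norm must have
  coefficient 0, so square integrability in a single chart already selects the sections that extend
  over the other one.\<close>

definition vec_upd :: "'a ^ 'n \<Rightarrow> 'n \<Rightarrow> 'a \<Rightarrow> 'a ^ 'n" where
  "vec_upd z i t = (\<chi> j. if j = i then t else z $ j)"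

lemma vec_upd_nth [simp]: "vec_upd z i t $ j = (if j = i then t else z $ j)"
  by (simp add: vec_upd_def)

lemma vec_upd_same [simp]: "vec_upd z i (z $ i) = z"
  by (simp add: vec_eq_iff)

lemma vec_upd_twice [simp]: "vec_upd (vec_upd z i s) i t = vec_upd z i t"
  by (simp add: vec_eq_iff)

lemma vec_upd_commute: "i \<noteq> j \<Longrightarrow> vec_upd (vec_upd z i s) j t = vec_upd (vec_upd z j t) i s"
  by (simp add: vec_eq_iff)

definition polydisc :: "('n \<Rightarrow> real) \<Rightarrow> (complex ^ 'n) set" where
  "polydisc \<rho> = {z. \<forall>i. cmod (z $ i) < \<rho> i}"

lemma vec_upd_polydisc: "z \<in> polydisc \<rho> \<Longrightarrow> cmod t < \<rho> i \<Longrightarrow> vec_upd z i t \<in> polydisc \<rho>"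
  by (simp add: polydisc_def)

text \<open>Holomorphy is asked in each variable separately: this is what survives taking a Taylor
  coefficient in one variable, so an induction over the variables can run on it.\<close>

definition sep_holo :: "('n \<Rightarrow> real) \<Rightarrow> (complex ^ 'n \<Rightarrow> complex) \<Rightarrow> bool" where
  "sep_holo \<rho> f \<longleftrightarrow> (\<forall>z\<in>polydisc \<rho>. \<forall>i. (\<lambda>t. f (vec_upd z i t)) holomorphic_on ball 0 (\<rho> i))"

definition taylor_coeff :: "'n \<Rightarrow> nat \<Rightarrow> (complex ^ 'n \<Rightarrow> complex) \<Rightarrow> complex ^ 'n \<Rightarrow> complex" where
  "taylor_coeff i n f z = (deriv ^^ n) (\<lambda>t. f (vec_upd z i t)) 0 / fact n"

lemma taylor_coeff_upd [simp]: "taylor_coeff i n f (vec_upd z i t) = taylor_coeff i n f z"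
  by (simp add: taylor_coeff_def)

lemma taylor_coeff_bound:
  assumes f: "sep_holo \<rho> f" and B: "\<And>z. z \<in> polydisc \<rho> \<Longrightarrow> cmod (f z) \<le> B"
    and \<rho>: "\<And>i. 0 < \<rho> i" and z: "z \<in> polydisc \<rho>"
  shows "cmod (taylor_coeff i n f z) \<le> B / \<rho> i ^ n"
proof -
  let ?c = "cmod (taylor_coeff i n f z)"
  have hol: "(\<lambda>t. f (vec_upd z i t)) holomorphic_on ball 0 (\<rho> i)"
    using f z by (auto simp: sep_holo_def)
  \<comment> \<open>Cauchy's inequality needs a closed disc inside the polydisc, hence a radius
    \<open>r < \<rho> i\<close>; afterwards \<open>r\<close> tends to
    \<open>\<rho> i\<close>.\<close>
  have "?c * r ^ n \<le> B" if r: "0 < r" "r < \<rho> i" for r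
  proof -
    have "cmod ((deriv ^^ n) (\<lambda>t. f (vec_upd z i t)) 0) \<le> fact n * B / r ^ n"
    proof (rule Cauchy_inequality)
      show "(\<lambda>t. f (vec_upd z i t)) holomorphic_on ball 0 r"
        by (rule holomorphic_on_subset[OF hol]) (use r in auto)
      show "continuous_on (cball 0 r) (\<lambda>t. f (vec_upd z i t))"
        by (rule continuous_on_subset[OF holomorphic_on_imp_continuous_on[OF hol]]) (use r in auto)
      show "0 < r" by fact
      fix x :: complex assume "cmod (0 - x) = r"
      then show "cmod (f (vec_upd z i x)) \<le> B"
        using r z by (intro B vec_upd_polydisc) auto
    qed
    then show ?thesis
      using r by (simp add: taylor_coeff_def norm_divide field_simps)
  qed
  moreover have "((\<lambda>r. ?c * r ^ n) \<longlongrightarrow> ?c * \<rho> i ^ n) (at_left (\<rho> i))"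
    by (intro tendsto_intros)
  ultimately have "?c * \<rho> i ^ n \<le> B"
    by (intro tendsto_upperbound[where F = "at_left (\<rho> i)"])
       (auto simp: eventually_at_left_field intro!: exI[of _ 0] \<rho>)
  then show ?thesis
    using \<rho>[of i] by (simp add: field_simps)
qed

lemma taylor_coeff_sums:
  assumes f: "sep_holo \<rho> f" and z: "z \<in> polydisc \<rho>"
  shows "(\<lambda>n. taylor_coeff i n f z * (z $ i) ^ n) sums f z"
proof -
  have "(\<lambda>t. f (vec_upd z i t)) holomorphic_on ball 0 (\<rho> i)" "z $ i \<in> ball 0 (\<rho> i)"
    using f z by (auto simp: sep_holo_def polydisc_def)
  from holomorphic_power_series[OF this] show ?thesis
    by (simp add: taylor_coeff_def)
qed

text \<open>The quotient minus \<open>c n\<close> is the tail beginning with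
  \<open>c (n + 1) * t\<close>, dominated by a geometric series of ratio
  \<open>cmod t / \<rho>\<close>. The bound tends to 0 with \<open>t\<close> and depends on the
  series only through \<open>B\<close> and \<open>\<rho>\<close>, so it is uniform in
  parameters.\<close>

lemma power_series_tail_bound:
  fixes c :: "nat \<Rightarrow> complex"
  assumes sums: "(\<lambda>m. c m * t ^ m) sums s" and c: "\<And>m. cmod (c m) \<le> B / \<rho> ^ m"
    and t: "t \<noteq> 0" "cmod t < \<rho>" and B: "0 \<le> B"
  shows "cmod ((s - (\<Sum>m<n. c m * t ^ m)) / t ^ n - c n) \<le> B / \<rho> ^ n * (cmod t / \<rho>) / (1 - cmod t / \<rho>)"
proof -
  have \<rho>: "0 < \<rho>" using t by (meson less_le_trans norm_ge_zero not_le order_le_less_trans)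
  define q where "q = cmod t / \<rho>"
  have q: "0 \<le> q" "q < 1" using t \<rho> by (auto simp: q_def)
  have "(\<lambda>m. c (m + n) * t ^ (m + n)) sums (s - (\<Sum>m<n. c m * t ^ m))"
    using sums by (rule sums_split_initial_segment)
  then have "(\<lambda>m. c (m + n) * t ^ (m + n) / t ^ n) sums ((s - (\<Sum>m<n. c m * t ^ m)) / t ^ n)"
    by (rule sums_divide)
  then have "(\<lambda>m. c (m + n) * t ^ m) sums ((s - (\<Sum>m<n. c m * t ^ m)) / t ^ n)"
    using t by (simp add: power_add)
  then have *: "(\<lambda>m. c (Suc m + n) * t ^ Suc m) sums ((s - (\<Sum>m<n. c m * t ^ m)) / t ^ n - c n)"
    by (subst sums_Suc_iff) simp
  have **: "(\<lambda>m. B / \<rho> ^ n * q * q ^ m) sums (B / \<rho> ^ n * q * (1 / (1 - q)))"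
    by (intro sums_mult geometric_sums) (use q in auto)
  have "cmod (c (Suc m + n) * t ^ Suc m) \<le> B / \<rho> ^ n * q * q ^ m" for m
  proof -
    have "cmod (c (Suc m + n) * t ^ Suc m) \<le> B / \<rho> ^ (Suc m + n) * cmod t ^ Suc m"
      unfolding norm_mult norm_power by (intro mult_right_mono c) auto
    also have "\<dots> = B / \<rho> ^ n * q * q ^ m"
      using \<rho> by (simp add: q_def power_divide power_add field_simps)
    finally show ?thesis .
  qed
  from norm_sums_le[OF * ** this] show ?thesis
    by (simp add: q_def)
qed

text \<open>The \<open>n\<close>-th coefficient in variable \<open>i\<close> is the uniform limit,
  as \<open>t\<close> tends to 0, of \<open>f\<close> minus its lower terms, divided by
  \<open>t ^ n\<close>. By strong induction on \<open>n\<close> these quotients are holomorphic in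
  the other variable, and locally uniform limits preserve that. In variable \<open>i\<close> itself
  the coefficient is constant.\<close>

lemma sep_holo_taylor_coeff:
  assumes f: "sep_holo \<rho> f" and B: "\<And>z. z \<in> polydisc \<rho> \<Longrightarrow> cmod (f z) \<le> B"
    and \<rho>: "\<And>i. 0 < \<rho> i"
  shows "sep_holo \<rho> (taylor_coeff i n f)"
proof -
  have "0 \<in> polydisc \<rho>" using \<rho> by (simp add: polydisc_def)
  from B[OF this] have B0: "0 \<le> B" by (meson norm_ge_zero order_trans)
  have "(\<lambda>s. taylor_coeff i n f (vec_upd z j s)) holomorphic_on ball 0 (\<rho> j)"
    if z: "z \<in> polydisc \<rho>" for z j
  proof (cases "j = i")
    case True
    then show ?thesis by simp
  next
    case False
    define c where "c m s = taylor_coeff i m f (vec_upd z j s)" for m s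
    show ?thesis
    proof (induction n rule: less_induct)
      case (less n)
      \<comment> \<open>A null sequence inside the disc with
        \<open>cmod (t N) / \<rho> i = 1 / (N + 2)\<close>, so that the tail bound becomes
        \<open>B / \<rho> i ^ n / (N + 1)\<close>.\<close>
      define t where "t N = (of_real (\<rho> i / (real N + 2)) :: complex)" for N :: nat
      have t: "t N \<noteq> 0" "cmod (t N) < \<rho> i" "cmod (t N) / \<rho> i = 1 / (real N + 2)" for N
      proof -
        have e: "cmod (t N) = \<rho> i / (real N + 2)"
          using \<rho>[of i] unfolding t_def norm_of_real by simp
        show "t N \<noteq> 0" using e \<rho>[of i] by (auto simp: field_simps)
        have "\<rho> i * 1 < \<rho> i * (real N + 2)" using \<rho>[of i] by (intro mult_strict_left_mono) auto
        then show "cmod (t N) < \<rho> i" unfolding e by (simp add: divide_less_eq)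
        show "cmod (t N) / \<rho> i = 1 / (real N + 2)" using e \<rho>[of i] by simp
      qed
      define F where "F N s = (f (vec_upd (vec_upd z j s) i (t N)) - (\<Sum>m<n. c m s * t N ^ m)) / t N ^ n" for N s
      have F: "F N holomorphic_on ball 0 (\<rho> j)" for N
        unfolding F_def
      proof (intro holomorphic_intros)
        have "vec_upd z i (t N) \<in> polydisc \<rho>"
          using z t by (intro vec_upd_polydisc)
        then show "(\<lambda>s. f (vec_upd (vec_upd z j s) i (t N))) holomorphic_on ball 0 (\<rho> j)"
          using f False by (subst vec_upd_commute) (auto simp: sep_holo_def)
        show "(\<lambda>s. c m s) holomorphic_on ball 0 (\<rho> j)" if "m \<in> {..<n}" for m
          unfolding c_def using less[of m] that by simp
      qed (use t in auto)
      have bd: "cmod (F N s - c n s) \<le> B / \<rho> i ^ n / (real N + 1)" if s: "s \<in> ball 0 (\<rho> j)" for N s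
      proof -
        have zs: "vec_upd z j s \<in> polydisc \<rho>" using z s by (intro vec_upd_polydisc) auto
        have z': "vec_upd (vec_upd z j s) i (t N) \<in> polydisc \<rho>"
          by (intro vec_upd_polydisc zs t)
        have "(\<lambda>m. c m s * t N ^ m) sums f (vec_upd (vec_upd z j s) i (t N))"
          using taylor_coeff_sums[OF f z', of i] by (simp add: c_def)
        then have "cmod (F N s - c n s) \<le> B / \<rho> i ^ n * (cmod (t N) / \<rho> i) / (1 - cmod (t N) / \<rho> i)"
          unfolding F_def using t B0 taylor_coeff_bound[OF f B \<rho> zs, of i]
          by (intro power_series_tail_bound) (auto simp: c_def)
        also have "\<dots> = B / \<rho> i ^ n / (real N + 1)"
          unfolding t by (simp add: divide_simps)
        finally show ?thesis .
      qed
      have lim: "(\<lambda>N. B / \<rho> i ^ n / (real N + 1)) \<longlonglongrightarrow> 0"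
        using tendsto_mult_right_zero[OF LIMSEQ_inverse_real_of_nat, of "B / \<rho> i ^ n"]
        by (simp add: field_simps)
      have "uniform_limit (ball 0 (\<rho> j)) F (c n) sequentially"
        unfolding uniform_limit_iff
      proof safe
        fix e :: real assume "0 < e"
        with lim have "\<forall>\<^sub>F N in sequentially. B / \<rho> i ^ n / (real N + 1) < e"
          by (simp add: order_tendsto_iff)
        then show "\<forall>\<^sub>F N in sequentially. \<forall>x\<in>ball 0 (\<rho> j). dist (F N x) (c n x) < e"
          by eventually_elim (use bd in \<open>fastforce simp: dist_norm intro: le_less_trans\<close>)
      qed
      then have ul: "uniform_limit (cball x d) F (c n) sequentially" if "cball x d \<subseteq> ball 0 (\<rho> j)" for x d
        using that by (rule uniform_limit_on_subset)
      have "c n holomorphic_on ball 0 (\<rho> j)"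
      proof (rule holomorphic_uniform_sequence[OF _ F])
        fix x :: complex assume "x \<in> ball 0 (\<rho> j)"
        then obtain d where "0 < d" "cball x d \<subseteq> ball 0 (\<rho> j)"
          using open_contains_cball[of "ball (0::complex) (\<rho> j)"] by fastforce
        then show "\<exists>d>0. cball x d \<subseteq> ball 0 (\<rho> j) \<and> uniform_limit (cball x d) F (c n) sequentially"
          using ul by blast
      qed simp
      then show ?case by (simp add: c_def[abs_def])
    qed
  qed
  then show ?thesis by (simp add: sep_holo_def)
qed

text \<open>Coefficients are extracted one variable at a time along a list. A
  \<open>taylor_coeff\<close> no longer depends on its own variable, so the final evaluation at 0
  loses nothing once every variable has been processed.\<close>

fun multi_coeff :: "'n list \<Rightarrow> ('n \<Rightarrow> nat) \<Rightarrow> (complex ^ 'n \<Rightarrow> complex) \<Rightarrow> complex" where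
  "multi_coeff [] \<alpha> f = f 0"
| "multi_coeff (i # is) \<alpha> f = multi_coeff is \<alpha> (taylor_coeff i (\<alpha> i) f)"

lemma multi_coeff_cong: "(\<And>i. i \<in> set is \<Longrightarrow> \<alpha> i = \<beta> i) \<Longrightarrow> multi_coeff is \<alpha> f = multi_coeff is \<beta> f"
  by (induction "is" arbitrary: f) auto

lemma multi_coeff_bound:
  assumes "sep_holo \<rho> f" "\<And>z. z \<in> polydisc \<rho> \<Longrightarrow> cmod (f z) \<le> B"
    and \<rho>: "\<And>i. 0 < \<rho> i" and "distinct is"
  shows "cmod (multi_coeff is \<alpha> f) \<le> B / (\<Prod>i\<in>set is. \<rho> i ^ \<alpha> i)"
  using assms(1,2,4)
proof (induction "is" arbitrary: f B)
  case Nil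
  then show ?case using \<rho> by (auto simp: polydisc_def)
next
  case (Cons i "is")
  have "cmod (multi_coeff is \<alpha> (taylor_coeff i (\<alpha> i) f)) \<le> (B / \<rho> i ^ \<alpha> i) / (\<Prod>i\<in>set is. \<rho> i ^ \<alpha> i)"
    using Cons.prems
    by (intro Cons.IH sep_holo_taylor_coeff[OF _ _ \<rho>] taylor_coeff_bound[OF _ _ \<rho>]) auto
  then show ?case using Cons.prems(3) by simp
qed

definition supp_in :: "'n set \<Rightarrow> ('n \<Rightarrow> nat) set" where
  "supp_in S = {\<alpha>. \<forall>i. i \<notin> S \<longrightarrow> \<alpha> i = 0}"

lemma supp_in_UNIV [simp]: "supp_in UNIV = UNIV"
  by (simp add: supp_in_def)

lemma supp_in_empty [simp]: "supp_in {} = {\<lambda>_. 0}"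
  by (auto simp: supp_in_def)

text \<open>Multi-indices split off their \<open>i\<close>-th entry. Both the power series and the
  multinomial series are inductions along this bijection.\<close>

lemma bij_betw_supp_in_insert:
  assumes "i \<notin> S"
  shows "bij_betw (\<lambda>(n, \<alpha>). \<alpha>(i := n)) (UNIV \<times> supp_in S) (supp_in (insert i S))"
proof (rule bij_betwI[where g = "\<lambda>\<alpha>. (\<alpha> i, \<alpha>(i := 0))"])
  show "(\<lambda>\<alpha>. (\<alpha> i, \<alpha>(i := 0))) ((\<lambda>(n, \<alpha>). \<alpha>(i := n)) x) = x" if "x \<in> UNIV \<times> supp_in S" for x
    using that assms by (cases x) (auto simp: supp_in_def fun_eq_iff)
qed (auto simp: supp_in_def)

lemma summable_on_prod_power:
  fixes x :: "'n \<Rightarrow> real"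
  assumes "finite S" and "\<And>i. 0 \<le> x i" "\<And>i. x i < 1"
  shows "(\<lambda>\<alpha>. \<Prod>i\<in>S. x i ^ \<alpha> i) summable_on supp_in S"
  using assms(1)
proof induction
  case empty
  then show ?case by simp
next
  case (insert i S)
  obtain s where s: "((\<lambda>\<alpha>. \<Prod>i\<in>S. x i ^ \<alpha> i) has_sum s) (supp_in S)"
    using insert.IH by (auto simp: summable_on_def)
  have "(\<lambda>n. x i ^ n) summable_on UNIV"
    by (intro norm_summable_imp_summable_on) (use assms(2,3) in simp)
  then have "(\<lambda>n. x i ^ n * s) summable_on UNIV"
    by (rule summable_on_cmult_left)
  then have "(\<lambda>(n, \<alpha>). x i ^ n * (\<Prod>i\<in>S. x i ^ \<alpha> i)) summable_on (UNIV \<times> supp_in S)"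
    by (intro summable_on_SigmaI[where g = "\<lambda>n. x i ^ n * s"])
       (auto intro!: has_sum_cmult_right s mult_nonneg_nonneg prod_nonneg zero_le_power assms(2))
  also have "(\<lambda>(n, \<alpha>). x i ^ n * (\<Prod>i\<in>S. x i ^ \<alpha> i))
      = (\<lambda>p. (\<lambda>\<alpha>. \<Prod>j\<in>insert i S. x j ^ \<alpha> j) ((\<lambda>(n, \<alpha>). \<alpha>(i := n)) p))"
  proof (intro ext, clarify)
    fix n \<alpha>
    have "(\<Prod>j\<in>S. x j ^ (\<alpha>(i := n)) j) = (\<Prod>j\<in>S. x j ^ \<alpha> j)"
      using insert.hyps by (intro prod.cong) auto
    then show "x i ^ n * (\<Prod>i\<in>S. x i ^ \<alpha> i) = (\<Prod>j\<in>insert i S. x j ^ (\<alpha>(i := n)) j)"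
      using insert.hyps by simp
  qed
  finally show ?case
    by (subst (asm) summable_on_reindex_bij_betw[OF bij_betw_supp_in_insert]) (use insert.hyps in auto)
qed

text \<open>Cauchy's estimates bound the term by \<open>B\<close> times a product of geometric terms
  with ratios \<open>cmod (z $ i) / \<rho> i < 1\<close>.\<close>

lemma multi_coeff_abs_summable:
  assumes "sep_holo \<rho> f" "\<And>z. z \<in> polydisc \<rho> \<Longrightarrow> cmod (f z) \<le> B"
    and \<rho>: "\<And>i. 0 < \<rho> i" and "distinct is" and z: "z \<in> polydisc \<rho>"
  shows "(\<lambda>\<alpha>. cmod (multi_coeff is \<alpha> f * (\<Prod>i\<in>set is. z $ i ^ \<alpha> i))) summable_on supp_in (set is)"
proof (rule Infinite_Sum.abs_summable_on_comparison_test')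
  show "(\<lambda>\<alpha>. B * (\<Prod>i\<in>set is. (cmod (z $ i) / \<rho> i) ^ \<alpha> i)) summable_on supp_in (set is)"
    using z \<rho> by (intro summable_on_cmult_right summable_on_prod_power) (auto simp: polydisc_def less_imp_le)
  fix \<alpha>
  have "cmod (multi_coeff is \<alpha> f * (\<Prod>i\<in>set is. z $ i ^ \<alpha> i))
      \<le> B / (\<Prod>i\<in>set is. \<rho> i ^ \<alpha> i) * (\<Prod>i\<in>set is. cmod (z $ i) ^ \<alpha> i)"
    unfolding norm_mult prod_norm[symmetric] norm_power
    by (intro mult_right_mono multi_coeff_bound[OF assms(1,2) \<rho> assms(4)] prod_nonneg) auto
  also have "\<dots> = B * (\<Prod>i\<in>set is. (cmod (z $ i) / \<rho> i) ^ \<alpha> i)"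
    by (simp add: power_divide prod_dividef)
  finally show "cmod (multi_coeff is \<alpha> f * (\<Prod>i\<in>set is. z $ i ^ \<alpha> i))
      \<le> B * (\<Prod>i\<in>set is. (cmod (z $ i) / \<rho> i) ^ \<alpha> i)" .
qed

text \<open>Induction along the list: sum first over the exponents of the remaining variables, then
  over that of \<open>i\<close> by the one-variable Taylor series. Coordinates outside the list have
  to vanish because \<open>multi_coeff\<close> evaluates them at 0.\<close>

lemma multi_coeff_has_sum:
  assumes "sep_holo \<rho> f" "\<And>z. z \<in> polydisc \<rho> \<Longrightarrow> cmod (f z) \<le> B"
    and \<rho>: "\<And>i. 0 < \<rho> i" and "distinct is"
    and "z \<in> polydisc \<rho>" "\<And>i. i \<notin> set is \<Longrightarrow> z $ i = 0"
  shows "((\<lambda>\<alpha>. multi_coeff is \<alpha> f * (\<Prod>i\<in>set is. z $ i ^ \<alpha> i)) has_sum f z) (supp_in (set is))"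
  using assms(1,2,4,5,6)
proof (induction "is" arbitrary: f B z)
  case Nil
  then have "z = 0" by (simp add: vec_eq_iff)
  then show ?case by (simp add: has_sum_finite_iff)
next
  case (Cons i "is")
  note f = Cons.prems(1) and B = Cons.prems(2)
  \<comment> \<open>Setting coordinate \<open>i\<close> to 0 makes the induction hypothesis
    applicable and does not change the coefficient in that variable.\<close>
  define z' where "z' = vec_upd z i 0"
  have i: "i \<notin> set is" and dis: "distinct is" using Cons.prems by auto
  have z': "z' \<in> polydisc \<rho>" "\<And>j. j \<notin> set is \<Longrightarrow> z' $ j = 0"
    using Cons.prems \<rho> by (auto simp: z'_def intro!: vec_upd_polydisc)
  define T where "T p = (\<lambda>\<alpha>. multi_coeff (i # is) \<alpha> f * (\<Prod>j\<in>set (i # is). z $ j ^ \<alpha> j))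
      ((\<lambda>(n, \<alpha>). \<alpha>(i := n)) p)" for p :: "nat \<times> ('a \<Rightarrow> nat)"
  have T: "T (n, \<alpha>) = multi_coeff is \<alpha> (taylor_coeff i n f) * (\<Prod>j\<in>set is. z' $ j ^ \<alpha> j) * z $ i ^ n" for n \<alpha>
  proof -
    have "multi_coeff is (\<alpha>(i := n)) (taylor_coeff i n f) = multi_coeff is \<alpha> (taylor_coeff i n f)"
      using i by (intro multi_coeff_cong) auto
    moreover have "(\<Prod>j\<in>set is. z $ j ^ (\<alpha>(i := n)) j) = (\<Prod>j\<in>set is. z' $ j ^ \<alpha> j)"
      using i by (intro prod.cong) (auto simp: z'_def)
    ultimately show ?thesis using i by (simp add: T_def)
  qed
  have c: "taylor_coeff i n f z' = taylor_coeff i n f z" for n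
    by (simp add: z'_def)
  have 1: "((\<lambda>\<alpha>. T (n, \<alpha>)) has_sum taylor_coeff i n f z * z $ i ^ n) (supp_in (set is))" for n
    unfolding T c[symmetric]
    by (intro has_sum_cmult_left Cons.IH[OF sep_holo_taylor_coeff[OF f B \<rho>] taylor_coeff_bound[OF f B \<rho>] dis z'])
  have 2: "((\<lambda>n. taylor_coeff i n f z * z $ i ^ n) has_sum f z) UNIV"
  proof (rule norm_summable_imp_has_sum)
    show "summable (\<lambda>n. cmod (taylor_coeff i n f z * z $ i ^ n))"
    proof (rule summable_comparison_test')
      show "summable (\<lambda>n. B * (cmod (z $ i) / \<rho> i) ^ n)"
        using Cons.prems(4) \<rho>[of i]
        by (intro summable_mult summable_geometric) (auto simp: polydisc_def abs_of_pos)
      fix n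
      have "cmod (taylor_coeff i n f z) * cmod (z $ i) ^ n \<le> B / \<rho> i ^ n * cmod (z $ i) ^ n"
        by (intro mult_right_mono taylor_coeff_bound[OF f B \<rho>] Cons.prems) auto
      then show "norm (cmod (taylor_coeff i n f z * z $ i ^ n)) \<le> B * (cmod (z $ i) / \<rho> i) ^ n"
        by (simp add: norm_mult norm_power power_divide)
    qed
    show "(\<lambda>n. taylor_coeff i n f z * z $ i ^ n) sums f z"
      by (rule taylor_coeff_sums[OF f Cons.prems(4)])
  qed
  \<comment> \<open>Iterated sums may be merged only when the double family is summable; absolute
    summability supplies this.\<close>
  have 3: "T summable_on (UNIV \<times> supp_in (set is))"
    unfolding T_def
    by (subst summable_on_reindex_bij_betw[OF bij_betw_supp_in_insert[OF i]])
       (use abs_summable_summable[OF multi_coeff_abs_summable[OF f B \<rho> Cons.prems(3,4)]] in simp)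
  have "(T has_sum f z) (UNIV \<times> supp_in (set is))"
    using has_sum_SigmaI[OF 1 2 3] by simp
  then show ?case
    unfolding T_def by (subst (asm) has_sum_reindex_bij_betw[OF bij_betw_supp_in_insert[OF i]]) simp
qed

section \<open>Power series on complete Reinhardt domains\<close>

definition zmono :: "('n::finite \<Rightarrow> nat) \<Rightarrow> complex ^ 'n \<Rightarrow> complex" where
  "zmono \<alpha> z = (\<Prod>i\<in>UNIV. z $ i ^ \<alpha> i)"

lemma norm_vec_le_sum: "norm x \<le> (\<Sum>i\<in>UNIV. norm (x $ i))" for x :: "'a::real_normed_vector ^ 'n"
  unfolding norm_vec_def by (rule L2_set_le_sum) simp

lemma bounded_linear_vec_axis: "bounded_linear (\<lambda>t. axis i t :: 'a::real_normed_vector ^ 'n)"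
proof (rule bounded_linear_intro)
  show "axis i (x + y) = axis i x + (axis i y :: 'a ^ 'n)" for x y
    by (simp add: vec_eq_iff axis_def)
  show "axis i (r *\<^sub>R x) = r *\<^sub>R (axis i x :: 'a ^ 'n)" for r x
    by (simp add: vec_eq_iff axis_def)
  show "norm (axis i x :: 'a ^ 'n) \<le> norm x * 1" for x
    using norm_vec_le_sum[of "axis i x"] by (simp add: axis_def if_distrib cong: if_cong)
qed

lemma vec_upd_eq_axis: "vec_upd z i t = vec_upd z i 0 + axis i t" for z :: "'a::monoid_add ^ 'n"
  by (simp add: vec_eq_iff axis_def)

lemma has_derivative_vec_upd:
  "((\<lambda>t. vec_upd z i t) has_derivative (\<lambda>t. axis i t)) (at s within T)" for z :: "'a::real_normed_vector ^ 'n"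
  by (subst vec_upd_eq_axis)
     (auto intro!: derivative_eq_intros bounded_linear_imp_has_derivative bounded_linear_vec_axis)

lemma axis_eq_smult: "axis i (t :: 'a::comm_semiring_1) = t *s axis i 1"
  by (simp add: vec_eq_iff axis_def)

lemma holo_on_vec_upd:
  fixes f :: "complex ^ 'n \<Rightarrow> complex"
  assumes f: "holo_on f S" and S: "\<And>t. t \<in> T \<Longrightarrow> vec_upd z i t \<in> S"
  shows "(\<lambda>t. f (vec_upd z i t)) holomorphic_on T"
  unfolding holomorphic_on_def
proof
  fix t assume "t \<in> T"
  with f S obtain D where D: "(f has_derivative D) (at (vec_upd z i t))" "\<And>c v. D (c *s v) = c * D v"
    unfolding holo_on_def by blast
  have "((\<lambda>t. f (vec_upd z i t)) has_derivative (\<lambda>h. D (axis i h))) (at t within T)"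
    using has_derivative_compose[OF has_derivative_vec_upd D(1)] by simp
  also have "(\<lambda>h. D (axis i h)) = (*) (D (axis i 1))"
    by (subst axis_eq_smult) (auto simp: D(2) mult.commute)
  finally show "(\<lambda>t. f (vec_upd z i t)) field_differentiable at t within T"
    by (auto simp: field_differentiable_def has_field_derivative_def)
qed

lemma holo_on_imp_continuous_on: "holo_on f S \<Longrightarrow> continuous_on S f"
  unfolding holo_on_def
  by (meson continuous_at_imp_continuous_on has_derivative_continuous)

lemma holo_on_imp_sep_holo:
  assumes "holo_on f S" "polydisc \<rho> \<subseteq> S"
  shows "sep_holo \<rho> f"
  unfolding sep_holo_def
proof (intro ballI allI holo_on_vec_upd[OF assms(1)])
  fix z :: "complex ^ 'a" and i :: 'a and t :: complex assume "z \<in> polydisc \<rho>" "t \<in> ball 0 (\<rho> i)"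
  then show "vec_upd z i t \<in> S" using assms(2) vec_upd_polydisc by fastforce
qed

definition complete_reinhardt :: "(complex ^ 'n) set \<Rightarrow> bool" where
  "complete_reinhardt D \<longleftrightarrow> (\<forall>z\<in>D. \<forall>w. (\<forall>i. cmod (w $ i) \<le> cmod (z $ i)) \<longrightarrow> w \<in> D)"

text \<open>Replacing \<open>z\<close> by the point \<open>a\<close> of its moduli and increasing
  every modulus by a small \<open>d\<close> stays in \<open>D\<close> by openness; completeness then
  puts the whole closed polydisc with these radii into \<open>D\<close>. The closure is included
  because compactness is what later bounds \<open>f\<close>.\<close>

lemma complete_reinhardt_polydisc:
  assumes D: "open D" "complete_reinhardt D" and z: "z \<in> D"
  obtains \<rho> where "\<And>i. 0 < \<rho> i" "z \<in> polydisc \<rho>" "closure (polydisc \<rho>) \<subseteq> D" "bounded (polydisc \<rho>)"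
proof -
  define a where "a = (\<chi> i. complex_of_real (cmod (z $ i)))"
  have "a \<in> D"
    using D(2) z unfolding complete_reinhardt_def by (auto simp: a_def)
  then obtain e where e: "0 < e" "cball a e \<subseteq> D"
    using D(1) open_contains_cball by blast
  \<comment> \<open>Dividing by the number of coordinates keeps the l1 bound on
    \<open>dist a b\<close> at \<open>e\<close>.\<close>
  define d where "d = e / real CARD('a)"
  have d: "0 < d" using e by (simp add: d_def)
  define \<rho> where "\<rho> i = cmod (z $ i) + d" for i
  define b where "b = (\<chi> i. complex_of_real (\<rho> i))"
  have "dist a b \<le> (\<Sum>i\<in>UNIV. norm ((a - b) $ i))"
    unfolding dist_norm by (rule norm_vec_le_sum)
  also have "\<dots> = (\<Sum>i\<in>(UNIV::'a set). d)"
    using d by (intro sum.cong) (simp_all add: a_def b_def \<rho>_def)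
  also have "\<dots> = e" by (simp add: d_def)
  finally have bD: "b \<in> D" using e by auto
  have \<rho>: "0 < \<rho> i" for i using d by (simp add: \<rho>_def add_nonneg_pos)
  define C where "C = {w::complex^'a. \<forall>i. cmod (w $ i) \<le> \<rho> i}"
  have "w \<in> D" if "w \<in> C" for w
  proof -
    have "cmod (w $ i) \<le> cmod (b $ i)" for i
      using that \<rho>[of i] by (simp add: C_def b_def)
    then show ?thesis using D(2) bD unfolding complete_reinhardt_def by blast
  qed
  moreover have "closed C"
    unfolding C_def by (intro closed_Collect_all closed_Collect_le continuous_intros)
  moreover have "polydisc \<rho> \<subseteq> C" by (auto simp: C_def polydisc_def less_imp_le)
  moreover have "bounded C"
  proof (rule boundedI)
    fix w assume "w \<in> C"
    then have "norm (w $ i) \<le> \<rho> i" for i by (simp add: C_def)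
    then show "norm w \<le> (\<Sum>i\<in>UNIV. \<rho> i)"
      by (rule order_trans[OF norm_vec_le_sum sum_mono])
  qed
  ultimately have "closure (polydisc \<rho>) \<subseteq> D" "bounded (polydisc \<rho>)"
    using closure_minimal bounded_subset by blast+
  moreover have "z \<in> polydisc \<rho>" using d by (simp add: polydisc_def \<rho>_def)
  ultimately show thesis using that \<rho> by blast
qed

text \<open>The coefficients are iterated derivatives at 0, hence the same for every polydisc; so
  one family \<open>c\<close> serves all \<open>z\<close>, although the polydisc varies with
  \<open>z\<close>.\<close>

theorem holo_on_reinhardt_power_series:
  fixes f :: "complex ^ 'n::finite \<Rightarrow> complex"
  assumes D: "open D" "complete_reinhardt D" and f: "holo_on f D"
  obtains c where "\<And>z. z \<in> D \<Longrightarrow> (\<lambda>\<alpha>. cmod (c \<alpha> * zmono \<alpha> z)) summable_on UNIV"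
    and "\<And>z. z \<in> D \<Longrightarrow> ((\<lambda>\<alpha>. c \<alpha> * zmono \<alpha> z) has_sum f z) UNIV"
proof -
  obtain xs :: "'n list" where xs: "set xs = UNIV" "distinct xs"
    using finite_distinct_list[OF finite_class.finite_UNIV] by blast
  have "(\<lambda>\<alpha>. cmod (multi_coeff xs \<alpha> f * zmono \<alpha> z)) summable_on UNIV \<and>
        ((\<lambda>\<alpha>. multi_coeff xs \<alpha> f * zmono \<alpha> z) has_sum f z) UNIV" if zD: "z \<in> D" for z
  proof -
    obtain \<rho> where \<rho>: "\<And>i. 0 < \<rho> i" "z \<in> polydisc \<rho>" "closure (polydisc \<rho>) \<subseteq> D" "bounded (polydisc \<rho>)"
      using complete_reinhardt_polydisc[OF D zD] by blast
    have "compact (f ` closure (polydisc \<rho>))"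
      using \<rho> by (intro compact_continuous_image continuous_on_subset[OF holo_on_imp_continuous_on[OF f]]) auto
    then have "bounded (f ` closure (polydisc \<rho>))" by (rule compact_imp_bounded)
    then obtain B where B: "\<And>w. w \<in> closure (polydisc \<rho>) \<Longrightarrow> cmod (f w) \<le> B"
      by (auto simp: bounded_iff)
    have B': "cmod (f w) \<le> B" if "w \<in> polydisc \<rho>" for w
      using B[of w] closure_subset[of "polydisc \<rho>"] that by auto
    have sep: "sep_holo \<rho> f"
      by (rule holo_on_imp_sep_holo[OF f order_trans[OF closure_subset \<rho>(3)]])
    show ?thesis
      using multi_coeff_abs_summable[OF sep B' \<rho>(1) xs(2) \<rho>(2)] xs
        multi_coeff_has_sum[OF sep B' \<rho>(1) xs(2) \<rho>(2)]
      by (simp add: zmono_def)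
  qed
  then show thesis by (intro that[of "\<lambda>\<alpha>. multi_coeff xs \<alpha> f"]) blast+
qed

section \<open>Lebesgue measure on complex n-space\<close>

lemma borel_measurable_vec_lambda [measurable (raw)]:
  fixes f :: "'b \<Rightarrow> 'n::finite \<Rightarrow> 'a::euclidean_space"
  assumes "\<And>i. (\<lambda>x. f x i) \<in> borel_measurable M"
  shows "(\<lambda>x. \<chi> i. f x i) \<in> borel_measurable M"
proof (subst borel_measurable_euclidean_space, safe)
  fix b :: "'a ^ 'n" assume "b \<in> Basis"
  then obtain i u where "b = axis i u" by (auto simp: Basis_vec_def)
  then show "(\<lambda>x. (\<chi> i. f x i) \<bullet> b) \<in> borel_measurable M"
    using assms by (simp add: inner_axis)
qed

lemma borel_measurable_vec_nth [measurable]: "(\<lambda>z. z $ i) \<in> borel_measurable borel"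
  for i :: "'n::finite"
  by (intro borel_measurable_continuous_onI continuous_intros)

lemma prod_Basis_vec: "(\<Prod>b\<in>Basis. f b) = (\<Prod>i\<in>UNIV. \<Prod>b\<in>Basis. f (axis i b))"
  for f :: "'a::euclidean_space ^ 'n \<Rightarrow> 'c::comm_monoid_mult"
proof -
  have B: "(Basis :: ('a ^ 'n) set) = (\<lambda>(i, b). axis i b) ` (UNIV \<times> Basis)"
    by (auto simp: Basis_vec_def)
  have inj: "inj_on (\<lambda>(i, b). axis i b :: 'a ^ 'n) (UNIV \<times> Basis)"
    by (auto simp: inj_on_def axis_eq_axis)
  show ?thesis
    unfolding B by (subst prod.reindex[OF inj]) (simp add: prod.cartesian_product case_prod_unfold)
qed

text \<open>Both measures give a box the product of its side lengths, which determines Lebesgue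
  measure. This makes it possible to integrate one complex coordinate at a time.\<close>

lemma lborel_vec:
  "(lborel :: ('a::euclidean_space ^ 'n) measure)
     = distr (Pi\<^sub>M UNIV (\<lambda>_. lborel)) borel (\<lambda>x. \<chi> i. x i)"
proof (rule lborel_eqI)
  interpret product_sigma_finite "\<lambda>_::'n. lborel :: 'a measure" ..
  fix l u :: "'a ^ 'n" assume lu: "\<And>b. b \<in> Basis \<Longrightarrow> l \<bullet> b \<le> u \<bullet> b"
  have lu': "(l $ i) \<bullet> b \<le> (u $ i) \<bullet> b" if "b \<in> Basis" for i b
    using lu[of "axis i b"] that by (simp add: inner_axis axis_in_Basis_iff)
  have "(\<lambda>x. \<chi> i. x i) -` box l u \<inter> space (Pi\<^sub>M UNIV (\<lambda>_. lborel)) = (\<Pi>\<^sub>E i\<in>UNIV. box (l $ i) (u $ i))"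
    by (auto simp: space_PiM box_def Basis_vec_def inner_axis PiE_def Pi_def)
  then have "emeasure (distr (Pi\<^sub>M UNIV (\<lambda>_. lborel)) borel (\<lambda>x. \<chi> i. x i)) (box l u)
    = (\<Prod>i\<in>UNIV. emeasure lborel (box (l $ i) (u $ i)))"
    by (subst emeasure_distr) (simp_all add: emeasure_PiM)
  also have "\<dots> = (\<Prod>i\<in>UNIV. ennreal (\<Prod>b\<in>Basis. (u $ i - l $ i) \<bullet> b))"
    by (intro prod.cong refl) (simp add: emeasure_lborel_box_eq lu')
  also have "\<dots> = ennreal (\<Prod>i\<in>UNIV. \<Prod>b\<in>Basis. (u $ i - l $ i) \<bullet> b)"
    by (intro prod_ennreal prod_nonneg ballI) (simp add: inner_diff_left lu')
  also have "(\<Prod>i\<in>UNIV. \<Prod>b\<in>Basis. (u $ i - l $ i) \<bullet> b) = (\<Prod>b\<in>Basis. (u - l) \<bullet> b)"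
    by (simp add: prod_Basis_vec inner_axis)
  finally show "emeasure (distr (Pi\<^sub>M UNIV (\<lambda>_. lborel)) borel (\<lambda>x. \<chi> i. x i)) (box l u)
    = (\<Prod>b\<in>Basis. (u - l) \<bullet> b)" .
qed simp

lemma lborel_complex:
  "(lborel :: complex measure) = distr (lborel \<Otimes>\<^sub>M lborel) borel (\<lambda>(x, y). Complex x y)"
proof (rule lborel_eqI)
  have [measurable]: "(\<lambda>(x, y). Complex x y) \<in> borel_measurable (borel \<Otimes>\<^sub>M borel)"
    by (subst borel_prod, intro borel_measurable_continuous_onI)
       (auto simp: case_prod_unfold Complex_eq intro!: continuous_intros)
  fix l u :: complex assume lu: "\<And>b. b \<in> Basis \<Longrightarrow> l \<bullet> b \<le> u \<bullet> b"
  have lu': "Re l \<le> Re u" "Im l \<le> Im u"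
    using lu[of 1] lu[of \<i>] by (simp_all add: Basis_complex_def inner_complex_def)
  have "(\<lambda>(x, y). Complex x y) -` box l u = {Re l<..<Re u} \<times> {Im l<..<Im u}"
    by (auto simp: box_def Basis_complex_def inner_complex_def)
  then have "emeasure (distr (lborel \<Otimes>\<^sub>M lborel) borel (\<lambda>(x, y). Complex x y)) (box l u)
     = emeasure lborel {Re l<..<Re u} * emeasure lborel {Im l<..<Im u}"
    by (subst emeasure_distr) (auto simp: lborel.emeasure_pair_measure_Times space_pair_measure)
  also have "\<dots> = ennreal ((Re u - Re l) * (Im u - Im l))"
    using lu' by (simp add: ennreal_mult)
  also have "(Re u - Re l) * (Im u - Im l) = (\<Prod>b\<in>Basis. (u - l) \<bullet> b)"
    by (simp add: Basis_complex_def inner_complex_def complex_eq_iff)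
  finally show "emeasure (distr (lborel \<Otimes>\<^sub>M lborel) borel (\<lambda>(x, y). Complex x y)) (box l u)
     = (\<Prod>b\<in>Basis. (u - l) \<bullet> b)" .
qed simp

lemma measurable_Complex [measurable]: "(\<lambda>(x, y). Complex x y) \<in> borel_measurable (borel \<Otimes>\<^sub>M borel)"
  by (subst borel_prod, intro borel_measurable_continuous_onI)
     (auto simp: case_prod_unfold Complex_eq intro!: continuous_intros)

section \<open>Rotation invariance of Lebesgue measure on the plane\<close>

lemma nn_integral_complex_iterated:
  assumes [measurable]: "f \<in> borel_measurable borel"
  shows "(\<integral>\<^sup>+z. f z \<partial>lborel) = (\<integral>\<^sup>+y. \<integral>\<^sup>+x. f (Complex x y) \<partial>lborel \<partial>lborel)"
proof -
  have "(\<integral>\<^sup>+z. f z \<partial>lborel) = (\<integral>\<^sup>+p. f (Complex (fst p) (snd p)) \<partial>(lborel \<Otimes>\<^sub>M lborel))"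
    by (subst lborel_complex, subst nn_integral_distr) (auto simp: case_prod_unfold)
  also have "\<dots> = (\<integral>\<^sup>+y. \<integral>\<^sup>+x. f (Complex x y) \<partial>lborel \<partial>lborel)"
    by (subst lborel_pair.nn_integral_snd[symmetric]) (simp_all add: case_prod_unfold)
  finally show ?thesis .
qed

lemma nn_integral_complex_iterated':
  assumes [measurable]: "f \<in> borel_measurable borel"
  shows "(\<integral>\<^sup>+z. f z \<partial>lborel) = (\<integral>\<^sup>+x. \<integral>\<^sup>+y. f (Complex x y) \<partial>lborel \<partial>lborel)"
  by (subst nn_integral_complex_iterated, measurable) (rule lborel_pair.Fubini', measurable)

lemma nn_integral_translate: 
  fixes f :: "real \<Rightarrow> ennreal"
  assumes [measurable]: "f \<in> borel_measurable borel"
  shows "(\<integral>\<^sup>+x. f (x + a) \<partial>lborel) = (\<integral>\<^sup>+x. f x \<partial>lborel)"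
  using nn_integral_real_affine[OF assms, of 1 a] by (simp add: add.commute)

text \<open>With the other real coordinate fixed, a shear is a translation, so Fubini reduces the
  claim to translation invariance on the line.\<close>

lemma nn_integral_complex_shear:
  fixes f :: "complex \<Rightarrow> ennreal"
  assumes [measurable]: "f \<in> borel_measurable borel"
  shows "(\<integral>\<^sup>+z. f (Complex (Re z + a * Im z) (Im z)) \<partial>lborel) = (\<integral>\<^sup>+z. f z \<partial>lborel)"
    and "(\<integral>\<^sup>+z. f (Complex (Re z) (Im z + a * Re z)) \<partial>lborel) = (\<integral>\<^sup>+z. f z \<partial>lborel)"
proof -
  have [measurable]: "(\<lambda>x. f (Complex x y)) \<in> borel_measurable borel" for y
    by measurable
  have "(\<integral>\<^sup>+z. f (Complex (Re z + a * Im z) (Im z)) \<partial>lborel)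
      = (\<integral>\<^sup>+y. \<integral>\<^sup>+x. f (Complex (x + a * y) y) \<partial>lborel \<partial>lborel)"
    by (subst nn_integral_complex_iterated) simp_all
  also have "\<dots> = (\<integral>\<^sup>+y. \<integral>\<^sup>+x. f (Complex x y) \<partial>lborel \<partial>lborel)"
    by (intro nn_integral_cong nn_integral_translate[where f = "\<lambda>x. f (Complex x _)"]) measurable
  finally show "(\<integral>\<^sup>+z. f (Complex (Re z + a * Im z) (Im z)) \<partial>lborel) = (\<integral>\<^sup>+z. f z \<partial>lborel)"
    by (simp add: nn_integral_complex_iterated)
  have "(\<integral>\<^sup>+z. f (Complex (Re z) (Im z + a * Re z)) \<partial>lborel)
      = (\<integral>\<^sup>+x. \<integral>\<^sup>+y. f (Complex x (y + a * x)) \<partial>lborel \<partial>lborel)"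
    by (subst nn_integral_complex_iterated') simp_all
  also have "\<dots> = (\<integral>\<^sup>+x. \<integral>\<^sup>+y. f (Complex x y) \<partial>lborel \<partial>lborel)"
    by (intro nn_integral_cong nn_integral_translate[where f = "\<lambda>y. f (Complex _ y)"]) measurable
  finally show "(\<integral>\<^sup>+z. f (Complex (Re z) (Im z + a * Re z)) \<partial>lborel) = (\<integral>\<^sup>+z. f z \<partial>lborel)"
    by (simp add: nn_integral_complex_iterated')
qed

text \<open>A rotation is a product of three shears.\<close>

lemma nn_integral_complex_rotate:
  fixes f :: "complex \<Rightarrow> ennreal"
  assumes [measurable]: "f \<in> borel_measurable borel" and c: "cmod c = 1" "Im c \<noteq> 0"
  shows "(\<integral>\<^sup>+z. f (c * z) \<partial>lborel) = (\<integral>\<^sup>+z. f z \<partial>lborel)"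
proof -
  \<comment> \<open>For \<open>c = cis \<theta>\<close> this is \<open>- tan (\<theta> / 2)\<close>,
    the parameter of the two outer shears in the classical factorization; \<open>Im c\<close>, that
    is \<open>sin \<theta>\<close>, is that of the middle one.\<close>
  define a where "a = (Re c - 1) / Im c"
  define S where "S z = Complex (Re z + a * Im z) (Im z)" for z
  define T where "T z = Complex (Re z) (Im z + Im c * Re z)" for z
  have [measurable]: "S \<in> borel_measurable borel" "T \<in> borel_measurable borel"
    unfolding S_def T_def Complex_eq by measurable
  have "(Re c)\<^sup>2 + (Im c)\<^sup>2 = 1"
    using c(1) by (simp add: cmod_def)
  then have "a * (1 + Re c) = - Im c"
    using c(2) by (simp add: a_def field_simps power2_eq_square)
  moreover have "Im c * a = Re c - 1"
    using c(2) by (simp add: a_def)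
  ultimately have "S (T (S z)) = c * z" for z
    by (simp add: S_def T_def complex_eq_iff) algebra
  then have "(\<integral>\<^sup>+z. f (c * z) \<partial>lborel) = (\<integral>\<^sup>+z. f (S (T (S z))) \<partial>lborel)"
    by simp
  also have "\<dots> = (\<integral>\<^sup>+z. f (S (T z)) \<partial>lborel)"
    using nn_integral_complex_shear(1)[of "\<lambda>z. f (S (T z))" a] by (simp add: S_def[symmetric])
  also have "\<dots> = (\<integral>\<^sup>+z. f (S z) \<partial>lborel)"
    using nn_integral_complex_shear(2)[of "\<lambda>z. f (S z)" "Im c"] by (simp add: T_def[symmetric])
  also have "\<dots> = (\<integral>\<^sup>+z. f z \<partial>lborel)"
    using nn_integral_complex_shear(1)[of f a] by (simp add: S_def[symmetric])
  finally show ?thesis .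
qed

lemma distr_lborel_complex_rotate:
  assumes c: "cmod c = 1" "Im c \<noteq> 0"
  shows "distr lborel borel (\<lambda>z. c * z) = lborel"
proof (rule measure_eqI)
  fix A assume "A \<in> sets (distr lborel borel (\<lambda>z. c * z))"
  then have [measurable]: "A \<in> sets borel" by simp
  have "emeasure (distr lborel borel (\<lambda>z. c * z)) A = (\<integral>\<^sup>+z. indicator A z \<partial>distr lborel borel (\<lambda>z. c * z))"
    by simp
  also have "\<dots> = (\<integral>\<^sup>+z. indicator A (c * z) \<partial>lborel)"
    by (rule nn_integral_distr) simp_all
  also have "\<dots> = emeasure lborel A"
    by (subst nn_integral_complex_rotate[OF _ c]) simp_all
  finally show "emeasure (distr lborel borel (\<lambda>z. c * z)) A = emeasure lborel A" .
qed simp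

text \<open>Rotation by \<open>c\<close> multiplies the integral by \<open>c ^ a * cnj c ^ b\<close>
  and at the same time leaves it unchanged, so an angle for which this factor is not 1 forces the
  value 0.\<close>

lemma integral_complex_power_eq_0:
  fixes \<phi> :: "real \<Rightarrow> complex"
  assumes [measurable]: "\<phi> \<in> borel_measurable borel" and "a \<noteq> b"
  shows "(\<integral>z. z ^ a * cnj z ^ b * \<phi> (cmod z) \<partial>lborel) = 0"
proof -
  define n where "n = max a b - min a b"
  have n: "n > 0" using assms(2) by (simp add: n_def)
  \<comment> \<open>A quarter turn divided by \<open>n = \<bar>a - b\<bar>\<close>: then
    \<open>c ^ n = \<i>\<close>, the factor is \<open>\<i>\<close> or its conjugate, and the angle
    is positive and at most \<open>pi / 2\<close>, so \<open>Im c \<noteq> 0\<close>.\<close>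
  define c where "c = cis (pi / (2 * real n))"
  have c1: "cmod c = 1" by (simp add: c_def)
  have "0 < sin (pi / (2 * real n))"
    using n by (intro sin_gt_zero) (auto simp: field_simps)
  then have c2: "Im c \<noteq> 0" by (simp add: c_def)
  have "c ^ n = \<i>"
    using n by (simp add: c_def Complex.DeMoivre)
  have cc: "c * cnj c = 1" by (simp add: c_def cis_cnj cis_mult)
  have "c ^ a * cnj c ^ b \<noteq> 1"
  proof (cases "a < b")
    case True
    then have "b = a + n" by (simp add: n_def)
    then have "c ^ a * cnj c ^ b = (c * cnj c) ^ a * cnj (c ^ n)"
      by (simp add: power_add power_mult_distrib)
    then show ?thesis using \<open>c ^ n = \<i>\<close> cc by (simp add: complex_eq_iff)
  next
    case False
    then have "a = b + n" by (simp add: n_def)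
    then have "c ^ a * cnj c ^ b = (c * cnj c) ^ b * c ^ n"
      by (simp add: power_add power_mult_distrib)
    then show ?thesis using \<open>c ^ n = \<i>\<close> cc by (simp add: complex_eq_iff)
  qed
  have [measurable]: "cnj \<in> borel_measurable borel"
    by (intro borel_measurable_continuous_onI continuous_intros)
  have "(\<integral>z. z ^ a * cnj z ^ b * \<phi> (cmod z) \<partial>lborel) = (\<integral>z. z ^ a * cnj z ^ b * \<phi> (cmod z) \<partial>distr lborel borel (\<lambda>z. c * z))"
    by (simp add: distr_lborel_complex_rotate[OF c1 c2])
  also have "\<dots> = (\<integral>z. (c * z) ^ a * cnj (c * z) ^ b * \<phi> (cmod (c * z)) \<partial>lborel)"
    by (rule integral_distr) simp_all
  also have "\<dots> = (\<integral>z. (c ^ a * cnj c ^ b) * (z ^ a * cnj z ^ b * \<phi> (cmod z)) \<partial>lborel)"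
    by (simp add: norm_mult c1 power_mult_distrib mult_ac)
  also have "\<dots> = (c ^ a * cnj c ^ b) * (\<integral>z. z ^ a * cnj z ^ b * \<phi> (cmod z) \<partial>lborel)"
    by (rule integral_mult_right_zero)
  finally have "(1 - c ^ a * cnj c ^ b) * (\<integral>z. z ^ a * cnj z ^ b * \<phi> (cmod z) \<partial>lborel) = 0"
    unfolding left_diff_distrib by (simp only: mult_1_left diff_self)
  then show ?thesis
    using \<open>c ^ a * cnj c ^ b \<noteq> 1\<close> by simp
qed

section \<open>Integrals of radial functions\<close>

text \<open>Polar coordinates in measure form: the disc of squared radius \<open>x\<close> has area
  \<open>pi * x\<close>, and half-lines are an intersection-stable generator of the Borel
  sets.\<close>

lemma distr_lborel_complex_norm_square:
  "distr lborel borel (\<lambda>z::complex. (cmod z)\<^sup>2) = density lborel (\<lambda>t::real. ennreal pi * indicator {0..} t)"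
proof (rule measure_eqI_generator_eq)
  let ?E = "range (\<lambda>a. {..a::real})"
  let ?N = "density lborel (\<lambda>t::real. ennreal pi * indicator {0..} t)"
  have N: "emeasure ?N {..x} = ennreal (pi * max 0 x)" for x :: real
  proof -
    have "emeasure ?N {..x} = (\<integral>\<^sup>+t. ennreal pi * indicator {0..x} t \<partial>lborel)"
      by (subst emeasure_density) (auto intro!: nn_integral_cong split: split_indicator)
    also have "\<dots> = ennreal pi * emeasure lborel {0..x}"
      by (subst nn_integral_cmult) simp_all
    also have "\<dots> = ennreal (pi * max 0 x)"
      by (cases "0 \<le> x") (simp_all add: ennreal_mult)
    finally show ?thesis .
  qed
  show "Int_stable ?E"
    by (auto simp: Int_stable_def)
  show "?E \<subseteq> Pow UNIV" by auto
  show "sets (distr lborel borel (\<lambda>z::complex. (cmod z)\<^sup>2)) = sigma_sets UNIV ?E"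
    by (simp add: borel_eq_atMost)
  show "sets ?N = sigma_sets UNIV ?E"
    by (simp add: borel_eq_atMost)
  show "range (\<lambda>n::nat. {..real n}) \<subseteq> ?E" by auto
  show "(\<Union>n::nat. {..real n}) = UNIV" using real_arch_simple by auto
  have M: "emeasure (distr lborel borel (\<lambda>z::complex. (cmod z)\<^sup>2)) {..x} = ennreal (pi * max 0 x)" for x :: real
  proof -
    have "emeasure (distr lborel borel (\<lambda>z::complex. (cmod z)\<^sup>2)) {..x}
        = emeasure lborel ({z::complex. (cmod z)\<^sup>2 \<le> x})"
      by (subst emeasure_distr) (auto intro!: arg_cong[where f = "emeasure lborel"])
    also have "\<dots> = ennreal (pi * max 0 x)"
    proof (cases "0 \<le> x")
      case True
      have "{z::complex. (cmod z)\<^sup>2 \<le> x} = cball 0 (sqrt x)"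
        using True by (auto simp: real_le_rsqrt real_sqrt_le_iff dest: real_sqrt_le_mono)
           (metis abs_norm_cancel real_sqrt_abs real_sqrt_le_iff)
      then show ?thesis
        using True by (simp add: emeasure_cball unit_ball_vol_2)
    next
      case False
      then have "{z::complex. (cmod z)\<^sup>2 \<le> x} = {}"
        by (auto simp: not_le intro: less_le_trans)
      then show ?thesis using False by simp
    qed
    finally show ?thesis .
  qed
  show "emeasure (distr lborel borel (\<lambda>z::complex. (cmod z)\<^sup>2)) X = emeasure ?N X" if "X \<in> ?E" for X
    using that by (auto simp: M N)
  show "emeasure (distr lborel borel (\<lambda>z::complex. (cmod z)\<^sup>2)) {..real n} \<noteq> \<infinity>" for n
    by (simp add: M)
qed

lemma nn_integral_complex_radial:
  fixes g :: "real \<Rightarrow> ennreal"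
  assumes [measurable]: "g \<in> borel_measurable borel"
  shows "(\<integral>\<^sup>+z. g ((cmod z)\<^sup>2) \<partial>lborel) = pi * (\<integral>\<^sup>+t. indicator {0..} t * g t \<partial>lborel)"
proof -
  have "(\<integral>\<^sup>+z. g ((cmod z)\<^sup>2) \<partial>lborel) = (\<integral>\<^sup>+t. g t \<partial>distr lborel borel (\<lambda>z::complex. (cmod z)\<^sup>2))"
    by (simp add: nn_integral_distr)
  also have "\<dots> = (\<integral>\<^sup>+t. ennreal pi * indicator {0..} t * g t \<partial>lborel)"
    unfolding distr_lborel_complex_norm_square by (simp add: nn_integral_density)
  also have "\<dots> = pi * (\<integral>\<^sup>+t. indicator {0..} t * g t \<partial>lborel)"
    by (simp add: nn_integral_cmult mult.assoc)
  finally show ?thesis .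
qed

text \<open>Euler's Beta integral for integer exponents, by induction on \<open>q\<close>: one
  factor \<open>v - s\<close> is split into \<open>v\<close> and \<open>- s\<close>, which lowers
  \<open>q\<close> at the cost of raising \<open>p\<close> in one of the two terms. Hence
  \<open>p\<close> stays arbitrary.\<close>

lemma has_integral_beta_nat:
  fixes v :: real
  assumes "0 \<le> v"
  shows "((\<lambda>s. s ^ p * (v - s) ^ q) has_integral v ^ (p + q + 1) * (fact p * fact q / fact (p + q + 1))) {0..v}"
proof (induction q arbitrary: p)
  case 0
  have "((\<lambda>s. s ^ p) has_integral (v ^ Suc p / real (Suc p) - 0 ^ Suc p / real (Suc p))) {0..v}"
  proof (rule fundamental_theorem_of_calculus[OF assms])
    fix x
    have "((\<lambda>s. s ^ Suc p / real (Suc p)) has_real_derivative x ^ p) (at x within {0..v})"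
      using DERIV_cdivide[OF DERIV_pow[of "Suc p" x "{0..v}"], of "real (Suc p)"] by simp
    then show "((\<lambda>s. s ^ Suc p / real (Suc p)) has_vector_derivative x ^ p) (at x within {0..v})"
      by (simp add: has_real_derivative_iff_has_vector_derivative)
  qed
  moreover have "fact p * fact 0 / fact (p + 0 + 1) = 1 / real (Suc p)"
    by (simp add: fact_Suc del: of_nat_Suc)
  ultimately show ?case by simp
next
  case (Suc q)
  have "((\<lambda>s. v * (s ^ p * (v - s) ^ q) - s ^ Suc p * (v - s) ^ q) has_integral
      v * (v ^ (p + q + 1) * (fact p * fact q / fact (p + q + 1)))
        - v ^ (Suc p + q + 1) * (fact (Suc p) * fact q / fact (Suc p + q + 1))) {0..v}"
    by (intro has_integral_diff has_integral_mult_right Suc.IH)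
  also have "(\<lambda>s. v * (s ^ p * (v - s) ^ q) - s ^ Suc p * (v - s) ^ q) = (\<lambda>s. s ^ p * (v - s) ^ Suc q)"
    by (auto simp: algebra_simps)
  also have "v * (v ^ (p + q + 1) * (fact p * fact q / fact (p + q + 1)))
        - v ^ (Suc p + q + 1) * (fact (Suc p) * fact q / fact (Suc p + q + 1))
      = v ^ (p + Suc q + 1) * (fact p * fact (Suc q) / fact (p + Suc q + 1))"
  proof -
    have "fact p * fact q / fact (p + q + 1) - fact (Suc p) * fact q / fact (Suc p + q + 1)
        = (fact p * fact (Suc q) / fact (p + Suc q + 1) :: real)"
      by (simp add: divide_simps) (simp add: algebra_simps)
    then have "v ^ (p + q + 2) * (fact p * fact q / fact (p + q + 1) - fact (Suc p) * fact q / fact (Suc p + q + 1))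
        = v ^ (p + q + 2) * (fact p * fact (Suc q) / fact (p + Suc q + 1))"
      by simp
    then show ?thesis by (simp add: right_diff_distrib mult.assoc)
  qed
  finally show ?case .
qed

lemma nn_integral_beta_nat:
  assumes "0 \<le> v"
  shows "(\<integral>\<^sup>+s. ennreal (indicator {0..} s * indicator {0..} (v - s) * (s ^ p * (v - s) ^ q)) \<partial>lborel)
    = ennreal (v ^ (p + q + 1) * (fact p * fact q / fact (p + q + 1)))"
proof (rule nn_integral_has_integral_lborel)
  have "((\<lambda>s. if s \<in> {0..v} then s ^ p * (v - s) ^ q else 0) has_integral
      v ^ (p + q + 1) * (fact p * fact q / fact (p + q + 1))) UNIV"
    using has_integral_beta_nat[OF assms] by (simp only: has_integral_restrict_UNIV)
  also have "(\<lambda>s. if s \<in> {0..v} then s ^ p * (v - s) ^ q else 0) = (\<lambda>s. indicator {0..} s * indicator {0..} (v - s) * (s ^ p * (v - s) ^ q))"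
    by (auto simp: fun_eq_iff split: split_indicator)
  finally show "((\<lambda>s. indicator {0..} s * indicator {0..} (v - s) * (s ^ p * (v - s) ^ q)) has_integral
      v ^ (p + q + 1) * (fact p * fact q / fact (p + q + 1))) UNIV" .
qed (auto split: split_indicator)

text \<open>Substituting \<open>v = s + t\<close> and exchanging the integrals leaves a Beta
  integral over \<open>0 \<le> s \<le> v\<close>. This is the step that adds one variable to a
  Dirichlet integral.\<close>

lemma nn_integral_convolution_nat:
  fixes g :: "real \<Rightarrow> ennreal"
  assumes [measurable]: "g \<in> borel_measurable borel"
  shows "(\<integral>\<^sup>+s. indicator {0..} s * (ennreal (s ^ p) * (\<integral>\<^sup>+t. indicator {0..} t * (ennreal (t ^ q) * g (s + t)) \<partial>lborel)) \<partial>lborel)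
    = ennreal (fact p * fact q / fact (p + q + 1)) * (\<integral>\<^sup>+v. indicator {0..} v * (ennreal (v ^ (p + q + 1)) * g v) \<partial>lborel)"
    (is "?L = ?R")
proof -
  define n and C :: real where "n = p + q + 1" and "C = fact p * fact q / fact n"
  have C: "0 \<le> C" by (simp add: C_def)
  have "?L = (\<integral>\<^sup>+s. \<integral>\<^sup>+t. indicator {0..} s * (ennreal (s ^ p) * (indicator {0..} t * (ennreal (t ^ q) * g (s + t)))) \<partial>lborel \<partial>lborel)"
    by (simp add: nn_integral_cmult)
  also have "\<dots> = (\<integral>\<^sup>+s. \<integral>\<^sup>+v. ennreal (indicator {0..} s * indicator {0..} (v - s) * (s ^ p * (v - s) ^ q)) * (indicator {0..} v * g v) \<partial>lborel \<partial>lborel)"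
  proof (rule nn_integral_cong)
    fix s :: real
    have "(\<integral>\<^sup>+t. indicator {0..} s * (ennreal (s ^ p) * (indicator {0..} t * (ennreal (t ^ q) * g (s + t)))) \<partial>lborel)
      = (\<integral>\<^sup>+v. indicator {0..} s * (ennreal (s ^ p) * (indicator {0..} (v - s) * (ennreal ((v - s) ^ q) * g v))) \<partial>lborel)"
      by (subst nn_integral_translate[where a = "- s", symmetric]) simp_all
    also have "\<dots> = (\<integral>\<^sup>+v. ennreal (indicator {0..} s * indicator {0..} (v - s) * (s ^ p * (v - s) ^ q)) * (indicator {0..} v * g v) \<partial>lborel)"
      by (intro nn_integral_cong) (auto split: split_indicator simp: ennreal_mult mult_ac)
    finally show "(\<integral>\<^sup>+t. indicator {0..} s * (ennreal (s ^ p) * (indicator {0..} t * (ennreal (t ^ q) * g (s + t)))) \<partial>lborel)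
      = (\<integral>\<^sup>+v. ennreal (indicator {0..} s * indicator {0..} (v - s) * (s ^ p * (v - s) ^ q)) * (indicator {0..} v * g v) \<partial>lborel)" .
  qed
  also have "\<dots> = (\<integral>\<^sup>+v. \<integral>\<^sup>+s. ennreal (indicator {0..} s * indicator {0..} (v - s) * (s ^ p * (v - s) ^ q)) * (indicator {0..} v * g v) \<partial>lborel \<partial>lborel)"
  proof (rule lborel_pair.Fubini')
    show "(\<lambda>(v, s). ennreal (indicator {0..} s * indicator {0..} (v - s) * (s ^ p * (v - s) ^ q)) * (indicator {0..} v * g v)) \<in> borel_measurable (lborel \<Otimes>\<^sub>M lborel)"
      by measurable
  qed
  also have "\<dots> = (\<integral>\<^sup>+v. ennreal (v ^ n * C) * (indicator {0..} v * g v) \<partial>lborel)"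
  proof (rule nn_integral_cong)
    fix v :: real
    show "(\<integral>\<^sup>+s. ennreal (indicator {0..} s * indicator {0..} (v - s) * (s ^ p * (v - s) ^ q)) * (indicator {0..} v * g v) \<partial>lborel)
      = ennreal (v ^ n * C) * (indicator {0..} v * g v)"
    proof (cases "0 \<le> v")
      case True
      then show ?thesis by (subst nn_integral_multc) (simp_all add: nn_integral_beta_nat n_def C_def)
    qed simp
  qed
  also have "\<dots> = (\<integral>\<^sup>+v. ennreal C * (indicator {0..} v * (ennreal (v ^ n) * g v)) \<partial>lborel)"
    by (intro nn_integral_cong) (auto split: split_indicator simp: ennreal_mult C mult_ac)
  also have "\<dots> = ?R"
    unfolding C_def n_def by (rule nn_integral_cmult) simp
  finally show ?thesis .
qed

text \<open>Dirichlet's integral: each complex coordinate contributes, through its squared modulus,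
  one nonnegative real variable with density \<open>pi\<close>, and the convolution formula merges
  these into a single one. The sums run over \<open>\<alpha> a + 1\<close>, so the exponent is the
  total degree plus \<open>card J\<close>, minus 1.\<close>

lemma nn_integral_PiM_radial:
  fixes g :: "real \<Rightarrow> ennreal"
  assumes "finite J" "J \<noteq> {}" and "g \<in> borel_measurable borel"
  shows "(\<integral>\<^sup>+x. ennreal (\<Prod>a\<in>J. ((cmod (x a))\<^sup>2) ^ \<alpha> a) * g (\<Sum>a\<in>J. (cmod (x a))\<^sup>2) \<partial>Pi\<^sub>M J (\<lambda>_. lborel))
    = ennreal (pi ^ card J * (\<Prod>a\<in>J. fact (\<alpha> a)) / fact ((\<Sum>a\<in>J. \<alpha> a + 1) - 1)) *
      (\<integral>\<^sup>+v. indicator {0..} v * (ennreal (v ^ ((\<Sum>a\<in>J. \<alpha> a + 1) - 1)) * g v) \<partial>lborel)"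
proof -
  interpret product_sigma_finite "\<lambda>_::'a. lborel :: complex measure" ..
  \<comment> \<open>Writing the sum as a successor removes the truncated subtraction, and
    quantifying over \<open>g\<close> inside the claim lets the induction hypothesis be used for the
    shifts of \<open>g\<close> by a squared modulus.\<close>
  have "\<exists>n. (\<Sum>a\<in>J. \<alpha> a + 1) = Suc n \<and> (\<forall>g\<in>borel_measurable borel.
    (\<integral>\<^sup>+x. ennreal (\<Prod>a\<in>J. ((cmod (x a))\<^sup>2) ^ \<alpha> a) * g (\<Sum>a\<in>J. (cmod (x a))\<^sup>2) \<partial>Pi\<^sub>M J (\<lambda>_. lborel))
    = ennreal (pi ^ card J * (\<Prod>a\<in>J. fact (\<alpha> a)) / fact n) *
      (\<integral>\<^sup>+v. indicator {0..} v * (ennreal (v ^ n) * g v) \<partial>lborel))"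
    using assms(1,2)
  proof (induction J rule: finite_ne_induct)
    case (singleton i)
    have "(\<integral>\<^sup>+x. ennreal (\<Prod>a\<in>{i}. ((cmod (x a))\<^sup>2) ^ \<alpha> a) * g (\<Sum>a\<in>{i}. (cmod (x a))\<^sup>2) \<partial>Pi\<^sub>M {i} (\<lambda>_. lborel))
      = ennreal (pi ^ card {i} * (\<Prod>a\<in>{i}. fact (\<alpha> a)) / fact (\<alpha> i)) *
        (\<integral>\<^sup>+v. indicator {0..} v * (ennreal (v ^ \<alpha> i) * g v) \<partial>lborel)"
      if [measurable]: "g \<in> borel_measurable borel" for g
    proof -
      have "(\<integral>\<^sup>+x. ennreal (\<Prod>a\<in>{i}. ((cmod (x a))\<^sup>2) ^ \<alpha> a) * g (\<Sum>a\<in>{i}. (cmod (x a))\<^sup>2) \<partial>Pi\<^sub>M {i} (\<lambda>_. lborel))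
        = (\<integral>\<^sup>+z. ennreal (((cmod z)\<^sup>2) ^ \<alpha> i) * g ((cmod z)\<^sup>2) \<partial>lborel)"
        using product_nn_integral_singleton[of "\<lambda>z. ennreal (((cmod z)\<^sup>2) ^ \<alpha> i) * g ((cmod z)\<^sup>2)" i] by simp
      also have "\<dots> = ennreal pi * (\<integral>\<^sup>+v. indicator {0..} v * (ennreal (v ^ \<alpha> i) * g v) \<partial>lborel)"
        by (rule nn_integral_complex_radial) measurable
      finally show ?thesis by simp
    qed
    then show ?case by (intro exI[of _ "\<alpha> i"]) auto
  next
    case (insert i J)
    from insert.IH obtain n where n: "(\<Sum>a\<in>J. \<alpha> a + 1) = Suc n"
      and IH: "\<And>g. g \<in> borel_measurable borel \<Longrightarrow>
        (\<integral>\<^sup>+x. ennreal (\<Prod>a\<in>J. ((cmod (x a))\<^sup>2) ^ \<alpha> a) * g (\<Sum>a\<in>J. (cmod (x a))\<^sup>2) \<partial>Pi\<^sub>M J (\<lambda>_. lborel))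
        = ennreal (pi ^ card J * (\<Prod>a\<in>J. fact (\<alpha> a)) / fact n) *
          (\<integral>\<^sup>+v. indicator {0..} v * (ennreal (v ^ n) * g v) \<partial>lborel)"
      by blast
    define C where "C = pi ^ card J * (\<Prod>a\<in>J. fact (\<alpha> a)) / fact n"
    define D where "D = fact (\<alpha> i) * fact n / (fact (\<alpha> i + n + 1) :: real)"
    have CD: "0 \<le> C" "0 \<le> D" by (auto simp: C_def D_def intro!: prod_nonneg divide_nonneg_nonneg mult_nonneg_nonneg)
    have "(\<integral>\<^sup>+x. ennreal (\<Prod>a\<in>insert i J. ((cmod (x a))\<^sup>2) ^ \<alpha> a) * g (\<Sum>a\<in>insert i J. (cmod (x a))\<^sup>2) \<partial>Pi\<^sub>M (insert i J) (\<lambda>_. lborel))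
      = ennreal (pi * C * D) * (\<integral>\<^sup>+v. indicator {0..} v * (ennreal (v ^ (\<alpha> i + n + 1)) * g v) \<partial>lborel)"
      (is "?L = _")
      if [measurable]: "g \<in> borel_measurable borel" for g
    proof -
      have "?L = (\<integral>\<^sup>+y. (\<integral>\<^sup>+x. ennreal (\<Prod>a\<in>insert i J. ((cmod ((x(i := y)) a))\<^sup>2) ^ \<alpha> a) *
          g (\<Sum>a\<in>insert i J. (cmod ((x(i := y)) a))\<^sup>2) \<partial>Pi\<^sub>M J (\<lambda>_. lborel)) \<partial>lborel)"
        by (rule product_nn_integral_insert_rev) (use insert.hyps in \<open>auto intro!: borel_measurable_times_ennreal\<close>)
      also have "\<dots> = (\<integral>\<^sup>+y. ennreal C * (ennreal (((cmod y)\<^sup>2) ^ \<alpha> i) *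
          (\<integral>\<^sup>+v. indicator {0..} v * (ennreal (v ^ n) * g ((cmod y)\<^sup>2 + v)) \<partial>lborel)) \<partial>lborel)"
      proof (rule nn_integral_cong)
        fix y :: complex
        have p: "(\<Prod>a\<in>J. ((cmod ((x(i := y)) a))\<^sup>2) ^ \<alpha> a) = (\<Prod>a\<in>J. ((cmod (x a))\<^sup>2) ^ \<alpha> a)" for x
          using insert.hyps by (intro prod.cong) auto
        have s: "(\<Sum>a\<in>J. (cmod ((x(i := y)) a))\<^sup>2) = (\<Sum>a\<in>J. (cmod (x a))\<^sup>2)" for x
          using insert.hyps by (intro sum.cong) auto
        have "(\<integral>\<^sup>+x. ennreal (\<Prod>a\<in>insert i J. ((cmod ((x(i := y)) a))\<^sup>2) ^ \<alpha> a) *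
            g (\<Sum>a\<in>insert i J. (cmod ((x(i := y)) a))\<^sup>2) \<partial>Pi\<^sub>M J (\<lambda>_. lborel))
          = (\<integral>\<^sup>+x. ennreal (((cmod y)\<^sup>2) ^ \<alpha> i) * (ennreal (\<Prod>a\<in>J. ((cmod (x a))\<^sup>2) ^ \<alpha> a) *
            g ((cmod y)\<^sup>2 + (\<Sum>a\<in>J. (cmod (x a))\<^sup>2))) \<partial>Pi\<^sub>M J (\<lambda>_. lborel))"
          unfolding prod.insert[OF insert.hyps(1,3)] sum.insert[OF insert.hyps(1,3)] p s
          by (simp add: ennreal_mult prod_nonneg mult.assoc)
        also have "\<dots> = ennreal (((cmod y)\<^sup>2) ^ \<alpha> i) * (\<integral>\<^sup>+x. ennreal (\<Prod>a\<in>J. ((cmod (x a))\<^sup>2) ^ \<alpha> a) *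
            g ((cmod y)\<^sup>2 + (\<Sum>a\<in>J. (cmod (x a))\<^sup>2)) \<partial>Pi\<^sub>M J (\<lambda>_. lborel))"
          by (rule nn_integral_cmult) measurable
        also have "\<dots> = ennreal (((cmod y)\<^sup>2) ^ \<alpha> i) * (ennreal C *
          (\<integral>\<^sup>+v. indicator {0..} v * (ennreal (v ^ n) * g ((cmod y)\<^sup>2 + v)) \<partial>lborel))"
          unfolding C_def by (subst IH) simp_all
        finally show "(\<integral>\<^sup>+x. ennreal (\<Prod>a\<in>insert i J. ((cmod ((x(i := y)) a))\<^sup>2) ^ \<alpha> a) *
            g (\<Sum>a\<in>insert i J. (cmod ((x(i := y)) a))\<^sup>2) \<partial>Pi\<^sub>M J (\<lambda>_. lborel))
          = ennreal C * (ennreal (((cmod y)\<^sup>2) ^ \<alpha> i) *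
          (\<integral>\<^sup>+v. indicator {0..} v * (ennreal (v ^ n) * g ((cmod y)\<^sup>2 + v)) \<partial>lborel))"
          by (simp only: mult.left_commute)
      qed
      also have "\<dots> = ennreal C * (\<integral>\<^sup>+y. ennreal (((cmod y)\<^sup>2) ^ \<alpha> i) *
          (\<integral>\<^sup>+v. indicator {0..} v * (ennreal (v ^ n) * g ((cmod y)\<^sup>2 + v)) \<partial>lborel) \<partial>lborel)"
        by (rule nn_integral_cmult) measurable
      also have "\<dots> = ennreal C * (ennreal pi * (\<integral>\<^sup>+s. indicator {0..} s * (ennreal (s ^ \<alpha> i) *
          (\<integral>\<^sup>+v. indicator {0..} v * (ennreal (v ^ n) * g (s + v)) \<partial>lborel)) \<partial>lborel))"
        by (subst nn_integral_complex_radial[where g = "\<lambda>s. ennreal (s ^ \<alpha> i) *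
          (\<integral>\<^sup>+v. indicator {0..} v * (ennreal (v ^ n) * g (s + v)) \<partial>lborel)"]) simp_all
      also have "\<dots> = ennreal C * (ennreal pi * (ennreal D *
          (\<integral>\<^sup>+v. indicator {0..} v * (ennreal (v ^ (\<alpha> i + n + 1)) * g v) \<partial>lborel)))"
        unfolding D_def by (subst nn_integral_convolution_nat) simp_all
      finally show ?thesis using CD by (simp add: ennreal_mult mult_ac)
    qed
    moreover have "pi * C * D = pi ^ card (insert i J) * (\<Prod>a\<in>insert i J. fact (\<alpha> a)) / fact (\<alpha> i + n + 1)"
      using insert.hyps by (simp add: C_def D_def del: fact_Suc)
    ultimately show ?case
      using insert.hyps n by (intro exI[of _ "\<alpha> i + n + 1"]) auto
  qed
  then obtain n where n: "(\<Sum>a\<in>J. \<alpha> a + 1) = Suc n" and *: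
    "(\<integral>\<^sup>+x. ennreal (\<Prod>a\<in>J. ((cmod (x a))\<^sup>2) ^ \<alpha> a) * g (\<Sum>a\<in>J. (cmod (x a))\<^sup>2) \<partial>Pi\<^sub>M J (\<lambda>_. lborel))
    = ennreal (pi ^ card J * (\<Prod>a\<in>J. fact (\<alpha> a)) / fact n) *
      (\<integral>\<^sup>+v. indicator {0..} v * (ennreal (v ^ n) * g v) \<partial>lborel)"
    using assms(3) by blast
  then show ?thesis unfolding n by simp
qed

lemma nn_integral_scale_power:
  fixes g :: "real \<Rightarrow> ennreal"
  assumes [measurable]: "g \<in> borel_measurable borel" and c: "0 < c"
  shows "(\<integral>\<^sup>+v. indicator {0..} v * (ennreal (v ^ n) * g (v * c)) \<partial>lborel)
    = ennreal (1 / c ^ (n + 1)) * (\<integral>\<^sup>+v. indicator {0..} v * (ennreal (v ^ n) * g v) \<partial>lborel)"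
proof -
  have "(\<integral>\<^sup>+v. indicator {0..} v * (ennreal (v ^ n) * g v) \<partial>lborel)
    = ennreal c * (\<integral>\<^sup>+v. indicator {0..} (c * v) * (ennreal ((c * v) ^ n) * g (c * v)) \<partial>lborel)"
    using nn_integral_real_affine[of "\<lambda>v. indicator {0..} v * (ennreal (v ^ n) * g v)" c 0] c by simp
  also have "\<dots> = ennreal c * (\<integral>\<^sup>+v. ennreal (c ^ n) * (indicator {0..} v * (ennreal (v ^ n) * g (v * c))) \<partial>lborel)"
  proof (intro arg_cong2[where f = "(*)"] refl, rule nn_integral_cong)
    fix v :: real
    show "indicator {0..} (c * v) * (ennreal ((c * v) ^ n) * g (c * v))
      = ennreal (c ^ n) * (indicator {0..} v * (ennreal (v ^ n) * g (v * c)))"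
      using c by (cases "0 \<le> v")
        (simp_all add: power_mult_distrib ennreal_mult mult_ac zero_le_mult_iff)
  qed
  also have "\<dots> = ennreal (c ^ (n + 1)) * (\<integral>\<^sup>+v. indicator {0..} v * (ennreal (v ^ n) * g (v * c)) \<partial>lborel)"
    using c by (subst nn_integral_cmult) (simp_all add: ennreal_mult mult.assoc)
  finally show ?thesis
    using c by (simp add: mult.assoc[symmetric] ennreal_mult'[symmetric])
qed

lemma nn_integral_vec:
  assumes "f \<in> borel_measurable borel"
  shows "(\<integral>\<^sup>+z. f z \<partial>lborel) = (\<integral>\<^sup>+x. f (\<chi> i. x i) \<partial>Pi\<^sub>M (UNIV :: 'n::finite set) (\<lambda>_. lborel :: 'a::euclidean_space measure))"
  by (subst lborel_vec, subst nn_integral_distr) (simp_all add: assms)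

lemma borel_measurable_zmono [measurable]: "zmono \<alpha> \<in> borel_measurable borel"
  unfolding zmono_def[abs_def] by measurable

lemma norm_zmono_square: "(cmod (zmono \<alpha> z))\<^sup>2 = (\<Prod>i\<in>UNIV. ((cmod (z $ i))\<^sup>2) ^ \<alpha> i)"
  by (simp add: zmono_def prod_norm[symmetric] norm_power prod_power_distrib power_mult[symmetric] mult.commute)

text \<open>Fubini with coordinate \<open>i0\<close> outermost: for fixed \<open>i0\<close> the
  remaining integral is a Dirichlet integral whose argument is rescaled by \<open>\<phi>\<close>.
  Rescaling pulls out \<open>1 / \<phi> ^ (n + 1)\<close>, after which the two integrals are
  decoupled.\<close>

lemma nn_integral_zmono_weight:
  fixes i0 :: "'n::finite" and A G :: "real \<Rightarrow> ennreal" and \<phi> :: "real \<Rightarrow> real"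
  assumes [measurable]: "A \<in> borel_measurable borel" "G \<in> borel_measurable borel" "\<phi> \<in> borel_measurable borel"
    and \<phi>: "\<And>t. 0 \<le> t \<Longrightarrow> 0 < \<phi> t" and J: "J = UNIV - {i0}" "J \<noteq> {}"
    and n: "n = (\<Sum>a\<in>J. \<alpha> a + 1) - 1"
  shows "(\<integral>\<^sup>+z. ennreal ((cmod (zmono \<alpha> z))\<^sup>2) *
      (A ((cmod (z $ i0))\<^sup>2) * G ((\<Sum>a\<in>J. (cmod (z $ a))\<^sup>2) * \<phi> ((cmod (z $ i0))\<^sup>2))) \<partial>lborel)
    = ennreal (pi ^ CARD('n) * (\<Prod>a\<in>J. fact (\<alpha> a)) / fact n)
      * (\<integral>\<^sup>+x. indicator {0..} x * (ennreal (x ^ \<alpha> i0 / \<phi> x ^ (n + 1)) * A x) \<partial>lborel)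
      * (\<integral>\<^sup>+t. indicator {0..} t * (ennreal (t ^ n) * G t) \<partial>lborel)" (is "?L = _")
proof -
  interpret product_sigma_finite "\<lambda>_::'n. lborel :: complex measure" ..
  have UNIV: "UNIV = insert i0 J" and i0: "i0 \<notin> J" and fin: "finite J"
    using J by auto
  define C where "C = pi ^ card J * (\<Prod>a\<in>J. fact (\<alpha> a)) / fact n"
  have C: "0 \<le> C" by (auto simp: C_def intro!: prod_nonneg divide_nonneg_nonneg mult_nonneg_nonneg)
  define I where "I = (\<integral>\<^sup>+t. indicator {0..} t * (ennreal (t ^ n) * G t) \<partial>lborel)"
  define F where "F x = ennreal (\<Prod>i\<in>insert i0 J. ((cmod (x i))\<^sup>2) ^ \<alpha> i) *
      (A ((cmod (x i0))\<^sup>2) * G ((\<Sum>a\<in>J. (cmod (x a))\<^sup>2) * \<phi> ((cmod (x i0))\<^sup>2)))" for x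
  have "?L = (\<integral>\<^sup>+x. F x \<partial>Pi\<^sub>M (insert i0 J) (\<lambda>_. lborel))"
    unfolding F_def UNIV[symmetric] norm_zmono_square by (subst nn_integral_vec) simp_all
  also have "\<dots> = (\<integral>\<^sup>+y. (\<integral>\<^sup>+x. F (x(i0 := y)) \<partial>Pi\<^sub>M J (\<lambda>_. lborel)) \<partial>lborel)"
    by (rule product_nn_integral_insert_rev[OF fin i0]) (use i0 in \<open>auto simp: F_def intro!: borel_measurable_times_ennreal\<close>)
  also have "\<dots> = (\<integral>\<^sup>+y. ennreal C * I * (ennreal (((cmod y)\<^sup>2) ^ \<alpha> i0 / \<phi> ((cmod y)\<^sup>2) ^ (n + 1)) * A ((cmod y)\<^sup>2)) \<partial>lborel)"
  proof (rule nn_integral_cong)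
    fix y :: complex
    have p: "(\<Prod>a\<in>J. ((cmod ((x(i0 := y)) a))\<^sup>2) ^ \<alpha> a) = (\<Prod>a\<in>J. ((cmod (x a))\<^sup>2) ^ \<alpha> a)" for x
      using i0 by (intro prod.cong) auto
    have s: "(\<Sum>a\<in>J. (cmod ((x(i0 := y)) a))\<^sup>2) = (\<Sum>a\<in>J. (cmod (x a))\<^sup>2)" for x
      using i0 by (intro sum.cong) auto
    let ?r = "(cmod y)\<^sup>2"
    have "(\<integral>\<^sup>+x. F (x(i0 := y)) \<partial>Pi\<^sub>M J (\<lambda>_. lborel))
      = (\<integral>\<^sup>+x. (ennreal (?r ^ \<alpha> i0) * A ?r) * (ennreal (\<Prod>a\<in>J. ((cmod (x a))\<^sup>2) ^ \<alpha> a) *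
          G ((\<Sum>a\<in>J. (cmod (x a))\<^sup>2) * \<phi> ?r)) \<partial>Pi\<^sub>M J (\<lambda>_. lborel))"
      unfolding F_def prod.insert[OF fin i0] p s
      by (simp add: ennreal_mult prod_nonneg mult_ac)
    also have "\<dots> = (ennreal (?r ^ \<alpha> i0) * A ?r) * (\<integral>\<^sup>+x. (ennreal (\<Prod>a\<in>J. ((cmod (x a))\<^sup>2) ^ \<alpha> a) *
          G ((\<Sum>a\<in>J. (cmod (x a))\<^sup>2) * \<phi> ?r)) \<partial>Pi\<^sub>M J (\<lambda>_. lborel))"
      by (rule nn_integral_cmult) measurable
    also have "\<dots> = (ennreal (?r ^ \<alpha> i0) * A ?r) * (ennreal C * (ennreal (1 / \<phi> ?r ^ (n + 1)) * I))"
      unfolding C_def I_def n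
      by (subst nn_integral_PiM_radial[OF fin J(2), where g = "\<lambda>t. G (t * \<phi> ?r)"])
         (simp_all add: nn_integral_scale_power \<phi>)
    also have "\<dots> = ennreal C * I * ((ennreal (?r ^ \<alpha> i0) * ennreal (1 / \<phi> ?r ^ (n + 1))) * A ?r)"
      by (simp only: mult_ac)
    also have "ennreal (?r ^ \<alpha> i0) * ennreal (1 / \<phi> ?r ^ (n + 1)) = ennreal (?r ^ \<alpha> i0 / \<phi> ?r ^ (n + 1))"
      using \<phi>[of ?r] by (subst ennreal_mult[symmetric]) (auto simp: less_imp_le)
    finally show "(\<integral>\<^sup>+x. F (x(i0 := y)) \<partial>Pi\<^sub>M J (\<lambda>_. lborel))
      = ennreal C * I * (ennreal (?r ^ \<alpha> i0 / \<phi> ?r ^ (n + 1)) * A ?r)" .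
  qed
  also have "\<dots> = ennreal pi * (\<integral>\<^sup>+x. indicator {0..} x * (ennreal C * I * (ennreal (x ^ \<alpha> i0 / \<phi> x ^ (n + 1)) * A x)) \<partial>lborel)"
    by (rule nn_integral_complex_radial) measurable
  also have "\<dots> = ennreal pi * (\<integral>\<^sup>+x. (ennreal C * I) * (indicator {0..} x * (ennreal (x ^ \<alpha> i0 / \<phi> x ^ (n + 1)) * A x)) \<partial>lborel)"
    by (simp only: mult_ac)
  also have "\<dots> = ennreal pi * ((ennreal C * I) * (\<integral>\<^sup>+x. indicator {0..} x * (ennreal (x ^ \<alpha> i0 / \<phi> x ^ (n + 1)) * A x) \<partial>lborel))"
    by (subst nn_integral_cmult) simp_all
  also have "\<dots> = ennreal (pi * C) * (\<integral>\<^sup>+x. indicator {0..} x * (ennreal (x ^ \<alpha> i0 / \<phi> x ^ (n + 1)) * A x) \<partial>lborel) * I"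
    using C by (simp add: ennreal_mult mult_ac)
  also have "pi * C = pi ^ CARD('n) * (\<Prod>a\<in>J. fact (\<alpha> a)) / fact n"
    unfolding C_def UNIV using i0 fin by simp
  finally show ?thesis unfolding I_def .
qed

text \<open>Raising \<open>j\<close> uses \<open>x / (1 + x) = 1 - 1 / (1 + x)\<close>: the integral
  is a difference of two integrals with the old \<open>j\<close>, one of them with \<open>K\<close>
  lowered by 1. Hence \<open>K\<close> varies in the induction.\<close>

lemma has_bochner_integral_beta_prime:
  assumes "j \<le> K"
  shows "has_bochner_integral lborel (\<lambda>x::real. indicator {0..} x * (x ^ j / (1 + x) ^ (K + 2)))
    (fact j * fact (K - j) / fact (K + 1))"
  using assms
proof (induction j arbitrary: K)
  case 0
  show ?case
  proof (rule has_bochner_integral_nn_integral)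
    let ?F = "\<lambda>x::real. - (1 / real (Suc K)) * inverse (1 + x) ^ Suc K"
    have "(\<integral>\<^sup>+x. ennreal (inverse (1 + x) ^ (K + 2)) * indicator {0..} x \<partial>lborel) = - (1 / real (Suc K)) * 0 ^ Suc K - ?F 0"
    proof (rule nn_integral_FTC_atLeast)
      fix x :: real assume x: "0 \<le> x"
      have "((\<lambda>x. inverse (1 + x)) has_real_derivative - (inverse (1 + x))\<^sup>2) (at x)"
        using x by (auto intro!: derivative_eq_intros simp: power2_eq_square)
      from DERIV_power[OF this, of "Suc K"]
      have "((\<lambda>x. inverse (1 + x) ^ Suc K) has_real_derivative real (Suc K) * (- (inverse (1 + x))\<^sup>2 * inverse (1 + x) ^ K)) (at x)"
        by (simp del: of_nat_Suc power_Suc)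
      from DERIV_cmult[OF this, of "- (1 / real (Suc K))"]
      show "(?F has_real_derivative inverse (1 + x) ^ (K + 2)) (at x)"
        by (simp add: power_add power2_eq_square mult_ac del: of_nat_Suc)
    next
      have "((\<lambda>x::real. inverse (1 + x)) \<longlongrightarrow> 0) at_top"
        by (intro tendsto_inverse_0_at_top filterlim_tendsto_add_at_top[OF tendsto_const filterlim_ident])
      then show "(?F \<longlongrightarrow> - (1 / real (Suc K)) * 0 ^ Suc K) at_top"
        by (intro tendsto_mult tendsto_power tendsto_const)
    qed auto
    moreover have "(\<integral>\<^sup>+x. ennreal (indicator {0..} x * (x ^ 0 / (1 + x) ^ (K + 2))) \<partial>lborel)
      = (\<integral>\<^sup>+x. ennreal (inverse (1 + x) ^ (K + 2)) * indicator {0..} x \<partial>lborel)"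
      by (rule nn_integral_cong) (auto simp: power_inverse inverse_eq_divide power_one_over split: split_indicator)
    moreover have "- (1 / real (Suc K)) * 0 ^ Suc K - ?F 0 = fact 0 * fact (K - 0) / fact (K + 1)"
      by (simp add: fact_Suc del: of_nat_Suc)
    ultimately show "(\<integral>\<^sup>+x. ennreal (indicator {0..} x * (x ^ 0 / (1 + x) ^ (K + 2))) \<partial>lborel) = ennreal (fact 0 * fact (K - 0) / fact (K + 1))"
      by metis
  qed (auto split: split_indicator)
next
  case (Suc j)
  then obtain K' where K: "K = Suc K'" by (cases K) auto
  have "has_bochner_integral lborel (\<lambda>x::real. indicator {0..} x * (x ^ j / (1 + x) ^ (K' + 2)) -
     indicator {0..} x * (x ^ j / (1 + x) ^ (K + 2)))
    (fact j * fact (K' - j) / fact (K' + 1) - fact j * fact (K - j) / fact (K + 1))"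
    using Suc.prems K by (intro has_bochner_integral_diff Suc.IH) auto
  also have "(\<lambda>x::real. indicator {0..} x * (x ^ j / (1 + x) ^ (K' + 2)) -
     indicator {0..} x * (x ^ j / (1 + x) ^ (K + 2))) = (\<lambda>x. indicator {0..} x * (x ^ Suc j / (1 + x) ^ (K + 2)))"
    unfolding K by (auto simp: fun_eq_iff divide_simps split: split_indicator) (simp add: algebra_simps)
  also have "fact j * fact (K' - j) / fact (K' + 1) - fact j * fact (K - j) / fact (K + 1)
     = (fact (Suc j) * fact (K - Suc j) / fact (K + 1) :: real)"
  proof -
    have j: "j \<le> K'" using Suc.prems K by simp
    define d where "d = K' - j"
    have "K' = j + d" using j by (simp add: d_def)
    then show ?thesis unfolding K by (simp add: Suc_diff_le divide_simps) (simp add: algebra_simps)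
  qed
  finally show ?case .
qed

text \<open>For \<open>x \<ge> 1\<close> one has \<open>1 + x \<le> 2 * x\<close>, so the integrand
  dominates \<open>c / x\<close>, whose integral diverges logarithmically.\<close>

lemma nn_integral_beta_prime_infinite:
  assumes "K < j"
  shows "(\<integral>\<^sup>+x. indicator {0..} x * ennreal (x ^ j / (1 + x) ^ (K + 2)) \<partial>lborel) = \<infinity>"
proof (rule ccontr)
  let ?I = "\<integral>\<^sup>+x. indicator {0..} x * ennreal (x ^ j / (1 + x) ^ (K + 2)) \<partial>lborel"
  define c :: real where "c = 1 / 2 ^ (K + 2)"
  have c: "0 < c" by (simp add: c_def)
  assume "?I \<noteq> \<infinity>"
  then obtain V where V: "0 \<le> V" "?I = ennreal V" by (cases ?I) auto
  \<comment> \<open>Chosen so that \<open>c * ln N = V + c\<close> exceeds the supposed finite value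
    \<open>V\<close>.\<close>
  define N where "N = exp (V / c + 1)"
  have N: "1 \<le> N" using V c by (simp add: N_def)
  have "ennreal (c * ln N - c * ln 1) = (\<integral>\<^sup>+x. ennreal (c / x) * indicator {1..N} x \<partial>lborel)"
    using c N by (intro nn_integral_FTC_Icc[symmetric])
      (auto intro!: derivative_eq_intros simp: divide_simps)
  also have "\<dots> \<le> ?I"
  proof (rule nn_integral_mono)
    fix x :: real
    show "ennreal (c / x) * indicator {1..N} x \<le> indicator {0..} x * ennreal (x ^ j / (1 + x) ^ (K + 2))"
    proof (cases "x \<in> {1..N}")
      case True
      then have x: "1 \<le> x" by simp
      have "c / x = x ^ (K + 1) / (2 * x) ^ (K + 2)"
        using x by (simp add: c_def power_mult_distrib)
      also have "\<dots> \<le> x ^ j / (1 + x) ^ (K + 2)"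
        using x assms by (intro frac_le power_increasing power_mono) auto
      finally show ?thesis using True by (simp add: ennreal_leI)
    qed simp
  qed
  finally have "ennreal (c * ln N) \<le> ?I" by (simp only: ln_one mult_zero_right diff_zero)
  then have "ennreal (c * ln N) \<le> ennreal V" by (simp only: V(2))
  then have "c * ln N \<le> V" using V by (simp add: ennreal_le_iff)
  moreover have "c * ln N = V + c" using c by (simp add: N_def field_simps)
  ultimately show False using c by simp
qed

section \<open>Parseval's identity on Reinhardt domains\<close>

definition radial :: "(complex ^ 'n::finite \<Rightarrow> 'b) \<Rightarrow> bool" where
  "radial W \<longleftrightarrow> (\<forall>z w. (\<forall>i. cmod (z $ i) = cmod (w $ i)) \<longrightarrow> W z = W w)"

text \<open>Integrate first over a coordinate in which the exponents differ: with the others fixed,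
  a radial \<open>W\<close> depends on the modulus only, and the rotation argument applies.\<close>

lemma integral_zmono_orthogonal:
  fixes W :: "complex ^ 'n::finite \<Rightarrow> real"
  assumes W [measurable]: "W \<in> borel_measurable borel" and rad: "radial W" and "\<alpha> \<noteq> \<beta>"
  shows "(\<integral>z. zmono \<alpha> z * cnj (zmono \<beta> z) * of_real (W z) \<partial>lborel) = 0"
proof (cases "integrable lborel (\<lambda>z. zmono \<alpha> z * cnj (zmono \<beta> z) * of_real (W z))")
  \<comment> \<open>The Bochner integral of a non-integrable function is 0 by convention;
    integrability is what Fubini requires in the other case.\<close>
  case False
  then show ?thesis by (rule not_integrable_integral_eq)
next
  case int: True
  interpret product_sigma_finite "\<lambda>_::'n. lborel :: complex measure" ..
  obtain i where i: "\<alpha> i \<noteq> \<beta> i" using assms(3) by auto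
  define J where "J = UNIV - {i}"
  have J: "UNIV = insert i J" "i \<notin> J" "finite J" by (auto simp: J_def)
  have [measurable]: "cnj \<in> borel_measurable borel"
    by (intro borel_measurable_continuous_onI continuous_intros)
  define F where "F x = zmono \<alpha> (vec_lambda x) * cnj (zmono \<beta> (vec_lambda x)) * of_real (W (vec_lambda x))" for x
  have "(\<integral>z. zmono \<alpha> z * cnj (zmono \<beta> z) * of_real (W z) \<partial>lborel) = (\<integral>x. F x \<partial>Pi\<^sub>M (insert i J) (\<lambda>_. lborel))"
    unfolding F_def J(1)[symmetric] by (subst lborel_vec, subst integral_distr) simp_all
  also have "\<dots> = (\<integral>x. (\<integral>y. F (x(i := y)) \<partial>lborel) \<partial>Pi\<^sub>M J (\<lambda>_. lborel))"
  proof (rule product_integral_insert[OF J(3,2)])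
    show "integrable (Pi\<^sub>M (insert i J) (\<lambda>_. lborel)) F"
      using int unfolding F_def J(1)[symmetric]
      by (subst (asm) lborel_vec, subst (asm) integrable_distr_eq) simp_all
  qed
  also have "(\<lambda>x. \<integral>y. F (x(i := y)) \<partial>lborel) = (\<lambda>_. 0)"
  proof
    fix x :: "'n \<Rightarrow> complex"
    define P Q where "P = (\<Prod>j\<in>J. x j ^ \<alpha> j)" and "Q = (\<Prod>j\<in>J. x j ^ \<beta> j)"
    define \<phi> where "\<phi> t = complex_of_real (W (vec_lambda (x(i := of_real t))))" for t
    have zm: "zmono \<gamma> (vec_lambda (x(i := y))) = y ^ \<gamma> i * (\<Prod>j\<in>J. x j ^ \<gamma> j)" for \<gamma> y
    proof -
      have "(\<Prod>j\<in>J. (x(i := y)) j ^ \<gamma> j) = (\<Prod>j\<in>J. x j ^ \<gamma> j)"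
        using J by (intro prod.cong) auto
      then show ?thesis
        unfolding zmono_def J(1) prod.insert[OF J(3,2)] vec_lambda_beta fun_upd_same by simp
    qed
    have "W (vec_lambda (x(i := y))) = W (vec_lambda (x(i := of_real (cmod y))))" for y
      using rad unfolding radial_def by auto
    then have "F (x(i := y)) = (P * cnj Q) * (y ^ \<alpha> i * cnj y ^ \<beta> i * \<phi> (cmod y))" for y
      unfolding F_def zm \<phi>_def P_def Q_def by simp
    then have "(\<integral>y. F (x(i := y)) \<partial>lborel) = (P * cnj Q) * (\<integral>y. y ^ \<alpha> i * cnj y ^ \<beta> i * \<phi> (cmod y) \<partial>lborel)"
      by (simp only: integral_mult_right_zero)
    also have "(\<integral>y. y ^ \<alpha> i * cnj y ^ \<beta> i * \<phi> (cmod y) \<partial>lborel) = 0"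
    proof (rule integral_complex_power_eq_0)
      have "(\<lambda>t. vec_lambda (x(i := complex_of_real t))) \<in> borel_measurable borel"
        by (rule borel_measurable_vec_lambda) simp
      then show "\<phi> \<in> borel_measurable borel"
        unfolding \<phi>_def by measurable
    qed fact
    finally show "(\<integral>y. F (x(i := y)) \<partial>lborel) = 0" by (simp only: mult_zero_right)
  qed
  finally show ?thesis by simp
qed

text \<open>Turns an unordered sum into a limit along an enumeration, the form that dominated and
  monotone convergence work with.\<close>

lemma has_sum_imp_enum_tendsto:
  fixes f :: "'a::countable \<Rightarrow> 'b::real_normed_vector"
  assumes "(f has_sum s) UNIV"
  shows "(\<lambda>N. \<Sum>x | to_nat x < N. f x) \<longlonglongrightarrow> s"
proof -
  have fin: "finite {x::'a. to_nat x < N}" for N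
    by (rule finite_imageD[of to_nat]) (auto intro: finite_subset[of _ "{..<N}"] inj_on_subset[OF inj_to_nat])
  have "filterlim (\<lambda>N. {x::'a. to_nat x < N}) (finite_subsets_at_top UNIV) sequentially"
    unfolding filterlim_iff eventually_finite_subsets_at_top
  proof safe
    fix P and X :: "'a set"
    assume X: "finite X" "\<forall>Y. finite Y \<and> X \<subseteq> Y \<and> Y \<subseteq> UNIV \<longrightarrow> P Y"
    show "\<forall>\<^sub>F N in sequentially. P {x. to_nat x < N}"
      using eventually_gt_at_top[of "Max (insert 0 (to_nat ` X))"]
    proof eventually_elim
      case (elim N)
      then have "X \<subseteq> {x. to_nat x < N}" using X(1) by auto
      then show ?case using X(2) fin by blast
    qed
  qed
  then show ?thesis using assms unfolding has_sum_def by (rule filterlim_compose[rotated])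
qed

lemma finite_to_nat_less: "finite {x::'a::countable. to_nat x < N}"
  by (rule finite_imageD[of to_nat]) (auto intro: finite_subset[of _ "{..<N}"] inj_on_subset[OF inj_to_nat])

lemma nn_integral_count_space_countable:
  fixes g :: "'a::countable \<Rightarrow> ennreal"
  shows "(\<integral>\<^sup>+x. g x \<partial>count_space UNIV) = (SUP N. \<Sum>x | to_nat x < N. g x)"
proof -
  have "(\<integral>\<^sup>+x. g x \<partial>count_space UNIV) = (\<integral>\<^sup>+x. (SUP N. g x * indicator {x. to_nat x < N} x) \<partial>count_space UNIV)"
  proof (rule nn_integral_cong)
    fix x :: 'a
    show "g x = (SUP N. g x * indicator {x. to_nat x < N} x)"
    proof (rule antisym)
      show "g x \<le> (SUP N. g x * indicator {x. to_nat x < N} x)"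
        by (rule SUP_upper2[of "Suc (to_nat x)"]) auto
    qed (auto intro!: SUP_least split: split_indicator)
  qed
  also have "\<dots> = (SUP N. \<integral>\<^sup>+x. g x * indicator {x. to_nat x < N} x \<partial>count_space UNIV)"
    by (rule nn_integral_monotone_convergence_SUP) (auto simp: incseq_def le_fun_def split: split_indicator)
  also have "(\<lambda>N. \<integral>\<^sup>+x. g x * indicator {x. to_nat x < N} x \<partial>count_space UNIV) = (\<lambda>N. \<Sum>x | to_nat x < N. g x)"
  proof
    fix N
    have "(\<integral>\<^sup>+x. g x * indicator {x. to_nat x < N} x \<partial>count_space UNIV) = (\<integral>\<^sup>+x. g x \<partial>count_space {x. to_nat x < N})"
      by (simp add: nn_integral_count_space_indicator)
    then show "(\<integral>\<^sup>+x. g x * indicator {x. to_nat x < N} x \<partial>count_space UNIV) = (\<Sum>x | to_nat x < N. g x)"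
      by (simp add: nn_integral_count_space_finite finite_to_nat_less)
  qed
  finally show ?thesis .
qed

text \<open>Finite partial sums satisfy the identity by orthogonality. The uniform bound
  \<open>T\<close> on the set where \<open>W\<close> is nonzero gives the dominating function
  \<open>T\<^sup>2 * W\<close>, so both sides pass to the limit.\<close>

lemma parseval_bounded:
  fixes W :: "complex ^ 'n::finite \<Rightarrow> real"
  assumes W [measurable]: "W \<in> borel_measurable borel" and W0: "\<And>z. 0 \<le> W z" and rad: "radial W"
    and W1: "integrable lborel W" and [measurable]: "f \<in> borel_measurable borel"
    and f: "\<And>z. W z \<noteq> 0 \<Longrightarrow> (\<lambda>N. \<Sum>\<alpha> | to_nat \<alpha> < N. c \<alpha> * zmono \<alpha> z) \<longlonglongrightarrow> f z"
    and T: "\<And>z N. W z \<noteq> 0 \<Longrightarrow> (\<Sum>\<alpha> | to_nat \<alpha> < N. cmod (c \<alpha> * zmono \<alpha> z)) \<le> T"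
  shows "(\<integral>\<^sup>+z. ennreal ((cmod (f z))\<^sup>2 * W z) \<partial>lborel)
    = (\<integral>\<^sup>+\<alpha>. ennreal ((cmod (c \<alpha>))\<^sup>2) * (\<integral>\<^sup>+z. ennreal ((cmod (zmono \<alpha> z))\<^sup>2 * W z) \<partial>lborel) \<partial>count_space UNIV)"
proof -
  define t where "t \<alpha> z = c \<alpha> * zmono \<alpha> z" for \<alpha> z
  define S where "S N = {\<alpha>::'n \<Rightarrow> nat. to_nat \<alpha> < N}" for N
  define s where "s N z = (\<Sum>\<alpha>\<in>S N. t \<alpha> z)" for N z
  have fin: "finite (S N)" for N by (simp add: S_def finite_to_nat_less)
  have [measurable]: "cnj \<in> borel_measurable borel"
    by (intro borel_measurable_continuous_onI continuous_intros)
  have [measurable]: "t \<alpha> \<in> borel_measurable borel" "s N \<in> borel_measurable borel" for \<alpha> N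
    unfolding t_def[abs_def] s_def[abs_def] by measurable
  have sT: "cmod (s N z) \<le> T" if "W z \<noteq> 0" for N z
    using T[OF that, of N] sum_norm_le[of "S N" "\<lambda>\<alpha>. t \<alpha> z" "\<lambda>\<alpha>. cmod (t \<alpha> z)"]
    by (simp add: s_def t_def S_def)
  have tT: "cmod (t \<alpha> z) \<le> T" if "W z \<noteq> 0" for \<alpha> z
  proof -
    have "cmod (t \<alpha> z) \<le> (\<Sum>\<alpha>\<in>S (Suc (to_nat \<alpha>)). cmod (t \<alpha> z))"
      by (rule member_le_sum) (auto simp: S_def finite_to_nat_less)
    also have "\<dots> \<le> T" using T[OF that] by (simp add: t_def S_def)
    finally show ?thesis .
  qed
  have intt: "integrable lborel (\<lambda>z. t \<alpha> z * cnj (t \<beta> z) * of_real (W z))" for \<alpha> \<beta>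
  proof (rule Bochner_Integration.integrable_bound)
    show "integrable lborel (\<lambda>z. T * T * W z)" using W1 by (rule integrable_mult_right)
    show "AE z in lborel. norm (t \<alpha> z * cnj (t \<beta> z) * of_real (W z)) \<le> norm (T * T * W z)"
    proof (rule AE_I2)
      fix z
      show "norm (t \<alpha> z * cnj (t \<beta> z) * of_real (W z)) \<le> norm (T * T * W z)"
      proof (cases "W z = 0")
        case False
        then have "cmod (t \<alpha> z) * cmod (t \<beta> z) \<le> T * T"
          using tT order_trans[OF norm_ge_zero tT] by (intro mult_mono) auto
        then show ?thesis using W0[of z] by (simp add: norm_mult abs_mult mult_right_mono)
      qed simp
    qed
  qed measurable
  have orth: "(\<integral>z. t \<alpha> z * cnj (t \<beta> z) * of_real (W z) \<partial>lborel) = 0" if "\<alpha> \<noteq> \<beta>" for \<alpha> \<beta>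
  proof -
    have "(\<integral>z. t \<alpha> z * cnj (t \<beta> z) * of_real (W z) \<partial>lborel)
      = (\<integral>z. (c \<alpha> * cnj (c \<beta>)) * (zmono \<alpha> z * cnj (zmono \<beta> z) * of_real (W z)) \<partial>lborel)"
      by (simp add: t_def mult_ac)
    also have "\<dots> = 0"
      by (simp only: integral_mult_right_zero integral_zmono_orthogonal[OF W rad that] mult_zero_right)
    finally show ?thesis .
  qed
  have tt: "t \<alpha> z * cnj (t \<alpha> z) * of_real (W z) = of_real ((cmod (t \<alpha> z))\<^sup>2 * W z)" for \<alpha> z
    by (simp only: of_real_mult complex_norm_square)
  have intr: "integrable lborel (\<lambda>z. (cmod (t \<alpha> z))\<^sup>2 * W z)" for \<alpha>
    using intt[of \<alpha> \<alpha>] unfolding tt by (simp only: complex_of_real_integrable_eq)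
  have fin_sum: "(\<integral>z. (cmod (s N z))\<^sup>2 * W z \<partial>lborel) = (\<Sum>\<alpha>\<in>S N. \<integral>z. (cmod (t \<alpha> z))\<^sup>2 * W z \<partial>lborel)" for N
  proof -
    have "complex_of_real (\<integral>z. (cmod (s N z))\<^sup>2 * W z \<partial>lborel) = (\<integral>z. s N z * cnj (s N z) * of_real (W z) \<partial>lborel)"
      by (simp only: integral_complex_of_real[symmetric] of_real_mult complex_norm_square)
    also have "\<dots> = (\<integral>z. (\<Sum>\<alpha>\<in>S N. \<Sum>\<beta>\<in>S N. t \<alpha> z * cnj (t \<beta> z) * of_real (W z)) \<partial>lborel)"
    proof -
      have "s N z * cnj (s N z) = (\<Sum>\<alpha>\<in>S N. \<Sum>\<beta>\<in>S N. t \<alpha> z * cnj (t \<beta> z))" for z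
        by (simp only: s_def cnj_sum sum_product)
      then show ?thesis by (simp only: sum_distrib_right)
    qed
    also have "\<dots> = (\<Sum>\<alpha>\<in>S N. \<Sum>\<beta>\<in>S N. \<integral>z. t \<alpha> z * cnj (t \<beta> z) * of_real (W z) \<partial>lborel)"
      by (simp add: intt Bochner_Integration.integrable_sum)
    also have "\<dots> = (\<Sum>\<alpha>\<in>S N. \<Sum>\<beta>\<in>S N. if \<beta> = \<alpha> then of_real (\<integral>z. (cmod (t \<alpha> z))\<^sup>2 * W z \<partial>lborel) else 0)"
      by (intro sum.cong refl) (auto simp: orth tt simp del: of_real_mult of_real_power)
    also have "\<dots> = of_real (\<Sum>\<alpha>\<in>S N. \<integral>z. (cmod (t \<alpha> z))\<^sup>2 * W z \<partial>lborel)"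
      using fin by (simp add: sum.delta)
    finally show ?thesis by (simp only: of_real_eq_iff)
  qed
  have lim: "(\<lambda>N. \<integral>z. (cmod (s N z))\<^sup>2 * W z \<partial>lborel) \<longlonglongrightarrow> (\<integral>z. (cmod (f z))\<^sup>2 * W z \<partial>lborel)"
    and intf: "integrable lborel (\<lambda>z. (cmod (f z))\<^sup>2 * W z)"
  proof -
    have *: "integrable lborel (\<lambda>z. T\<^sup>2 * W z)" using W1 by (rule integrable_mult_right)
    have 1: "AE z in lborel. (\<lambda>N. (cmod (s N z))\<^sup>2 * W z) \<longlonglongrightarrow> (cmod (f z))\<^sup>2 * W z"
    proof (rule AE_I2)
      fix z
      show "(\<lambda>N. (cmod (s N z))\<^sup>2 * W z) \<longlonglongrightarrow> (cmod (f z))\<^sup>2 * W z"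
      proof (cases "W z = 0")
        case False
        then have "(\<lambda>N. s N z) \<longlonglongrightarrow> f z" using f by (simp add: s_def t_def S_def)
        then show ?thesis by (intro tendsto_intros)
      qed simp
    qed
    have 2: "AE z in lborel. norm ((cmod (s N z))\<^sup>2 * W z) \<le> T\<^sup>2 * W z" for N
    proof (rule AE_I2)
      fix z
      show "norm ((cmod (s N z))\<^sup>2 * W z) \<le> T\<^sup>2 * W z"
      proof (cases "W z = 0")
        case False
        then have "(cmod (s N z))\<^sup>2 \<le> T\<^sup>2" using sT by (intro power_mono) auto
        then show ?thesis using W0[of z] by (simp add: mult_right_mono)
      qed simp
    qed
    show "(\<lambda>N. \<integral>z. (cmod (s N z))\<^sup>2 * W z \<partial>lborel) \<longlonglongrightarrow> (\<integral>z. (cmod (f z))\<^sup>2 * W z \<partial>lborel)"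
      by (rule integral_dominated_convergence[OF _ _ * 1 2]) measurable
    show "integrable lborel (\<lambda>z. (cmod (f z))\<^sup>2 * W z)"
      by (rule integrable_dominated_convergence[OF _ _ * 1 2]) measurable
  qed
  have nn: "ennreal ((cmod (c \<alpha>))\<^sup>2) * (\<integral>\<^sup>+z. ennreal ((cmod (zmono \<alpha> z))\<^sup>2 * W z) \<partial>lborel)
    = ennreal (\<integral>z. (cmod (t \<alpha> z))\<^sup>2 * W z \<partial>lborel)" for \<alpha>
  proof -
    have "ennreal ((cmod (c \<alpha>))\<^sup>2) * (\<integral>\<^sup>+z. ennreal ((cmod (zmono \<alpha> z))\<^sup>2 * W z) \<partial>lborel)
      = (\<integral>\<^sup>+z. ennreal ((cmod (c \<alpha>))\<^sup>2) * ennreal ((cmod (zmono \<alpha> z))\<^sup>2 * W z) \<partial>lborel)"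
      by (rule nn_integral_cmult[symmetric]) measurable
    also have "\<dots> = (\<integral>\<^sup>+z. ennreal ((cmod (t \<alpha> z))\<^sup>2 * W z) \<partial>lborel)"
      using W0 by (intro nn_integral_cong) (simp add: t_def norm_mult power_mult_distrib ennreal_mult'[symmetric] mult_ac)
    also have "\<dots> = ennreal (\<integral>z. (cmod (t \<alpha> z))\<^sup>2 * W z \<partial>lborel)"
      using W0 by (intro nn_integral_eq_integral intr) auto
    finally show ?thesis .
  qed
  have "(\<integral>\<^sup>+z. ennreal ((cmod (f z))\<^sup>2 * W z) \<partial>lborel) = ennreal (\<integral>z. (cmod (f z))\<^sup>2 * W z \<partial>lborel)"
    using W0 by (intro nn_integral_eq_integral intf) auto
  moreover have "(\<lambda>N. ennreal (\<Sum>\<alpha>\<in>S N. \<integral>z. (cmod (t \<alpha> z))\<^sup>2 * W z \<partial>lborel)) \<longlonglongrightarrow> ennreal (\<integral>z. (cmod (f z))\<^sup>2 * W z \<partial>lborel)"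
    using lim unfolding fin_sum by (rule tendsto_ennrealI)
  moreover have "ennreal (\<Sum>\<alpha>\<in>S N. \<integral>z. (cmod (t \<alpha> z))\<^sup>2 * W z \<partial>lborel)
    = (\<Sum>\<alpha>\<in>S N. ennreal ((cmod (c \<alpha>))\<^sup>2) * (\<integral>\<^sup>+z. ennreal ((cmod (zmono \<alpha> z))\<^sup>2 * W z) \<partial>lborel))" for N
    unfolding nn using W0 by (intro sum_ennreal[symmetric] integral_nonneg_AE AE_I2) auto
  moreover have "(\<lambda>N. \<Sum>\<alpha>\<in>S N. ennreal ((cmod (c \<alpha>))\<^sup>2) * (\<integral>\<^sup>+z. ennreal ((cmod (zmono \<alpha> z))\<^sup>2 * W z) \<partial>lborel))
     \<longlonglongrightarrow> (SUP N. \<Sum>\<alpha>\<in>S N. ennreal ((cmod (c \<alpha>))\<^sup>2) * (\<integral>\<^sup>+z. ennreal ((cmod (zmono \<alpha> z))\<^sup>2 * W z) \<partial>lborel))"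
    by (rule LIMSEQ_SUP) (auto simp: incseq_def S_def intro!: sum_mono2 finite_to_nat_less)
  ultimately show ?thesis
    unfolding nn_integral_count_space_countable S_def[symmetric]
    by (metis (no_types, lifting) LIMSEQ_unique ext)
qed

text \<open>The sets \<open>A T\<close>, on which all absolute partial sums are at most
  \<open>T\<close>, exhaust the set where \<open>W\<close> is nonzero. The bounded case applies to
  \<open>W\<close> cut off to \<open>A T\<close>, and monotone convergence in \<open>T\<close>
  finishes. Both sides may be infinite, which later excludes monomials that are not square
  integrable.\<close>

theorem parseval_reinhardt:
  fixes W :: "complex ^ 'n::finite \<Rightarrow> real"
  assumes W [measurable]: "W \<in> borel_measurable borel" and W0: "\<And>z. 0 \<le> W z" and rad: "radial W"
    and W1: "integrable lborel W" and [measurable]: "f \<in> borel_measurable borel"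
    and abs: "\<And>z. W z \<noteq> 0 \<Longrightarrow> (\<lambda>\<alpha>. cmod (c \<alpha> * zmono \<alpha> z)) summable_on UNIV"
    and f: "\<And>z. W z \<noteq> 0 \<Longrightarrow> ((\<lambda>\<alpha>. c \<alpha> * zmono \<alpha> z) has_sum f z) UNIV"
  shows "(\<integral>\<^sup>+z. ennreal ((cmod (f z))\<^sup>2 * W z) \<partial>lborel)
    = (\<integral>\<^sup>+\<alpha>. ennreal ((cmod (c \<alpha>))\<^sup>2) * (\<integral>\<^sup>+z. ennreal ((cmod (zmono \<alpha> z))\<^sup>2 * W z) \<partial>lborel) \<partial>count_space UNIV)"
proof -
  define A where "A T = {z. \<forall>N. (\<Sum>\<alpha> | to_nat \<alpha> < N. cmod (c \<alpha> * zmono \<alpha> z)) \<le> real T}" for T :: nat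
  have A [measurable]: "A T \<in> sets borel" for T
    unfolding A_def by measurable
  have cz: "cmod (zmono \<alpha> z) = cmod (zmono \<alpha> w)" if "\<forall>i. cmod (z $ i) = cmod (w $ i)" for \<alpha> and z w :: "complex ^ 'n"
    using that by (simp add: zmono_def prod_norm[symmetric] norm_power)
  define V where "V T z = W z * indicator (A T) z" for T z
  have [measurable]: "V T \<in> borel_measurable borel" for T
    unfolding V_def[abs_def] by measurable
  \<comment> \<open>The cut-off depends on the moduli only, so the orthogonality of monomials
    survives it.\<close>
  have radV: "radial (V T)" for T
    unfolding radial_def
  proof safe
    fix z w :: "complex ^ 'n" assume zw: "\<forall>i. cmod (z $ i) = cmod (w $ i)"
    have "z \<in> A T \<longleftrightarrow> w \<in> A T"
      unfolding A_def by (simp add: norm_mult cz[OF zw])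
    moreover have "W z = W w" using rad zw unfolding radial_def by blast
    ultimately show "V T z = V T w" by (simp add: V_def indicator_def)
  qed
  have P: "(\<integral>\<^sup>+z. ennreal ((cmod (f z))\<^sup>2 * V T z) \<partial>lborel)
    = (\<integral>\<^sup>+\<alpha>. ennreal ((cmod (c \<alpha>))\<^sup>2) * (\<integral>\<^sup>+z. ennreal ((cmod (zmono \<alpha> z))\<^sup>2 * V T z) \<partial>lborel) \<partial>count_space UNIV)" for T
  proof (rule parseval_bounded[where T = "real T", OF _ _ radV])
    show "integrable lborel (V T)"
      unfolding V_def[abs_def] using integrable_mult_indicator[OF _ W1, of "A T"] by (simp add: mult.commute)
    show "(\<lambda>N. \<Sum>\<alpha> | to_nat \<alpha> < N. c \<alpha> * zmono \<alpha> z) \<longlonglongrightarrow> f z" if "V T z \<noteq> 0" for z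
      using that by (intro has_sum_imp_enum_tendsto f) (auto simp: V_def)
    show "(\<Sum>\<alpha> | to_nat \<alpha> < N. cmod (c \<alpha> * zmono \<alpha> z)) \<le> real T" if "V T z \<noteq> 0" for z N
      using that by (auto simp: V_def A_def indicator_def split: if_splits)
  qed (auto simp: V_def W0)
  have SUP: "(SUP T. ennreal (p * V T z)) = ennreal (p * W z)" if "0 \<le> p" for p z
  proof (cases "W z = 0")
    case False
    from abs[OF this] obtain s where s: "((\<lambda>\<alpha>. cmod (c \<alpha> * zmono \<alpha> z)) has_sum s) UNIV"
      by (auto simp: summable_on_def)
    obtain T0 :: nat where T0: "s \<le> real T0" using real_arch_simple by blast
    have "z \<in> A T0"
      unfolding A_def
    proof safe
      fix N
      have "(\<Sum>\<alpha> | to_nat \<alpha> < N. cmod (c \<alpha> * zmono \<alpha> z)) \<le> s"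
        by (rule has_sum_mono_neutral[OF has_sum_finite s]) (auto simp: finite_to_nat_less)
      then show "(\<Sum>\<alpha> | to_nat \<alpha> < N. cmod (c \<alpha> * zmono \<alpha> z)) \<le> real T0" using T0 by simp
    qed
    then have "ennreal (p * W z) \<le> (SUP T. ennreal (p * V T z))"
      by (intro SUP_upper2[of T0]) (auto simp: V_def)
    moreover have "(SUP T. ennreal (p * V T z)) \<le> ennreal (p * W z)"
      using W0[of z] that by (intro SUP_least ennreal_leI mult_left_mono) (auto simp: V_def indicator_def)
    ultimately show ?thesis by (rule antisym[rotated])
  qed (simp add: V_def)
  have Amono: "A T \<subseteq> A T'" if "T \<le> T'" for T T'
    using that unfolding A_def by (auto intro: order_trans)
  have inc: "incseq (\<lambda>T z. ennreal (p z * V T z))" if "\<And>z. 0 \<le> p z" for p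
    unfolding incseq_def le_fun_def
  proof (intro allI impI ennreal_leI mult_left_mono that)
    fix T T' :: nat and z assume "T \<le> T'"
    then show "V T z \<le> V T' z"
      using Amono W0[of z] by (auto simp: V_def indicator_def)
  qed
  have L: "(\<integral>\<^sup>+z. ennreal (p z * W z) \<partial>lborel) = (SUP T. \<integral>\<^sup>+z. ennreal (p z * V T z) \<partial>lborel)"
    if p: "\<And>z. 0 \<le> p z" and [measurable]: "p \<in> borel_measurable borel" for p
    unfolding SUP[OF p, symmetric] V_def
    by (rule nn_integral_monotone_convergence_SUP[OF inc[OF p, unfolded V_def]]) measurable
  have "(\<integral>\<^sup>+z. ennreal ((cmod (f z))\<^sup>2 * W z) \<partial>lborel) = (SUP T. \<integral>\<^sup>+z. ennreal ((cmod (f z))\<^sup>2 * V T z) \<partial>lborel)"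
    by (rule L) simp_all
  also have "\<dots> = (SUP T. \<integral>\<^sup>+\<alpha>. ennreal ((cmod (c \<alpha>))\<^sup>2) * (\<integral>\<^sup>+z. ennreal ((cmod (zmono \<alpha> z))\<^sup>2 * V T z) \<partial>lborel) \<partial>count_space UNIV)"
    unfolding P ..
  also have "\<dots> = (\<integral>\<^sup>+\<alpha>. (SUP T. ennreal ((cmod (c \<alpha>))\<^sup>2) * (\<integral>\<^sup>+z. ennreal ((cmod (zmono \<alpha> z))\<^sup>2 * V T z) \<partial>lborel)) \<partial>count_space UNIV)"
  proof (rule nn_integral_monotone_convergence_SUP[symmetric])
    show "incseq (\<lambda>T \<alpha>. ennreal ((cmod (c \<alpha>))\<^sup>2) * (\<integral>\<^sup>+z. ennreal ((cmod (zmono \<alpha> z))\<^sup>2 * V T z) \<partial>lborel))"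
      using inc[of "\<lambda>z. (cmod (zmono _ z))\<^sup>2"]
      by (auto simp: incseq_def le_fun_def intro!: mult_left_mono nn_integral_mono)
  qed simp
  also have "\<dots> = (\<integral>\<^sup>+\<alpha>. ennreal ((cmod (c \<alpha>))\<^sup>2) * (\<integral>\<^sup>+z. ennreal ((cmod (zmono \<alpha> z))\<^sup>2 * W z) \<partial>lborel) \<partial>count_space UNIV)"
    by (simp add: SUP_mult_left_ennreal[symmetric] L)
  finally show ?thesis .
qed

section \<open>Reproducing kernels and orthonormal bases\<close>

lemma integrable_mult_cnj:
  fixes f g :: "'a \<Rightarrow> complex"
  assumes [measurable]: "f \<in> borel_measurable M" "g \<in> borel_measurable M"
    and "integrable M (\<lambda>x. (cmod (f x))\<^sup>2)" "integrable M (\<lambda>x. (cmod (g x))\<^sup>2)"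
  shows "integrable M (\<lambda>x. f x * cnj (g x))"
proof (rule Bochner_Integration.integrable_bound)
  show "integrable M (\<lambda>x. (cmod (f x))\<^sup>2 + (cmod (g x))\<^sup>2)"
    using assms by simp
  have [measurable]: "cnj \<in> borel_measurable borel"
    by (intro borel_measurable_continuous_onI continuous_intros)
  show "(\<lambda>x. f x * cnj (g x)) \<in> borel_measurable M" by measurable
  show "AE x in M. norm (f x * cnj (g x)) \<le> norm ((cmod (f x))\<^sup>2 + (cmod (g x))\<^sup>2)"
  proof (rule AE_I2)
    fix x
    have "0 \<le> (cmod (f x) - cmod (g x))\<^sup>2" "0 \<le> cmod (f x) * cmod (g x)" by simp_all
    then have "cmod (f x) * cmod (g x) \<le> (cmod (f x))\<^sup>2 + (cmod (g x))\<^sup>2"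
      unfolding power2_diff by linarith
    then show "norm (f x * cnj (g x)) \<le> norm ((cmod (f x))\<^sup>2 + (cmod (g x))\<^sup>2)"
      by (simp add: norm_mult)
  qed
qed

lemma orthonormal_sum_norm:
  fixes r :: "'s \<Rightarrow> 'a \<Rightarrow> complex"
  assumes F: "finite F" and r: "\<And>s. s \<in> F \<Longrightarrow> r s \<in> borel_measurable M"
    and L2: "\<And>s. s \<in> F \<Longrightarrow> integrable M (\<lambda>x. (cmod (r s x))\<^sup>2)"
    and on: "\<And>s t. s \<in> F \<Longrightarrow> t \<in> F \<Longrightarrow> (\<integral>x. r s x * cnj (r t x) \<partial>M) = (if s = t then 1 else 0)"
  shows "(\<integral>x. (cmod (\<Sum>s\<in>F. c s * r s x))\<^sup>2 \<partial>M) = (\<Sum>s\<in>F. (cmod (c s))\<^sup>2)"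
proof -
  have int: "integrable M (\<lambda>x. r s x * cnj (r t x))" if "s \<in> F" "t \<in> F" for s t
    using that by (intro integrable_mult_cnj r L2)
  have "complex_of_real (\<integral>x. (cmod (\<Sum>s\<in>F. c s * r s x))\<^sup>2 \<partial>M)
    = (\<integral>x. (\<Sum>s\<in>F. c s * r s x) * cnj (\<Sum>s\<in>F. c s * r s x) \<partial>M)"
    by (simp only: integral_complex_of_real[symmetric] complex_norm_square)
  also have "\<dots> = (\<integral>x. (\<Sum>s\<in>F. \<Sum>t\<in>F. (c s * cnj (c t)) * (r s x * cnj (r t x))) \<partial>M)"
    by (simp only: cnj_sum sum_product complex_cnj_mult mult_ac)
  also have "\<dots> = (\<Sum>s\<in>F. \<Sum>t\<in>F. (c s * cnj (c t)) * (\<integral>x. r s x * cnj (r t x) \<partial>M))"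
    by (simp add: int Bochner_Integration.integrable_sum integrable_mult_right)
  also have "\<dots> = (\<Sum>s\<in>F. \<Sum>t\<in>F. if t = s then of_real ((cmod (c s))\<^sup>2) else 0)"
    by (intro sum.cong refl) (simp add: on complex_norm_square del: of_real_power)
  also have "\<dots> = of_real (\<Sum>s\<in>F. (cmod (c s))\<^sup>2)"
    using F by (simp add: sum.delta)
  finally show ?thesis by (simp only: of_real_eq_iff)
qed

text \<open>Young's inequality with a weight: letting \<open>t\<close> shrink together with the size
  of \<open>v\<close> keeps the factor of \<open>u\<close> close to 1 and the second term
  small.\<close>

lemma norm_diff_square_le:
  fixes u v :: complex
  assumes "0 < t"
  shows "(cmod (u - v))\<^sup>2 \<le> (1 + t) * (cmod u)\<^sup>2 + (1 + 1 / t) * (cmod v)\<^sup>2"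
proof -
  have "(cmod (u - v))\<^sup>2 \<le> (cmod u + cmod v)\<^sup>2"
    by (intro power_mono norm_triangle_ineq4) simp
  also have "\<dots> \<le> (1 + t) * (cmod u)\<^sup>2 + (1 + 1 / t) * (cmod v)\<^sup>2"
  proof -
    have "0 \<le> (t * cmod u - cmod v)\<^sup>2 / t" using assms by simp
    also have "\<dots> = t * (cmod u)\<^sup>2 + (cmod v)\<^sup>2 / t - 2 * cmod u * cmod v"
      using assms by (simp add: power2_eq_square field_simps)
    finally show ?thesis by (simp add: power2_sum algebra_simps)
  qed
  finally show ?thesis .
qed

text \<open>The value of the reproducing kernel on the diagonal is the squared norm of the evaluation
  functional, hence does not depend on the orthonormal basis.\<close>

theorem kernel_independent_of_basis:
  fixes rep :: "'s \<Rightarrow> 'a \<Rightarrow> complex" and ev :: "'s \<Rightarrow> complex"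
  assumes meas: "\<And>s. s \<in> V \<Longrightarrow> rep s \<in> borel_measurable M"
    and L2: "\<And>s. s \<in> V \<Longrightarrow> integrable M (\<lambda>x. (cmod (rep s x))\<^sup>2)"
    and ev: "\<And>s. s \<in> V \<Longrightarrow> (cmod (ev s))\<^sup>2 \<le> \<kappa> * (\<integral>x. (cmod (rep s x))\<^sup>2 \<partial>M)"
    and lin: "\<And>f F c a. f \<in> V \<Longrightarrow> finite F \<Longrightarrow> F \<subseteq> V \<Longrightarrow>
      \<exists>g\<in>V. (\<forall>x. rep g x = a * rep f x - (\<Sum>s\<in>F. c s * rep s x)) \<and> ev g = a * ev f - (\<Sum>s\<in>F. c s * ev s)"
    and EV: "E \<subseteq> V" and E: "\<And>s t. s \<in> E \<Longrightarrow> t \<in> E \<Longrightarrow> (\<integral>x. rep s x * cnj (rep t x) \<partial>M) = (if s = t then 1 else 0)"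
    and \<kappa>: "((\<lambda>s. (cmod (ev s))\<^sup>2) has_sum \<kappa>) E"
    and BV: "B \<subseteq> V" and B: "\<And>s t. s \<in> B \<Longrightarrow> t \<in> B \<Longrightarrow> (\<integral>x. rep s x * cnj (rep t x) \<partial>M) = (if s = t then 1 else 0)"
    and dense: "\<And>f e. f \<in> V \<Longrightarrow> 0 < e \<Longrightarrow> \<exists>F c. finite F \<and> F \<subseteq> B \<and>
      (\<integral>x. (cmod (rep f x - (\<Sum>s\<in>F. c s * rep s x)))\<^sup>2 \<partial>M) < e\<^sup>2"
  shows "((\<lambda>s. (cmod (ev s))\<^sup>2) has_sum \<kappa>) B"
proof -
  have \<kappa>0: "0 \<le> \<kappa>" using \<kappa> by (rule has_sum_nonneg) simp
  \<comment> \<open>Finite combinations are realized inside \<open>V\<close> by using the closure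
    hypothesis \<open>lin\<close> with \<open>a = 0\<close>; an element \<open>f\<close> of
    \<open>V\<close> only fills its first argument.\<close>
  have comb: "\<exists>g\<in>V. (\<forall>x. rep g x = (\<Sum>s\<in>F. c s * rep s x)) \<and> ev g = (\<Sum>s\<in>F. c s * ev s) \<and>
      (\<integral>x. (cmod (rep g x))\<^sup>2 \<partial>M) = (\<Sum>s\<in>F. (cmod (c s))\<^sup>2)"
    if F: "finite F" "F \<subseteq> X" and X: "X \<subseteq> V" "V \<noteq> {}"
      "\<And>s t. s \<in> X \<Longrightarrow> t \<in> X \<Longrightarrow> (\<integral>x. rep s x * cnj (rep t x) \<partial>M) = (if s = t then 1 else 0)" for F X c
  proof -
    from X(2) obtain f where f: "f \<in> V" by blast
    have FV: "F \<subseteq> V" using F X by blast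
    obtain g where g: "g \<in> V" "\<And>x. rep g x = 0 * rep f x - (\<Sum>s\<in>F. - c s * rep s x)"
        "ev g = 0 * ev f - (\<Sum>s\<in>F. - c s * ev s)"
      using lin[OF f F(1) FV, of 0 "\<lambda>s. - c s"] by blast
    have 1: "rep g x = (\<Sum>s\<in>F. c s * rep s x)" for x
      using g(2) by (simp add: sum_negf)
    have "(\<integral>x. (cmod (rep g x))\<^sup>2 \<partial>M) = (\<Sum>s\<in>F. (cmod (c s))\<^sup>2)"
      unfolding 1
    proof (rule orthonormal_sum_norm[OF F(1)])
      show "(\<integral>x. rep s x * cnj (rep t x) \<partial>M) = (if s = t then 1 else 0)" if "s \<in> F" "t \<in> F" for s t
        using that F by (intro X(3)) auto
    qed (use FV meas L2 in auto)
    then show ?thesis using g(1,3) 1 by (intro bexI[of _ g]) (auto simp: sum_negf)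
  qed
  \<comment> \<open>A partial reproducing kernel: with coefficients \<open>cnj (ev s)\<close> the
    value \<open>ev g\<close> and the squared norm of \<open>g\<close> are the same number.\<close>
  have kernel: "\<exists>g\<in>V. ev g = of_real (\<Sum>s\<in>F. (cmod (ev s))\<^sup>2) \<and> (\<integral>x. (cmod (rep g x))\<^sup>2 \<partial>M) = (\<Sum>s\<in>F. (cmod (ev s))\<^sup>2)"
    if F: "finite F" "F \<subseteq> X" and X: "X \<subseteq> V" "V \<noteq> {}"
      "\<And>s t. s \<in> X \<Longrightarrow> t \<in> X \<Longrightarrow> (\<integral>x. rep s x * cnj (rep t x) \<partial>M) = (if s = t then 1 else 0)" for F X
  proof -
    obtain g where g: "g \<in> V" "ev g = (\<Sum>s\<in>F. cnj (ev s) * ev s)"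
       "(\<integral>x. (cmod (rep g x))\<^sup>2 \<partial>M) = (\<Sum>s\<in>F. (cmod (cnj (ev s)))\<^sup>2)"
      using comb[OF F X, of "\<lambda>s. cnj (ev s)"] by blast
    then show ?thesis
      by (intro bexI[of _ g]) (simp_all add: complex_norm_square mult.commute del: of_real_power)
  qed
  \<comment> \<open>The evaluation bound at the partial kernel says that the square of the sum is at
    most \<open>\<kappa>\<close> times the sum.\<close>
  have upper: "(\<Sum>s\<in>F. (cmod (ev s))\<^sup>2) \<le> \<kappa>" if F: "finite F" "F \<subseteq> B" for F
  proof (cases "F = {}")
    case False
    then have "V \<noteq> {}" using F BV by blast
    let ?S = "\<Sum>s\<in>F. (cmod (ev s))\<^sup>2"
    have S0: "0 \<le> ?S" by (rule sum_nonneg) simp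
    obtain g where g: "g \<in> V" "ev g = of_real ?S" "(\<integral>x. (cmod (rep g x))\<^sup>2 \<partial>M) = ?S"
      using kernel[OF F BV \<open>V \<noteq> {}\<close> B] by blast
    have "(cmod (ev g))\<^sup>2 = ?S * ?S"
      by (simp only: g(2) norm_of_real power2_abs power2_eq_square[of ?S])
    then have "?S * ?S \<le> \<kappa> * ?S"
      using ev[OF g(1)] by (simp only: g(3))
    then show ?thesis using S0 \<kappa>0 by (cases "?S = 0") (auto simp: mult_le_cancel_right)
  qed (simp add: \<kappa>0)
  define S where "S = (SUP F\<in>{F. finite F \<and> F \<subseteq> B}. \<Sum>s\<in>F. (cmod (ev s))\<^sup>2)"
  have bdd: "bdd_above ((\<lambda>F. \<Sum>s\<in>F. (cmod (ev s))\<^sup>2) ` {F. finite F \<and> F \<subseteq> B})"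
    using upper by (intro bdd_aboveI2) auto
  have SB: "((\<lambda>s. (cmod (ev s))\<^sup>2) has_sum S) B"
    unfolding S_def using bdd by (intro nonneg_bdd_above_has_sum) (auto simp: conj_commute)
  have le_S: "(\<Sum>s\<in>F. (cmod (ev s))\<^sup>2) \<le> S" if "finite F" "F \<subseteq> B" for F
    unfolding S_def using that by (intro cSUP_upper bdd) auto
  have S0: "0 \<le> S" using le_S[of "{}"] by simp
  have "S \<le> \<kappa>"
    unfolding S_def by (rule cSUP_least) (use upper in auto)
  \<comment> \<open>Conversely, the partial kernel \<open>g\<close> of the basis \<open>E\<close> is
    approximated in the span of \<open>B\<close>. Cauchy-Schwarz bounds the evaluation of the
    approximant by its norm times \<open>sqrt S\<close>, and the evaluation bound controls the
    error.\<close>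
  moreover have "(\<Sum>e\<in>N. (cmod (ev e))\<^sup>2) \<le> S" if N: "finite N" "N \<subseteq> E" for N
  proof (cases "(\<Sum>e\<in>N. (cmod (ev e))\<^sup>2) = 0")
    case True
    then show ?thesis using S0 by simp
  next
    case False
    let ?K = "\<Sum>e\<in>N. (cmod (ev e))\<^sup>2"
    have K: "0 < ?K" using False by (simp add: sum_nonneg less_le)
    then have "V \<noteq> {}" using N EV by force
    obtain g where g: "g \<in> V" "ev g = of_real ?K" "(\<integral>x. (cmod (rep g x))\<^sup>2 \<partial>M) = ?K"
      using kernel[OF N EV \<open>V \<noteq> {}\<close> E] by blast
    \<comment> \<open>The same \<open>\<delta>\<close> is the approximation error and the weight in
      \<open>norm_diff_square_le\<close>, so the correction \<open>(1 + 1 / \<delta>) *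
      \<delta>\<^sup>2 = \<delta>\<^sup>2 + \<delta>\<close> vanishes in the limit.\<close>
    have est: "?K \<le> sqrt (((1 + \<delta>) * ?K + (1 + 1 / \<delta>) * \<delta>\<^sup>2) * S) + sqrt (\<kappa> * \<delta>\<^sup>2)" if \<delta>: "0 < \<delta>" for \<delta>
    proof -
      obtain F c where F: "finite F" "F \<subseteq> B"
        and d: "(\<integral>x. (cmod (rep g x - (\<Sum>s\<in>F. c s * rep s x)))\<^sup>2 \<partial>M) < \<delta>\<^sup>2"
        using dense[OF g(1) \<delta>] by blast
      have FV: "F \<subseteq> V" using F BV by blast
      obtain h where h: "h \<in> V" "\<And>x. rep h x = (\<Sum>s\<in>F. c s * rep s x)" "ev h = (\<Sum>s\<in>F. c s * ev s)"
         "(\<integral>x. (cmod (rep h x))\<^sup>2 \<partial>M) = (\<Sum>s\<in>F. (cmod (c s))\<^sup>2)"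
        using comb[OF F BV \<open>V \<noteq> {}\<close> B, of c] by blast
      obtain e where e: "e \<in> V" "\<And>x. rep e x = 1 * rep g x - (\<Sum>s\<in>F. c s * rep s x)"
        "ev e = 1 * ev g - (\<Sum>s\<in>F. c s * ev s)"
        using lin[OF g(1) F(1) FV, of 1 c] by blast
      have e2: "(\<integral>x. (cmod (rep e x))\<^sup>2 \<partial>M) < \<delta>\<^sup>2"
        using d by (simp add: e(2))
      have "(\<integral>x. (cmod (rep h x))\<^sup>2 \<partial>M)
        \<le> (\<integral>x. (1 + \<delta>) * (cmod (rep g x))\<^sup>2 + (1 + 1 / \<delta>) * (cmod (rep e x))\<^sup>2 \<partial>M)"
      proof (rule integral_mono)
        fix x
        have "rep h x = rep g x - rep e x" by (simp add: e(2) h(2))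
        then show "(cmod (rep h x))\<^sup>2 \<le> (1 + \<delta>) * (cmod (rep g x))\<^sup>2 + (1 + 1 / \<delta>) * (cmod (rep e x))\<^sup>2"
          using norm_diff_square_le[OF \<delta>, of "rep g x" "rep e x"] by simp
      qed (intro Bochner_Integration.integrable_add integrable_mult_right L2 g e h)+
      also have "\<dots> = (1 + \<delta>) * ?K + (1 + 1 / \<delta>) * (\<integral>x. (cmod (rep e x))\<^sup>2 \<partial>M)"
        by (subst Bochner_Integration.integral_add; (intro integrable_mult_right L2 g e)?)
           (simp only: integral_mult_right_zero g(3))
      also have "\<dots> \<le> (1 + \<delta>) * ?K + (1 + 1 / \<delta>) * \<delta>\<^sup>2"
        using e2 \<delta> by (intro add_left_mono mult_left_mono) auto
      finally have c: "(\<Sum>s\<in>F. (cmod (c s))\<^sup>2) \<le> (1 + \<delta>) * ?K + (1 + 1 / \<delta>) * \<delta>\<^sup>2"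
        by (simp only: h(4))
      have "cmod (ev h) \<le> (\<Sum>s\<in>F. cmod (c s) * cmod (ev s))"
        unfolding h(3) by (rule order_trans[OF norm_sum]) (simp add: norm_mult)
      then have "(cmod (ev h))\<^sup>2 \<le> (\<Sum>s\<in>F. cmod (c s) * cmod (ev s))\<^sup>2"
        by (rule power_mono) simp
      also have "\<dots> \<le> (\<Sum>s\<in>F. (cmod (c s))\<^sup>2) * (\<Sum>s\<in>F. (cmod (ev s))\<^sup>2)"
        by (rule Cauchy_Schwarz_ineq_sum)
      also have "\<dots> \<le> ((1 + \<delta>) * ?K + (1 + 1 / \<delta>) * \<delta>\<^sup>2) * S"
        using le_S[OF F] c by (intro mult_mono order_trans[OF sum_nonneg c]) (auto intro: sum_nonneg)
      finally have eh: "cmod (ev h) \<le> sqrt (((1 + \<delta>) * ?K + (1 + 1 / \<delta>) * \<delta>\<^sup>2) * S)"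
        by (rule real_le_rsqrt)
      have "(cmod (ev e))\<^sup>2 \<le> \<kappa> * \<delta>\<^sup>2"
        using ev[OF e(1)] e2 \<kappa>0 by (meson less_imp_le mult_left_mono order_trans)
      then have ee: "cmod (ev e) \<le> sqrt (\<kappa> * \<delta>\<^sup>2)" by (rule real_le_rsqrt)
      have "ev g = ev h + ev e" by (simp add: e(3) h(3))
      then have "cmod (ev g) \<le> cmod (ev h) + cmod (ev e)" by (simp add: norm_triangle_ineq)
      moreover have "cmod (ev g) = ?K" using K unfolding g(2) norm_of_real by simp
      ultimately show ?thesis using eh ee by linarith
    qed
    have "((\<lambda>\<delta>. sqrt (((1 + \<delta>) * ?K + (\<delta>\<^sup>2 + \<delta>)) * S) + sqrt (\<kappa> * \<delta>\<^sup>2)) \<longlongrightarrow>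
        sqrt (((1 + 0) * ?K + (0\<^sup>2 + 0)) * S) + sqrt (\<kappa> * 0\<^sup>2)) (at_right 0)"
      by (intro tendsto_intros)
    then have "?K \<le> sqrt (((1 + 0) * ?K + (0\<^sup>2 + 0)) * S) + sqrt (\<kappa> * 0\<^sup>2)"
    proof (rule tendsto_lowerbound)
      show "\<forall>\<^sub>F \<delta> in at_right 0. ?K \<le> sqrt (((1 + \<delta>) * ?K + (\<delta>\<^sup>2 + \<delta>)) * S) + sqrt (\<kappa> * \<delta>\<^sup>2)"
      proof (rule eventually_at_right_less[THEN eventually_mono])
        fix \<delta> :: real assume "0 < \<delta>"
        moreover from this have "(1 + 1 / \<delta>) * \<delta>\<^sup>2 = \<delta>\<^sup>2 + \<delta>"
          by (simp add: power2_eq_square field_simps)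
        ultimately show "?K \<le> sqrt (((1 + \<delta>) * ?K + (\<delta>\<^sup>2 + \<delta>)) * S) + sqrt (\<kappa> * \<delta>\<^sup>2)"
          using est by metis
      qed
    qed simp
    then have "?K \<le> sqrt (?K * S)" by simp
    then have "?K\<^sup>2 \<le> ?K * S"
      using K S0 by (metis less_imp_le mult_nonneg_nonneg real_sqrt_pow2 power_mono)
    then show ?thesis using K by (simp add: power2_eq_square)
  qed
  then have "\<kappa> \<le> S"
    using has_sum_le_finite_sums[OF \<kappa>] by blast
  ultimately show ?thesis using SB by simp
qed

section \<open>Determinants\<close>

text \<open>Cramer's rule for the identity matrix.\<close>

lemma det_identity_replace_row:
  fixes y :: "'a::field ^ 'n"
  shows "det (\<chi> i. if i = k then y else axis i 1) = y $ k"
proof -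
  have r: "row i (mat 1 :: 'a ^ 'n ^ 'n) = axis i 1" for i
    by (simp add: vec_eq_iff row_def mat_def axis_def)
  have S: "(\<Sum>i\<in>UNIV. y $ i *s axis i 1) = y"
    by (simp add: vec_eq_iff axis_def if_distrib cong: if_cong)
  then show ?thesis
    using cramer_lemma_transpose[where A = "mat 1 :: 'a ^ 'n ^ 'n" and x = y and k = k, unfolded r S] by simp
qed

text \<open>Multilinearity in the new row \<open>k\<close>: its unit part gives the induction
  hypothesis, and its \<open>y\<close> part gives \<open>y $ k\<close>, because the multiples of
  \<open>y\<close> in the other rows can be cleared by row operations with row
  \<open>k\<close>.\<close>

lemma det_rank_one_update_aux:
  fixes x :: "'a::field ^ 'n" and y :: "'a ^ 'n"
  assumes "finite S"
  shows "det (\<chi> i. if i \<in> S then axis i 1 + x $ i *s y else axis i 1) = 1 + (\<Sum>i\<in>S. x $ i * y $ i)"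
  using assms
proof induction
  case empty
  have "(\<chi> i. axis i 1) = (mat 1 :: 'a ^ 'n ^ 'n)"
    by (simp add: vec_eq_iff mat_def axis_def)
  then show ?case by simp
next
  case (insert k S)
  define c where "c i = (if i \<in> S then axis i 1 + x $ i *s y else axis i 1)" for i
  have "(\<chi> i. if i \<in> insert k S then axis i 1 + x $ i *s y else axis i 1)
    = (\<chi> i. if i = k then axis k 1 + x $ k *s y else c i)"
    by (simp add: vec_eq_iff c_def)
  also have "det \<dots> = det (\<chi> i. if i = k then axis k 1 else c i) + det (\<chi> i. if i = k then x $ k *s y else c i)"
    by (rule det_row_add)
  also have "det (\<chi> i. if i = k then axis k 1 else c i) = 1 + (\<Sum>i\<in>S. x $ i * y $ i)"
    using insert.hyps unfolding insert.IH[symmetric]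
    by (intro arg_cong[where f = det]) (auto simp: vec_eq_iff c_def)
  also have "det (\<chi> i. if i = k then x $ k *s y else c i) = x $ k * det (\<chi> i. if i = k then y else c i)"
    by (rule det_row_mul)
  also have "det (\<chi> i. if i = k then y else c i) = y $ k"
  proof -
    have "det (\<chi> i. if i = k then y else if i \<in> R then axis i 1 + x $ i *s y else axis i 1) = y $ k"
      if "finite R" "k \<notin> R" for R
      using that
    proof induction
      case empty
      show ?case by (simp only: empty_iff if_False det_identity_replace_row)
    next
      case (insert l R)
      define A where "A = (\<chi> i. if i = k then y else if i \<in> R then axis i 1 + x $ i *s y else axis i 1)"
      have lk: "l \<noteq> k" using insert by auto
      have "(\<chi> i. if i = k then y else if i \<in> insert l R then axis i 1 + x $ i *s y else axis i 1)
        = (\<chi> i. if i = l then row l A + x $ l *s row k A else row i A)"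
        using insert.hyps lk by (auto simp: vec_eq_iff A_def row_def)
      also have "det \<dots> = det A"
        by (rule det_row_operation[OF lk])
      also have "\<dots> = y $ k" using insert unfolding A_def by auto
      finally show ?case .
    qed
    from this[OF insert.hyps] show ?thesis unfolding c_def .
  qed
  finally show ?case using insert.hyps by (simp add: algebra_simps)
qed

lemma det_rank_one_update:
  fixes x y :: "'a::field ^ 'n"
  shows "det (\<chi> i j. (if i = j then 1 else 0) + x $ i * y $ j) = 1 + (\<Sum>i\<in>UNIV. x $ i * y $ i)"
proof -
  have "(\<chi> i j. (if i = j then 1 else 0) + x $ i * y $ j) = (\<chi> i. if i \<in> UNIV then axis i 1 + x $ i *s y else axis i 1)"
    by (simp add: vec_eq_iff axis_def)
  then show ?thesis using det_rank_one_update_aux[of UNIV x y] by simp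
qed

text \<open>Factoring out the diagonal matrix leaves the identity plus a rank-one matrix.\<close>

lemma det_diagonal_rank_one:
  fixes d x y :: "'a::field ^ 'n"
  assumes "\<And>i. d $ i \<noteq> 0"
  shows "det (\<chi> i j. (if i = j then d $ i else 0) + x $ i * y $ j)
    = (\<Prod>i\<in>UNIV. d $ i) * (1 + (\<Sum>i\<in>UNIV. x $ i * y $ i / d $ i))"
proof -
  define A :: "'a ^ 'n ^ 'n" where "A = (\<chi> i j. if i = j then d $ i else 0)"
  define B :: "'a ^ 'n ^ 'n" where "B = (\<chi> i j. (if i = j then 1 else 0) + (\<chi> i. x $ i / d $ i) $ i * y $ j)"
  have "(\<chi> i j. (if i = j then d $ i else 0) + x $ i * y $ j) = A ** B"
  proof -
    have "(A ** B) $ i $ j = (\<Sum>k\<in>UNIV. if i = k then d $ i * B $ k $ j else 0)" for i j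
      unfolding matrix_matrix_mult_def A_def vec_lambda_beta by (intro sum.cong) auto
    then have "(A ** B) $ i $ j = d $ i * B $ i $ j" for i j
      by simp
    then show ?thesis
      using assms by (simp add: vec_eq_iff B_def distrib_left)
  qed
  also have "det \<dots> = (\<Prod>i\<in>UNIV. d $ i) * (1 + (\<Sum>i\<in>UNIV. x $ i * y $ i / d $ i))"
    unfolding det_mul A_def B_def det_rank_one_update
    by (subst det_diagonal) (auto simp: mult_ac)
  finally show ?thesis .
qed

text \<open>Substituting \<open>\<tau> \<circ> \<sigma>\<close> for \<open>\<tau>\<close> removes
  \<open>\<sigma>\<close> from the product and from the sign, so every \<open>\<sigma>\<close>
  contributes one determinant. The resulting factorial cancels the one in
  \<open>vol_density\<close>.\<close>

lemma sum_permutation_pairs_eq_det: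
  fixes A :: "'a::field_char_0 ^ 'n ^ 'n"
  shows "(\<Sum>\<sigma> | \<sigma> permutes (UNIV::'n set). \<Sum>\<tau> | \<tau> permutes (UNIV::'n set).
      of_int (sign \<sigma>) * of_int (sign \<tau>) * (\<Prod>a\<in>UNIV. A $ \<sigma> a $ \<tau> a)) = fact CARD('n) * det A"
proof -
  let ?P = "{\<sigma>. \<sigma> permutes (UNIV::'n set)}"
  have fin: "finite ?P" by (simp add: finite_permutations)
  have "(\<Sum>\<tau>\<in>?P. of_int (sign \<sigma>) * of_int (sign \<tau>) * (\<Prod>a\<in>UNIV. A $ \<sigma> a $ \<tau> a)) = det A" if \<sigma>: "\<sigma> \<in> ?P" for \<sigma>
  proof -
    have s: "\<sigma> permutes UNIV" using \<sigma> by simp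
    have "(\<Sum>\<tau>\<in>?P. of_int (sign \<sigma>) * of_int (sign \<tau>) * (\<Prod>a\<in>UNIV. A $ \<sigma> a $ \<tau> a))
      = (\<Sum>\<tau>\<in>?P. of_int (sign \<sigma>) * of_int (sign (\<tau> \<circ> \<sigma>)) * (\<Prod>a\<in>UNIV. A $ \<sigma> a $ (\<tau> \<circ> \<sigma>) a))"
      by (rule sum.reindex_bij_betw[symmetric]) (rule bij_betw_byWitness[where f' = "\<lambda>\<tau>. \<tau> \<circ> inv \<sigma>"];
          use s in \<open>auto simp: permutes_compose permutes_inv comp_assoc permutes_inv_o\<close>)
    also have "\<dots> = (\<Sum>\<tau>\<in>?P. of_int (sign \<tau>) * (\<Prod>a\<in>UNIV. A $ a $ \<tau> a))"
    proof (rule sum.cong[OF refl])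
      fix \<tau> assume "\<tau> \<in> ?P"
      then have t: "\<tau> permutes UNIV" by simp
      have "sign (\<tau> \<circ> \<sigma>) = sign \<tau> * sign \<sigma>"
        using s t by (intro sign_compose) (auto simp: permutation_permutes)
      moreover have "(of_int (sign \<sigma>) * of_int (sign \<sigma>) :: 'a) = 1"
        by (simp flip: of_int_mult)
      moreover have "(\<Prod>a\<in>UNIV. A $ \<sigma> a $ (\<tau> \<circ> \<sigma>) a) = (\<Prod>a\<in>UNIV. A $ a $ \<tau> a)"
        unfolding comp_def by (rule prod.reindex_bij_betw[OF permutes_imp_bij[OF s], of "\<lambda>a. A $ a $ \<tau> a"])
      ultimately show "of_int (sign \<sigma>) * of_int (sign (\<tau> \<circ> \<sigma>)) * (\<Prod>a\<in>UNIV. A $ \<sigma> a $ (\<tau> \<circ> \<sigma>) a)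
        = of_int (sign \<tau>) * (\<Prod>a\<in>UNIV. A $ a $ \<tau> a)"
        by (simp add: mult.assoc mult.left_commute[of "of_int (sign \<sigma>)" "of_int (sign \<tau>)"])
    qed
    also have "\<dots> = det A" by (simp add: det_def)
    finally show ?thesis .
  qed
  then have "(\<Sum>\<sigma>\<in>?P. \<Sum>\<tau>\<in>?P. of_int (sign \<sigma>) * of_int (sign \<tau>) * (\<Prod>a\<in>UNIV. A $ \<sigma> a $ \<tau> a)) = (\<Sum>\<sigma>\<in>?P. det A)"
    by (intro sum.cong) auto
  also have "\<dots> = of_nat (card ?P) * det A" by simp
  also have "card ?P = fact CARD('n)" by (rule card_permutations) auto
  finally show ?thesis by simp
qed

lemma vol_density_eq_det:
  "vol_density \<omega> i q = 2 ^ CARD('n) * Re (det (\<omega> i q))" for \<omega> :: "('p, 'i, 'n::finite) form11"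
proof -
  have f: "(fact CARD('n) :: complex) = complex_of_real (fact CARD('n))" by simp
  have "Re (fact CARD('n) * det (\<omega> i q)) = fact CARD('n) * Re (det (\<omega> i q))"
    unfolding f by (simp only: times_complex.sel Re_complex_of_real Im_complex_of_real mult_zero_left diff_zero)
  then show ?thesis
    unfolding vol_density_def sum_permutation_pairs_eq_det by simp
qed

section \<open>Calculus of smooth functions\<close>

lemma Ck_on_cong:
  assumes S: "open S" and "\<And>x. x \<in> S \<Longrightarrow> f x = g x"
  shows "Ck_on n f S \<longleftrightarrow> Ck_on n g S"
proof -
  have "Ck_on n g S" if "Ck_on n f S" "\<And>x. x \<in> S \<Longrightarrow> f x = g x" for f g :: "'a \<Rightarrow> 'b"
    using that
  proof (induction n arbitrary: f g)
    case 0
    then show ?case by (metis Ck_on.simps(1) continuous_on_cong)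
  next
    case (Suc n)
    have der: "(g has_derivative frechet_derivative f (at x)) (at x)" if "x \<in> S" for x
    proof (rule has_derivative_transform_within_open[OF _ S that])
      show "(f has_derivative frechet_derivative f (at x)) (at x)"
        using Suc.prems(1) that by (simp add: frechet_derivative_works)
    qed (use Suc.prems(2) in auto)
    have eq: "frechet_derivative f (at x) = frechet_derivative g (at x)" if "x \<in> S" for x
      by (rule frechet_derivative_at[OF der[OF that]])
    have "Ck_on n (\<lambda>x. frechet_derivative g (at x) v) S" for v
      by (rule Suc.IH[of "\<lambda>x. frechet_derivative f (at x) v"]) (use Suc.prems(1) eq in auto)
    then show ?case using der unfolding Ck_on.simps differentiable_def by blast
  qed
  from this[of f g] this[of g f] assms(2) show ?thesis by auto
qed

lemma Ck_on_SucD: "Ck_on (Suc n) f S \<Longrightarrow> Ck_on n f S"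
proof (induction n arbitrary: f)
  case 0
  then show ?case
    by (auto intro!: differentiable_imp_continuous_on simp: differentiable_on_def differentiable_at_withinI)
next
  case (Suc n)
  have "\<forall>x\<in>S. f differentiable at x" using Suc.prems by simp
  moreover have "Ck_on n (\<lambda>x. frechet_derivative f (at x) v) S" for v
    using Suc.prems by (intro Suc.IH) simp
  ultimately show ?case by simp
qed

lemma Ck_on_Suc_derivative:
  "Ck_on (Suc n) f S \<Longrightarrow> x \<in> S \<Longrightarrow> (f has_derivative frechet_derivative f (at x)) (at x)"
  by (simp add: frechet_derivative_works)

lemma Ck_on_SucI:
  assumes S: "open S" and f: "\<And>x. x \<in> S \<Longrightarrow> (f has_derivative f' x) (at x)"
    and "\<And>v. Ck_on n (\<lambda>x. f' x v) S"
  shows "Ck_on (Suc n) f S"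
proof -
  have eq: "f' x = frechet_derivative f (at x)" if "x \<in> S" for x
    by (rule frechet_derivative_at[OF f[OF that]])
  have "Ck_on n (\<lambda>x. frechet_derivative f (at x) v) S" for v
    using assms(3)[of v] Ck_on_cong[OF S, of "\<lambda>x. f' x v" "\<lambda>x. frechet_derivative f (at x) v" n] eq by simp
  moreover have "f differentiable at x" if "x \<in> S" for x
    using f[OF that] by (auto simp: differentiable_def)
  ultimately show ?thesis by simp
qed

lemma Ck_on_const: "open S \<Longrightarrow> Ck_on n (\<lambda>x. c) S"
proof (induction n arbitrary: c)
  case (Suc n)
  then show ?case by (intro Ck_on_SucI[where f' = "\<lambda>x v. 0"]) auto
qed simp

lemma Ck_on_compose_linear:
  assumes L: "bounded_linear L" and S: "open S"
  shows "Ck_on n f S \<Longrightarrow> Ck_on n (\<lambda>x. L (f x)) S"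
proof (induction n arbitrary: f)
  case 0
  then show ?case using L by (auto intro: bounded_linear.continuous_on)
next
  case (Suc n)
  show ?case
  proof (rule Ck_on_SucI[OF S])
    show "((\<lambda>x. L (f x)) has_derivative (\<lambda>v. L (frechet_derivative f (at x) v))) (at x)" if "x \<in> S" for x
      by (rule bounded_linear.has_derivative[OF L Ck_on_Suc_derivative[OF Suc.prems that]])
    show "Ck_on n (\<lambda>x. L (frechet_derivative f (at x) v)) S" for v
      using Suc.prems by (intro Suc.IH) simp
  qed
qed

lemma Ck_on_bounded_linear:
  assumes L: "bounded_linear L" and S: "open S"
  shows "Ck_on n L S"
proof (cases n)
  case 0
  then show ?thesis using L by (simp add: linear_continuous_on)
next
  case (Suc m)
  have "Ck_on (Suc m) L S"
    by (rule Ck_on_SucI[OF S, where f' = "\<lambda>x. L"]) (simp_all add: bounded_linear_imp_has_derivative[OF L] Ck_on_const S)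
  then show ?thesis using Suc by simp
qed

lemma Ck_on_add:
  assumes S: "open S"
  shows "Ck_on n f S \<Longrightarrow> Ck_on n g S \<Longrightarrow> Ck_on n (\<lambda>x. f x + g x) S"
proof (induction n arbitrary: f g)
  case 0
  then show ?case by (auto intro: continuous_on_add)
next
  case (Suc n)
  show ?case
  proof (rule Ck_on_SucI[OF S])
    show "((\<lambda>x. f x + g x) has_derivative (\<lambda>v. frechet_derivative f (at x) v + frechet_derivative g (at x) v)) (at x)"
      if "x \<in> S" for x
      by (intro has_derivative_add Ck_on_Suc_derivative[OF Suc.prems(1) that] Ck_on_Suc_derivative[OF Suc.prems(2) that])
    show "Ck_on n (\<lambda>x. frechet_derivative f (at x) v + frechet_derivative g (at x) v) S" for v
      using Suc.prems by (intro Suc.IH) simp_all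
  qed
qed

lemma Ck_on_mult:
  fixes f g :: "'a::real_normed_vector \<Rightarrow> 'b::real_normed_algebra"
  assumes S: "open S"
  shows "Ck_on n f S \<Longrightarrow> Ck_on n g S \<Longrightarrow> Ck_on n (\<lambda>x. f x * g x) S"
proof (induction n arbitrary: f g)
  case 0
  then show ?case by (auto intro: continuous_on_mult)
next
  case (Suc n)
  show ?case
  proof (rule Ck_on_SucI[OF S])
    show "((\<lambda>x. f x * g x) has_derivative
        (\<lambda>v. f x * frechet_derivative g (at x) v + frechet_derivative f (at x) v * g x)) (at x)"
      if "x \<in> S" for x
      by (intro has_derivative_mult Ck_on_Suc_derivative[OF Suc.prems(1) that] Ck_on_Suc_derivative[OF Suc.prems(2) that])
    show "Ck_on n (\<lambda>x. f x * frechet_derivative g (at x) v + frechet_derivative f (at x) v * g x) S" for v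
      using Suc.prems Ck_on_SucD[OF Suc.prems(1)] Ck_on_SucD[OF Suc.prems(2)]
      by (intro Ck_on_add[OF S] Suc.IH) simp_all
  qed
qed

text \<open>By the chain rule a directional derivative is a product of the derivative of
  \<open>\<phi>\<close> along \<open>u\<close> and a derivative of \<open>u\<close>, both one order
  lower. A linear map on the reals is multiplication by its value at 1, which is why
  \<open>frechet_derivative \<phi>\<close> is applied to 1.\<close>

lemma Ck_on_compose_real:
  fixes u :: "'a::real_normed_vector \<Rightarrow> real" and \<phi> :: "real \<Rightarrow> real"
  assumes S: "open S" and u: "\<And>x. x \<in> S \<Longrightarrow> u x \<in> R"
  shows "Ck_on n \<phi> R \<Longrightarrow> Ck_on n u S \<Longrightarrow> Ck_on n (\<lambda>x. \<phi> (u x)) S"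
proof (induction n arbitrary: \<phi>)
  case 0
  then show ?case using u by (auto intro!: continuous_on_compose2[of R \<phi> S u])
next
  case (Suc n)
  show ?case
  proof (rule Ck_on_SucI[OF S])
    fix x assume x: "x \<in> S"
    have \<phi>: "(\<phi> has_derivative frechet_derivative \<phi> (at (u x))) (at (u x))"
      by (rule Ck_on_Suc_derivative[OF Suc.prems(1) u[OF x]])
    then have lin: "linear (frechet_derivative \<phi> (at (u x)))"
      by (rule has_derivative_linear)
    define c where "c = frechet_derivative \<phi> (at (u x)) 1"
    have "frechet_derivative \<phi> (at (u x)) t = c * t" for t
      using linear_scale[OF lin, of t 1] by (simp add: c_def mult.commute)
    then have "((\<lambda>x. \<phi> (u x)) has_derivative (\<lambda>v. c * frechet_derivative u (at x) v)) (at x)"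
      using has_derivative_compose[OF Ck_on_Suc_derivative[OF Suc.prems(2) x] \<phi>] by simp
    then show "((\<lambda>x. \<phi> (u x)) has_derivative
        (\<lambda>v. frechet_derivative \<phi> (at (u x)) 1 * frechet_derivative u (at x) v)) (at x)"
      unfolding c_def .
  next
    show "Ck_on n (\<lambda>x. frechet_derivative \<phi> (at (u x)) 1 * frechet_derivative u (at x) v) S" for v
      using Suc.prems Ck_on_SucD[OF Suc.prems(2)]
      by (intro Ck_on_mult[OF S] Suc.IH[of "\<lambda>y. frechet_derivative \<phi> (at y) 1"]) simp_all
  qed
qed

lemma smooth_on_cong: "open S \<Longrightarrow> (\<And>x. x \<in> S \<Longrightarrow> f x = g x) \<Longrightarrow> smooth_on f S \<longleftrightarrow> smooth_on g S"
  unfolding smooth_on_def by (simp add: Ck_on_cong[of S f g])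

lemma smooth_on_const: "open S \<Longrightarrow> smooth_on (\<lambda>x. c) S"
  by (simp add: smooth_on_def Ck_on_const)

lemma smooth_on_bounded_linear: "bounded_linear L \<Longrightarrow> open S \<Longrightarrow> smooth_on L S"
  by (simp add: smooth_on_def Ck_on_bounded_linear)

lemma smooth_on_compose_linear: "bounded_linear L \<Longrightarrow> open S \<Longrightarrow> smooth_on f S \<Longrightarrow> smooth_on (\<lambda>x. L (f x)) S"
  by (simp add: smooth_on_def Ck_on_compose_linear)

lemma smooth_on_add: "open S \<Longrightarrow> smooth_on f S \<Longrightarrow> smooth_on g S \<Longrightarrow> smooth_on (\<lambda>x. f x + g x) S"
  by (simp add: smooth_on_def Ck_on_add)

lemma smooth_on_mult:
  fixes f g :: "'a::real_normed_vector \<Rightarrow> 'b::real_normed_algebra"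
  shows "open S \<Longrightarrow> smooth_on f S \<Longrightarrow> smooth_on g S \<Longrightarrow> smooth_on (\<lambda>x. f x * g x) S"
  by (simp add: smooth_on_def Ck_on_mult)

lemma smooth_on_minus: "open S \<Longrightarrow> smooth_on f S \<Longrightarrow> smooth_on (\<lambda>x. - f x) S"
  by (rule smooth_on_compose_linear[OF bounded_linear_minus[OF bounded_linear_ident]])

lemma smooth_on_sum:
  "open S \<Longrightarrow> (\<And>i. i \<in> I \<Longrightarrow> smooth_on (f i) S) \<Longrightarrow> smooth_on (\<lambda>x. \<Sum>i\<in>I. f i x) S"
  by (induction I rule: infinite_finite_induct) (auto intro: smooth_on_const smooth_on_add)

lemma smooth_on_power:
  fixes f :: "'a::real_normed_vector \<Rightarrow> 'b::real_normed_algebra_1"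
  shows "open S \<Longrightarrow> smooth_on f S \<Longrightarrow> smooth_on (\<lambda>x. f x ^ n) S"
  by (induction n) (simp_all add: smooth_on_const smooth_on_mult)

lemma smooth_on_compose_real:
  fixes u :: "'a::real_normed_vector \<Rightarrow> real" and \<phi> :: "real \<Rightarrow> real"
  shows "smooth_on \<phi> R \<Longrightarrow> open S \<Longrightarrow> smooth_on u S \<Longrightarrow> (\<And>x. x \<in> S \<Longrightarrow> u x \<in> R) \<Longrightarrow> smooth_on (\<lambda>x. \<phi> (u x)) S"
  unfolding smooth_on_def by (intro allI, rule Ck_on_compose_real[where R = R]) (assumption | blast)+

lemma smooth_on_imp_Ck_on: "smooth_on f S \<Longrightarrow> Ck_on n f S"
  by (simp add: smooth_on_def)

lemma smooth_on_imp_continuous_on: "smooth_on f S \<Longrightarrow> continuous_on S f"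
  using smooth_on_imp_Ck_on[of f S 0] by simp

lemma smooth_on_imp_derivative:
  "smooth_on f S \<Longrightarrow> x \<in> S \<Longrightarrow> (f has_derivative frechet_derivative f (at x)) (at x)"
  by (rule Ck_on_Suc_derivative[OF smooth_on_imp_Ck_on])

lemma smooth_on_frechet_derivative: "smooth_on f S \<Longrightarrow> smooth_on (\<lambda>x. frechet_derivative f (at x) v) S"
  unfolding smooth_on_def
proof
  fix n assume "\<forall>n. Ck_on n f S"
  then have "Ck_on (Suc n) f S" ..
  then show "Ck_on n (\<lambda>x. frechet_derivative f (at x) v) S" by simp
qed

lemma smooth_on_exp: "smooth_on (exp :: real \<Rightarrow> real) UNIV"
proof -
  \<comment> \<open>The factor \<open>c\<close> takes up the direction of differentiation, so the
    family reproduces itself.\<close>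
  have "Ck_on n (\<lambda>x. exp x * c) (UNIV :: real set)" for n and c :: real
  proof (induction n arbitrary: c)
    case 0
    show ?case by (auto intro!: continuous_intros)
  next
    case (Suc n)
    show ?case
    proof (rule Ck_on_SucI[where f' = "\<lambda>x v. exp x * (c * v)"])
      show "((\<lambda>x. exp x * c) has_derivative (\<lambda>v. exp x * (c * v))) (at x)" for x
        by (auto intro!: derivative_eq_intros simp: mult_ac)
    qed (simp_all add: Suc.IH)
  qed
  from this[of _ 1] show ?thesis by (simp add: smooth_on_def)
qed

text \<open>Multiples of real powers are closed under differentiation, which carries the induction
  on the order. Smoothness of \<open>ln\<close> follows because its derivative is a power.\<close>

lemma smooth_on_powr: "smooth_on (\<lambda>x::real. x powr a) {0<..}"
proof -
  have "Ck_on n (\<lambda>x. x powr a * c) {0<..}" for n and c :: real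
  proof (induction n arbitrary: a c)
    case 0
    show ?case by (auto intro!: continuous_intros)
  next
    case (Suc n)
    show ?case
    proof (rule Ck_on_SucI[where f' = "\<lambda>x v. x powr (a - 1) * (a * c * v)"])
      show "((\<lambda>x. x powr a * c) has_derivative (\<lambda>v. x powr (a - 1) * (a * c * v))) (at x)" if "x \<in> {0<..}" for x
      proof -
        have "((\<lambda>x. x powr a * c) has_real_derivative x powr (a - 1) * (a * c)) (at x)"
          using that has_real_derivative_powr[of x a] by (auto intro!: derivative_eq_intros)
        moreover have "(\<lambda>v. x powr (a - 1) * (a * c * v)) = (*) (x powr (a - 1) * (a * c))"
          by (simp add: fun_eq_iff mult.assoc)
        ultimately show ?thesis by (simp only: has_field_derivative_def)
      qed
    qed (simp_all add: Suc.IH)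
  qed
  from this[of _ 1] show ?thesis by (simp add: smooth_on_def)
qed

lemma smooth_on_ln: "smooth_on (ln :: real \<Rightarrow> real) {0<..}"
  unfolding smooth_on_def
proof
  fix n show "Ck_on n (ln :: real \<Rightarrow> real) {0<..}"
  proof (cases n)
    case 0
    then show ?thesis by (auto intro!: continuous_intros)
  next
    case (Suc m)
    have "Ck_on (Suc m) (ln :: real \<Rightarrow> real) {0<..}"
    proof (rule Ck_on_SucI[where f' = "\<lambda>x v. x powr (-1) * v"])
      show "(ln has_derivative (\<lambda>v. x powr (-1) * v)) (at x)" if "x \<in> {0<..}" for x :: real
      proof -
        have "(\<lambda>v. x powr (-1) * v) = (*) (inverse x)"
          using that by (simp add: fun_eq_iff powr_minus)
        moreover have "(ln has_real_derivative inverse x) (at x)"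
          using that by (simp add: DERIV_ln)
        ultimately show ?thesis by (simp only: has_field_derivative_def)
      qed
      show "Ck_on m (\<lambda>x. x powr (-1) * v) {0<..}" for v :: real
        using smooth_on_mult[OF _ smooth_on_powr smooth_on_const, of "-1" v] by (simp add: smooth_on_def)
    qed simp
    then show ?thesis using Suc by simp
  qed
qed

text \<open>Both mixed second derivatives agree with the same second difference, up to moving the
  base point by the mean value theorem.\<close>

lemma second_derivative_symmetric_real:
  fixes f :: "'a::real_normed_vector \<Rightarrow> real"
  assumes f: "Ck_on 2 f S" and S: "open S" and x: "x \<in> S"
  defines "D \<equiv> \<lambda>u v y. frechet_derivative (\<lambda>z. frechet_derivative f (at z) u) (at y) v"
  shows "D u v x = D v u x"
proof (rule ccontr)
  assume neq: "D u v x \<noteq> D v u x"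
  define \<epsilon> where "\<epsilon> = \<bar>D u v x - D v u x\<bar> / 2"
  have \<epsilon>: "0 < \<epsilon>" using neq by (simp add: \<epsilon>_def)
  have f2: "Ck_on (Suc (Suc 0)) f S" using f by (simp add: numeral_2_eq_2)
  have d1: "(f has_derivative frechet_derivative f (at y)) (at y)" if "y \<in> S" for y
    using Ck_on_Suc_derivative[OF f2 that] .
  have "Ck_on (Suc 0) (\<lambda>z. frechet_derivative f (at z) w) S" for w
    using f2 by simp
  then have d2: "((\<lambda>z. frechet_derivative f (at z) w) has_derivative (\<lambda>v. D w v y)) (at y)" if "y \<in> S" for y w
    using Ck_on_Suc_derivative[of 0 "\<lambda>z. frechet_derivative f (at z) w" S y] that by (simp add: D_def)
  have cont: "isCont (D u v) x" for u v
    using f2 S x unfolding D_def by (simp add: continuous_on_eq_continuous_at)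
  obtain r where r: "0 < r" "ball x r \<subseteq> S"
    using S x open_contains_ball by blast
  obtain r1 where r1: "0 < r1" "\<And>y. dist y x < r1 \<Longrightarrow> dist (D u v y) (D u v x) < \<epsilon>"
    using cont[of u v] \<epsilon> unfolding continuous_at_eps_delta by blast
  obtain r2 where r2: "0 < r2" "\<And>y. dist y x < r2 \<Longrightarrow> dist (D v u y) (D v u x) < \<epsilon>"
    using cont[of v u] \<epsilon> unfolding continuous_at_eps_delta by blast
  define \<rho> where "\<rho> = min r (min r1 r2)"
  have \<rho>: "0 < \<rho>" using r r1 r2 by (simp add: \<rho>_def)
  \<comment> \<open>Small enough that the parallelogram spanned at \<open>x\<close> by
    \<open>h\<close> times the two directions stays within distance \<open>\<rho>\<close>; the added
    1 keeps the denominator positive.\<close>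
  define h where "h = \<rho> / (2 * (norm u + norm v + 1))"
  have pos: "0 < 2 * (norm u + norm v + 1)" by (simp add: add_nonneg_pos)
  have h: "0 < h" using \<rho> pos by (simp add: h_def)
  have hb: "h * (norm u + norm v) < \<rho>"
  proof -
    have "h * (norm u + norm v) < h * (2 * (norm u + norm v + 1))"
      using h by (intro mult_strict_left_mono) (auto simp: add_nonneg_pos intro: add_nonneg_nonneg)
    also have "\<dots> = \<rho>" unfolding h_def using pos by simp
    finally show ?thesis .
  qed
  have near: "dist (x + s *\<^sub>R a + t *\<^sub>R b) x < \<rho>" if "0 \<le> s" "s \<le> h" "0 \<le> t" "t \<le> h" "norm a + norm b = norm u + norm v" for s t a b
  proof -
    have "dist (x + s *\<^sub>R a + t *\<^sub>R b) x \<le> s * norm a + t * norm b"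
      using norm_triangle_ineq[of "s *\<^sub>R a" "t *\<^sub>R b"] that by (simp add: dist_norm algebra_simps)
    also have "\<dots> \<le> h * norm a + h * norm b"
      using that by (intro add_mono mult_right_mono) auto
    also have "\<dots> = h * (norm u + norm v)" using that(5) by (simp flip: distrib_left)
    also have "\<dots> < \<rho>" by (rule hb)
    finally show ?thesis .
  qed
  have inS: "x + s *\<^sub>R a + t *\<^sub>R b \<in> S" if "0 \<le> s" "s \<le> h" "0 \<le> t" "t \<le> h" "norm a + norm b = norm u + norm v" for s t a b
    using near[OF that] r(2) by (auto simp: \<rho>_def dist_commute subset_iff)
  have key: "\<exists>y. dist y x < \<rho> \<and> f (x + h *\<^sub>R a + h *\<^sub>R b) - f (x + h *\<^sub>R a) - f (x + h *\<^sub>R b) + f x = h * h * D a b y"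
    if ab: "norm a + norm b = norm u + norm v" for a b
  proof -
    have der1: "((\<lambda>s. f (x + s *\<^sub>R a + t *\<^sub>R b)) has_derivative (\<lambda>d. d * frechet_derivative f (at (x + s *\<^sub>R a + t *\<^sub>R b)) a)) (at s)"
      if "0 \<le> s" "s \<le> h" "0 \<le> t" "t \<le> h" for s t
    proof -
      have "((\<lambda>s. x + s *\<^sub>R a + t *\<^sub>R b) has_derivative (\<lambda>d. d *\<^sub>R a)) (at s)"
        by (auto intro!: derivative_eq_intros)
      from has_derivative_compose[OF this d1[OF inS[OF that ab]]] show ?thesis
        using linear_scale[OF has_derivative_linear[OF d1[OF inS[OF that ab]]]] by simp
    qed
    have der2: "((\<lambda>t. frechet_derivative f (at (x + s *\<^sub>R a + t *\<^sub>R b)) a) has_derivative (\<lambda>d. d * D a b (x + s *\<^sub>R a + t *\<^sub>R b))) (at t)"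
      if "0 \<le> s" "s \<le> h" "0 \<le> t" "t \<le> h" for s t
    proof -
      have "((\<lambda>t. x + s *\<^sub>R a + t *\<^sub>R b) has_derivative (\<lambda>d. d *\<^sub>R b)) (at t)"
        by (auto intro!: derivative_eq_intros)
      from has_derivative_compose[OF this d2[OF inS[OF that ab]]] show ?thesis
        using linear_scale[OF has_derivative_linear[OF d2[OF inS[OF that ab]]]] by simp
    qed
    define g where "g s = f (x + s *\<^sub>R a + h *\<^sub>R b) - f (x + s *\<^sub>R a + 0 *\<^sub>R b)" for s
    have "\<exists>\<xi>\<in>{0<..<h}. g h - g 0 = (h - 0) * frechet_derivative f (at (x + \<xi> *\<^sub>R a + h *\<^sub>R b)) a - (h - 0) * frechet_derivative f (at (x + \<xi> *\<^sub>R a + 0 *\<^sub>R b)) a"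
    proof (rule mvt[OF h])
      have gd: "(g has_derivative (\<lambda>d. d * frechet_derivative f (at (x + s *\<^sub>R a + h *\<^sub>R b)) a - d * frechet_derivative f (at (x + s *\<^sub>R a + 0 *\<^sub>R b)) a)) (at s)"
        if "0 \<le> s" "s \<le> h" for s
        unfolding g_def using h that by (intro has_derivative_diff der1) auto
      show "continuous_on {0..h} g"
        by (intro continuous_at_imp_continuous_on ballI, rule has_derivative_continuous, rule gd) auto
      show "\<And>s. 0 < s \<Longrightarrow> s < h \<Longrightarrow> (g has_derivative (\<lambda>d. d * frechet_derivative f (at (x + s *\<^sub>R a + h *\<^sub>R b)) a - d * frechet_derivative f (at (x + s *\<^sub>R a + 0 *\<^sub>R b)) a)) (at s)"
        by (rule gd) auto
    qed (rule bexI; simp)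
    then obtain \<xi> where \<xi>: "0 < \<xi>" "\<xi> < h" and 1: "g h - g 0 = h * (frechet_derivative f (at (x + \<xi> *\<^sub>R a + h *\<^sub>R b)) a - frechet_derivative f (at (x + \<xi> *\<^sub>R a + 0 *\<^sub>R b)) a)"
      by (auto simp: right_diff_distrib)
    define k where "k t = frechet_derivative f (at (x + \<xi> *\<^sub>R a + t *\<^sub>R b)) a" for t
    have "\<exists>\<eta>\<in>{0<..<h}. k h - k 0 = (h - 0) * D a b (x + \<xi> *\<^sub>R a + \<eta> *\<^sub>R b)"
    proof (rule mvt[OF h])
      have kd: "(k has_derivative (\<lambda>d. d * D a b (x + \<xi> *\<^sub>R a + t *\<^sub>R b))) (at t)" if "0 \<le> t" "t \<le> h" for t
        unfolding k_def using \<xi> that by (intro der2) auto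
      show "continuous_on {0..h} k"
        by (intro continuous_at_imp_continuous_on ballI, rule has_derivative_continuous, rule kd) auto
      show "\<And>t. 0 < t \<Longrightarrow> t < h \<Longrightarrow> (k has_derivative (\<lambda>d. d * D a b (x + \<xi> *\<^sub>R a + t *\<^sub>R b))) (at t)"
        by (rule kd) auto
    qed (rule bexI; simp)
    then obtain \<eta> where \<eta>: "0 < \<eta>" "\<eta> < h" and 2: "k h - k 0 = h * D a b (x + \<xi> *\<^sub>R a + \<eta> *\<^sub>R b)"
      by auto
    have "dist (x + \<xi> *\<^sub>R a + \<eta> *\<^sub>R b) x < \<rho>" using \<xi> \<eta> ab by (intro near) auto
    moreover have "g h - g 0 = h * (k h - k 0)" using 1 by (simp add: k_def)
    ultimately show ?thesis
      using 2 by (intro exI[of _ "x + \<xi> *\<^sub>R a + \<eta> *\<^sub>R b"]) (simp add: g_def algebra_simps)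
  qed
  obtain y where y: "dist y x < \<rho>" "f (x + h *\<^sub>R u + h *\<^sub>R v) - f (x + h *\<^sub>R u) - f (x + h *\<^sub>R v) + f x = h * h * D u v y"
    using key[of u v] by auto
  obtain z where z: "dist z x < \<rho>" "f (x + h *\<^sub>R v + h *\<^sub>R u) - f (x + h *\<^sub>R v) - f (x + h *\<^sub>R u) + f x = h * h * D v u z"
    using key[of v u] by (auto simp: add.commute)
  have "f (x + h *\<^sub>R v + h *\<^sub>R u) = f (x + h *\<^sub>R u + h *\<^sub>R v)" by (simp add: add_ac)
  then have "h * h * D u v y = h * h * D v u z" using y(2) z(2) by linarith
  then have "D u v y = D v u z" using h by simp
  moreover have "\<bar>D u v y - D u v x\<bar> < \<epsilon>" using r1(2)[of y] y(1) by (simp add: \<rho>_def dist_real_def)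
  moreover have "\<bar>D v u z - D v u x\<bar> < \<epsilon>" using r2(2)[of z] z(1) by (simp add: \<rho>_def dist_real_def)
  ultimately show False unfolding \<epsilon>_def by (simp add: abs_if split: if_splits)
qed

section \<open>Wirtinger calculus\<close>

text \<open>Real and imaginary part are bounded linear and commute with differentiation, which
  reduces the claim to the real case.\<close>

lemma second_derivative_symmetric:
  fixes f :: "'a::real_normed_vector \<Rightarrow> complex"
  assumes f: "smooth_on f S" and S: "open S" and x: "x \<in> S"
  shows "frechet_derivative (\<lambda>z. frechet_derivative f (at z) u) (at x) v
       = frechet_derivative (\<lambda>z. frechet_derivative f (at z) v) (at x) u"
proof -
  have comm: "frechet_derivative (\<lambda>z. frechet_derivative (\<lambda>z. L (f z)) (at z) u) (at x) v
      = L (frechet_derivative (\<lambda>z. frechet_derivative f (at z) u) (at x) v)"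
    if L: "bounded_linear L" for L :: "complex \<Rightarrow> real" and u v
  proof -
    have 1: "frechet_derivative (\<lambda>z. L (f z)) (at z) u = L (frechet_derivative f (at z) u)" if "z \<in> S" for z
      using frechet_derivative_at[OF bounded_linear.has_derivative[OF L smooth_on_imp_derivative[OF f that]]]
      by metis
    have "((\<lambda>z. L (frechet_derivative f (at z) u)) has_derivative
        (\<lambda>v. L (frechet_derivative (\<lambda>z. frechet_derivative f (at z) u) (at x) v))) (at x)"
      by (rule bounded_linear.has_derivative[OF L smooth_on_imp_derivative[OF smooth_on_frechet_derivative[OF f] x]])
    then have "((\<lambda>z. frechet_derivative (\<lambda>z. L (f z)) (at z) u) has_derivative
        (\<lambda>v. L (frechet_derivative (\<lambda>z. frechet_derivative f (at z) u) (at x) v))) (at x)"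
      by (rule has_derivative_transform_within_open[OF _ S x]) (simp add: 1)
    from frechet_derivative_at[OF this] show ?thesis by metis
  qed
  have C2: "Ck_on 2 (\<lambda>z. L (f z)) S" if L: "bounded_linear L" for L :: "complex \<Rightarrow> real"
    by (rule Ck_on_compose_linear[OF L S smooth_on_imp_Ck_on[OF f]])
  show ?thesis
  proof (rule complex_eqI)
    note c = comm[OF bounded_linear_Re] and s = second_derivative_symmetric_real[OF C2[OF bounded_linear_Re] S x]
    show "Re (frechet_derivative (\<lambda>z. frechet_derivative f (at z) u) (at x) v)
       = Re (frechet_derivative (\<lambda>z. frechet_derivative f (at z) v) (at x) u)"
      using s[of u v] unfolding c .
    note c = comm[OF bounded_linear_Im] and s = second_derivative_symmetric_real[OF C2[OF bounded_linear_Im] S x]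
    show "Im (frechet_derivative (\<lambda>z. frechet_derivative f (at z) u) (at x) v)
       = Im (frechet_derivative (\<lambda>z. frechet_derivative f (at z) v) (at x) u)"
      using s[of u v] unfolding c .
  qed
qed

text \<open>The splitting of the differential into its holomorphic and antiholomorphic part, as a
  relation. Unlike the operators \<open>wirt\<close> and \<open>wirt_bar\<close> it includes
  differentiability, so it has sum, product and chain rules; the operators are read off afterwards
  by \<open>has_wirt_eqs\<close>.\<close>

definition has_wirt :: "(complex ^ 'n::finite \<Rightarrow> complex) \<Rightarrow> ('n \<Rightarrow> complex) \<Rightarrow> ('n \<Rightarrow> complex) \<Rightarrow> complex ^ 'n \<Rightarrow> bool" where
  "has_wirt f a b z \<longleftrightarrow> (f has_derivative (\<lambda>v. \<Sum>j\<in>UNIV. a j * v $ j + b j * cnj (v $ j))) (at z)"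

lemma sum_axis: "(\<Sum>j\<in>UNIV. a j * axis k t $ j + b j * cnj (axis k t $ j)) = a k * t + b k * cnj t"
  for a :: "'n::finite \<Rightarrow> complex"
proof -
  have "(\<Sum>j\<in>UNIV. a j * axis k t $ j + b j * cnj (axis k t $ j)) = (\<Sum>j\<in>UNIV. if j = k then a k * t + b k * cnj t else 0)"
    by (intro sum.cong) (auto simp: axis_def)
  then show ?thesis by simp
qed

lemma has_wirt_eqs:
  assumes "has_wirt f a b z"
  shows "wirt j f z = a j" "wirt_bar j f z = b j"
proof -
  have D: "frechet_derivative f (at z) = (\<lambda>v. \<Sum>j\<in>UNIV. a j * v $ j + b j * cnj (v $ j))"
    using assms unfolding has_wirt_def by (rule frechet_derivative_at[symmetric])
  show "wirt j f z = a j" "wirt_bar j f z = b j"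
    unfolding wirt_def wirt_bar_def D sum_axis by (simp_all add: algebra_simps)
qed

lemma has_wirtI:
  assumes "f differentiable at z"
  shows "has_wirt f (\<lambda>j. wirt j f z) (\<lambda>j. wirt_bar j f z) z"
proof -
  let ?D = "frechet_derivative f (at z)"
  have D: "(f has_derivative ?D) (at z)" using assms by (simp add: frechet_derivative_works)
  have lin: "linear ?D" by (rule has_derivative_linear[OF D])
  have "?D v = (\<Sum>j\<in>UNIV. wirt j f z * v $ j + wirt_bar j f z * cnj (v $ j))" for v
  proof -
    have "v = (\<Sum>j\<in>UNIV. Re (v $ j) *\<^sub>R axis j 1 + Im (v $ j) *\<^sub>R axis j \<i>)"
    proof (subst vec_eq_iff, intro allI)
      fix k
      have "(\<Sum>j\<in>UNIV. Re (v $ j) *\<^sub>R axis j 1 + Im (v $ j) *\<^sub>R axis j \<i>) $ k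
        = (\<Sum>j\<in>UNIV. if j = k then v $ k else 0)"
        unfolding sum_component by (intro sum.cong) (auto simp: axis_def complex_eq_iff)
      then show "v $ k = (\<Sum>j\<in>UNIV. Re (v $ j) *\<^sub>R axis j 1 + Im (v $ j) *\<^sub>R axis j \<i>) $ k" by simp
    qed
    then have "?D v = ?D (\<Sum>j\<in>UNIV. Re (v $ j) *\<^sub>R axis j 1 + Im (v $ j) *\<^sub>R axis j \<i>)" by simp
    also have "\<dots> = (\<Sum>j\<in>UNIV. Re (v $ j) *\<^sub>R ?D (axis j 1) + Im (v $ j) *\<^sub>R ?D (axis j \<i>))"
      by (simp add: linear_sum[OF lin] linear_add[OF lin] linear_scale[OF lin])
    also have "\<dots> = (\<Sum>j\<in>UNIV. wirt j f z * v $ j + wirt_bar j f z * cnj (v $ j))"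
      by (intro sum.cong refl) (simp add: wirt_def wirt_bar_def complex_eq_iff field_simps)
    finally show ?thesis .
  qed
  then have "?D = (\<lambda>v. \<Sum>j\<in>UNIV. wirt j f z * v $ j + wirt_bar j f z * cnj (v $ j))" by (rule ext)
  then show ?thesis using D by (simp only: has_wirt_def)
qed

lemma has_wirt_const: "has_wirt (\<lambda>z. c) (\<lambda>_. 0) (\<lambda>_. 0) z"
  by (simp add: has_wirt_def)

lemma has_wirt_nth: "has_wirt (\<lambda>z. z $ k) (\<lambda>j. if j = k then 1 else 0) (\<lambda>_. 0) z"
proof -
  have "((\<lambda>z. z $ k) has_derivative (\<lambda>v. v $ k)) (at z)"
    by (rule bounded_linear_imp_has_derivative[OF bounded_linear_vec_nth])
  moreover have "(\<lambda>v. \<Sum>j\<in>UNIV. (if j = k then 1 else 0) * v $ j + 0 * cnj (v $ j)) = (\<lambda>v::complex^'a. v $ k)"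
    by (simp add: if_distrib[of "\<lambda>x. x * _"] cong: if_cong)
  ultimately show ?thesis by (simp only: has_wirt_def)
qed

lemma has_wirt_cnj:
  assumes "has_wirt f a b z"
  shows "has_wirt (\<lambda>z. cnj (f z)) (\<lambda>j. cnj (b j)) (\<lambda>j. cnj (a j)) z"
proof -
  have "((\<lambda>z. cnj (f z)) has_derivative (\<lambda>v. cnj (\<Sum>j\<in>UNIV. a j * v $ j + b j * cnj (v $ j)))) (at z)"
    using assms unfolding has_wirt_def by (rule bounded_linear.has_derivative[OF bounded_linear_cnj])
  moreover have "(\<lambda>v. cnj (\<Sum>j\<in>UNIV. a j * v $ j + b j * cnj (v $ j))) = (\<lambda>v. \<Sum>j\<in>UNIV. cnj (b j) * v $ j + cnj (a j) * cnj (v $ j))"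
    by (simp add: add.commute)
  ultimately show ?thesis by (simp only: has_wirt_def)
qed

lemma has_wirt_add:
  assumes "has_wirt f a b z" "has_wirt g c d z"
  shows "has_wirt (\<lambda>z. f z + g z) (\<lambda>j. a j + c j) (\<lambda>j. b j + d j) z"
proof -
  have "((\<lambda>z. f z + g z) has_derivative (\<lambda>v. (\<Sum>j\<in>UNIV. a j * v $ j + b j * cnj (v $ j)) + (\<Sum>j\<in>UNIV. c j * v $ j + d j * cnj (v $ j)))) (at z)"
    using assms unfolding has_wirt_def by (rule has_derivative_add)
  moreover have "(\<lambda>v. (\<Sum>j\<in>UNIV. a j * v $ j + b j * cnj (v $ j)) + (\<Sum>j\<in>UNIV. c j * v $ j + d j * cnj (v $ j)))
    = (\<lambda>v. \<Sum>j\<in>UNIV. (a j + c j) * v $ j + (b j + d j) * cnj (v $ j))"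
    by (simp add: sum.distrib[symmetric] algebra_simps)
  ultimately show ?thesis by (simp only: has_wirt_def)
qed

lemma has_wirt_mult:
  assumes "has_wirt f a b z" "has_wirt g c d z"
  shows "has_wirt (\<lambda>z. f z * g z) (\<lambda>j. f z * c j + a j * g z) (\<lambda>j. f z * d j + b j * g z) z"
proof -
  have "((\<lambda>z. f z * g z) has_derivative (\<lambda>v. f z * (\<Sum>j\<in>UNIV. c j * v $ j + d j * cnj (v $ j)) + (\<Sum>j\<in>UNIV. a j * v $ j + b j * cnj (v $ j)) * g z)) (at z)"
    using assms unfolding has_wirt_def by (rule has_derivative_mult)
  moreover have "(\<lambda>v. f z * (\<Sum>j\<in>UNIV. c j * v $ j + d j * cnj (v $ j)) + (\<Sum>j\<in>UNIV. a j * v $ j + b j * cnj (v $ j)) * g z)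
    = (\<lambda>v. \<Sum>j\<in>UNIV. (f z * c j + a j * g z) * v $ j + (f z * d j + b j * g z) * cnj (v $ j))"
    by (simp add: sum_distrib_left sum_distrib_right sum.distrib[symmetric] algebra_simps)
  ultimately show ?thesis by (simp only: has_wirt_def)
qed

lemma has_wirt_sum:
  assumes "finite I" "\<And>i. i \<in> I \<Longrightarrow> has_wirt (f i) (a i) (b i) z"
  shows "has_wirt (\<lambda>z. \<Sum>i\<in>I. f i z) (\<lambda>j. \<Sum>i\<in>I. a i j) (\<lambda>j. \<Sum>i\<in>I. b i j) z"
  using assms by (induction I) (simp_all add: has_wirt_const has_wirt_add)

text \<open>The function \<open>of_real (u z)\<close> has a derivative with real values, since its
  imaginary part is constantly 0. Therefore the real chain rule for \<open>\<phi>\<close> can be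
  rewritten in terms of the complex coefficients \<open>a\<close> and \<open>b\<close>.\<close>

lemma has_wirt_compose_real:
  assumes u: "has_wirt (\<lambda>z. of_real (u z)) a b z" and \<phi>: "(\<phi> has_real_derivative d) (at (u z))"
  shows "has_wirt (\<lambda>z. of_real (\<phi> (u z))) (\<lambda>j. of_real d * a j) (\<lambda>j. of_real d * b j) z"
proof -
  let ?D = "\<lambda>v. \<Sum>j\<in>UNIV. a j * v $ j + b j * cnj (v $ j)"
  have *: "((\<lambda>z. complex_of_real (u z)) has_derivative ?D) (at z)"
    using u by (simp add: has_wirt_def)
  have 1: "(u has_derivative (\<lambda>v. Re (?D v))) (at z)"
    using bounded_linear.has_derivative[OF bounded_linear_Re *] by simp
  have "((\<lambda>z. Im (complex_of_real (u z))) has_derivative (\<lambda>v. Im (?D v))) (at z)"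
    by (rule bounded_linear.has_derivative[OF bounded_linear_Im *])
  then have "((\<lambda>z. 0::real) has_derivative (\<lambda>v. Im (?D v))) (at z)" by simp
  then have "(\<lambda>v. Im (?D v)) = (\<lambda>v. 0)"
    using has_derivative_unique[OF _ has_derivative_const] by blast
  then have "Im (?D v) = 0" for v by meson
  then have re: "of_real (Re (?D v)) = ?D v" for v by (simp add: complex_eq_iff)
  have "(\<phi> has_derivative (*) d) (at (u z))"
    using \<phi> by (simp add: has_field_derivative_def)
  from has_derivative_compose[OF 1 this]
  have "((\<lambda>z. complex_of_real (\<phi> (u z))) has_derivative (\<lambda>v. of_real (d * Re (?D v)))) (at z)"
    by (rule bounded_linear.has_derivative[OF bounded_linear_of_real])
  moreover have "(\<lambda>v. complex_of_real (d * Re (?D v))) = (\<lambda>v. \<Sum>j\<in>UNIV. (of_real d * a j) * v $ j + (of_real d * b j) * cnj (v $ j))"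
    unfolding of_real_mult re by (simp add: sum_distrib_left algebra_simps)
  ultimately show ?thesis by (simp only: has_wirt_def)
qed

lemma has_wirt_transform:
  assumes "has_wirt f a b z" "open S" "z \<in> S" "\<And>w. w \<in> S \<Longrightarrow> f w = g w"
  shows "has_wirt g a b z"
  using assms unfolding has_wirt_def by (rule has_derivative_transform_within_open)

lemma has_wirt_cong: "has_wirt f a b z \<Longrightarrow> (\<And>j. a j = a' j) \<Longrightarrow> (\<And>j. b j = b' j) \<Longrightarrow> has_wirt f a' b' z"
  by (simp add: has_wirt_def)

text \<open>The components of \<open>\<phi>\<close> have no antiholomorphic part, so the chain rule
  does not mix the two kinds of coefficients.\<close>

lemma has_wirt_compose_holo:
  fixes \<phi> :: "complex ^ 'n::finite \<Rightarrow> complex ^ 'm::finite"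
  assumes f: "has_wirt f a b (\<phi> z)" and \<phi>: "\<And>k. has_wirt (\<lambda>z. \<phi> z $ k) (J k) (\<lambda>_. 0) z"
  shows "has_wirt (\<lambda>z. f (\<phi> z)) (\<lambda>j. \<Sum>k\<in>UNIV. a k * J k j) (\<lambda>j. \<Sum>k\<in>UNIV. b k * cnj (J k j)) z"
proof -
  let ?D = "\<lambda>v. \<chi> k. \<Sum>j\<in>UNIV. J k j * v $ j"
  have "(\<phi> has_derivative ?D) (at z)"
  proof (subst has_derivative_componentwise_within, rule ballI)
    fix e :: "complex ^ 'm" assume "e \<in> Basis"
    then obtain k u where e: "e = axis k u" by (auto simp: Basis_vec_def)
    have "((\<lambda>z. \<phi> z $ k) has_derivative (\<lambda>v. \<Sum>j\<in>UNIV. J k j * v $ j)) (at z)"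
      using \<phi>[of k] by (simp add: has_wirt_def)
    then have "((\<lambda>z. \<phi> z $ k \<bullet> u) has_derivative (\<lambda>v. (\<Sum>j\<in>UNIV. J k j * v $ j) \<bullet> u)) (at z)"
      by (rule bounded_linear.has_derivative[OF bounded_linear_inner_left])
    then show "((\<lambda>z. \<phi> z \<bullet> e) has_derivative (\<lambda>v. ?D v \<bullet> e)) (at z)"
      by (simp add: e inner_axis)
  qed
  then have "((\<lambda>z. f (\<phi> z)) has_derivative (\<lambda>v. \<Sum>k\<in>UNIV. a k * ?D v $ k + b k * cnj (?D v $ k))) (at z)"
    using f unfolding has_wirt_def by (rule has_derivative_compose)
  moreover have "(\<lambda>v. \<Sum>k\<in>UNIV. a k * ?D v $ k + b k * cnj (?D v $ k))
    = (\<lambda>v. \<Sum>j\<in>UNIV. (\<Sum>k\<in>UNIV. a k * J k j) * v $ j + (\<Sum>k\<in>UNIV. b k * cnj (J k j)) * cnj (v $ j))"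
  proof
    fix v :: "complex ^ 'n"
    have "(\<Sum>k\<in>UNIV. a k * ?D v $ k + b k * cnj (?D v $ k))
      = (\<Sum>k\<in>UNIV. \<Sum>j\<in>UNIV. a k * J k j * v $ j + b k * cnj (J k j) * cnj (v $ j))"
      by (simp add: sum_distrib_left sum.distrib mult.assoc)
    also have "\<dots> = (\<Sum>j\<in>UNIV. \<Sum>k\<in>UNIV. a k * J k j * v $ j + b k * cnj (J k j) * cnj (v $ j))"
      by (rule sum.swap)
    also have "\<dots> = (\<Sum>j\<in>UNIV. (\<Sum>k\<in>UNIV. a k * J k j) * v $ j + (\<Sum>k\<in>UNIV. b k * cnj (J k j)) * cnj (v $ j))"
      by (simp add: sum_distrib_right sum.distrib)
    finally show "(\<Sum>k\<in>UNIV. a k * ?D v $ k + b k * cnj (?D v $ k))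
      = (\<Sum>j\<in>UNIV. (\<Sum>k\<in>UNIV. a k * J k j) * v $ j + (\<Sum>k\<in>UNIV. b k * cnj (J k j)) * cnj (v $ j))" .
  qed
  ultimately show ?thesis by (simp only: has_wirt_def)
qed

lemma smooth_on_wirt:
  assumes S: "open S" and f: "smooth_on f S"
  shows "smooth_on (wirt a f) S"
proof -
  have "wirt a f = (\<lambda>z. (frechet_derivative f (at z) (axis a 1) + (- \<i>) * frechet_derivative f (at z) (axis a \<i>)) * inverse 2)"
    by (simp only: fun_eq_iff wirt_def divide_inverse diff_conv_add_uminus mult_minus_left) simp
  then show ?thesis
    by (simp only: smooth_on_mult[OF S] smooth_on_add[OF S] smooth_on_const[OF S] smooth_on_frechet_derivative[OF f])
qed

lemma smooth_on_wirt_bar: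
  assumes S: "open S" and f: "smooth_on f S"
  shows "smooth_on (wirt_bar a f) S"
proof -
  have "wirt_bar a f = (\<lambda>z. (frechet_derivative f (at z) (axis a 1) + \<i> * frechet_derivative f (at z) (axis a \<i>)) * inverse 2)"
    by (simp only: fun_eq_iff wirt_bar_def divide_inverse) simp
  then show ?thesis
    by (simp only: smooth_on_mult[OF S] smooth_on_add[OF S] smooth_on_const[OF S] smooth_on_frechet_derivative[OF f])
qed

lemma smooth_on_imp_has_wirt:
  "smooth_on f S \<Longrightarrow> z \<in> S \<Longrightarrow> has_wirt f (\<lambda>j. wirt j f z) (\<lambda>j. wirt_bar j f z) z"
  unfolding has_wirt_def
  by (rule has_wirtI[unfolded has_wirt_def]) (unfold differentiable_def, rule exI, erule (1) smooth_on_imp_derivative)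

lemma frechet_derivative_wirt:
  assumes "smooth_on f S" "z \<in> S"
  shows "frechet_derivative (wirt b f) (at z) v
      = (frechet_derivative (\<lambda>z. frechet_derivative f (at z) (axis b 1)) (at z) v
         - \<i> * frechet_derivative (\<lambda>z. frechet_derivative f (at z) (axis b \<i>)) (at z) v) / 2"
    and "frechet_derivative (wirt_bar b f) (at z) v
      = (frechet_derivative (\<lambda>z. frechet_derivative f (at z) (axis b 1)) (at z) v
         + \<i> * frechet_derivative (\<lambda>z. frechet_derivative f (at z) (axis b \<i>)) (at z) v) / 2"
proof -
  note d = smooth_on_imp_derivative[OF smooth_on_frechet_derivative[OF assms(1)] assms(2)]
  have "(wirt b f has_derivative (\<lambda>v. (frechet_derivative (\<lambda>z. frechet_derivative f (at z) (axis b 1)) (at z) v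
         - \<i> * frechet_derivative (\<lambda>z. frechet_derivative f (at z) (axis b \<i>)) (at z) v) * inverse 2)) (at z)"
    unfolding wirt_def[abs_def] divide_inverse
    by (rule has_derivative_mult_left[OF has_derivative_diff[OF d[of "axis b 1"] has_derivative_mult_right[OF d[of "axis b \<i>"], of "\<i>"]], of "inverse 2"])
  from frechet_derivative_at[OF this, symmetric]
  show "frechet_derivative (wirt b f) (at z) v
      = (frechet_derivative (\<lambda>z. frechet_derivative f (at z) (axis b 1)) (at z) v
         - \<i> * frechet_derivative (\<lambda>z. frechet_derivative f (at z) (axis b \<i>)) (at z) v) / 2"
    by (simp only: divide_inverse)
  have "(wirt_bar b f has_derivative (\<lambda>v. (frechet_derivative (\<lambda>z. frechet_derivative f (at z) (axis b 1)) (at z) v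
         + \<i> * frechet_derivative (\<lambda>z. frechet_derivative f (at z) (axis b \<i>)) (at z) v) * inverse 2)) (at z)"
    unfolding wirt_bar_def[abs_def] divide_inverse
    by (rule has_derivative_mult_left[OF has_derivative_add[OF d[of "axis b 1"] has_derivative_mult_right[OF d[of "axis b \<i>"], of "\<i>"]], of "inverse 2"])
  from frechet_derivative_at[OF this, symmetric]
  show "frechet_derivative (wirt_bar b f) (at z) v
      = (frechet_derivative (\<lambda>z. frechet_derivative f (at z) (axis b 1)) (at z) v
         + \<i> * frechet_derivative (\<lambda>z. frechet_derivative f (at z) (axis b \<i>)) (at z) v) / 2"
    by (simp only: divide_inverse)
qed

lemma wirt_commute_aux:
  fixes p q r s :: complex
  shows "((p - \<i> * q) / 2 - \<i> * ((r - \<i> * s) / 2)) / 2 = ((p - \<i> * r) / 2 - \<i> * ((q - \<i> * s) / 2)) / 2"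
    and "((p + \<i> * q) / 2 + \<i> * ((r + \<i> * s) / 2)) / 2 = ((p + \<i> * r) / 2 + \<i> * ((q + \<i> * s) / 2)) / 2"
    and "((p - \<i> * q) / 2 + \<i> * ((r - \<i> * s) / 2)) / 2 = ((p + \<i> * r) / 2 - \<i> * ((q + \<i> * s) / 2)) / 2"
  by (rule complex_eqI; simp add: add_divide_distrib diff_divide_distrib)+

text \<open>Second Wirtinger derivatives are fixed combinations of real second derivatives, whose
  symmetry is already known.\<close>

lemma wirt_commute:
  assumes f: "smooth_on f S" and S: "open S" and z: "z \<in> S"
  shows "wirt a (wirt b f) z = wirt b (wirt a f) z"
    and "wirt_bar a (wirt_bar b f) z = wirt_bar b (wirt_bar a f) z"
    and "wirt_bar a (wirt b f) z = wirt b (wirt_bar a f) z"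
proof -
  define H where "H u v = frechet_derivative (\<lambda>z. frechet_derivative f (at z) u) (at z) v" for u v
  have sym: "H u v = H v u" for u v
    unfolding H_def by (rule second_derivative_symmetric[OF f S z])
  have 1: "frechet_derivative (wirt b f) (at z) v = (H (axis b 1) v - \<i> * H (axis b \<i>) v) / 2"
    and 2: "frechet_derivative (wirt_bar b f) (at z) v = (H (axis b 1) v + \<i> * H (axis b \<i>) v) / 2" for b v
    unfolding H_def by (rule frechet_derivative_wirt[OF f z])+
  have w: "wirt a (wirt b f) z = (frechet_derivative (wirt b f) (at z) (axis a 1) - \<i> * frechet_derivative (wirt b f) (at z) (axis a \<i>)) / 2" for a b
    by (rule wirt_def)
  show "wirt a (wirt b f) z = wirt b (wirt a f) z"
    unfolding w[of a b] w[of b a] 1 sym[of "axis b _" "axis a _"] by (rule wirt_commute_aux)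
  have w: "wirt_bar a (wirt_bar b f) z = (frechet_derivative (wirt_bar b f) (at z) (axis a 1) + \<i> * frechet_derivative (wirt_bar b f) (at z) (axis a \<i>)) / 2" for a b
    by (rule wirt_bar_def)
  show "wirt_bar a (wirt_bar b f) z = wirt_bar b (wirt_bar a f) z"
    unfolding w[of a b] w[of b a] 2 sym[of "axis b _" "axis a _"] by (rule wirt_commute_aux)
  have w1: "wirt_bar a (wirt b f) z = (frechet_derivative (wirt b f) (at z) (axis a 1) + \<i> * frechet_derivative (wirt b f) (at z) (axis a \<i>)) / 2"
    by (rule wirt_bar_def)
  have w2: "wirt b (wirt_bar a f) z = (frechet_derivative (wirt_bar a f) (at z) (axis b 1) - \<i> * frechet_derivative (wirt_bar a f) (at z) (axis b \<i>)) / 2"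
    by (rule wirt_def)
  show "wirt_bar a (wirt b f) z = wirt b (wirt_bar a f) z"
    unfolding w1 w2 1 2 sym[of "axis b _" "axis a _"] by (rule wirt_commute_aux)
qed

section \<open>A multinomial series\<close>

text \<open>Regrouping by \<open>e = n + d\<close> turns the inner sum into the binomial theorem,
  since \<open>H\<close> sees only the total degree; nonnegativity justifies the
  rearrangement.\<close>

lemma has_sum_binomial_diagonal:
  fixes H :: "nat \<Rightarrow> real"
  assumes H: "\<And>d. 0 \<le> H d" and x: "0 \<le> x" and y: "0 \<le> y"
    and L: "((\<lambda>d. H d * (x + y) ^ d / fact d) has_sum L) UNIV"
  shows "((\<lambda>(n, d). H (n + d) * (x ^ n / fact n) * (y ^ d / fact d)) has_sum L) (UNIV \<times> UNIV)"
proof -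
  let ?g = "\<lambda>(e, n). H e * (x ^ n / fact n) * (y ^ (e - n) / fact (e - n))"
  have inner: "((\<lambda>n. ?g (e, n)) has_sum (H e * (x + y) ^ e / fact e)) {..e}" for e
  proof -
    have "(\<Sum>n\<le>e. ?g (e, n)) = H e * (\<Sum>n\<le>e. real (e choose n) * x ^ n * y ^ (e - n)) / fact e"
      unfolding sum_distrib_left sum_divide_distrib
      by (intro sum.cong refl) (simp add: binomial_fact field_simps)
    also have "(\<Sum>n\<le>e. real (e choose n) * x ^ n * y ^ (e - n)) = (x + y) ^ e"
      by (simp add: binomial_ring)
    finally show ?thesis by (intro has_sum_finiteI) simp_all
  qed
  have "?g summable_on (SIGMA e:UNIV. {..e})"
    using inner L has_sum_imp_summable x y H
    by (intro summable_on_SigmaI[where g = "\<lambda>e. H e * (x + y) ^ e / fact e"]) (auto intro!: mult_nonneg_nonneg)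
  then have "(?g has_sum L) (SIGMA e:UNIV. {..e})"
    by (rule has_sum_SigmaI[OF inner L])
  moreover have "bij_betw (\<lambda>(n, d). (n + d, n)) (UNIV \<times> UNIV) (SIGMA e:UNIV. {..e :: nat})"
    by (rule bij_betwI[where g = "\<lambda>(e, n). (n, e - n)"]) auto
  ultimately have "((\<lambda>p. ?g ((\<lambda>(n, d). (n + d, n)) p)) has_sum L) (UNIV \<times> UNIV)"
    by (simp add: has_sum_reindex_bij_betw)
  then show ?thesis by (simp add: case_prod_unfold)
qed

text \<open>Splitting off the exponent \<open>n\<close> of one variable leaves a series of the same
  shape with new weight \<open>H (n + d) * (x i ^ n / fact n)\<close>. This is why \<open>H\<close>
  has to be arbitrary in the induction.\<close>

lemma has_sum_multinomial_series:
  fixes H :: "nat \<Rightarrow> real" and x :: "'n \<Rightarrow> real"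
  assumes "finite S" and "\<And>d. 0 \<le> H d" and x: "\<And>i. 0 \<le> x i"
    and "((\<lambda>d. H d * (\<Sum>i\<in>S. x i) ^ d / fact d) has_sum L) UNIV"
  shows "((\<lambda>\<beta>. H (\<Sum>i\<in>S. \<beta> i) * (\<Prod>i\<in>S. x i ^ \<beta> i / fact (\<beta> i))) has_sum L) (supp_in S)"
  using assms(1,2,4)
proof (induction S arbitrary: H L)
  case empty
  \<comment> \<open>Without variables the base of the power is 0, and \<open>0 ^ 0 = 1\<close>
    leaves exactly the term \<open>d = 0\<close>.\<close>
  have "((\<lambda>d. H d * (\<Sum>i\<in>{}. x i) ^ d / fact d) has_sum H 0) UNIV"
    by (rule has_sum_finite_neutralI[where B = "{0}"]) auto
  then have "L = H 0" using empty.prems(2) has_sum_unique by blast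
  then show ?case by (simp add: has_sum_finite_iff)
next
  case (insert i S)
  define y where "y = (\<Sum>i\<in>S. x i)"
  have y0: "0 \<le> y" unfolding y_def by (rule sum_nonneg) (rule x)
  have L: "((\<lambda>d. H d * (x i + y) ^ d / fact d) has_sum L) UNIV"
    using insert.prems(2) insert.hyps by (simp add: y_def)
  note T = has_sum_binomial_diagonal[OF insert.prems(1) x y0 L]
  define Ln where "Ln n = (\<Sum>\<^sub>\<infinity>d. H (n + d) * (x i ^ n / fact n) * (y ^ d / fact d))" for n
  have inner: "((\<lambda>d. H (n + d) * (x i ^ n / fact n) * (y ^ d / fact d)) has_sum Ln n) UNIV" for n
  proof -
    have "(\<lambda>d. (\<lambda>(n, d). H (n + d) * (x i ^ n / fact n) * (y ^ d / fact d)) (n, d)) summable_on UNIV"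
      by (rule summable_on_SigmaD1[where A = UNIV and B = "\<lambda>_. UNIV"]) (use has_sum_imp_summable[OF T] in auto)
    then show ?thesis unfolding Ln_def by simp
  qed
  have outer: "(Ln has_sum L) UNIV"
    by (rule has_sum_SigmaD[OF T]) (simp only: prod.case inner)
  have IH: "((\<lambda>\<beta>. H (n + (\<Sum>j\<in>S. \<beta> j)) * (x i ^ n / fact n) * (\<Prod>j\<in>S. x j ^ \<beta> j / fact (\<beta> j))) has_sum Ln n) (supp_in S)" for n
  proof (rule insert.IH)
    show "0 \<le> H (n + d) * (x i ^ n / fact n)" for d using insert.prems(1) x by simp
    show "((\<lambda>d. H (n + d) * (x i ^ n / fact n) * (\<Sum>i\<in>S. x i) ^ d / fact d) has_sum Ln n) UNIV"
      using inner[of n] by (simp add: y_def)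
  qed
  let ?U = "\<lambda>(n, \<beta>). H (n + (\<Sum>j\<in>S. \<beta> j)) * (x i ^ n / fact n) * (\<Prod>j\<in>S. x j ^ \<beta> j / fact (\<beta> j))"
  have summ: "?U summable_on (UNIV \<times> supp_in S)"
    by (rule summable_on_SigmaI[where g = Ln])
       (use IH has_sum_imp_summable[OF outer] insert.prems(1) x in \<open>auto intro!: mult_nonneg_nonneg divide_nonneg_nonneg prod_nonneg zero_le_power\<close>)
  have "(?U has_sum L) (UNIV \<times> supp_in S)"
    by (rule has_sum_SigmaI[OF _ outer summ]) (simp only: prod.case IH)
  moreover have e: "?U p = (\<lambda>\<beta>. H (\<Sum>i\<in>insert i S. \<beta> i) * (\<Prod>i\<in>insert i S. x i ^ \<beta> i / fact (\<beta> i))) ((\<lambda>(n, \<alpha>). \<alpha>(i := n)) p)" for p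
  proof -
    obtain n \<beta> where p: "p = (n, \<beta>)" by (cases p)
    have "(\<Sum>j\<in>S. (\<beta>(i := n)) j) = (\<Sum>j\<in>S. \<beta> j)" "(\<Prod>j\<in>S. x j ^ (\<beta>(i := n)) j / fact ((\<beta>(i := n)) j)) = (\<Prod>j\<in>S. x j ^ \<beta> j / fact (\<beta> j))"
      using insert.hyps by (auto intro!: sum.cong prod.cong)
    then show ?thesis unfolding p prod.case sum.insert[OF insert.hyps] prod.insert[OF insert.hyps] by simp
  qed
  ultimately have "((\<lambda>p. (\<lambda>\<beta>. H (\<Sum>i\<in>insert i S. \<beta> i) * (\<Prod>i\<in>insert i S. x i ^ \<beta> i / fact (\<beta> i))) ((\<lambda>(n, \<alpha>). \<alpha>(i := n)) p)) has_sum L) (UNIV \<times> supp_in S)"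
    by (simp only: has_sum_cong[OF e])
  then show ?case
    by (subst (asm) has_sum_reindex_bij_betw[OF bij_betw_supp_in_insert[OF insert.hyps(2)]])
qed

section \<open>The total space in coordinates\<close>

lemma two_add [simp]: "(j::2) + 1 + 1 = j"
  using exhaust_2[of j] by auto

lemma two_cases: "i = j \<or> i = (j::2) + 1"
  using exhaust_2[of i] exhaust_2[of j] by auto

lemma two_all: "(\<forall>i::2. P i) \<longleftrightarrow> P j \<and> P (j + 1)"
  by (metis two_cases)

lemma two_UNIV: "UNIV = {j, (j::2) + 1}"
  using two_cases by blast

section \<open>Affine coordinates on the projective line\<close>

definition aff_vec :: "2 \<Rightarrow> complex \<Rightarrow> complex ^ 2" where
  "aff_vec j w = (\<chi> a. if a = j then 1 else w)"

definition aff_line :: "2 \<Rightarrow> complex \<Rightarrow> (complex ^ 2) set" where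
  "aff_line j w = range (\<lambda>c. c *s aff_vec j w)"

lemma aff_vec_nth [simp]: "aff_vec j w $ j = 1" "aff_vec j w $ (j + 1) = w"
  by (simp_all add: aff_vec_def)

lemma aff_vec_neq_0: "aff_vec j w \<noteq> 0"
  by (metis aff_vec_nth(1) zero_index zero_neq_one)

lemma aff_line_points [simp]: "aff_line j w \<in> points CP1"
  using aff_vec_neq_0 by (auto simp: CP1_def aff_line_def)

lemma aff_vec_in_line: "aff_vec j w \<in> aff_line j w"
  unfolding aff_line_def by (rule range_eqI[of _ _ 1]) simp

lemma hom_rep_eqI:
  assumes "v \<in> l" "v $ j = 1" "l = range (\<lambda>c. c *s x)"
  shows "hom_rep j l = v"
  unfolding hom_rep_def
proof (rule the_equality)
  show "v \<in> l \<and> v $ j = 1" using assms by simp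
  fix y assume y: "y \<in> l \<and> y $ j = 1"
  obtain c d where "v = c *s x" "y = d *s x" using assms y by auto
  then show "y = v" using y assms(2) by (auto simp: vec_eq_iff) (metis mult_cancel_right mult_zero_right zero_neq_one)
qed

lemma hom_rep_aff_line [simp]: "hom_rep j (aff_line j w) = aff_vec j w"
  by (rule hom_rep_eqI[OF aff_vec_in_line _ aff_line_def]) simp

lemma aff_line_cdom [simp]: "aff_line j w \<in> cdom CP1 j"
  using aff_line_points[of j w] aff_vec_in_line[of j w] aff_vec_nth(1)[of j w]
  by (auto simp: CP1_def intro!: bexI[of _ "aff_vec j w"])

lemma aff_line_switch: 
  assumes "w \<noteq> 0"
  shows "aff_line j w = aff_line (j + 1) (1 / w)"
proof -
  have e: "aff_vec j w = w *s aff_vec (j + 1) (1 / w)"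
    using assms two_all[of _ j] by (simp add: vec_eq_iff aff_vec_def)
  have "range (\<lambda>c. c *s aff_vec j w) = range (\<lambda>c. c *s aff_vec (j + 1) (1 / w))"
  proof safe
    fix c
    show "c *s aff_vec j w \<in> range (\<lambda>c. c *s aff_vec (j + 1) (1 / w))"
      by (rule range_eqI[of _ _ "c * w"]) (simp add: e)
    show "c *s aff_vec (j + 1) (1 / w) \<in> range (\<lambda>c. c *s aff_vec j w)"
      by (rule range_eqI[of _ _ "c / w"]) (use assms in \<open>simp add: e\<close>)
  qed
  then show ?thesis by (simp add: aff_line_def)
qed

lemma aff_line_cdom_switch [simp]: "aff_line j w \<in> cdom CP1 (j + 1) \<longleftrightarrow> w \<noteq> 0"
proof
  assume "aff_line j w \<in> cdom CP1 (j + 1)"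
  then obtain v where "v \<in> aff_line j w" "v $ (j + 1) \<noteq> 0" by (auto simp: CP1_def)
  then show "w \<noteq> 0" by (auto simp: aff_line_def)
next
  assume "w \<noteq> 0"
  then show "aff_line j w \<in> cdom CP1 (j + 1)" by (subst aff_line_switch) simp_all
qed

lemma cdom_CP1_imp_aff_line:
  assumes "l \<in> cdom CP1 j"
  shows "l = aff_line j (hom_rep j l $ (j + 1))"
proof -
  obtain v x where l: "l = range (\<lambda>c. c *s x)" "v \<in> l" "v $ j \<noteq> 0"
    using assms by (auto simp: CP1_def)
  then obtain c where c: "v = c *s x" by auto
  then have xj: "x $ j \<noteq> 0" "c \<noteq> 0" using l by auto
  define w where "w = x $ (j + 1) / x $ j"
  have x: "x = x $ j *s aff_vec j w"
    using xj two_all[of _ j] by (simp add: vec_eq_iff aff_vec_def w_def)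
  have "l = aff_line j w"
    unfolding l aff_line_def
  proof safe
    fix c
    show "c *s x \<in> range (\<lambda>c. c *s aff_vec j w)"
      by (rule range_eqI[of _ _ "c * x $ j"]) (metis x vector_smult_assoc)
    show "c *s aff_vec j w \<in> range (\<lambda>c. c *s x)"
      by (rule range_eqI[of _ _ "c / x $ j"]) (subst (2) x, use xj in simp)
  qed
  then show ?thesis by simp
qed

lemma cdom_CP1_iff: "l \<in> cdom CP1 j \<longleftrightarrow> (\<exists>w. l = aff_line j w)"
  using cdom_CP1_imp_aff_line by auto

lemma points_CP1: "points CP1 = (\<Union>i. cdom CP1 i)"
proof -
  have "\<exists>i. l \<in> cdom CP1 i" if l: "l \<in> points CP1" for l
  proof -
    obtain v where v: "v \<noteq> 0" "l = range (\<lambda>c. c *s v)" using l by (auto simp: CP1_def)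
    then obtain i where "v $ i \<noteq> 0" by (auto simp: vec_eq_iff)
    moreover have "v \<in> l" unfolding v(2) by (rule range_eqI[of _ _ 1]) simp
    ultimately show ?thesis using l by (auto simp: CP1_def)
  qed
  moreover have "cdom CP1 i \<subseteq> points CP1" for i unfolding CP1_def by (simp, blast)
  ultimately show ?thesis by blast
qed

section \<open>Chart coordinates of the total space\<close>

type_synonym 'r tot = "(complex ^ 2) set \<times> (2 \<Rightarrow> complex ^ 'r)"

definition total_space :: "nat \<Rightarrow> ('r::finite tot, 2, 1 + 'r) cmanifold" where
  "total_space k = sum_bundle CP1 (\<lambda>_. bundle_dual (bundle_power hyperplane_bundle k))"

definition sq_norm :: "nat \<Rightarrow> 'r::finite tot \<Rightarrow> real" where
  "sq_norm k = sum_metric CP1 (\<lambda>_. metric_dual (metric_power h_FS k))"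

definition base :: "complex ^ (1 + 'r::finite) \<Rightarrow> complex" where
  "base z = z $ Inl 1"

definition fib :: "complex ^ (1 + 'r::finite) \<Rightarrow> complex ^ 'r" where
  "fib z = (\<chi> b. z $ Inr b)"

definition mk_pt :: "complex \<Rightarrow> complex ^ 'r \<Rightarrow> complex ^ (1 + 'r::finite)" where
  "mk_pt w \<xi> = (\<chi> a. case a of Inl b \<Rightarrow> w | Inr b \<Rightarrow> \<xi> $ b)"

lemma base_mk_pt [simp]: "base (mk_pt w \<xi>) = w" and fib_mk_pt [simp]: "fib (mk_pt w \<xi>) = \<xi>"
  by (simp_all add: base_def fib_def mk_pt_def)

lemma one_sum_all: "(\<forall>a::1 + 'r. P a) \<longleftrightarrow> P (Inl 1) \<and> (\<forall>b. P (Inr b))"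
proof -
  have "(\<forall>a::1. P (Inl a)) \<longleftrightarrow> P (Inl 1)" by (rule forall_1)
  then show ?thesis by (simp add: split_sum_all)
qed

lemma mk_pt_base_fib [simp]: "mk_pt (base z) (fib z) = z"
  by (simp add: vec_eq_iff one_sum_all mk_pt_def base_def fib_def)

text \<open>An explicit inverse of chart \<open>i\<close>. Where \<open>base z = 0\<close> the other
  trivialization is undefined and its fibre coordinate must be 0; for \<open>k \<ge> 1\<close> the
  formula \<open>base z ^ k *s fib z\<close> already gives this value.\<close>

definition tot_pt :: "nat \<Rightarrow> 2 \<Rightarrow> complex ^ (1 + 'r::finite) \<Rightarrow> 'r tot" where
  "tot_pt k i z = (aff_line i (base z), \<lambda>j. if j = i then fib z else base z ^ k *s fib z)"

text \<open>The change of charts. Fibre coordinates transform by the inverse of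
  \<open>(1 / base z) ^ k\<close>, since the summands are dual to the \<open>k\<close>-th power of
  the hyperplane bundle.\<close>

definition switch :: "nat \<Rightarrow> complex ^ (1 + 'r::finite) \<Rightarrow> complex ^ (1 + 'r)" where
  "switch k z = mk_pt (1 / base z) (base z ^ k *s fib z)"

lemma tot_pt_switch:
  assumes "base z \<noteq> 0"
  shows "tot_pt k i z = tot_pt k (i + 1) (switch k z)"
  unfolding tot_pt_def switch_def base_mk_pt fib_mk_pt prod_eq_iff fst_conv snd_conv
proof
  show "aff_line i (base z) = aff_line (i + 1) (1 / base z)"
    using assms by (rule aff_line_switch)
  have "(1 / base z) ^ k *s (base z ^ k *s fib z) = fib z"
    using assms by (simp add: vec_eq_iff power_one_over)
  then show "(\<lambda>j. if j = i then fib z else base z ^ k *s fib z) =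
      (\<lambda>j. if j = i + 1 then base z ^ k *s fib z else (1 / base z) ^ k *s (base z ^ k *s fib z))"
    using two_cases by (auto simp: fun_eq_iff)
qed

lemma hyperplane_aff [simp]:
  "hyperplane_bundle i i (aff_line i w) = 1" "hyperplane_bundle i (i + 1) (aff_line i w) = w"
  by (simp_all add: hyperplane_bundle_def)

lemma hyperplane_aff_switch: "w \<noteq> 0 \<Longrightarrow> hyperplane_bundle (i + 1) i (aff_line i w) = 1 / w"
  using hyperplane_aff(2)[of "i + 1" "1 / w"] by (simp add: aff_line_switch[of w i])

lemma hyperplane_aff_switch': "w \<noteq> 0 \<Longrightarrow> hyperplane_bundle (i + 1) (i + 1) (aff_line i w) = 1"
  using hyperplane_aff(1)[of "i + 1" "1 / w"] by (simp add: aff_line_switch[of w i])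

lemma points_total_space:
  "v \<in> points (total_space k) \<longleftrightarrow> fst v \<in> points CP1 \<and> (\<forall>i. fst v \<notin> cdom CP1 i \<longrightarrow> snd v i = 0) \<and>
     (\<forall>i j a. fst v \<in> cdom CP1 i \<inter> cdom CP1 j \<longrightarrow> snd v i $ a = inverse (hyperplane_bundle i j (fst v) ^ k) * snd v j $ a)"
  by (cases v) (simp add: total_space_def sum_bundle_def Let_def bundle_dual_def bundle_power_def)

lemma cdom_total_space: "cdom (total_space k) i = {v \<in> points (total_space k). fst v \<in> cdom CP1 i}"
  by (simp add: total_space_def sum_bundle_def Let_def)

lemma chart_total_space: "chart (total_space k) i v = mk_pt (hom_rep i (fst v) $ (i + 1)) (snd v i)"
  by (simp add: total_space_def sum_bundle_def Let_def mk_pt_def CP1_def vec_eq_iff one_sum_all)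

lemma tot_pt_points:
  assumes k: "1 \<le> k"
  shows "tot_pt k i z \<in> points (total_space k)"
  unfolding points_total_space two_all[of _ i] using k
  by (auto simp: tot_pt_def hyperplane_aff_switch hyperplane_aff_switch' power_one_over)

lemma tot_pt_cdom: "1 \<le> k \<Longrightarrow> tot_pt k i z \<in> cdom (total_space k) i"
  by (simp add: cdom_total_space tot_pt_points) (simp add: tot_pt_def)

lemma chart_tot_pt [simp]: "chart (total_space k) i (tot_pt k i z) = z"
  by (simp add: chart_total_space tot_pt_def)

lemma tot_pt_chart:
  assumes v: "v \<in> cdom (total_space k) i" and k: "1 \<le> k"
  shows "tot_pt k i (chart (total_space k) i v) = v"
proof -
  obtain l \<xi> where v_eq: "v = (l, \<xi>)" by (cases v)
  have P: "v \<in> points (total_space k)" and l: "l \<in> cdom CP1 i"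
    using v by (auto simp: cdom_total_space v_eq)
  obtain w where w: "l = aff_line i w" using l cdom_CP1_iff by blast
  note P' = P[unfolded points_total_space v_eq fst_conv snd_conv]
  have "\<xi> (i + 1) = w ^ k *s \<xi> i"
  \<comment> \<open>Over \<open>w = 0\<close> the other fibre coordinate is 0 by convention, and
    \<open>k \<ge> 1\<close> makes \<open>w ^ k\<close> vanish as well.\<close>
  proof (cases "w = 0")
    case True
    then have "\<xi> (i + 1) = 0" using P' unfolding w by simp
    then show ?thesis using True k by simp
  next
    case False
    have "\<xi> (i + 1) $ a = inverse (hyperplane_bundle (i + 1) i l ^ k) * \<xi> i $ a" for a
      using P' False unfolding w by auto
    then show ?thesis using False by (simp add: w vec_eq_iff hyperplane_aff_switch power_one_over)
  qed
  then have "(if j = i then \<xi> i else w ^ k *s \<xi> i) = \<xi> j" for j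
    using two_cases[of j i] by auto
  then have "(\<lambda>j. if j = i then \<xi> i else w ^ k *s \<xi> i) = \<xi>" by (rule ext)
  then show ?thesis
    unfolding v_eq chart_total_space tot_pt_def base_mk_pt fib_mk_pt fst_conv snd_conv w
      hom_rep_aff_line aff_vec_nth by simp
qed

lemma tot_pt_cdom_switch: "1 \<le> k \<Longrightarrow> tot_pt k i z \<in> cdom (total_space k) (i + 1) \<longleftrightarrow> base z \<noteq> 0"
  by (simp add: cdom_total_space tot_pt_points) (simp add: tot_pt_def)

lemma chart_tot_pt_switch: "base z \<noteq> 0 \<Longrightarrow> chart (total_space k) (i + 1) (tot_pt k i z) = switch k z"
  by (simp add: tot_pt_switch[of z k i])

definition uu :: "nat \<Rightarrow> complex ^ (1 + 'r::finite) \<Rightarrow> real" where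
  "uu k z = (\<Sum>b\<in>UNIV. (cmod (z $ Inr b))\<^sup>2) * (1 + (cmod (z $ Inl 1))\<^sup>2) ^ k"

text \<open>The factor \<open>|w|^(2k)\<close> coming from the fibre turns
  \<open>(1 + 1 / |w|^2)^k\<close> into \<open>(1 + |w|^2)^k\<close>.\<close>

lemma uu_switch:
  assumes "base z \<noteq> 0"
  shows "uu k (switch k z) = uu k z"
proof -
  let ?r = "(cmod (base z))\<^sup>2"
  have r: "0 < ?r" using assms by simp
  have "(cmod (base z ^ k * z $ Inr b))\<^sup>2 = ?r ^ k * (cmod (z $ Inr b))\<^sup>2" for b
    by (simp add: norm_mult norm_power power_mult_distrib power_mult[symmetric] mult.commute)
  then have "uu k (switch k z) = ?r ^ k * (1 + 1 / ?r) ^ k * (\<Sum>b\<in>UNIV. (cmod (z $ Inr b))\<^sup>2)"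
    by (simp add: uu_def switch_def mk_pt_def fib_def norm_divide power_divide sum_distrib_left[symmetric])
  also have "?r ^ k * (1 + 1 / ?r) ^ k = (1 + ?r) ^ k"
    using r by (simp add: power_mult_distrib[symmetric] distrib_left add.commute)
  finally show ?thesis by (simp add: uu_def base_def)
qed

lemma sq_norm_tot_pt: "sq_norm k (tot_pt k i z) = uu k z"
proof -
  \<comment> \<open>\<open>sum_metric\<close> evaluates in an arbitrarily chosen trivialization
    \<open>j\<close>, which may be the other one.\<close>
  define j where "j = (SOME j. aff_line i (base z) \<in> cdom CP1 j)"
  have j: "aff_line i (base z) \<in> cdom CP1 j"
    unfolding j_def by (rule someI[of _ i]) simp
  have s: "sq_norm k (tot_pt k i z) = (\<Sum>a\<in>UNIV. (1 + (cmod (hom_rep j (aff_line i (base z)) $ (j + 1)))\<^sup>2) ^ k * (cmod (snd (tot_pt k i z) j $ a))\<^sup>2)"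
    by (simp add: sq_norm_def sum_metric_def Let_def tot_pt_def j_def metric_dual_def metric_power_def h_FS_def power_one_over)
  have direct: "(\<Sum>a\<in>UNIV. (1 + (cmod (hom_rep j (aff_line j (base z)) $ (j + 1)))\<^sup>2) ^ k * (cmod (snd (tot_pt k j z) j $ a))\<^sup>2) = uu k z"
    for z :: "complex ^ (1 + 'a)" and j
  proof -
    have e: "snd (tot_pt k j z) j $ a = z $ Inr a" for a by (simp add: tot_pt_def fib_def)
    show ?thesis
      unfolding hom_rep_aff_line aff_vec_nth sum_distrib_left[symmetric] uu_def base_def e by (rule mult.commute)
  qed
  show ?thesis
  proof (cases "j = i")
    case True
    then show ?thesis using s direct[of i z] by (simp only:)
  next
    case False
    then have ji: "j = i + 1" using two_cases by blast
    then have b: "base z \<noteq> 0" using j by simp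
    have 1: "aff_line i (base z) = aff_line j (base (switch k z))"
      unfolding ji switch_def base_mk_pt by (rule aff_line_switch[OF b])
    have 2: "tot_pt k i z = tot_pt k j (switch k z)" unfolding ji by (rule tot_pt_switch[OF b])
    show ?thesis unfolding s unfolding 1 2 unfolding direct by (rule uu_switch[OF b])
  qed
qed

section \<open>The Kaehler potential\<close>

lemma sum_one_sum: "(\<Sum>a\<in>UNIV. f a) = f (Inl 1) + (\<Sum>b\<in>UNIV. f (Inr b))"
  for f :: "1 + 'r::finite \<Rightarrow> 'a::comm_monoid_add"
proof -
  have "(UNIV :: 1 set) = {1}" by auto
  then show ?thesis
    by (simp add: UNIV_Plus_UNIV[symmetric] sum.Plus del: UNIV_Plus_UNIV)
qed

lemma prod_one_sum: "(\<Prod>a\<in>UNIV. f a) = f (Inl 1) * (\<Prod>b\<in>UNIV. f (Inr b))"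
  for f :: "1 + 'r::finite \<Rightarrow> 'a::comm_monoid_mult"
proof -
  have "(UNIV :: 1 set) = {1}" by auto
  then show ?thesis
    by (simp add: UNIV_Plus_UNIV[symmetric] prod.Plus del: UNIV_Plus_UNIV)
qed

lemma has_wirt_norm_square:
  "has_wirt (\<lambda>z. of_real ((cmod (z $ i))\<^sup>2)) (\<lambda>j. if j = i then cnj (z $ i) else 0) (\<lambda>j. if j = i then z $ i else 0) z"
proof -
  have "has_wirt (\<lambda>z. z $ i * cnj (z $ i)) (\<lambda>j. if j = i then cnj (z $ i) else 0) (\<lambda>j. if j = i then z $ i else 0) z"
    by (rule has_wirt_cong[OF has_wirt_mult[OF has_wirt_nth has_wirt_cnj[OF has_wirt_nth]]]) auto
  then show ?thesis by (simp only: complex_norm_square)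
qed

lemma smooth_on_norm_square: "open S \<Longrightarrow> smooth_on (\<lambda>z::complex ^ 'n::finite. (cmod (z $ i))\<^sup>2) S"
  unfolding cmod_power2
  by (intro smooth_on_add smooth_on_power smooth_on_compose_linear[OF bounded_linear_Re]
      smooth_on_compose_linear[OF bounded_linear_Im] smooth_on_bounded_linear bounded_linear_vec_nth)

definition GG :: "complex ^ (1 + 'r::finite) \<Rightarrow> real" where
  "GG z = 1 + (cmod (z $ Inl 1))\<^sup>2"

lemma GG_pos: "0 < GG z" and GG_ge_1: "1 \<le> GG z" and GG_nz [simp]: "GG z \<noteq> 0"
proof -
  show "1 \<le> GG z" by (simp add: GG_def)
  then show "0 < GG z" "GG z \<noteq> 0" by auto
qed

lemma uu_GG: "uu k z = (\<Sum>b\<in>UNIV. (cmod (z $ Inr b))\<^sup>2) * GG z ^ k"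
  by (simp add: uu_def GG_def)

lemma uu_nonneg: "0 \<le> uu k z"
  unfolding uu_GG using GG_pos[of z] by (intro mult_nonneg_nonneg sum_nonneg) auto

lemma smooth_on_GG: "open S \<Longrightarrow> smooth_on GG S"
  unfolding GG_def[abs_def] by (intro smooth_on_add smooth_on_const smooth_on_norm_square)

lemma smooth_on_uu: "open S \<Longrightarrow> smooth_on (uu k) S"
  unfolding uu_GG[abs_def] by (intro smooth_on_mult smooth_on_sum smooth_on_power smooth_on_norm_square smooth_on_GG)

lemma continuous_on_GG: "continuous_on S GG" and continuous_on_uu: "continuous_on S (uu k)"
  unfolding GG_def[abs_def] uu_def[abs_def] by (intro continuous_intros)+

lemma has_wirt_GG:
  "has_wirt (\<lambda>z. of_real (GG z)) (\<lambda>j. if j = Inl 1 then cnj (z $ Inl 1) else 0) (\<lambda>j. if j = Inl 1 then z $ Inl 1 else 0) z"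
  unfolding GG_def of_real_add
  by (rule has_wirt_cong[OF has_wirt_add[OF has_wirt_const has_wirt_norm_square]]) auto

text \<open>The holomorphic part of the differential of \<open>uu\<close>. Writing the base entry
  with \<open>uu k z / GG z\<close> absorbs the power \<open>GG z ^ (k - 1)\<close>.\<close>

definition du :: "nat \<Rightarrow> complex ^ (1 + 'r::finite) \<Rightarrow> 1 + 'r \<Rightarrow> complex" where
  "du k z j = (case j of Inl _ \<Rightarrow> of_real (real k * uu k z / GG z) * cnj (z $ Inl 1)
      | Inr b \<Rightarrow> of_real (GG z ^ k) * cnj (z $ Inr b))"

lemma has_wirt_uu: "has_wirt (\<lambda>z. of_real (uu k z)) (du k z) (\<lambda>j. cnj (du k z j)) z" for z :: "complex ^ (1 + 'r::finite)"
proof -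
  have P: "has_wirt (\<lambda>z. of_real (GG z ^ k)) (\<lambda>j. of_real (real k * GG z ^ (k - 1)) * (if j = Inl 1 then cnj (z $ Inl 1) else 0))
      (\<lambda>j. of_real (real k * GG z ^ (k - 1)) * (if j = Inl 1 then z $ Inl 1 else 0)) z"
    using has_wirt_compose_real[OF has_wirt_GG, of "\<lambda>x. x ^ k" "real k * GG z ^ (k - 1)" z]
    by (simp add: DERIV_pow)
  have S: "has_wirt (\<lambda>z. of_real (\<Sum>b\<in>UNIV. (cmod (z $ Inr b))\<^sup>2))
      (\<lambda>j. \<Sum>b\<in>UNIV. if j = Inr b then cnj (z $ Inr b) else 0) (\<lambda>j. \<Sum>b\<in>UNIV. if j = Inr b then z $ Inr b else 0) z"
    unfolding of_real_sum by (intro has_wirt_sum has_wirt_norm_square) simp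
  have G: "GG z ^ k = GG z ^ (k - 1) * GG z" if "k \<noteq> 0"
    using that by (cases k) simp_all
  show ?thesis
    unfolding uu_GG of_real_mult
  proof (rule has_wirt_cong[OF has_wirt_mult[OF S P]])
    fix j :: "1 + 'r"
    show "of_real (\<Sum>b\<in>UNIV. (cmod (z $ Inr b))\<^sup>2) * (of_real (real k * GG z ^ (k - 1)) * (if j = Inl 1 then cnj (z $ Inl 1) else 0)) +
        (\<Sum>b\<in>UNIV. if j = Inr b then cnj (z $ Inr b) else 0) * of_real (GG z ^ k) = du k z j"
      and "of_real (\<Sum>b\<in>UNIV. (cmod (z $ Inr b))\<^sup>2) * (of_real (real k * GG z ^ (k - 1)) * (if j = Inl 1 then z $ Inl 1 else 0)) +
        (\<Sum>b\<in>UNIV. if j = Inr b then z $ Inr b else 0) * of_real (GG z ^ k) = cnj (du k z j)"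
      by (cases j; cases "k = 0"; simp add: du_def uu_GG G)+
  qed
qed

text \<open>\<open>R\<close> is a neighbourhood of 0, so that \<open>f\<close> can be differentiated
  at \<open>u = 0\<close> although squared norms are nonnegative, and it is closed downwards, so
  that \<open>DD\<close> is a complete Reinhardt domain. The signs of \<open>f1\<close> and
  \<open>f2\<close> at nonnegative arguments yield positivity of the form.\<close>

locale potential =
  fixes k :: nat and R :: "real set" and f f1 f2 :: "real \<Rightarrow> real"
  assumes k: "1 \<le> k" and R: "open R" "0 \<in> R" and R_down: "\<And>x y. x \<in> R \<Longrightarrow> y \<le> x \<Longrightarrow> y \<in> R"
    and f_smooth: "smooth_on f R"
    and f1: "\<And>x. x \<in> R \<Longrightarrow> (f has_real_derivative f1 x) (at x)"
    and f2: "\<And>x. x \<in> R \<Longrightarrow> (f1 has_real_derivative f2 x) (at x)"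
    and f1_pos: "\<And>x. x \<in> R \<Longrightarrow> 0 \<le> x \<Longrightarrow> 0 < f1 x" and f2_nonneg: "\<And>x. x \<in> R \<Longrightarrow> 0 \<le> x \<Longrightarrow> 0 \<le> f2 x"
begin

definition DD :: "(complex ^ (1 + 'r::finite)) set" where
  "DD = {z. uu k z \<in> R}"

lemma open_DD: "open DD"
  unfolding DD_def using open_vimage[OF R(1) continuous_on_uu] by (simp add: vimage_def)

definition Phi :: "complex ^ (1 + 'r::finite) \<Rightarrow> real" where
  "Phi z = real k * ln (GG z) + f (uu k z)"

lemma smooth_on_Phi: "smooth_on Phi (DD :: (complex ^ (1 + 'r::finite)) set)"
  unfolding Phi_def[abs_def]
proof (intro smooth_on_add smooth_on_mult smooth_on_const open_DD)
  show "smooth_on (\<lambda>z :: complex ^ (1 + 'r). ln (GG z)) DD"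
    using GG_pos by (intro smooth_on_compose_real[OF smooth_on_ln open_DD smooth_on_GG[OF open_DD]]) auto
  show "smooth_on (\<lambda>z :: complex ^ (1 + 'r). f (uu k z)) DD"
    by (rule smooth_on_compose_real[OF f_smooth open_DD smooth_on_uu[OF open_DD]]) (simp add: DD_def)
qed

definition dPhi_bar :: "complex ^ (1 + 'r::finite) \<Rightarrow> 1 + 'r \<Rightarrow> complex" where
  "dPhi_bar z j = (case j of Inl _ \<Rightarrow> of_real (real k * (1 + uu k z * f1 (uu k z)) / GG z) * z $ Inl 1
      | Inr b \<Rightarrow> of_real (f1 (uu k z) * GG z ^ k) * z $ Inr b)"

lemma has_wirt_Phi:
  assumes "z \<in> DD"
  shows "has_wirt (\<lambda>z. of_real (Phi z)) (\<lambda>j. cnj (dPhi_bar z j)) (dPhi_bar z) z"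
proof -
  have u: "uu k z \<in> R" using assms by (simp add: DD_def)
  have 1: "has_wirt (\<lambda>z. of_real (ln (GG z))) (\<lambda>j. of_real (1 / GG z) * (if j = Inl 1 then cnj (z $ Inl 1) else 0))
      (\<lambda>j. of_real (1 / GG z) * (if j = Inl 1 then z $ Inl 1 else 0)) z"
    by (rule has_wirt_compose_real[OF has_wirt_GG DERIV_ln_divide[OF GG_pos]])
  have 2: "has_wirt (\<lambda>z. of_real (f (uu k z))) (\<lambda>j. of_real (f1 (uu k z)) * du k z j) (\<lambda>j. of_real (f1 (uu k z)) * cnj (du k z j)) z"
    by (rule has_wirt_compose_real[OF has_wirt_uu f1[OF u]])
  show ?thesis
    unfolding Phi_def of_real_add of_real_mult[of "real k"]
  proof (rule has_wirt_cong[OF has_wirt_add[OF has_wirt_mult[OF has_wirt_const 1] 2]])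
    fix j
    show "of_real (real k) * (of_real (1 / GG z) * (if j = Inl 1 then cnj (z $ Inl 1) else 0)) + 0 * of_real (ln (GG z)) +
         of_real (f1 (uu k z)) * du k z j = cnj (dPhi_bar z j)"
      and "of_real (real k) * (of_real (1 / GG z) * (if j = Inl 1 then z $ Inl 1 else 0)) + 0 * of_real (ln (GG z)) +
         of_real (f1 (uu k z)) * cnj (du k z j) = dPhi_bar z j"
      by (cases j; simp add: dPhi_bar_def du_def field_simps)+
  qed
qed

text \<open>The derivative of \<open>x * f1 x\<close>; it enters every Hessian entry that involves
  the base coordinate.\<close>

definition g1 :: "real \<Rightarrow> real" where "g1 x = f1 x + x * f2 x"

text \<open>The complex Hessian of \<open>Phi\<close>, as \<open>wirt_dPhi_bar\<close> shows. The
  base entry is written as the Schur complement of the fibre block plus the contribution of the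
  mixed entries, which prepares the factorization.\<close>

definition HH :: "complex ^ (1 + 'r::finite) \<Rightarrow> 1 + 'r \<Rightarrow> 1 + 'r \<Rightarrow> complex" where
  "HH z a b = (let \<kappa> = of_real (real k / GG z); P = of_real (GG z ^ k); g = of_real (g1 (uu k z)) in
    case (a, b) of
      (Inl _, Inl _) \<Rightarrow> of_real (real k * (1 + uu k z * f1 (uu k z)) / (GG z)\<^sup>2) + \<kappa>\<^sup>2 * g * of_real (uu k z) * of_real ((cmod (z $ Inl 1))\<^sup>2)
    | (Inr a, Inl _) \<Rightarrow> \<kappa> * z $ Inl 1 * g * P * cnj (z $ Inr a)
    | (Inl _, Inr b) \<Rightarrow> \<kappa> * cnj (z $ Inl 1) * g * P * z $ Inr b
    | (Inr a, Inr b) \<Rightarrow> (if a = b then of_real (f1 (uu k z)) * P else 0) + of_real (f2 (uu k z)) * P\<^sup>2 * cnj (z $ Inr a) * z $ Inr b)"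

lemma wirt_dPhi_bar:
  assumes "z \<in> DD"
  shows "wirt a (\<lambda>z. dPhi_bar z b) z = HH z a b"
proof -
  have u: "uu k z \<in> R" using assms by (simp add: DD_def)
  let ?u = "uu k z" and ?G = "GG z" and ?w = "z $ Inl 1"
  have Gk: "?G ^ k = ?G ^ (k - 1) * ?G"
    using k by (cases k) simp_all
  show ?thesis
  proof (cases b)
    case (Inl b')
    have 1: "((\<lambda>x. real k * (1 + x * f1 x)) has_real_derivative real k * g1 ?u) (at ?u)"
      using f2[OF u] by (auto intro!: derivative_eq_intros simp: g1_def)
    have 2: "((\<lambda>x. inverse x) has_real_derivative - (inverse ?G)\<^sup>2) (at ?G)"
      by (auto intro!: derivative_eq_intros simp: power2_eq_square)
    have "(\<lambda>z. dPhi_bar z b) = (\<lambda>z. of_real (real k * (1 + uu k z * f1 (uu k z))) * (of_real (inverse (GG z)) * z $ Inl 1))"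
      by (simp add: fun_eq_iff dPhi_bar_def Inl divide_inverse)
    then have "wirt a (\<lambda>z. dPhi_bar z b) z =
        of_real (real k * (1 + ?u * f1 ?u)) * (of_real (inverse ?G) * (if a = Inl 1 then 1 else 0) +
          of_real (- (inverse ?G)\<^sup>2) * (if a = Inl 1 then cnj ?w else 0) * ?w) +
        of_real (real k * g1 ?u) * du k z a * (of_real (inverse ?G) * ?w)"
      by (simp only: has_wirt_eqs(1)[OF has_wirt_mult[OF has_wirt_compose_real[OF has_wirt_uu 1]
            has_wirt_mult[OF has_wirt_compose_real[OF has_wirt_GG 2] has_wirt_nth]]])
    also have "\<dots> = HH z a b"
    proof (cases a)
      case (Inr a')
      then show ?thesis by (simp add: HH_def Inl du_def Let_def divide_inverse)
    next
      case (Inl a')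
      have w: "of_real ((cmod ?w)\<^sup>2) = ?w * cnj ?w" by (simp only: complex_norm_square)
      have "complex_of_real ((cmod ?w)\<^sup>2) = of_real ?G - 1" by (simp add: GG_def)
      then have ww: "?w * cnj ?w = of_real ?G - 1" unfolding w .
      have G0: "complex_of_real ?G \<noteq> 0" by simp
      \<comment> \<open>The Fubini-Study computation \<open>1 / G - |w|^2 / G^2 = 1 / G^2\<close>,
        from \<open>|w|^2 = G - 1\<close>.\<close>
      have key: "of_real (inverse ?G) + of_real (- (inverse ?G)\<^sup>2) * cnj ?w * ?w = of_real (inverse (?G\<^sup>2))"
      proof -
        have "of_real (inverse ?G) + of_real (- (inverse ?G)\<^sup>2) * cnj ?w * ?w
          = of_real (inverse ?G) - of_real (inverse ?G) * of_real (inverse ?G) * (?w * cnj ?w)"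
          by (simp add: power2_eq_square)
        also have "\<dots> = of_real (inverse (?G\<^sup>2))"
          unfolding ww using G0 by (simp add: field_simps power2_eq_square)
        finally show ?thesis .
      qed
      have "a = Inl 1" using Inl by simp
      then have "of_real (real k * (1 + ?u * f1 ?u)) * (of_real (inverse ?G) * (if a = Inl 1 then 1 else 0) +
          of_real (- (inverse ?G)\<^sup>2) * (if a = Inl 1 then cnj ?w else 0) * ?w) +
        of_real (real k * g1 ?u) * du k z a * (of_real (inverse ?G) * ?w)
        = of_real (real k * (1 + ?u * f1 ?u)) * of_real (inverse (?G\<^sup>2)) +
          of_real (real k * g1 ?u) * (of_real (real k * ?u / ?G) * cnj ?w) * (of_real (inverse ?G) * ?w)"
        using key by (simp add: du_def)
      also have "\<dots> = HH z a b"
        unfolding HH_def Let_def \<open>a = Inl 1\<close> \<open>b = Inl b'\<close> prod.case sum.case w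
        by (simp add: divide_inverse power2_eq_square)
      finally show ?thesis .
    qed
    finally show ?thesis .
  next
    case (Inr b')
    have 3: "((\<lambda>x. x ^ k) has_real_derivative real k * ?G ^ (k - 1)) (at ?G)"
      using DERIV_pow[of k ?G UNIV] by simp
    have "(\<lambda>z. dPhi_bar z b) = (\<lambda>z. (of_real (f1 (uu k z)) * of_real (GG z ^ k)) * z $ Inr b')"
      by (simp add: fun_eq_iff dPhi_bar_def Inr)
    then have "wirt a (\<lambda>z. dPhi_bar z b) z =
        of_real (f1 ?u) * of_real (?G ^ k) * (if a = Inr b' then 1 else 0) +
        (of_real (f1 ?u) * (of_real (real k * ?G ^ (k - 1)) * (if a = Inl 1 then cnj ?w else 0)) +
          of_real (f2 ?u) * du k z a * of_real (?G ^ k)) * z $ Inr b'"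
      by (simp only: has_wirt_eqs(1)[OF has_wirt_mult[OF has_wirt_mult[OF has_wirt_compose_real[OF has_wirt_uu f2[OF u]]
            has_wirt_compose_real[OF has_wirt_GG 3]] has_wirt_nth]])
    also have "\<dots> = HH z a b"
    proof (cases a)
      case (Inr a')
      then show ?thesis by (auto simp: HH_def \<open>b = Inr b'\<close> du_def Let_def power2_eq_square)
    next
      case (Inl a')
      then have a: "a = Inl 1" by simp
      have "of_real (real k * ?G ^ (k - 1)) = of_real (real k / ?G) * complex_of_real (?G ^ k)"
        unfolding Gk by simp
      then show ?thesis
        unfolding HH_def Let_def a \<open>b = Inr b'\<close> prod.case sum.case
        by (simp add: du_def g1_def algebra_simps)
    qed
    finally show ?thesis .
  qed
qed

text \<open>Completing the square: \<open>HH\<close> is congruent, by the unipotent matrix \<open>shear\<close>, to a diagonal matrix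
  plus a rank-one term, which gives its positivity and its determinant.\<close>

definition shear :: "complex ^ (1 + 'r::finite) \<Rightarrow> complex ^ (1 + 'r) ^ (1 + 'r)" where
  "shear z = (\<chi> c a. (if c = a then 1 else 0) +
     (\<chi> c. case c of Inl _ \<Rightarrow> 0 | Inr c \<Rightarrow> of_real (real k / GG z) * cnj (z $ Inl 1) * z $ Inr c) $ c * axis (Inl 1) 1 $ a)"

definition core_diag :: "complex ^ (1 + 'r::finite) \<Rightarrow> complex ^ (1 + 'r)" where
  "core_diag z = (\<chi> c. case c of Inl _ \<Rightarrow> of_real (real k * (1 + uu k z * f1 (uu k z)) / (GG z)\<^sup>2)
      | Inr _ \<Rightarrow> of_real (f1 (uu k z) * GG z ^ k))"

definition core_vec :: "complex ^ (1 + 'r::finite) \<Rightarrow> complex ^ (1 + 'r)" where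
  "core_vec z = (\<chi> c. case c of Inl _ \<Rightarrow> 0 | Inr c \<Rightarrow> cnj (z $ Inr c))"

definition core :: "complex ^ (1 + 'r::finite) \<Rightarrow> complex ^ (1 + 'r) ^ (1 + 'r)" where
  "core z = (\<chi> c d. (if c = d then core_diag z $ c else 0) +
     (of_real (f2 (uu k z) * (GG z ^ k)\<^sup>2) *s core_vec z) $ c * (\<chi> d. cnj (core_vec z $ d)) $ d)"

lemma sum_shear: "(\<Sum>c\<in>UNIV. shear z $ c $ a * N c) =
    N a + (if a = Inl 1 then of_real (real k / GG z) * cnj (z $ Inl 1) * (\<Sum>b\<in>UNIV. z $ Inr b * N (Inr b)) else 0)"
  for z :: "complex ^ (1 + 'r::finite)"
proof -
  let ?\<gamma> = "of_real (real k / GG z) * cnj (z $ Inl 1)"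
  define x where "x c = (case c of Inl _ \<Rightarrow> 0 | Inr c \<Rightarrow> ?\<gamma> * z $ Inr c)" for c :: "1 + 'r"
  have "shear z $ c $ a * N c = (if c = a then N a else 0) + (if a = Inl 1 then x c * N c else 0)" for c
    by (auto simp: shear_def x_def axis_def distrib_right)
  then have "(\<Sum>c\<in>UNIV. shear z $ c $ a * N c) = N a + (if a = Inl 1 then (\<Sum>c\<in>UNIV. x c * N c) else 0)"
    by (simp add: sum.distrib)
  also have "(\<Sum>c\<in>UNIV. x c * N c) = ?\<gamma> * (\<Sum>b\<in>UNIV. z $ Inr b * N (Inr b))"
    by (simp add: sum_one_sum x_def sum_distrib_left mult.assoc)
  finally show ?thesis .
qed

lemma uu_complex: "of_real (uu k z) = of_real (GG z ^ k) * (\<Sum>b\<in>UNIV. z $ Inr b * cnj (z $ Inr b))"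
  unfolding uu_GG of_real_mult of_real_sum complex_norm_square by (rule mult.commute)

text \<open>The vector of fibre coordinates is a left eigenvector of the fibre block of
  \<open>core\<close>: the diagonal part contributes \<open>f1\<close>, and the rank-one part
  contributes \<open>u * f2\<close> because \<open>GG z ^ k\<close> times the squared length of the
  vector is \<open>u\<close>. This is where \<open>g1\<close> in the mixed Hessian entries comes
  from.\<close>

lemma sum_core_Inr: "(\<Sum>b\<in>UNIV. z $ Inr b * core z $ Inr b $ Inr d) = z $ Inr d * of_real (GG z ^ k) * of_real (g1 (uu k z))"
  for z :: "complex ^ (1 + 'r::finite)"
proof -
  let ?P = "complex_of_real (GG z ^ k)" and ?S = "\<Sum>b\<in>UNIV. z $ Inr b * cnj (z $ Inr b)"
  have "z $ Inr b * core z $ Inr b $ Inr d = (if b = d then z $ Inr d * of_real (f1 (uu k z)) * ?P else 0) +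
      of_real (f2 (uu k z)) * ?P\<^sup>2 * z $ Inr d * (z $ Inr b * cnj (z $ Inr b))" for b
    by (auto simp: core_def core_diag_def core_vec_def algebra_simps)
  then have "(\<Sum>b\<in>UNIV. z $ Inr b * core z $ Inr b $ Inr d) =
      z $ Inr d * of_real (f1 (uu k z)) * ?P + of_real (f2 (uu k z)) * ?P\<^sup>2 * z $ Inr d * ?S"
    by (simp only: sum.distrib sum.delta finite sum_distrib_left[symmetric]) simp
  also have "\<dots> = z $ Inr d * ?P * (of_real (f1 (uu k z)) + of_real (f2 (uu k z)) * (?P * ?S))"
    by (simp add: algebra_simps power2_eq_square)
  also have "?P * ?S = of_real (uu k z)" by (simp only: uu_complex)
  finally show ?thesis by (simp add: g1_def mult.commute)
qed

lemma HH_factor: "HH z a b = (\<Sum>c\<in>UNIV. shear z $ c $ a * (\<Sum>d\<in>UNIV. core z $ c $ d * cnj (shear z $ d $ b)))"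
  for z :: "complex ^ (1 + 'r::finite)"
proof -
  let ?\<gamma> = "of_real (real k / GG z) * cnj (z $ Inl 1)"
  have inner: "(\<Sum>d\<in>UNIV. core z $ c $ d * cnj (shear z $ d $ b)) = core z $ c $ b +
      (if b = Inl 1 then cnj ?\<gamma> * (\<Sum>d\<in>UNIV. cnj (z $ Inr d) * core z $ c $ Inr d) else 0)" for c
  proof -
    have "(\<Sum>d\<in>UNIV. core z $ c $ d * cnj (shear z $ d $ b)) = cnj (\<Sum>d\<in>UNIV. shear z $ d $ b * cnj (core z $ c $ d))"
      by (simp add: mult.commute)
    then show ?thesis unfolding sum_shear by simp
  qed
  have L0: "core z $ Inl 1 $ Inr d = 0" "core z $ Inr d $ Inl 1 = 0" for d
    by (simp_all add: core_def core_vec_def)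
  show ?thesis
  proof (cases a)
    case a: (Inr a')
    show ?thesis
    proof (cases b)
      case b: (Inr b')
      show ?thesis unfolding sum_shear inner
        by (simp add: a b HH_def Let_def core_def core_diag_def core_vec_def)
    next
      case b: (Inl b')
      have "(\<Sum>d\<in>UNIV. cnj (z $ Inr d) * core z $ Inr a' $ Inr d) = cnj (\<Sum>d\<in>UNIV. z $ Inr d * core z $ Inr d $ Inr a')"
        unfolding cnj_sum by (intro sum.cong refl) (auto simp: core_def core_diag_def core_vec_def)
      also have "\<dots> = cnj (z $ Inr a') * of_real (GG z ^ k) * of_real (g1 (uu k z))"
        unfolding sum_core_Inr by simp
      finally have q: "(\<Sum>d\<in>UNIV. cnj (z $ Inr d) * core z $ Inr a' $ Inr d) =
          cnj (z $ Inr a') * of_real (GG z ^ k) * of_real (g1 (uu k z))" .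
      have b1: "b = Inl 1" using b by simp
      show ?thesis unfolding sum_shear inner unfolding a b1 q
        by (simp add: HH_def Let_def L0 mult_ac)
    qed
  next
    case a: (Inl a')
    show ?thesis
    proof (cases b)
      case b: (Inr b')
      have a1: "a = Inl 1" using a by simp
      show ?thesis unfolding sum_shear inner unfolding a1 b
        by (simp add: HH_def Let_def L0 sum_core_Inr mult_ac)
    next
      case b: (Inl b')
      have "(\<Sum>c\<in>UNIV. z $ Inr c * (\<Sum>d\<in>UNIV. cnj (z $ Inr d) * core z $ Inr c $ Inr d))
        = (\<Sum>c\<in>UNIV. \<Sum>d\<in>UNIV. cnj (z $ Inr d) * (z $ Inr c * core z $ Inr c $ Inr d))"
        by (simp add: sum_distrib_left mult.left_commute)
      also have "\<dots> = (\<Sum>d\<in>UNIV. cnj (z $ Inr d) * (\<Sum>c\<in>UNIV. z $ Inr c * core z $ Inr c $ Inr d))"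
        by (subst sum.swap) (simp add: sum_distrib_left)
      also have "\<dots> = (\<Sum>d\<in>UNIV. of_real (g1 (uu k z)) * (of_real (GG z ^ k) * (z $ Inr d * cnj (z $ Inr d))))"
        unfolding sum_core_Inr by (intro sum.cong refl) (simp only: mult_ac)
      also have "\<dots> = of_real (g1 (uu k z)) * of_real (uu k z)"
        unfolding uu_complex sum_distrib_left[symmetric] ..
      finally have q: "(\<Sum>c\<in>UNIV. z $ Inr c * (\<Sum>d\<in>UNIV. cnj (z $ Inr d) * core z $ Inr c $ Inr d)) = of_real (g1 (uu k z)) * of_real (uu k z)" .
      have q': "(\<Sum>c\<in>UNIV. z $ Inr c * (cnj ?\<gamma> * (\<Sum>d\<in>UNIV. cnj (z $ Inr d) * core z $ Inr c $ Inr d))) = cnj ?\<gamma> * (of_real (g1 (uu k z)) * of_real (uu k z))"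
      proof -
        have "(\<Sum>c\<in>UNIV. p c * (g * X c)) = g * (\<Sum>c\<in>UNIV. p c * X c)" for p X :: "'r \<Rightarrow> complex" and g
          by (simp add: sum_distrib_left mult.left_commute)
        then show ?thesis by (simp only: q)
      qed
      have w: "of_real ((cmod (z $ Inl 1))\<^sup>2) = z $ Inl 1 * cnj (z $ Inl 1)" by (simp only: complex_norm_square)
      have a1: "a = Inl 1" and b1: "b = Inl 1" using a b by simp_all
      have c00: "core z $ Inl 1 $ Inl 1 = of_real (real k * (1 + uu k z * f1 (uu k z)) / (GG z)\<^sup>2)"
        by (simp add: core_def core_diag_def core_vec_def)
      have "(\<Sum>c\<in>UNIV. shear z $ c $ a * (\<Sum>d\<in>UNIV. core z $ c $ d * cnj (shear z $ d $ b)))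
        = core z $ Inl 1 $ Inl 1 + ?\<gamma> * (cnj ?\<gamma> * (of_real (g1 (uu k z)) * of_real (uu k z)))"
        unfolding sum_shear inner unfolding a1 b1 by (simp add: L0 q'[simplified])
      also have "\<dots> = HH z a b"
        unfolding HH_def Let_def a1 b1 prod.case sum.case w c00
        by (simp add: power2_eq_square)
      finally show ?thesis ..
    qed
  qed
qed

lemma core_diag_pos:
  assumes "z \<in> DD"
  obtains d where "0 < d" "core_diag z $ c = of_real d"
proof -
  have u: "uu k z \<in> R" "0 \<le> uu k z" using assms uu_nonneg by (auto simp: DD_def)
  have "0 < real k * (1 + uu k z * f1 (uu k z)) / (GG z)\<^sup>2"
    using u f1_pos[OF u] k GG_pos[of z] by (intro divide_pos_pos mult_pos_pos add_pos_nonneg mult_nonneg_nonneg) auto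
  moreover have "0 < f1 (uu k z) * GG z ^ k"
    using f1_pos[OF u] GG_pos[of z] by simp
  ultimately show thesis
    using that by (cases c) (auto simp: core_diag_def)
qed

lemma HH_hermitian: "HH z b a = cnj (HH z a b)"
  by (cases a; cases b) (auto simp: HH_def Let_def)

text \<open>In the sheared variables \<open>v'\<close> the form is a sum of positive multiples of
  \<open>|v'_c|^2\<close> plus \<open>f2\<close> times the square of a linear form.\<close>

lemma HH_positive:
  fixes z v :: "complex ^ (1 + 'r::finite)"
  assumes z: "z \<in> DD" and v: "v \<noteq> 0"
  shows "0 < Re (\<Sum>a\<in>UNIV. \<Sum>b\<in>UNIV. HH z a b * v $ a * cnj (v $ b))"
proof -
  define v' where "v' c = (\<Sum>a\<in>UNIV. shear z $ c $ a * v $ a)" for c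
  have v'0: "v' (Inl 1) = v $ Inl 1"
  proof -
    have "shear z $ Inl 1 $ a * v $ a = (if a = Inl 1 then v $ Inl 1 else 0)" for a
      by (auto simp: shear_def axis_def)
    then show ?thesis by (simp add: v'_def)
  qed
  have v'b: "v' (Inr b) = v $ Inr b" if "v $ Inl 1 = 0" for b
  proof -
    have "shear z $ Inr b $ a * v $ a = (if a = Inr b then v $ Inr b else 0)" for a
      using that by (auto simp: shear_def axis_def)
    then show ?thesis by (simp add: v'_def)
  qed
  \<comment> \<open>\<open>shear z\<close> is unipotent: \<open>v'\<close> agrees with
    \<open>v\<close> in the base entry, and in all entries if that one is 0.\<close>
  have nz: "\<exists>c. v' c \<noteq> 0"
  proof (cases "v $ Inl 1 = 0")
    case True
    then obtain b where "v $ Inr b \<noteq> 0" using v by (auto simp: vec_eq_iff one_sum_all)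
    then show ?thesis using v'b[OF True] by metis
  qed (use v'0 in metis)
  have "(\<Sum>a\<in>UNIV. \<Sum>b\<in>UNIV. HH z a b * v $ a * cnj (v $ b))
      = (\<Sum>a\<in>UNIV. \<Sum>b\<in>UNIV. \<Sum>c\<in>UNIV. \<Sum>d\<in>UNIV. (shear z $ c $ a * v $ a) * (core z $ c $ d * cnj (shear z $ d $ b * v $ b)))"
    unfolding HH_factor sum_distrib_left sum_distrib_right by (simp add: mult_ac)
  also have "\<dots> = (\<Sum>c\<in>UNIV. \<Sum>d\<in>UNIV. \<Sum>a\<in>UNIV. \<Sum>b\<in>UNIV. (shear z $ c $ a * v $ a) * (core z $ c $ d * cnj (shear z $ d $ b * v $ b)))"
  proof -
    have sw: "(\<Sum>b\<in>UNIV. \<Sum>c\<in>UNIV. \<Sum>d\<in>UNIV. F b c d) = (\<Sum>c\<in>UNIV. \<Sum>d\<in>UNIV. \<Sum>b\<in>UNIV. F b c d)"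
      for F :: "1 + 'r \<Rightarrow> 1 + 'r \<Rightarrow> 1 + 'r \<Rightarrow> complex"
      by (rule trans[OF sum.swap]) (rule sum.cong[OF refl], rule sum.swap)
    show ?thesis
      by (rule trans[OF _ sw]) (rule sum.cong[OF refl], rule sw)
  qed
  also have "\<dots> = (\<Sum>c\<in>UNIV. \<Sum>d\<in>UNIV. v' c * (core z $ c $ d * cnj (v' d)))"
  proof -
    have "(\<Sum>a\<in>UNIV. \<Sum>b\<in>UNIV. x a * (t * cnj (y b))) = (\<Sum>a\<in>UNIV. x a) * (t * cnj (\<Sum>b\<in>UNIV. y b))"
      for x y :: "1 + 'r \<Rightarrow> complex" and t
      by (simp only: cnj_sum sum_distrib_left[of t] sum_product)
    then show ?thesis by (simp only: v'_def)
  qed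
  also have "\<dots> = (\<Sum>c\<in>UNIV. core_diag z $ c * (v' c * cnj (v' c))) +
      of_real (f2 (uu k z) * (GG z ^ k)\<^sup>2) * ((\<Sum>c\<in>UNIV. core_vec z $ c * v' c) * cnj (\<Sum>c\<in>UNIV. core_vec z $ c * v' c))"
  proof -
    have "v' c * (core z $ c $ d * cnj (v' d)) = (if c = d then core_diag z $ c * (v' c * cnj (v' c)) else 0) +
      of_real (f2 (uu k z) * (GG z ^ k)\<^sup>2) * ((core_vec z $ c * v' c) * cnj (core_vec z $ d * v' d))" for c d
      by (simp add: core_def algebra_simps)
    moreover have "(\<Sum>c\<in>UNIV. \<Sum>d\<in>UNIV. if c = d then p c else 0) = (\<Sum>c\<in>UNIV. p c)" for p :: "1 + 'r \<Rightarrow> complex"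
      by simp
    moreover have "(\<Sum>c\<in>UNIV. \<Sum>d\<in>UNIV. K * (x c * cnj (x d))) = K * ((\<Sum>c\<in>UNIV. x c) * cnj (\<Sum>c\<in>UNIV. x c))"
      for K and x :: "1 + 'r \<Rightarrow> complex"
    proof -
      have e: "(\<Sum>c\<in>UNIV. x c) * cnj (\<Sum>c\<in>UNIV. x c) = (\<Sum>c\<in>UNIV. \<Sum>d\<in>UNIV. x c * cnj (x d))"
        by (simp only: cnj_sum sum_product)
      show ?thesis unfolding e by (simp only: sum_distrib_left)
    qed
    ultimately show ?thesis by (simp only: sum.distrib)
  qed
  finally have "Re (\<Sum>a\<in>UNIV. \<Sum>b\<in>UNIV. HH z a b * v $ a * cnj (v $ b)) =
      (\<Sum>c\<in>UNIV. Re (core_diag z $ c * (v' c * cnj (v' c)))) +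
      f2 (uu k z) * (GG z ^ k)\<^sup>2 * (cmod (\<Sum>c\<in>UNIV. core_vec z $ c * v' c))\<^sup>2"
    by (simp only: plus_complex.sel Re_sum complex_norm_square[symmetric] of_real_mult[symmetric] Re_complex_of_real)
  moreover have "0 \<le> f2 (uu k z) * (GG z ^ k)\<^sup>2 * (cmod (\<Sum>c\<in>UNIV. core_vec z $ c * v' c))\<^sup>2"
    using z uu_nonneg[of k z] by (intro mult_nonneg_nonneg f2_nonneg) (auto simp: DD_def)
  moreover have "0 < (\<Sum>c\<in>UNIV. Re (core_diag z $ c * (v' c * cnj (v' c))))"
  proof -
    have t: "0 \<le> Re (core_diag z $ c * (v' c * cnj (v' c)))" "v' c \<noteq> 0 \<Longrightarrow> 0 < Re (core_diag z $ c * (v' c * cnj (v' c)))" for c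
    proof -
      obtain d where d: "0 < d" "core_diag z $ c = of_real d" using core_diag_pos[OF z] by blast
      have "Re (core_diag z $ c * (v' c * cnj (v' c))) = d * (cmod (v' c))\<^sup>2"
        by (simp only: d(2) complex_norm_square[symmetric] of_real_mult[symmetric] Re_complex_of_real)
      then show "0 \<le> Re (core_diag z $ c * (v' c * cnj (v' c)))" "v' c \<noteq> 0 \<Longrightarrow> 0 < Re (core_diag z $ c * (v' c * cnj (v' c)))"
        using d(1) by simp_all
    qed
    obtain c where "v' c \<noteq> 0" using nz by blast
    then show ?thesis using t by (intro sum_pos2[of UNIV c]) auto
  qed
  ultimately show ?thesis by simp
qed

lemma det_shear: "det (shear z) = 1" and det_cnj_shear: "det (\<chi> c a. cnj (shear z $ c $ a)) = 1"
proof -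
  show "det (shear z) = 1"
    unfolding shear_def det_rank_one_update by (simp add: sum_one_sum axis_def)
  have "(\<chi> c a. cnj (shear z $ c $ a)) = (\<chi> c a. (if c = a then 1 else 0) +
     (\<chi> c. cnj (case c of Inl _ \<Rightarrow> 0 | Inr c \<Rightarrow> of_real (real k / GG z) * cnj (z $ Inl 1) * z $ Inr c)) $ c * axis (Inl 1) 1 $ a)"
    by (simp add: vec_eq_iff shear_def axis_def)
  then show "det (\<chi> c a. cnj (shear z $ c $ a)) = 1"
    by (simp only: det_rank_one_update) (simp add: sum_one_sum axis_def)
qed

text \<open>The shears have determinant 1, so only \<open>core z\<close> counts. By the rank-one
  formula the factor \<open>1 + u * f2 / f1\<close> turns one of the \<open>r\<close> factors
  \<open>f1\<close> into \<open>g1\<close>.\<close>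

lemma det_HH:
  fixes z :: "complex ^ (1 + 'r::finite)"
  assumes z: "z \<in> DD"
  shows "det (\<chi> a b. HH z a b) = of_real (real k * (1 + uu k z * f1 (uu k z)) / (GG z)\<^sup>2 * GG z ^ (k * CARD('r)) * f1 (uu k z) ^ (CARD('r) - 1) * g1 (uu k z))"
proof -
  let ?P = "GG z ^ k" and ?u = "uu k z" and ?r = "CARD('r)"
  let ?A = "real k * (1 + ?u * f1 ?u) / (GG z)\<^sup>2"
  have u: "?u \<in> R" "0 \<le> ?u" using z uu_nonneg by (auto simp: DD_def)
  have f10: "f1 ?u \<noteq> 0" using f1_pos[OF u] by simp
  have P0: "?P \<noteq> 0" by simp
  have "(\<chi> a b. HH z a b) = transpose (shear z) ** (core z ** (\<chi> c a. cnj (shear z $ c $ a)))"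
    by (simp add: vec_eq_iff HH_factor matrix_matrix_mult_def transpose_def)
  then have "det (\<chi> a b. HH z a b) = det (core z)"
    by (simp add: det_mul det_transpose det_shear det_cnj_shear)
  also have "\<dots> = (\<Prod>i\<in>UNIV. core_diag z $ i) * (1 + (\<Sum>i\<in>UNIV. (of_real (f2 ?u * ?P\<^sup>2) *s core_vec z) $ i * (\<chi> d. cnj (core_vec z $ d)) $ i / core_diag z $ i))"
    unfolding core_def
  proof (rule det_diagonal_rank_one)
    show "core_diag z $ i \<noteq> 0" for i
      using core_diag_pos[OF z, of i] by (metis less_irrefl of_real_eq_0_iff)
  qed
  also have "(\<Prod>i\<in>UNIV. core_diag z $ i) = of_real (?A * (f1 ?u * ?P) ^ ?r)"
    by (simp add: prod_one_sum core_diag_def)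
  also have "(\<Sum>i\<in>UNIV. (of_real (f2 ?u * ?P\<^sup>2) *s core_vec z) $ i * (\<chi> d. cnj (core_vec z $ d)) $ i / core_diag z $ i)
    = of_real (f2 ?u * ?P\<^sup>2 / (f1 ?u * ?P)) * (\<Sum>b\<in>UNIV. z $ Inr b * cnj (z $ Inr b))"
    by (simp add: sum_one_sum core_diag_def core_vec_def sum_distrib_left sum_divide_distrib mult_ac)
  also have "\<dots> = of_real (f2 ?u / f1 ?u) * (of_real ?P * (\<Sum>b\<in>UNIV. z $ Inr b * cnj (z $ Inr b)))"
    using P0 by (simp add: power2_eq_square)
  also have "\<dots> = of_real (f2 ?u / f1 ?u * ?u)"
    unfolding uu_complex[symmetric] by simp
  also have "of_real (?A * (f1 ?u * ?P) ^ ?r) * (1 + of_real (f2 ?u / f1 ?u * ?u)) = complex_of_real (?A * (f1 ?u * ?P) ^ ?r * (1 + f2 ?u / f1 ?u * ?u))"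
    by simp
  also have "?A * (f1 ?u * ?P) ^ ?r * (1 + f2 ?u / f1 ?u * ?u) = ?A * GG z ^ (k * ?r) * f1 ?u ^ (?r - 1) * g1 ?u"
  proof -
    have 1: "f1 ?u ^ ?r = f1 ?u ^ (?r - 1) * f1 ?u"
      by (rule power_minus_mult[symmetric]) (rule zero_less_card_finite)
    have 2: "f1 ?u * (1 + f2 ?u / f1 ?u * ?u) = g1 ?u"
      using f10 by (simp add: g1_def field_simps)
    have "?A * (f1 ?u * ?P) ^ ?r * (1 + f2 ?u / f1 ?u * ?u)
      = ?A * ?P ^ ?r * f1 ?u ^ (?r - 1) * (f1 ?u * (1 + f2 ?u / f1 ?u * ?u))"
    proof -
      have "a * (x * p) * q = a * p * x' * y" if "x = x' * t" "t * q = y" for a p q x x' t y :: real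
        unfolding that(1) that(2)[symmetric] by (simp only: mult_ac)
      from this[OF 1 refl] show ?thesis by (simp only: power_mult_distrib)
    qed
    then show ?thesis by (simp only: 2 power_mult)
  qed
  finally show ?thesis .
qed

end

section \<open>The manifold and the line bundle\<close>

lemma open_compl_base: "open {z :: complex ^ (1 + 'r::finite). base z \<noteq> 0}"
  unfolding base_def by (intro open_Collect_neq continuous_intros)

lemma has_wirt_imp_holo_on:
  assumes "\<And>z. z \<in> S \<Longrightarrow> has_wirt f (a z) (\<lambda>_. 0) z"
  shows "holo_on f S"
  unfolding holo_on_def
proof
  fix z assume "z \<in> S"
  then have "(f has_derivative (\<lambda>v. \<Sum>j\<in>UNIV. a z j * v $ j)) (at z)"
    using assms unfolding has_wirt_def by simp
  then show "\<exists>D. (f has_derivative D) (at z) \<and> (\<forall>c v. D (c *s v) = c * D v)"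
    by (intro exI[of _ "\<lambda>v. \<Sum>j\<in>UNIV. a z j * v $ j"]) (simp add: sum_distrib_left mult_ac)
qed

lemma holo_on_cong:
  assumes "open S" "\<And>z. z \<in> S \<Longrightarrow> f z = g z" "holo_on f S"
  shows "holo_on g S"
  using assms has_derivative_transform_within_open[OF _ assms(1)] unfolding holo_on_def by blast

lemma has_wirt_compose_field:
  assumes f: "has_wirt f a b z" and g: "(g has_field_derivative d) (at (f z))"
  shows "has_wirt (\<lambda>z. g (f z)) (\<lambda>j. d * a j) (\<lambda>j. d * b j) z"
proof -
  have "((\<lambda>z. g (f z)) has_derivative (\<lambda>v. d * (\<Sum>j\<in>UNIV. a j * v $ j + b j * cnj (v $ j)))) (at z)"
    using has_derivative_compose[OF f[unfolded has_wirt_def] g[unfolded has_field_derivative_def]] .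
  moreover have "(\<lambda>v. d * (\<Sum>j\<in>UNIV. a j * v $ j + b j * cnj (v $ j))) = (\<lambda>v. \<Sum>j\<in>UNIV. (d * a j) * v $ j + (d * b j) * cnj (v $ j))"
    by (simp add: sum_distrib_left algebra_simps)
  ultimately show ?thesis by (simp only: has_wirt_def)
qed

definition sw_jac :: "nat \<Rightarrow> complex ^ (1 + 'r::finite) \<Rightarrow> 1 + 'r \<Rightarrow> 1 + 'r \<Rightarrow> complex" where
  "sw_jac k z c a = (case c of Inl _ \<Rightarrow> (if a = Inl 1 then - (inverse (base z))\<^sup>2 else 0)
     | Inr b \<Rightarrow> (if a = Inl 1 then of_nat k * base z ^ (k - 1) * z $ Inr b else 0) + (if a = Inr b then base z ^ k else 0))"

lemma has_wirt_base_power: "has_wirt (\<lambda>z. base z ^ n) (\<lambda>a. of_nat n * base z ^ (n - 1) * (if a = Inl 1 then 1 else 0)) (\<lambda>_. 0) z"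
proof -
  have "((\<lambda>x. x ^ n) has_field_derivative of_nat n * x ^ (n - 1)) (at x)" for x :: complex
    by (auto intro!: derivative_eq_intros)
  from has_wirt_compose_field[OF has_wirt_nth this] show ?thesis
    unfolding base_def by (rule has_wirt_cong) simp_all
qed

lemma has_wirt_base_inverse:
  "base z \<noteq> 0 \<Longrightarrow> has_wirt (\<lambda>z. inverse (base z)) (\<lambda>a. - (inverse (base z))\<^sup>2 * (if a = Inl 1 then 1 else 0)) (\<lambda>_. 0) z"
  unfolding base_def
  by (rule has_wirt_cong[OF has_wirt_compose_field[OF has_wirt_nth DERIV_inverse]]) (simp_all add: numeral_2_eq_2)

lemma has_wirt_switch:
  assumes "base z \<noteq> 0"
  shows "has_wirt (\<lambda>z. switch k z $ c) (sw_jac k z c) (\<lambda>_. 0) z"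
proof (cases c)
  case (Inl c')
  have "(\<lambda>z::complex^(1 + 'a). switch k z $ c) = (\<lambda>z. inverse (base z))"
    by (simp add: fun_eq_iff switch_def mk_pt_def Inl inverse_eq_divide)
  then show ?thesis
    by (simp only:) (rule has_wirt_cong[OF has_wirt_base_inverse[OF assms]]; simp add: sw_jac_def Inl)
next
  case (Inr b)
  have "(\<lambda>z::complex^(1 + 'a). switch k z $ c) = (\<lambda>z. base z ^ k * z $ Inr b)"
    by (simp add: fun_eq_iff switch_def mk_pt_def fib_def Inr)
  then show ?thesis
    by (simp only:) (rule has_wirt_cong[OF has_wirt_mult[OF has_wirt_base_power has_wirt_nth]]; simp add: sw_jac_def Inr add.commute)
qed

text \<open>What matters is the vanishing antiholomorphic part: in \<open>HH_switch\<close> it makes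
  the conjugated Jacobian entries constants for a holomorphic derivative.\<close>

lemma has_wirt_sw_jac:
  assumes "base z \<noteq> 0"
  obtains A where "has_wirt (\<lambda>z. sw_jac k z c a) A (\<lambda>_. 0) z"
proof (cases c)
  case (Inl c')
  show thesis
  proof (cases "a = Inl 1")
    case True
    have "(\<lambda>z. sw_jac k z c a) = (\<lambda>z. (- 1) * (inverse (base z) * inverse (base z)))"
      by (simp add: fun_eq_iff sw_jac_def Inl True power2_eq_square)
    then show thesis
      by (intro that) (simp only:, rule has_wirt_cong[OF has_wirt_mult[OF has_wirt_const has_wirt_mult[OF has_wirt_base_inverse[OF assms] has_wirt_base_inverse[OF assms]]] refl], simp)
  next
    case False
    then have "(\<lambda>z. sw_jac k z c a) = (\<lambda>z. 0)" by (simp add: fun_eq_iff sw_jac_def Inl)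
    then show thesis by (intro that) (simp only:, rule has_wirt_const)
  qed
next
  case (Inr b)
  show thesis
  proof (cases "a = Inl 1")
    case True
    have "(\<lambda>z. sw_jac k z c a) = (\<lambda>z. of_nat k * (base z ^ (k - 1) * z $ Inr b))"
      by (simp add: fun_eq_iff sw_jac_def Inr True mult.assoc)
    then show thesis
      by (intro that) (simp only:, rule has_wirt_cong[OF has_wirt_mult[OF has_wirt_const has_wirt_mult[OF has_wirt_base_power has_wirt_nth]] refl], simp)
  next
    case False
    then have e: "(\<lambda>z. sw_jac k z c a) = (\<lambda>z. (if a = Inr b then 1 else 0) * base z ^ k)"
      by (simp add: fun_eq_iff sw_jac_def Inr)
    show thesis
      by (rule that, unfold e, rule has_wirt_cong[OF has_wirt_mult[OF has_wirt_const has_wirt_base_power] refl], simp)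
  qed
qed

context potential
begin

text \<open>One definition serves both cases: \<open>R = {..<1}\<close> gives the unit disc bundle
  and \<open>R = UNIV\<close> the whole total space.\<close>

definition MM :: "('r::finite tot, 2, 1 + 'r) cmanifold" where
  "MM = submanifold (total_space k) {v. sq_norm k v \<in> R}"

definition LL :: "('r::finite tot, 2) line_bundle" where
  "LL = bundle_pullback fst (bundle_power hyperplane_bundle k)"

lemma chart_MM: "chart MM i (tot_pt k i z) = z"
  by (simp add: MM_def submanifold_def)

lemma cdom_MM: "v \<in> cdom MM i \<longleftrightarrow> (\<exists>z\<in>DD. v = tot_pt k i z)"
proof
  assume v: "v \<in> cdom MM i"
  then have c: "v \<in> cdom (total_space k) i" "sq_norm k v \<in> R" by (auto simp: MM_def submanifold_def)
  have e: "tot_pt k i (chart (total_space k) i v) = v" by (rule tot_pt_chart[OF c(1) k])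
  have "uu k (chart (total_space k) i v) \<in> R" using c(2) sq_norm_tot_pt[of k i "chart (total_space k) i v"] unfolding e by simp
  then show "\<exists>z\<in>DD. v = tot_pt k i z" using e by (intro bexI[of _ "chart (total_space k) i v"]) (auto simp: DD_def)
next
  assume "\<exists>z\<in>DD. v = tot_pt k i z"
  then show "v \<in> cdom MM i" using tot_pt_cdom[OF k] by (auto simp: MM_def submanifold_def DD_def sq_norm_tot_pt)
qed

lemma chart_inv_MM: "z \<in> DD \<Longrightarrow> chart_inv MM i z = tot_pt k i z"
proof -
  assume z: "z \<in> DD"
  have inj: "inj_on (chart MM i) (cdom MM i)"
  proof (rule inj_onI)
    fix x y assume "x \<in> cdom MM i" "y \<in> cdom MM i" "chart MM i x = chart MM i y"
    then show "x = y" by (auto simp: cdom_MM chart_MM)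
  qed
  have "tot_pt k i z \<in> cdom MM i" using z cdom_MM by blast
  from inv_into_f_f[OF inj this] show ?thesis by (simp add: chart_inv_def chart_MM)
qed

lemma inj_chart_MM: "inj_on (chart MM i) (cdom MM i)"
proof (rule inj_onI)
  fix x y assume "x \<in> cdom MM i" "y \<in> cdom MM i" "chart MM i x = chart MM i y"
  then show "x = y" by (auto simp: cdom_MM chart_MM)
qed

lemma image_chart_MM: "chart MM i ` (X \<inter> cdom MM i) = {z \<in> DD. tot_pt k i z \<in> X}"
proof safe
  fix v assume "v \<in> X" "v \<in> cdom MM i"
  then show "chart MM i v \<in> DD" "tot_pt k i (chart MM i v) \<in> X" by (auto simp: cdom_MM chart_MM)
next
  fix z assume "z \<in> DD" "tot_pt k i z \<in> X"
  then show "z \<in> chart MM i ` (X \<inter> cdom MM i)"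
    by (intro image_eqI[of _ _ "tot_pt k i z"]) (auto simp: chart_MM cdom_MM)
qed

lemma image_cdom_MM: "chart MM i ` cdom MM i = DD"
  using image_chart_MM[of i UNIV] by simp

lemma cdom_MM_switch: "z \<in> DD \<Longrightarrow> tot_pt k i z \<in> cdom MM (i + 1) \<longleftrightarrow> base z \<noteq> 0"
  using tot_pt_cdom_switch[OF k, of i z] by (auto simp: MM_def submanifold_def sq_norm_tot_pt DD_def)

lemma image_overlap_MM: "chart MM i ` (cdom MM i \<inter> cdom MM (i + 1)) = DD \<inter> {z. base z \<noteq> 0}"
  unfolding Int_commute[of "cdom MM i"] image_chart_MM using cdom_MM_switch by auto

lemma open_overlap: "open (DD \<inter> {z. base z \<noteq> 0})"
  by (intro open_Int open_DD open_compl_base)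

lemma switch_DD: "z \<in> DD \<Longrightarrow> base z \<noteq> 0 \<Longrightarrow> switch k z \<in> DD"
  by (simp add: DD_def uu_switch)

lemma chart_MM_switch: "base z \<noteq> 0 \<Longrightarrow> chart MM (i + 1) (tot_pt k i z) = switch k z"
  by (simp add: MM_def submanifold_def chart_tot_pt_switch)

lemma points_MM: "points (MM :: ('r::finite tot, 2, 1 + 'r) cmanifold) = (\<Union>i. cdom MM i)"
proof -
  have "points (total_space k :: ('r tot, 2, 1 + 'r) cmanifold) = (\<Union>i. cdom (total_space k) i)"
  proof -
    have "\<exists>i. fst v \<in> cdom CP1 i" if "v \<in> points (total_space k)" for v :: "'r tot"
    proof -
      have "fst v \<in> (\<Union>i. cdom CP1 i)"
        unfolding points_CP1[symmetric] using that by (simp add: points_total_space)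
      then show ?thesis by simp
    qed
    then show ?thesis by (auto simp: cdom_total_space)
  qed
  then show ?thesis by (auto simp: MM_def submanifold_def)
qed

section \<open>The topology of the manifold\<close>

lemma openin_MM: "openin (manifold_topology (MM :: ('r::finite tot, 2, 1 + 'r) cmanifold)) S \<longleftrightarrow> S \<subseteq> points MM \<and> (\<forall>i. open (chart MM i ` (S \<inter> cdom MM i)))"
proof -
  have "istopology (\<lambda>S. S \<subseteq> points (MM :: ('r tot, 2, 1 + 'r) cmanifold) \<and> (\<forall>i. open (chart MM i ` (S \<inter> cdom MM i))))"
    unfolding istopology_def image_chart_MM
  proof (intro conjI allI impI)
    fix S T :: "'r tot set" and i
    assume "S \<subseteq> points MM \<and> (\<forall>i. open {z \<in> DD. tot_pt k i z \<in> S})" "T \<subseteq> points MM \<and> (\<forall>i. open {z \<in> DD. tot_pt k i z \<in> T})"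
    then have "open ({z \<in> DD. tot_pt k i z \<in> S} \<inter> {z \<in> DD. tot_pt k i z \<in> T})" by blast
    also have "{z \<in> DD. tot_pt k i z \<in> S} \<inter> {z \<in> DD. tot_pt k i z \<in> T} = {z \<in> DD. tot_pt k i z \<in> S \<inter> T}" by blast
    finally show "open {z \<in> DD. tot_pt k i z \<in> S \<inter> T}" .
  next
    fix \<K> :: "'r tot set set" and i
    assume "\<forall>K\<in>\<K>. K \<subseteq> points MM \<and> (\<forall>i. open {z \<in> DD. tot_pt k i z \<in> K})"
    then have "open (\<Union>K\<in>\<K>. {z \<in> DD. tot_pt k i z \<in> K})" by blast
    also have "(\<Union>K\<in>\<K>. {z \<in> DD. tot_pt k i z \<in> K}) = {z \<in> DD. tot_pt k i z \<in> \<Union>\<K>}" by blast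
    finally show "open {z \<in> DD. tot_pt k i z \<in> \<Union>\<K>}" .
  qed blast+
  then show ?thesis unfolding manifold_topology_def by (simp add: topology_inverse')
qed

lemma openin_MM_preimage:
  fixes F :: "'r::finite tot \<Rightarrow> 'x::topological_space"
  assumes F: "\<And>i. continuous_on DD (\<lambda>z. F (tot_pt k i z))" and U: "open U"
  shows "openin (manifold_topology MM) {v \<in> points MM. F v \<in> U}"
  unfolding openin_MM
proof (intro conjI allI)
  fix i
  have "chart MM i ` ({v \<in> points MM. F v \<in> U} \<inter> cdom MM i) = DD \<inter> (\<lambda>z. F (tot_pt k i z)) -` U"
    unfolding image_chart_MM by (auto simp: points_MM cdom_MM)
  then show "open (chart MM i ` ({v \<in> points MM. F v \<in> U} \<inter> cdom MM i))"
    by (simp only: continuous_open_preimage[OF F open_DD U])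
qed auto

text \<open>Up to an affine map this is the embedding of the projective line as a round sphere by
  stereographic projection. The default value 0 outside chart 0 is the limit at infinity, so the map
  is continuous in chart 1 as well.\<close>

definition chordal :: "(complex ^ 2) set \<Rightarrow> complex \<times> real" where
  "chordal l = (if l \<in> cdom CP1 0 then (hom_rep 0 l $ 1 / of_real (1 + (cmod (hom_rep 0 l $ 1))\<^sup>2), 1 / (1 + (cmod (hom_rep 0 l $ 1))\<^sup>2)) else 0)"

lemma one_add_one_2: "(1::2) + 1 = 0"
  using two_add[of 0] by (simp only: add_0)

lemma chordal_0: "chordal (aff_line 0 w) = (w / of_real (1 + (cmod w)\<^sup>2), 1 / (1 + (cmod w)\<^sup>2))"
  using aff_vec_nth(2)[of 0 w] by (simp add: chordal_def)

lemma chordal_1: "chordal (aff_line 1 w) = (cnj w / of_real (1 + (cmod w)\<^sup>2), (cmod w)\<^sup>2 / (1 + (cmod w)\<^sup>2))"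
proof (cases "w = 0")
  case True
  then have "aff_line 1 w \<notin> cdom CP1 0" using aff_line_cdom_switch[of 1 w, unfolded one_add_one_2] by simp
  then show ?thesis using True by (simp add: chordal_def zero_prod_def)
next
  case False
  have e: "aff_line 1 w = aff_line 0 (1 / w)" using aff_line_switch[OF False, of 1, unfolded one_add_one_2] .
  have p: "1 + (cmod w)\<^sup>2 \<noteq> 0" by (metis add_pos_nonneg less_numeral_extra(1,3) zero_le_power2)
  have n: "(cmod w)\<^sup>2 \<noteq> 0" using False by simp
  have "1 / w = cnj w / of_real ((cmod w)\<^sup>2)"
    unfolding complex_norm_square using False by simp
  moreover have "1 + (cmod (1 / w))\<^sup>2 = (1 + (cmod w)\<^sup>2) / (cmod w)\<^sup>2"
    using n by (simp add: norm_divide power_divide field_simps)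
  ultimately show ?thesis unfolding e chordal_0 using n p by simp
qed

text \<open>Disjoint neighbourhoods are pulled back along \<open>F\<close>, an injective map into a
  Hausdorff space that is continuous in both charts. It may record the fibre coordinates of both
  trivializations, since with the default value 0 each of them is continuous in both charts.\<close>

lemma Hausdorff_MM: "Hausdorff_space (manifold_topology (MM :: ('r::finite tot, 2, 1 + 'r) cmanifold))"
  unfolding Hausdorff_space_def
proof (intro allI impI)
  fix x y :: "'r tot"
  assume xy: "x \<in> topspace (manifold_topology MM) \<and> y \<in> topspace (manifold_topology MM) \<and> x \<noteq> y"
  have "topspace (manifold_topology (MM :: ('r tot, 2, 1 + 'r) cmanifold)) \<subseteq> points MM"
    unfolding topspace_def openin_MM by blast
  then have x: "x \<in> points MM" and y: "y \<in> points MM" using xy by auto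
  define F where "F v = (chordal (fst v), snd v 0, snd v 1)" for v :: "'r tot"
  have cont: "continuous_on DD (\<lambda>z :: complex ^ (1 + 'r). F (tot_pt k i z))" for i
  proof -
    have n: "1 + (cmod w)\<^sup>2 \<noteq> 0" for w by (metis add_pos_nonneg less_numeral_extra(1,3) zero_le_power2)
    have n': "complex_of_real (1 + (cmod w)\<^sup>2) \<noteq> 0" for w using n by (simp only: of_real_eq_0_iff not_False_eq_True)
    have b: "continuous_on DD (\<lambda>z :: complex ^ (1 + 'r). base z)" unfolding base_def by (intro continuous_intros)
    have fb: "continuous_on DD (\<lambda>z :: complex ^ (1 + 'r). fib z)" unfolding fib_def by (intro continuous_intros)
    have bf: "continuous_on DD (\<lambda>z :: complex ^ (1 + 'r). base z ^ k *s fib z)"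
      unfolding vector_scalar_mult_def fib_def by (simp, intro continuous_intros b)
    have c: "continuous_on DD (\<lambda>z :: complex ^ (1 + 'r). chordal (aff_line i (base z)))"
    proof (cases "i = 0")
      case True
      show ?thesis unfolding True chordal_0 by (intro continuous_intros b ballI n n')
    next
      case False
      then have "i = 1" using two_cases[of i 0] by simp
      show ?thesis unfolding \<open>i = 1\<close> chordal_1 by (intro continuous_intros b ballI n n')
    qed
    show ?thesis
      unfolding F_def tot_pt_def fst_conv snd_conv
      by (intro continuous_on_Pair c; cases "i = 0"; cases "i = 1"; simp add: fb bf)
  qed
  have "F x \<noteq> F y"
  proof
    assume F: "F x = F y"
    have inj: "l = l'" if "l \<in> points CP1" "l' \<in> points CP1" "chordal l = chordal l'" for l l'
    proof -
      \<comment> \<open>Height 0 on the sphere characterizes the point at infinity of chart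
        0.\<close>
      have out: "snd (chordal l) = 0 \<Longrightarrow> l = aff_line 1 0" if lP: "l \<in> points CP1" for l
      proof -
        assume s: "snd (chordal l) = 0"
        have "l \<notin> cdom CP1 0"
        proof
          assume "l \<in> cdom CP1 0"
          then obtain w where "l = aff_line 0 w" using cdom_CP1_iff by blast
          then have "1 + (cmod w)\<^sup>2 = 0" using s by (simp add: chordal_0)
          then show False by (metis add_pos_nonneg less_numeral_extra(1,3) zero_le_power2)
        qed
        moreover obtain i where "l \<in> cdom CP1 i" using lP unfolding points_CP1 by blast
        moreover have "i = 0 \<or> i = 1" using two_cases[of i 0] by (simp only: add_0)
        ultimately have "l \<in> cdom CP1 1" by auto
        then obtain w where w: "l = aff_line 1 w" using cdom_CP1_iff by blast
        moreover have "w = 0" using \<open>l \<notin> cdom CP1 0\<close> aff_line_cdom_switch[of 1 w, unfolded one_add_one_2] w by simp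
        ultimately show "l = aff_line 1 0" by simp
      qed
      show ?thesis
      proof (cases "snd (chordal l) = 0")
        case True
        then have "snd (chordal l') = 0" using that(3) by simp
        then show ?thesis using out[OF that(1) True] out[OF that(2)] by simp
      next
        case False
        have "\<exists>w. l = aff_line 0 w" if "snd (chordal l) \<noteq> 0" for l
          using that cdom_CP1_iff[of l 0] by (auto simp: chordal_def)
        from this[OF False] this[of l'] False that(3)
        obtain w w' where w: "l = aff_line 0 w" "l' = aff_line 0 w'" by auto
        have p: "1 + (cmod w)\<^sup>2 \<noteq> 0" for w by (metis add_pos_nonneg less_numeral_extra(1,3) zero_le_power2)
        have p': "complex_of_real (1 + (cmod w)\<^sup>2) \<noteq> 0" for w
          using p[of w] by (simp only: of_real_eq_0_iff not_False_eq_True)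
        have c: "w / of_real (1 + (cmod w)\<^sup>2) = w' / of_real (1 + (cmod w')\<^sup>2) \<and> 1 / (1 + (cmod w)\<^sup>2) = 1 / (1 + (cmod w')\<^sup>2)"
          using that(3) unfolding w chordal_0 prod.inject .
        then have "1 + (cmod w)\<^sup>2 = 1 + (cmod w')\<^sup>2" by simp
        with conjunct1[OF c] have e: "w / of_real (1 + (cmod w)\<^sup>2) = w' / of_real (1 + (cmod w)\<^sup>2)" by (simp only:)
        have "w = w'" using e[unfolded divide_cancel_right] p'[of w] by blast
        then show ?thesis using w by simp
      qed
    qed
    have "fst x \<in> points CP1" "fst y \<in> points CP1"
      using x y by (simp_all add: MM_def submanifold_def points_total_space)
    from inj[OF this] have "fst x = fst y" using F by (simp add: F_def)
    moreover have "snd x = snd y"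
    proof
      fix j :: 2
      have "j = 0 \<or> j = 1" using two_cases[of j 0] by (simp only: add_0)
      then show "snd x j = snd y j" using F by (auto simp: F_def)
    qed
    ultimately show False using xy by (simp add: prod_eq_iff)
  qed
  from hausdorff[OF this] obtain U V where UV: "open U" "open V" "F x \<in> U" "F y \<in> V" "U \<inter> V = {}"
    by blast
  show "\<exists>U V. openin (manifold_topology MM) U \<and> openin (manifold_topology MM) V \<and> x \<in> U \<and> y \<in> V \<and> disjnt U V"
  proof (intro exI conjI)
    show "openin (manifold_topology MM) {v \<in> points MM. F v \<in> U}" "openin (manifold_topology MM) {v \<in> points MM. F v \<in> V}"
      by (intro openin_MM_preimage cont UV)+
  qed (use x y UV in \<open>auto simp: disjnt_def\<close>)
qed

lemma holo_on_nth: "holo_on (\<lambda>z. z $ a) S"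
  by (rule has_wirt_imp_holo_on) (rule has_wirt_nth)

lemma complex_manifold_MM: "complex_manifold (MM :: ('r::finite tot, 2, 1 + 'r) cmanifold)"
  unfolding complex_manifold_def
proof (intro conjI allI)
  have "(0 :: complex ^ (1 + 'r)) \<in> DD" using R by (simp add: DD_def uu_def)
  then show "points (MM :: ('r tot, 2, 1 + 'r) cmanifold) \<noteq> {}" unfolding points_MM using cdom_MM by blast
  show "points (MM :: ('r tot, 2, 1 + 'r) cmanifold) = (\<Union>i. cdom MM i)" by (rule points_MM)
  fix i j :: 2 and a :: "1 + 'r"
  show "inj_on (chart (MM :: ('r tot, 2, 1 + 'r) cmanifold) i) (cdom MM i)" by (rule inj_chart_MM)
  show "open (chart (MM :: ('r tot, 2, 1 + 'r) cmanifold) i ` (cdom MM i \<inter> cdom MM j))"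
  proof (cases "j = i")
    case True
    then show ?thesis by (simp add: image_cdom_MM open_DD)
  next
    case False
    then have "j = i + 1" using two_cases by blast
    then show ?thesis by (simp add: image_overlap_MM open_overlap)
  qed
  show "holo_on (\<lambda>z. chart MM j (chart_inv MM i z) $ a) (chart (MM :: ('r tot, 2, 1 + 'r) cmanifold) i ` (cdom MM i \<inter> cdom MM j))"
  proof (cases "j = i")
    case True
    show ?thesis unfolding True Int_absorb image_cdom_MM
      by (rule holo_on_cong[OF open_DD _ holo_on_nth[of a]]) (simp add: chart_inv_MM chart_MM)
  next
    case False
    then have j: "j = i + 1" using two_cases by blast
    show ?thesis unfolding j image_overlap_MM
    proof (rule holo_on_cong[OF open_overlap])
      show "holo_on (\<lambda>z. switch k z $ a) (DD \<inter> {z. base z \<noteq> 0})"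
        by (rule has_wirt_imp_holo_on) (rule has_wirt_switch, simp)
      show "switch k z $ a = chart MM (i + 1) (chart_inv MM i z) $ a" if "z \<in> DD \<inter> {z. base z \<noteq> 0}" for z
        using that by (simp add: chart_inv_MM chart_MM_switch)
    qed
  qed
qed (rule Hausdorff_MM)

section \<open>The pulled-back line bundle\<close>

lemma LL_tot_pt: "LL i i (tot_pt k i z) = 1" "LL i (i + 1) (tot_pt k i z) = base z ^ k"
  "base z \<noteq> 0 \<Longrightarrow> LL (i + 1) i (tot_pt k i z) = inverse (base z ^ k)"
  "base z \<noteq> 0 \<Longrightarrow> LL (i + 1) (i + 1) (tot_pt k i z) = 1"
  by (simp_all add: LL_def bundle_pullback_def bundle_power_def tot_pt_def hyperplane_aff_switch hyperplane_aff_switch' power_one_over inverse_eq_divide)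

lemma holomorphic_line_bundle_LL: "holomorphic_line_bundle (MM :: ('r::finite tot, 2, 1 + 'r) cmanifold) LL"
  unfolding holomorphic_line_bundle_def
proof (intro conjI allI ballI)
  fix i j l :: 2
  show "LL i i q = 1" if "q \<in> cdom (MM :: ('r tot, 2, 1 + 'r) cmanifold) i" for q
    using that by (auto simp: cdom_MM LL_tot_pt)
  show "LL i j q * LL j l q = LL i l q" if q: "q \<in> cdom (MM :: ('r tot, 2, 1 + 'r) cmanifold) i \<inter> cdom MM j \<inter> cdom MM l" for q
  proof -
    obtain z where z: "z \<in> DD" "q = tot_pt k i z" using q cdom_MM by blast
    have b: "base z \<noteq> 0" if "j = i + 1 \<or> l = i + 1" using that q z cdom_MM_switch[OF z(1), of i] by auto
    consider "j = i" "l = i" | "j = i" "l = i + 1" | "j = i + 1" "l = i" | "j = i + 1" "l = i + 1"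
      using two_cases[of j i] two_cases[of l i] by blast
    then show ?thesis using b unfolding z(2) by cases (auto simp: LL_tot_pt)
  qed
  show "holo_on (\<lambda>z. LL i j (chart_inv MM i z)) (chart (MM :: ('r tot, 2, 1 + 'r) cmanifold) i ` (cdom MM i \<inter> cdom MM j))"
  proof (cases "j = i")
    case True
    have "holo_on (\<lambda>z. 1 :: complex) (DD :: (complex ^ (1 + 'r)) set)"
      by (rule has_wirt_imp_holo_on) (rule has_wirt_const)
    then show ?thesis unfolding True Int_absorb image_cdom_MM
      by (rule holo_on_cong[OF open_DD, rotated]) (simp add: chart_inv_MM LL_tot_pt)
  next
    case False
    then have j: "j = i + 1" using two_cases by blast
    have "holo_on (\<lambda>z. base z ^ k) (DD \<inter> {z :: complex ^ (1 + 'r). base z \<noteq> 0})"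
      by (rule has_wirt_imp_holo_on) (rule has_wirt_base_power)
    then show ?thesis unfolding j image_overlap_MM
      by (rule holo_on_cong[OF open_overlap, rotated]) (simp add: chart_inv_MM LL_tot_pt)
  qed
qed

end

section \<open>The Hermitian metric and its Chern form\<close>

lemma has_wirt_local:
  assumes S: "open S" "z \<in> S" and fg: "\<And>w. w \<in> S \<Longrightarrow> f w = g w"
  shows "wirt a f z = wirt a g z" "wirt_bar a f z = wirt_bar a g z"
proof -
  have "(f has_derivative D) (at z) \<longleftrightarrow> (g has_derivative D) (at z)" for D
    using has_derivative_transform_within_open[OF _ S, of f D UNIV g] has_derivative_transform_within_open[OF _ S, of g D UNIV f] fg
    by auto
  then have "frechet_derivative f (at z) = frechet_derivative g (at z)"
    by (simp add: frechet_derivative_def)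
  then show "wirt a f z = wirt a g z" "wirt_bar a f z = wirt_bar a g z"
    by (simp_all add: wirt_def wirt_bar_def)
qed

text \<open>\<open>F\<close> is separated from \<open>exp (- f)\<close> so that the metric can have
  literally the form given in the theorem; the two have to agree on \<open>R\<close>, where the
  manifold lives.\<close>

locale potential_metric = potential +
  fixes F :: "real \<Rightarrow> real"
  assumes F: "\<And>x. x \<in> R \<Longrightarrow> F x = exp (- f x)"
begin

definition hM :: "('r::finite tot, 2) metric" where
  "hM = metric_scale (\<lambda>v. F (sq_norm k v)) (metric_pullback fst (metric_power h_FS k))"

lemma hM_tot_pt: "z \<in> DD \<Longrightarrow> hM i (tot_pt k i z) = exp (- Phi z)"
proof -
  assume z: "z \<in> DD"
  have "exp (- Phi z) = exp (- f (uu k z)) * exp (- ln (GG z)) ^ k"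
    by (simp add: Phi_def exp_add[symmetric] exp_of_nat_mult[symmetric] algebra_simps)
  also have "exp (- ln (GG z)) = 1 / GG z"
    using GG_pos[of z] by (simp add: exp_minus inverse_eq_divide)
  finally have "exp (- Phi z) = exp (- f (uu k z)) * (1 / GG z) ^ k" .
  moreover have "hM i (tot_pt k i z) = F (uu k z) * (1 / GG z) ^ k"
    by (simp add: hM_def metric_scale_def metric_pullback_def metric_power_def h_FS_def sq_norm_tot_pt)
      (simp add: tot_pt_def GG_def base_def)
  ultimately show ?thesis using z F by (simp add: DD_def)
qed

text \<open>The correction is \<open>k\<close> times the logarithm of \<open>|w|^2\<close>, which is
  pluriharmonic; therefore the Hessian transforms as a form although the potential is not a global
  function.\<close>

lemma Phi_switch:
  assumes "base z \<noteq> 0"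
  shows "Phi (switch k z) = Phi z - real k * ln ((cmod (base z))\<^sup>2)"
proof -
  have w: "0 < (cmod (base z))\<^sup>2" using assms by simp
  have "GG (switch k z) = 1 + (cmod (1 / base z))\<^sup>2"
    by (simp add: GG_def switch_def mk_pt_def)
  also have "\<dots> = GG z / (cmod (base z))\<^sup>2"
    using assms by (simp add: GG_def base_def norm_divide power_divide field_simps)
  finally have "ln (GG (switch k z)) = ln (GG z) - ln ((cmod (base z))\<^sup>2)"
    using GG_pos[of z] w by (simp only: ln_divide_pos)
  then show ?thesis unfolding Phi_def uu_switch[OF assms] by (simp add: right_diff_distrib)
qed

lemma hermitian_metric_hM: "hermitian_metric (MM :: ('r::finite tot, 2, 1 + 'r) cmanifold) LL hM"
  unfolding hermitian_metric_def
proof (intro conjI allI ballI)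
  fix i j :: 2 and q :: "'r tot"
  show "0 < hM i q" if "q \<in> cdom MM i"
    using that by (auto simp: cdom_MM hM_tot_pt)
  have "smooth_on (\<lambda>z. exp (- Phi z)) (DD :: (complex ^ (1 + 'r)) set)"
    by (rule smooth_on_compose_real[OF smooth_on_exp open_DD smooth_on_minus[OF open_DD smooth_on_Phi]]) simp
  then show "smooth_on (\<lambda>z. hM i (chart_inv MM i z)) (chart (MM :: ('r tot, 2, 1 + 'r) cmanifold) i ` cdom MM i)"
    unfolding image_cdom_MM by (subst smooth_on_cong[OF open_DD]) (simp_all add: chart_inv_MM hM_tot_pt)
  show "hM j q = (cmod (LL i j q))\<^sup>2 * hM i q" if q: "q \<in> cdom MM i \<inter> cdom MM j"
  proof (cases "j = i")
    case True
    then show ?thesis using q by (auto simp: cdom_MM LL_tot_pt)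
  next
    case False
    then have j: "j = i + 1" using two_cases by blast
    obtain z where z: "z \<in> DD" "q = tot_pt k i z" using q cdom_MM by blast
    have b: "base z \<noteq> 0" using q z cdom_MM_switch[OF z(1), of i] by (simp add: j)
    have "hM j q = exp (- Phi (switch k z))"
      unfolding z(2) j tot_pt_switch[OF b] by (rule hM_tot_pt[OF switch_DD[OF z(1) b]])
    also have "\<dots> = exp (ln ((cmod (base z))\<^sup>2)) ^ k * exp (- Phi z)"
      unfolding Phi_switch[OF b] by (simp add: exp_of_nat_mult[symmetric] exp_add[symmetric])
    also have "exp (ln ((cmod (base z))\<^sup>2)) = (cmod (base z))\<^sup>2" using b by simp
    also have "((cmod (base z))\<^sup>2) ^ k = (cmod (LL i j q))\<^sup>2"
      unfolding z(2) j LL_tot_pt norm_power by (simp add: power_mult[symmetric] mult.commute)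
    finally show ?thesis unfolding z(2) hM_tot_pt[OF z(1)] .
  qed
qed

definition omM :: "('r::finite tot, 2, 1 + 'r) form11" where
  "omM = chern_form MM hM"

lemma wirt_bar_Phi: "z \<in> DD \<Longrightarrow> wirt_bar b (\<lambda>z. of_real (Phi z)) z = dPhi_bar z b"
  by (rule has_wirt_eqs(2)[OF has_wirt_Phi])

lemma smooth_on_Phi_complex: "smooth_on (\<lambda>z. complex_of_real (Phi z)) (DD :: (complex ^ (1 + 'r::finite)) set)"
  by (rule smooth_on_compose_linear[OF bounded_linear_of_real open_DD smooth_on_Phi])

text \<open>Two descriptions with different uses: the explicit matrix gives positivity, the change
  of charts and the volume, while the expression as second derivatives of \<open>Phi\<close> gives
  smoothness and closedness.\<close>

lemma omM_tot_pt:
  assumes z: "z \<in> DD"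
  shows "omM i (tot_pt k i z) $ a $ b = of_real (1 / (2 * pi)) * HH z a b"
    and "omM i (tot_pt k i z) $ a $ b = of_real (1 / (2 * pi)) * wirt a (wirt_bar b (\<lambda>z. of_real (Phi z))) z"
proof -
  have 1: "wirt_bar b (\<lambda>z. of_real (ln (hM i (chart_inv MM i z)))) w = - dPhi_bar w b" if w: "w \<in> DD" for w
  proof -
    have "has_wirt (\<lambda>z. (- 1) * complex_of_real (Phi z)) (\<lambda>j. (- 1) * cnj (dPhi_bar w j)) (\<lambda>j. (- 1) * dPhi_bar w j) w"
      by (rule has_wirt_cong[OF has_wirt_mult[OF has_wirt_const has_wirt_Phi[OF w]]]) simp_all
    from has_wirt_eqs(2)[OF this]
    have "wirt_bar b (\<lambda>z. (- 1) * complex_of_real (Phi z)) w = - dPhi_bar w b" by simp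
    moreover have "wirt_bar b (\<lambda>z. of_real (ln (hM i (chart_inv MM i z)))) w = wirt_bar b (\<lambda>z. (- 1) * complex_of_real (Phi z)) w"
      by (rule has_wirt_local[OF open_DD w]) (simp add: chart_inv_MM hM_tot_pt)
    ultimately show ?thesis by simp
  qed
  have sm: "smooth_on (wirt_bar b (\<lambda>z. complex_of_real (Phi z))) (DD :: (complex ^ (1 + 'a)) set)"
    by (rule smooth_on_wirt_bar[OF open_DD smooth_on_Phi_complex])
  have h: "has_wirt (\<lambda>z. dPhi_bar z b) (\<lambda>j. wirt j (wirt_bar b (\<lambda>z. of_real (Phi z))) z) (\<lambda>j. wirt_bar j (wirt_bar b (\<lambda>z. of_real (Phi z))) z) z"
    by (rule has_wirt_transform[OF smooth_on_imp_has_wirt[OF sm z] open_DD z]) (rule wirt_bar_Phi)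
  have eq: "wirt a (wirt_bar b (\<lambda>z. of_real (Phi z))) z = HH z a b"
    using has_wirt_eqs(1)[OF h, of a] wirt_dPhi_bar[OF z, of a b] by simp
  have "has_wirt (\<lambda>z. (- 1) * dPhi_bar z b) (\<lambda>j. (- 1) * wirt j (wirt_bar b (\<lambda>z. of_real (Phi z))) z) (\<lambda>j. (- 1) * wirt_bar j (wirt_bar b (\<lambda>z. of_real (Phi z))) z) z"
    by (rule has_wirt_cong[OF has_wirt_mult[OF has_wirt_const h]]) simp_all
  from has_wirt_eqs(1)[OF this, of a]
  have "wirt a (\<lambda>z. (- 1) * dPhi_bar z b) z = - HH z a b" by (simp add: eq)
  moreover have "wirt a (wirt_bar b (\<lambda>z. of_real (ln (hM i (chart_inv MM i z))))) z = wirt a (\<lambda>z. (- 1) * dPhi_bar z b) z"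
    by (rule has_wirt_local[OF open_DD z]) (simp add: 1)
  ultimately show om: "omM i (tot_pt k i z) $ a $ b = of_real (1 / (2 * pi)) * HH z a b"
    by (simp add: omM_def chern_form_def chart_MM)
  show "omM i (tot_pt k i z) $ a $ b = of_real (1 / (2 * pi)) * wirt a (wirt_bar b (\<lambda>z. of_real (Phi z))) z"
    unfolding om eq ..
qed

lemma has_wirt_dPhi_bar:
  assumes z: "z \<in> DD"
  obtains B where "has_wirt (\<lambda>z. dPhi_bar z b) (\<lambda>a. HH z a b) B z"
proof -
  have sm: "smooth_on (wirt_bar b (\<lambda>z. complex_of_real (Phi z))) (DD :: (complex ^ (1 + 'a)) set)"
    by (rule smooth_on_wirt_bar[OF open_DD smooth_on_Phi_complex])
  have "has_wirt (\<lambda>z. dPhi_bar z b) (\<lambda>j. wirt j (wirt_bar b (\<lambda>z. of_real (Phi z))) z) (\<lambda>j. wirt_bar j (wirt_bar b (\<lambda>z. of_real (Phi z))) z) z"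
    by (rule has_wirt_transform[OF smooth_on_imp_has_wirt[OF sm z] open_DD z]) (rule wirt_bar_Phi)
  moreover from has_wirt_eqs(1)[OF this] have "wirt a (wirt_bar b (\<lambda>z. of_real (Phi z))) z = HH z a b" for a
    using wirt_dPhi_bar[OF z, of a b] by simp
  ultimately show thesis using that by simp
qed

text \<open>The antiholomorphic derivative of \<open>Phi_switch\<close>. The logarithm leaves
  \<open>k / cnj w\<close>, which the next holomorphic derivative annihilates.\<close>

lemma dPhi_bar_switch:
  assumes z: "z \<in> DD" and b: "base z \<noteq> 0"
  shows "dPhi_bar z c = (\<Sum>d\<in>UNIV. dPhi_bar (switch k z) d * cnj (sw_jac k z d c)) + of_nat k * (cnj (inverse (base z)) * (if c = Inl 1 then 1 else 0))"
proof -
  have 1: "has_wirt (\<lambda>z. of_real (Phi (switch k z))) (\<lambda>j. \<Sum>d\<in>UNIV. cnj (dPhi_bar (switch k z) d) * sw_jac k z d j)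
      (\<lambda>j. \<Sum>d\<in>UNIV. dPhi_bar (switch k z) d * cnj (sw_jac k z d j)) z"
    by (rule has_wirt_compose_holo[OF has_wirt_Phi[OF switch_DD[OF z b]] has_wirt_switch[OF b]])
  have 2: "has_wirt (\<lambda>z. of_real (ln ((cmod (base z))\<^sup>2))) (\<lambda>j. of_real (1 / (cmod (base z))\<^sup>2) * (if j = Inl 1 then cnj (base z) else 0))
     (\<lambda>j. of_real (1 / (cmod (base z))\<^sup>2) * (if j = Inl 1 then base z else 0)) z"
    unfolding base_def
    by (rule has_wirt_compose_real[OF has_wirt_norm_square DERIV_ln_divide]) (use b in \<open>simp add: base_def\<close>)
  have "has_wirt (\<lambda>z. of_real (Phi z)) (\<lambda>j. (\<Sum>d\<in>UNIV. cnj (dPhi_bar (switch k z) d) * sw_jac k z d j) + of_nat k * (of_real (1 / (cmod (base z))\<^sup>2) * (if j = Inl 1 then cnj (base z) else 0)))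
      (\<lambda>j. (\<Sum>d\<in>UNIV. dPhi_bar (switch k z) d * cnj (sw_jac k z d j)) + of_nat k * (of_real (1 / (cmod (base z))\<^sup>2) * (if j = Inl 1 then base z else 0))) z"
  proof (rule has_wirt_transform[OF _ open_compl_base])
    show "has_wirt (\<lambda>z. of_real (Phi (switch k z)) + of_nat k * of_real (ln ((cmod (base z))\<^sup>2)))
      (\<lambda>j. (\<Sum>d\<in>UNIV. cnj (dPhi_bar (switch k z) d) * sw_jac k z d j) + of_nat k * (of_real (1 / (cmod (base z))\<^sup>2) * (if j = Inl 1 then cnj (base z) else 0)))
      (\<lambda>j. (\<Sum>d\<in>UNIV. dPhi_bar (switch k z) d * cnj (sw_jac k z d j)) + of_nat k * (of_real (1 / (cmod (base z))\<^sup>2) * (if j = Inl 1 then base z else 0))) z"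
      by (rule has_wirt_cong[OF has_wirt_add[OF 1 has_wirt_mult[OF has_wirt_const 2]]]) simp_all
  qed (use b in \<open>simp_all add: Phi_switch\<close>)
  from has_wirt_eqs(2)[OF this, of c] wirt_bar_Phi[OF z, of c]
  have "dPhi_bar z c = (\<Sum>d\<in>UNIV. dPhi_bar (switch k z) d * cnj (sw_jac k z d c)) + of_nat k * (of_real (1 / (cmod (base z))\<^sup>2) * (if c = Inl 1 then base z else 0))"
    by simp
  moreover have "of_real (1 / (cmod (base z))\<^sup>2) * (if c = Inl 1 then base z else 0) = cnj (inverse (base z)) * (if c = Inl 1 then 1 else 0)"
  proof -
    have "of_real (1 / (cmod (base z))\<^sup>2) = 1 / (base z * cnj (base z))"
      unfolding complex_norm_square[symmetric] by simp
    then show ?thesis using b by (simp add: field_simps)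
  qed
  ultimately show ?thesis by (simp only:)
qed

text \<open>Differentiate \<open>dPhi_bar_switch\<close> once more: conjugated Jacobian entries pass
  through a holomorphic derivative, so what remains is the chain rule for \<open>dPhi_bar\<close> at
  the switched point. This is the transformation law demanded by \<open>smooth_form\<close>.\<close>

lemma HH_switch:
  assumes z: "z \<in> DD" and b: "base z \<noteq> 0"
  shows "HH z a c = (\<Sum>d\<in>UNIV. \<Sum>e\<in>UNIV. sw_jac k z d a * cnj (sw_jac k z e c) * HH (switch k z) d e)"
proof -
  have zS: "z \<in> DD \<inter> {z. base z \<noteq> 0}" using z b by simp
  have "\<forall>e. \<exists>B. has_wirt (\<lambda>z. dPhi_bar (switch k z) e) (\<lambda>j. \<Sum>d\<in>UNIV. HH (switch k z) d e * sw_jac k z d j) B z"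
  proof
    fix e
    obtain B where B: "has_wirt (\<lambda>z. dPhi_bar z e) (\<lambda>a. HH (switch k z) a e) B (switch k z)"
      by (rule has_wirt_dPhi_bar[OF switch_DD[OF z b]])
    show "\<exists>B. has_wirt (\<lambda>z. dPhi_bar (switch k z) e) (\<lambda>j. \<Sum>d\<in>UNIV. HH (switch k z) d e * sw_jac k z d j) B z"
      by (rule exI, rule has_wirt_compose_holo[OF B has_wirt_switch[OF b]])
  qed
  from choice[OF this] obtain B where "\<forall>e. has_wirt (\<lambda>z. dPhi_bar (switch k z) e) (\<lambda>j. \<Sum>d\<in>UNIV. HH (switch k z) d e * sw_jac k z d j) (B e) z" ..
  then have B: "has_wirt (\<lambda>z. dPhi_bar (switch k z) e) (\<lambda>j. \<Sum>d\<in>UNIV. HH (switch k z) d e * sw_jac k z d j) (B e) z" for e ..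
  have "\<forall>e. \<exists>A. has_wirt (\<lambda>z. sw_jac k z e c) A (\<lambda>_. 0) z"
  proof
    fix e
    obtain A where A: "has_wirt (\<lambda>z. sw_jac k z e c) A (\<lambda>_. 0) z" by (rule has_wirt_sw_jac[OF b])
    show "\<exists>A. has_wirt (\<lambda>z. sw_jac k z e c) A (\<lambda>_. 0) z" by (rule exI, rule A)
  qed
  from choice[OF this] obtain A where "\<forall>e. has_wirt (\<lambda>z. sw_jac k z e c) (A e) (\<lambda>_. 0) z" ..
  then have A: "has_wirt (\<lambda>z. sw_jac k z e c) (A e) (\<lambda>_. 0) z" for e ..
  note h = has_wirt_add[OF has_wirt_sum[OF finite_class.finite_UNIV, OF has_wirt_mult[OF B has_wirt_cnj[OF A]]]
      has_wirt_mult[OF has_wirt_const[of "of_nat k"] has_wirt_mult[OF has_wirt_cnj[OF has_wirt_base_inverse[OF b]] has_wirt_const[of "if c = Inl 1 then 1 else 0"]]]]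
  have "wirt a (\<lambda>z. dPhi_bar z c) z = wirt a (\<lambda>z. (\<Sum>d\<in>UNIV. dPhi_bar (switch k z) d * cnj (sw_jac k z d c)) + of_nat k * (cnj (inverse (base z)) * (if c = Inl 1 then 1 else 0))) z"
    by (rule has_wirt_local[OF open_overlap zS]) (rule dPhi_bar_switch, simp_all)
  also have "\<dots> = (\<Sum>e\<in>UNIV. (\<Sum>d\<in>UNIV. HH (switch k z) d e * sw_jac k z d a) * cnj (sw_jac k z e c))"
    unfolding has_wirt_eqs(1)[OF h] by simp
  also have "\<dots> = (\<Sum>e\<in>UNIV. \<Sum>d\<in>UNIV. sw_jac k z d a * cnj (sw_jac k z e c) * HH (switch k z) d e)"
    unfolding sum_distrib_right by (simp only: mult_ac)
  also have "\<dots> = (\<Sum>d\<in>UNIV. \<Sum>e\<in>UNIV. sw_jac k z d a * cnj (sw_jac k z e c) * HH (switch k z) d e)"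
    by (rule sum.swap)
  finally show ?thesis using wirt_dPhi_bar[OF z] by simp
qed

lemma positive_form_omM: "positive_form (MM :: ('r::finite tot, 2, 1 + 'r) cmanifold) omM"
  unfolding positive_form_def hermitian_form_def
proof (intro conjI allI ballI impI)
  fix i :: 2 and q :: "'r tot" and a b and v :: "complex ^ (1 + 'r)"
  assume "q \<in> cdom MM i"
  then obtain z where z: "z \<in> DD" "q = tot_pt k i z" using cdom_MM by blast
  show "omM i q $ b $ a = cnj (omM i q $ a $ b)"
    unfolding z(2) omM_tot_pt(1)[OF z(1)] by (subst HH_hermitian) simp
  assume "v \<noteq> 0"
  have "(\<Sum>a\<in>UNIV. \<Sum>b\<in>UNIV. omM i q $ a $ b * v $ a * cnj (v $ b))
    = of_real (1 / (2 * pi)) * (\<Sum>a\<in>UNIV. \<Sum>b\<in>UNIV. HH z a b * v $ a * cnj (v $ b))"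
    unfolding z(2) omM_tot_pt(1)[OF z(1)] sum_distrib_left by (simp only: mult_ac)
  then have "Re (\<Sum>a\<in>UNIV. \<Sum>b\<in>UNIV. omM i q $ a $ b * v $ a * cnj (v $ b))
    = 1 / (2 * pi) * Re (\<Sum>a\<in>UNIV. \<Sum>b\<in>UNIV. HH z a b * v $ a * cnj (v $ b))"
    by (simp only: times_complex.sel Re_complex_of_real Im_complex_of_real mult_zero_left diff_zero)
  then show "0 < Re (\<Sum>a\<in>UNIV. \<Sum>b\<in>UNIV. omM i q $ a $ b * v $ a * cnj (v $ b))"
    using HH_positive[OF z(1) \<open>v \<noteq> 0\<close>] by simp
qed

lemma wirt_cmult:
  assumes "smooth_on g S" "z \<in> S"
  shows "wirt c (\<lambda>z. t * g z) z = t * wirt c g z" "wirt_bar c (\<lambda>z. t * g z) z = t * wirt_bar c g z"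
  using has_wirt_eqs[OF has_wirt_mult[OF has_wirt_const smooth_on_imp_has_wirt[OF assms]]] by auto

lemma kaehler_form_omM: "kaehler_form (MM :: ('r::finite tot, 2, 1 + 'r) cmanifold) omM"
  unfolding kaehler_form_def smooth_form_def closed_form_def image_cdom_MM
proof (intro conjI allI ballI)
  fix i j :: 2 and a b c :: "1 + 'r" and q :: "'r tot" and z :: "complex ^ (1 + 'r)"
  let ?P = "\<lambda>z :: complex ^ (1 + 'r). complex_of_real (Phi z)"
  let ?t = "complex_of_real (1 / (2 * pi))"
  have sm: "smooth_on (wirt_bar b ?P) DD" "smooth_on (wirt a (wirt_bar b ?P)) DD" for a b
    by (intro smooth_on_wirt smooth_on_wirt_bar open_DD smooth_on_Phi_complex)+
  have om: "omM i (chart_inv MM i w) $ a $ b = ?t * wirt a (wirt_bar b ?P) w" if "w \<in> DD" for w a b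
    by (simp only: chart_inv_MM[OF that] omM_tot_pt(2)[OF that])
  show "smooth_on (\<lambda>z. omM i (chart_inv MM i z) $ a $ b) DD"
    using smooth_on_mult[OF open_DD smooth_on_const[OF open_DD] sm(2), of ?t a b]
    by (subst smooth_on_cong[OF open_DD om]) simp_all
  show "positive_form (MM :: ('r tot, 2, 1 + 'r) cmanifold) omM" by (rule positive_form_omM)
  {
    \<comment> \<open>Closedness: all coefficients are second derivatives of the single function
      \<open>Phi\<close>, and third Wirtinger derivatives may be taken in any order.\<close>
    assume z: "z \<in> DD"
    have w: "wirt c (\<lambda>z. omM i (chart_inv MM i z) $ a $ b) z = ?t * wirt c (wirt a (wirt_bar b ?P)) z"
      "wirt_bar c (\<lambda>z. omM i (chart_inv MM i z) $ a $ b) z = ?t * wirt_bar c (wirt a (wirt_bar b ?P)) z" for a b c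
    proof -
      show "wirt c (\<lambda>z. omM i (chart_inv MM i z) $ a $ b) z = ?t * wirt c (wirt a (wirt_bar b ?P)) z"
        by (rule trans[OF has_wirt_local(1)[OF open_DD z om] wirt_cmult(1)[OF sm(2) z]])
      show "wirt_bar c (\<lambda>z. omM i (chart_inv MM i z) $ a $ b) z = ?t * wirt_bar c (wirt a (wirt_bar b ?P)) z"
        by (rule trans[OF has_wirt_local(2)[OF open_DD z om] wirt_cmult(2)[OF sm(2) z]])
    qed
    show "wirt c (\<lambda>z. omM i (chart_inv MM i z) $ a $ b) z = wirt a (\<lambda>z. omM i (chart_inv MM i z) $ c $ b) z"
      unfolding w wirt_commute(1)[OF sm(1) open_DD z, of c a] ..
    have "wirt_bar c (wirt a (wirt_bar b ?P)) z = wirt a (wirt_bar c (wirt_bar b ?P)) z" for b c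
      by (rule wirt_commute(3)[OF sm(1) open_DD z])
    moreover have "wirt a (wirt_bar c (wirt_bar b ?P)) z = wirt a (wirt_bar b (wirt_bar c ?P)) z"
      by (rule has_wirt_local[OF open_DD z]) (rule wirt_commute(2)[OF smooth_on_Phi_complex open_DD])
    ultimately show "wirt_bar c (\<lambda>z. omM i (chart_inv MM i z) $ a $ b) z = wirt_bar b (\<lambda>z. omM i (chart_inv MM i z) $ a $ c) z"
      unfolding w by simp
  }
  assume q: "q \<in> cdom MM i \<inter> cdom MM j"
  then obtain z where z: "z \<in> DD" "q = tot_pt k i z" using cdom_MM by blast
  show "omM i q $ a $ b = (\<Sum>c\<in>UNIV. \<Sum>d\<in>UNIV. wirt a (\<lambda>z. chart MM j (chart_inv MM i z) $ c) (chart MM i q) *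
      cnj (wirt b (\<lambda>z. chart MM j (chart_inv MM i z) $ d) (chart MM i q)) * omM j q $ c $ d)"
  proof (cases "j = i")
    case True
    have "wirt a (\<lambda>z. chart MM i (chart_inv MM i z) $ c) z = (if a = c then 1 else 0)" for a c
    proof -
      have "wirt a (\<lambda>z. chart MM i (chart_inv MM i z) $ c) z = wirt a (\<lambda>z. z $ c) z"
        by (rule has_wirt_local[OF open_DD z(1)]) (simp add: chart_inv_MM chart_MM)
      then show ?thesis using has_wirt_eqs(1)[OF has_wirt_nth, of a c z] by simp
    qed
    then have "(\<Sum>c\<in>UNIV. \<Sum>d\<in>UNIV. wirt a (\<lambda>z. chart MM i (chart_inv MM i z) $ c) z *
      cnj (wirt b (\<lambda>z. chart MM i (chart_inv MM i z) $ d) z) * omM i q $ c $ d)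
      = (\<Sum>c\<in>UNIV. \<Sum>d\<in>UNIV. if d = b then (if c = a then omM i q $ c $ d else 0) else 0)"
      by (intro sum.cong refl) auto
    also have "\<dots> = omM i q $ a $ b" by simp
    finally show ?thesis unfolding True z(2) chart_MM ..
  next
    case False
    then have j: "j = i + 1" using two_cases by blast
    have bz: "base z \<noteq> 0" using q z cdom_MM_switch[OF z(1), of i] by (simp add: j)
    have J: "wirt a (\<lambda>z. chart MM (i + 1) (chart_inv MM i z) $ c) z = sw_jac k z c a" for a c
    proof -
      have "wirt a (\<lambda>z. chart MM (i + 1) (chart_inv MM i z) $ c) z = wirt a (\<lambda>z. switch k z $ c) z"
        by (rule has_wirt_local[OF open_overlap, of z]) (use z bz in \<open>simp_all add: chart_inv_MM chart_MM_switch\<close>)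
      then show ?thesis using has_wirt_eqs(1)[OF has_wirt_switch[OF bz]] by simp
    qed
    have o: "omM (i + 1) (tot_pt k i z) $ c $ d = ?t * HH (switch k z) c d" for c d
      unfolding tot_pt_switch[OF bz] by (rule omM_tot_pt(1)[OF switch_DD[OF z(1) bz]])
    show ?thesis
      unfolding j z(2) chart_MM J o omM_tot_pt(1)[OF z(1)] HH_switch[OF z(1) bz] sum_distrib_left by (simp only: mult_ac)
  qed
qed

theorem quantum_line_bundle_MM: "quantum_line_bundle (MM :: ('r::finite tot, 2, 1 + 'r) cmanifold) omM LL hM"
  unfolding quantum_line_bundle_def
  using complex_manifold_MM kaehler_form_omM holomorphic_line_bundle_LL hermitian_metric_hM positive_form_omM
  by (simp add: omM_def)

text \<open>Each of the \<open>1 + r\<close> rows brings a factor \<open>1 / (2 * pi)\<close> into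
  the determinant; the powers of 2 cancel against the one in \<open>vol_density\<close>.\<close>

lemma vol_density_omM:
  fixes z :: "complex ^ (1 + 'r::finite)"
  assumes z: "z \<in> DD"
  shows "vol_density omM i (tot_pt k i z) =
    real k * (1 + uu k z * f1 (uu k z)) / (GG z)\<^sup>2 * GG z ^ (k * CARD('r)) * f1 (uu k z) ^ (CARD('r) - 1) * g1 (uu k z) / pi ^ (1 + CARD('r))"
proof -
  let ?n = "CARD(1 + 'r)"
  have "omM i (tot_pt k i z) = (\<chi> a. of_real (1 / (2 * pi)) *s (\<chi> a b. HH z a b) $ a)"
    by (simp only: vec_eq_iff omM_tot_pt(1)[OF z] vec_lambda_beta vector_smult_component) simp
  then have "det (omM i (tot_pt k i z)) = of_real (1 / (2 * pi)) ^ ?n * det (\<chi> a b. HH z a b)"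
    by (simp only: det_rows_mul prod_constant vec_lambda_eta)
  then have "Re (det (omM i (tot_pt k i z))) = (1 / (2 * pi)) ^ ?n *
      (real k * (1 + uu k z * f1 (uu k z)) / (GG z)\<^sup>2 * GG z ^ (k * CARD('r)) * f1 (uu k z) ^ (CARD('r) - 1) * g1 (uu k z))"
    unfolding det_HH[OF z] by (simp only: of_real_power[symmetric] of_real_mult[symmetric] Re_complex_of_real)
  moreover have "?n = 1 + CARD('r)" by simp
  moreover have "(2::real) ^ n * ((1 / (2 * pi)) ^ n * X) = X / pi ^ n" for n X
  proof -
    have "(2::real) ^ n * ((1 / (2 * pi)) ^ n * X) = (2 * (1 / (2 * pi))) ^ n * X"
      by (simp only: power_mult_distrib mult.assoc)
    then show ?thesis by (simp add: power_one_over)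
  qed
  ultimately show ?thesis
    unfolding vol_density_eq_det by (simp only:)
qed

end

section \<open>The Bergman spaces\<close>

lemma holo_on_mult: "holo_on f S \<Longrightarrow> holo_on g S \<Longrightarrow> holo_on (\<lambda>z. f z * g z) S"
  unfolding holo_on_def
proof
  fix z assume "\<forall>z\<in>S. \<exists>D. (f has_derivative D) (at z) \<and> (\<forall>c v. D (c *s v) = c * D v)"
    "\<forall>z\<in>S. \<exists>D. (g has_derivative D) (at z) \<and> (\<forall>c v. D (c *s v) = c * D v)" "z \<in> S"
  then obtain D E where D: "(f has_derivative D) (at z)" "\<And>c v. D (c *s v) = c * D v"
    and E: "(g has_derivative E) (at z)" "\<And>c v. E (c *s v) = c * E v" by blast
  have "((\<lambda>z. f z * g z) has_derivative (\<lambda>v. f z * E v + D v * g z)) (at z)"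
    by (rule has_derivative_mult[OF D(1) E(1)])
  then show "\<exists>D. ((\<lambda>z. f z * g z) has_derivative D) (at z) \<and> (\<forall>c v. D (c *s v) = c * D v)"
    by (intro exI[of _ "\<lambda>v. f z * E v + D v * g z"]) (simp add: D(2) E(2) algebra_simps)
qed

lemma holo_on_diff: "holo_on f S \<Longrightarrow> holo_on g S \<Longrightarrow> holo_on (\<lambda>z. f z - g z) S"
  unfolding holo_on_def
proof
  fix z assume "\<forall>z\<in>S. \<exists>D. (f has_derivative D) (at z) \<and> (\<forall>c v. D (c *s v) = c * D v)"
    "\<forall>z\<in>S. \<exists>D. (g has_derivative D) (at z) \<and> (\<forall>c v. D (c *s v) = c * D v)" "z \<in> S"
  then obtain D E where D: "(f has_derivative D) (at z)" "\<And>c v. D (c *s v) = c * D v"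
    and E: "(g has_derivative E) (at z)" "\<And>c v. E (c *s v) = c * E v" by blast
  have "((\<lambda>z. f z - g z) has_derivative (\<lambda>v. D v - E v)) (at z)"
    by (rule has_derivative_diff[OF D(1) E(1)])
  then show "\<exists>D. ((\<lambda>z. f z - g z) has_derivative D) (at z) \<and> (\<forall>c v. D (c *s v) = c * D v)"
    by (intro exI[of _ "\<lambda>v. D v - E v"]) (simp add: D(2) E(2) algebra_simps)
qed

lemma holo_on_const: "holo_on (\<lambda>z. c) S"
  by (rule has_wirt_imp_holo_on) (rule has_wirt_const)

lemma holo_on_zmono: "holo_on (zmono \<alpha>) S"
proof -
  have "holo_on (\<lambda>z. z $ i ^ n) S" for i n
    by (induction n) (simp_all add: holo_on_const holo_on_mult has_wirt_imp_holo_on[OF has_wirt_nth])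
  then have "holo_on (\<lambda>z. \<Prod>i\<in>J. z $ i ^ \<alpha> i) S" for J
    by (induction J rule: infinite_finite_induct) (simp_all add: holo_on_const holo_on_mult)
  then show ?thesis unfolding zmono_def[abs_def] .
qed

text \<open>The exceptional set lies in the real hyperplane \<open>Re (z $ i) = 0\<close>, which is
  null. For the base coordinate it contains everything that chart \<open>c0\<close> misses.\<close>

lemma AE_nth_neq_0: "AE z in lborel. (z :: complex ^ 'n) $ i \<noteq> 0"
proof -
  let ?S = "{z :: complex ^ 'n. axis i 1 \<bullet> z = 0}"
  have "negligible ?S" by (rule negligible_hyperplane) (simp add: axis_eq_0_iff)
  moreover have "closed ?S" by (rule closed_hyperplane)
  ultimately have "?S \<in> null_sets lborel"
    by (simp add: negligible_iff_null_sets null_sets_completion_iff)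
  then show ?thesis
    by (rule AE_I') (auto simp: inner_axis')
qed

text \<open>Those factors of the volume density and of the \<open>m\<close>-th power of the metric
  that depend on the squared norm alone; the last bracket is \<open>g1\<close>.\<close>

definition fib_weight :: "real set \<Rightarrow> (real \<Rightarrow> real) \<Rightarrow> (real \<Rightarrow> real) \<Rightarrow> (real \<Rightarrow> real) \<Rightarrow> nat \<Rightarrow> nat \<Rightarrow> real \<Rightarrow> real" where
  "fib_weight R f f1 f2 m r t = indicator R t * (exp (- (real m * f t)) * (1 + t * f1 t) * f1 t ^ (r - 1) * (f1 t + t * f2 t))"

text \<open>The Lebesgue density only has to be integrated over the chart of the smaller index \<open>c0\<close>,
  which covers everything but a null set.  The numbers \<open>I d\<close> are the radial moments of the fibre
  weight, and \<open>kern\<close> is the generating function identity that makes the kernel constant.\<close>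

locale bergman = potential_metric k R f f1 f2 F
  for k :: nat and R f f1 f2 F +
  fixes ty :: "'r::finite itself" and m :: nat and I :: "nat \<Rightarrow> real" and C :: real and c0 :: 2
  assumes c0: "c0 < c0 + 1" and f2_cont: "continuous_on R f2"
    and I_pos: "\<And>d. 0 < I d"
    and moment: "\<And>d. (\<integral>\<^sup>+t. indicator {0..} t * (ennreal (t ^ (d + CARD('r) - 1)) * ennreal (fib_weight R f f1 f2 m CARD('r) t)) \<partial>lborel) = ennreal (I d)"
    and kern: "\<And>t. t \<in> R \<Longrightarrow> 0 \<le> t \<Longrightarrow>
      ((\<lambda>d. fact (d + CARD('r) - 1) * real (k * (m + d) + 1) / I d * t ^ d / fact d) has_sum C * exp (real m * f t)) UNIV"
    and C: "0 < C"
begin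

text \<open>The Lebesgue density of the squared norm in a chart, that is, the volume density times
  the \<open>m\<close>-th power of the metric (see \<open>W_eq\<close>), extended by 0 beyond
  \<open>DD\<close>.\<close>

definition W :: "complex ^ (1 + 'r) \<Rightarrow> real" where
  "W z = real k / pi ^ CARD(1 + 'r) * (GG z ^ (k * CARD('r)) / (GG z)\<^sup>2 / GG z ^ (k * m)) * fib_weight R f f1 f2 m CARD('r) (uu k z)"

lemma r_pos: "0 < CARD('r)"
  by (rule zero_less_card_finite)

lemma Gw_nonneg: "0 \<le> t \<Longrightarrow> 0 \<le> fib_weight R f f1 f2 m CARD('r) t"
  unfolding fib_weight_def
  by (cases "t \<in> R") (auto intro!: mult_nonneg_nonneg add_nonneg_nonneg zero_le_power less_imp_le[OF f1_pos] f2_nonneg)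

lemma f_cont: "continuous_on R f" "continuous_on R f1"
proof -
  show "continuous_on R f" by (intro continuous_at_imp_continuous_on ballI DERIV_isCont[OF f1])
  show "continuous_on R f1" by (intro continuous_at_imp_continuous_on ballI DERIV_isCont[OF f2])
qed

lemma Gw_measurable [measurable]: "fib_weight R f f1 f2 m CARD('r) \<in> borel_measurable borel"
proof -
  have "continuous_on R (\<lambda>t. exp (- (real m * f t)) * (1 + t * f1 t) * f1 t ^ (CARD('r) - 1) * (f1 t + t * f2 t))"
    by (intro continuous_intros f_cont f2_cont)
  then have "(\<lambda>t. indicator R t *\<^sub>R (exp (- (real m * f t)) * (1 + t * f1 t) * f1 t ^ (CARD('r) - 1) * (f1 t + t * f2 t))) \<in> borel_measurable borel"
    using R(1) by (intro borel_measurable_continuous_on_indicator) auto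
  then show ?thesis by (simp add: fib_weight_def[abs_def])
qed

lemma GG_measurable [measurable]: "GG \<in> borel_measurable borel"
  and uu_measurable [measurable]: "uu k \<in> borel_measurable borel"
  by (intro borel_measurable_continuous_onI continuous_on_GG continuous_on_uu)+

lemma W_measurable [measurable]: "W \<in> borel_measurable borel"
  unfolding W_def[abs_def] by measurable

lemma W_nonneg: "0 \<le> W z"
  unfolding W_def using GG_pos[of z] Gw_nonneg[OF uu_nonneg[of k z]]
  by (intro mult_nonneg_nonneg divide_nonneg_nonneg) auto

lemma W_outside: "z \<notin> DD \<Longrightarrow> W z = 0"
  by (simp add: W_def fib_weight_def DD_def)

lemma radial_W: "radial W"
  unfolding radial_def W_def uu_def GG_def by auto

lemma W_eq:
  assumes z: "z \<in> DD"
  shows "W z = vol_density omM i (tot_pt k i z) * hM i (tot_pt k i z) ^ m"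
proof -
  have u: "uu k z \<in> R" using z by (simp add: DD_def)
  have "hM i (tot_pt k i z) ^ m = exp (- (real m * f (uu k z))) * exp (- ln (GG z)) ^ (k * m)"
    unfolding hM_tot_pt[OF z] Phi_def
    by (simp add: exp_of_nat_mult[symmetric] exp_add[symmetric] algebra_simps)
  also have "exp (- ln (GG z)) = 1 / GG z"
    using GG_pos[of z] by (simp add: exp_minus inverse_eq_divide)
  finally have h: "hM i (tot_pt k i z) ^ m = exp (- (real m * f (uu k z))) * (1 / GG z ^ (k * m))"
    by (simp add: power_one_over)
  show ?thesis
    unfolding vol_density_omM[OF z] h W_def fib_weight_def g1_def using u by (simp add: mult_ac)
qed

text \<open>\<open>uu\<close> increases with every modulus, and \<open>R\<close> is closed
  downwards.\<close>

lemma complete_reinhardt_DD: "complete_reinhardt (DD :: (complex ^ (1 + 'r)) set)"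
  unfolding complete_reinhardt_def
proof (intro ballI allI impI)
  fix z w :: "complex ^ (1 + 'r)"
  assume z: "z \<in> DD" and le: "\<forall>i. cmod (w $ i) \<le> cmod (z $ i)"
  have "uu k w \<le> uu k z"
    unfolding uu_def using le by (intro mult_mono sum_mono power_mono add_left_mono sum_nonneg zero_le_power add_nonneg_nonneg) auto
  then show "w \<in> DD" using z R_down by (auto simp: DD_def)
qed

definition deg :: "(1 + 'r \<Rightarrow> nat) \<Rightarrow> nat" where "deg \<alpha> = (\<Sum>b\<in>UNIV. \<alpha> (Inr b))"

text \<open>The coefficient of a fibre monomial of degree \<open>d\<close> in a section of
  \<open>Lm\<close> is a section of the bundle of degree \<open>k * (m + d)\<close> on the
  projective line; \<open>KK\<close> is this degree, and it bounds the base exponent of global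
  sections.\<close>

definition KK :: "(1 + 'r \<Rightarrow> nat) \<Rightarrow> nat" where "KK \<alpha> = k * (m + deg \<alpha>)"

text \<open>The squared norm of the monomial with exponent \<open>\<alpha>\<close>: a Dirichlet integral over the fibre
  times a Beta integral over the base.  The monomials with \<open>\<alpha> (Inl 1) > KK \<alpha>\<close> are not square
  integrable, and they are those that do not extend to the other chart.\<close>

definition NN :: "(1 + 'r \<Rightarrow> nat) \<Rightarrow> real" where
  "NN \<alpha> = real k * ((\<Prod>b\<in>UNIV. fact (\<alpha> (Inr b))) / fact (deg \<alpha> + CARD('r) - 1)) * I (deg \<alpha>) *
     (fact (\<alpha> (Inl 1)) * fact (KK \<alpha> - \<alpha> (Inl 1)) / fact (KK \<alpha> + 1))"

definition AA :: "(1 + 'r \<Rightarrow> nat) set" where "AA = {\<alpha>. \<alpha> (Inl 1) \<le> KK \<alpha>}"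

lemma NN_pos: "0 < NN \<alpha>"
  unfolding NN_def using k I_pos by (intro mult_pos_pos divide_pos_pos prod_pos) auto

lemma UNIV_minus_Inl: "UNIV - {Inl 1} = range (Inr :: 'r \<Rightarrow> 1 + 'r)"
proof -
  have "x \<in> range Inr \<or> x = Inl 1" for x :: "1 + 'r"
    by (cases x) auto
  then show ?thesis by auto
qed

text \<open>After separation the fibre gives the moment \<open>I\<close> and the base gives a Beta
  integral, which converges exactly when the base exponent is at most
  \<open>KK \<alpha>\<close>.\<close>

lemma nn_integral_zmono_W:
  "(\<integral>\<^sup>+z. ennreal ((cmod (zmono \<alpha> z))\<^sup>2 * W z) \<partial>lborel) = (if \<alpha> \<in> AA then ennreal (NN \<alpha>) else \<infinity>)"
proof -
  let ?d = "deg \<alpha>" and ?r = "CARD('r)" and ?j = "\<alpha> (Inl 1)" and ?K = "KK \<alpha>"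
  let ?c = "real k / pi ^ CARD(1 + 'r)"
  define A where "A x = ennreal (?c * ((1 + x) ^ (k * ?r) / (1 + x)\<^sup>2 / (1 + x) ^ (k * m)))" for x :: real
  define n where "n = ?d + ?r - 1"
  have J: "(\<Sum>a\<in>range Inr. g a) = (\<Sum>b\<in>UNIV. g (Inr b))" "(\<Prod>a\<in>range Inr. h a) = (\<Prod>b\<in>UNIV. h (Inr b))"
    for g h :: "1 + 'r \<Rightarrow> 'x::comm_semiring_1"
    by (simp_all add: sum.reindex prod.reindex)
  have n: "n = (\<Sum>a\<in>range Inr. \<alpha> a + 1) - 1"
    by (simp add: J n_def deg_def sum_Suc card_image)
  have [measurable]: "A \<in> borel_measurable borel" unfolding A_def[abs_def] by measurable
  have "(\<integral>\<^sup>+z. ennreal ((cmod (zmono \<alpha> z))\<^sup>2 * W z) \<partial>lborel)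
    = (\<integral>\<^sup>+z. ennreal ((cmod (zmono \<alpha> z))\<^sup>2) * (A ((cmod (z $ Inl 1))\<^sup>2) *
        ennreal (fib_weight R f f1 f2 m CARD('r) ((\<Sum>a\<in>range Inr. (cmod (z $ a))\<^sup>2) * (1 + (cmod (z $ Inl 1))\<^sup>2) ^ k))) \<partial>lborel)"
  proof (rule nn_integral_cong)
    fix z :: "complex ^ (1 + 'r)"
    have u: "(\<Sum>a\<in>range Inr. (cmod (z $ a))\<^sup>2) * (1 + (cmod (z $ Inl 1))\<^sup>2) ^ k = uu k z"
      by (simp add: J uu_def)
    have p: "0 \<le> ?c * (GG z ^ (k * ?r) / (GG z)\<^sup>2 / GG z ^ (k * m))" using GG_pos[of z] by simp
    have gen: "ennreal (a * (p * q)) = ennreal a * (ennreal p * ennreal q)" if "0 \<le> a" "0 \<le> p" "0 \<le> q" for a p q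
      using that by (simp add: ennreal_mult)
    show "ennreal ((cmod (zmono \<alpha> z))\<^sup>2 * W z) = ennreal ((cmod (zmono \<alpha> z))\<^sup>2) * (A ((cmod (z $ Inl 1))\<^sup>2) *
        ennreal (fib_weight R f f1 f2 m CARD('r) ((\<Sum>a\<in>range Inr. (cmod (z $ a))\<^sup>2) * (1 + (cmod (z $ Inl 1))\<^sup>2) ^ k)))"
      unfolding u unfolding A_def GG_def[symmetric] W_def by (rule gen[OF zero_le_power2 p Gw_nonneg[OF uu_nonneg[of k z]]])
  qed
  also have "\<dots> = ennreal (pi ^ CARD(1 + 'r) * (\<Prod>a\<in>range Inr. fact (\<alpha> a)) / fact n)
      * (\<integral>\<^sup>+x. indicator {0..} x * (ennreal (x ^ ?j / ((1 + x) ^ k) ^ (n + 1)) * A x) \<partial>lborel)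
      * (\<integral>\<^sup>+t. indicator {0..} t * (ennreal (t ^ n) * ennreal (fib_weight R f f1 f2 m CARD('r) t)) \<partial>lborel)"
    by (rule nn_integral_zmono_weight[where \<phi> = "\<lambda>x. (1 + x) ^ k" and G = "\<lambda>t. ennreal (fib_weight R f f1 f2 m CARD('r) t)"])
       (auto simp: UNIV_minus_Inl n)
  also have "(\<integral>\<^sup>+t. indicator {0..} t * (ennreal (t ^ n) * ennreal (fib_weight R f f1 f2 m CARD('r) t)) \<partial>lborel) = ennreal (I ?d)"
    unfolding n_def by (rule moment)
  also have "(\<integral>\<^sup>+x. indicator {0..} x * (ennreal (x ^ ?j / ((1 + x) ^ k) ^ (n + 1)) * A x) \<partial>lborel)
    = (\<integral>\<^sup>+x. ennreal ?c * (indicator {0..} x * ennreal (x ^ ?j / (1 + x) ^ (?K + 2))) \<partial>lborel)"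
  proof (rule nn_integral_cong)
    fix x :: real
    show "indicator {0..} x * (ennreal (x ^ ?j / ((1 + x) ^ k) ^ (n + 1)) * A x) = ennreal ?c * (indicator {0..} x * ennreal (x ^ ?j / (1 + x) ^ (?K + 2)))"
    proof (cases "0 \<le> x")
      case True
      then have y: "0 < 1 + x" by simp
      \<comment> \<open>The count of exponents of \<open>1 + x\<close>: rescaling the fibre costs
        \<open>k * (d + r)\<close>, the metric costs \<open>k * m\<close>, the volume contributes
        \<open>k * r - 2\<close>; altogether \<open>- (KK \<alpha> + 2)\<close>.\<close>
      have e: "k * (n + 1) + 2 + k * m = k * ?r + (?K + 2)"
        using r_pos by (simp add: n_def KK_def algebra_simps)
      have "x ^ ?j / ((1 + x) ^ k) ^ (n + 1) * (?c * ((1 + x) ^ (k * ?r) / (1 + x)\<^sup>2 / (1 + x) ^ (k * m)))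
        = ?c * (x ^ ?j * (1 + x) ^ (k * ?r) / (1 + x) ^ (k * (n + 1) + 2 + k * m))"
      proof -
        have "a / P * (c * (A / S / B)) = c * (a * A / (P * S * B))" for a P c A S B :: real by (simp add: mult_ac)
        then show ?thesis unfolding power_add[of _ "k * (n + 1) + 2"] power_add[of _ "k * (n + 1)"] power_mult[of _ k "n + 1"] .
      qed
      also have "\<dots> = ?c * (x ^ ?j / (1 + x) ^ (?K + 2))"
        unfolding e power_add[of "1 + x" "k * ?r"] using y by simp
      finally have e: "x ^ ?j / ((1 + x) ^ k) ^ (n + 1) * (?c * ((1 + x) ^ (k * ?r) / (1 + x)\<^sup>2 / (1 + x) ^ (k * m)))
        = ?c * (x ^ ?j / (1 + x) ^ (?K + 2))" .
      have p: "0 \<le> x ^ ?j / ((1 + x) ^ k) ^ (n + 1)" "0 \<le> ?c" using True by simp_all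
      have "indicator {0..} x = (1 :: ennreal)" using True by simp
      then show ?thesis
        unfolding A_def by (simp only: mult_1_left ennreal_mult'[OF p(1), symmetric] e) (rule ennreal_mult'[OF p(2)])
    qed simp
  qed
  also have "\<dots> = ennreal ?c * (\<integral>\<^sup>+x. indicator {0..} x * ennreal (x ^ ?j / (1 + x) ^ (?K + 2)) \<partial>lborel)"
    by (rule nn_integral_cmult) measurable
  also have "(\<Prod>a\<in>range Inr. fact (\<alpha> a)) = (\<Prod>b\<in>UNIV. fact (\<alpha> (Inr b)) :: real)" by (rule J)
  finally have *: "(\<integral>\<^sup>+z. ennreal ((cmod (zmono \<alpha> z))\<^sup>2 * W z) \<partial>lborel)
    = ennreal (pi ^ CARD(1 + 'r) * (\<Prod>b\<in>UNIV. fact (\<alpha> (Inr b))) / fact n) *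
      (ennreal ?c * (\<integral>\<^sup>+x. indicator {0..} x * ennreal (x ^ ?j / (1 + x) ^ (?K + 2)) \<partial>lborel)) * ennreal (I ?d)" .
  have pos: "0 < pi ^ CARD(1 + 'r) * (\<Prod>b\<in>UNIV. fact (\<alpha> (Inr b))) / fact n" "0 < ?c"
    using k by (auto intro!: prod_pos mult_pos_pos divide_pos_pos)
  show ?thesis
  proof (cases "\<alpha> \<in> AA")
    case True
    let ?B = "fact ?j * fact (?K - ?j) / fact (?K + 1) :: real"
    have "has_bochner_integral lborel (\<lambda>x::real. indicator {0..} x * (x ^ ?j / (1 + x) ^ (?K + 2))) ?B"
      using True by (intro has_bochner_integral_beta_prime) (simp add: AA_def)
    then have "(\<integral>\<^sup>+x. ennreal (indicator {0..} x * (x ^ ?j / (1 + x) ^ (?K + 2))) \<partial>lborel) = ennreal ?B"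
      by (subst nn_integral_eq_integral) (auto simp: has_bochner_integral_iff split: split_indicator)
    moreover have "(\<integral>\<^sup>+x. ennreal (indicator {0..} x * (x ^ ?j / (1 + x) ^ (?K + 2))) \<partial>lborel)
       = (\<integral>\<^sup>+x. indicator {0..} x * ennreal (x ^ ?j / (1 + x) ^ (?K + 2)) \<partial>lborel)"
      by (rule nn_integral_cong) (auto split: split_indicator)
    ultimately have "(\<integral>\<^sup>+x. indicator {0..} x * ennreal (x ^ ?j / (1 + x) ^ (?K + 2)) \<partial>lborel) = ennreal ?B" by simp
    then have "(\<integral>\<^sup>+z. ennreal ((cmod (zmono \<alpha> z))\<^sup>2 * W z) \<partial>lborel)
      = ennreal (pi ^ CARD(1 + 'r) * (\<Prod>b\<in>UNIV. fact (\<alpha> (Inr b))) / fact n * (?c * ?B) * I ?d)"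
      unfolding * using pos I_pos[of ?d] by (simp only: ennreal_mult'[symmetric] ennreal_mult''[symmetric] less_imp_le mult_nonneg_nonneg)
    also have "pi ^ CARD(1 + 'r) * (\<Prod>b\<in>UNIV. fact (\<alpha> (Inr b))) / fact n * (?c * ?B) * I ?d = NN \<alpha>"
    proof -
      have "p * x / y * (q / p * b) * i = q * (x / y) * i * b" if "p \<noteq> 0" for p x y q b i :: real
        using that by simp
      from this[of "pi ^ CARD(1 + 'r)"] show ?thesis unfolding NN_def n_def by simp
    qed
    finally show ?thesis using True by simp
  next
    case False
    then have "?K < ?j" by (simp add: AA_def)
    then show ?thesis
      unfolding * nn_integral_beta_prime_infinite[OF \<open>?K < ?j\<close>] using False pos I_pos[of ?d] k
      by (simp add: ennreal_mult_eq_top_iff ennreal_top_mult ennreal_mult_top del: times_divide_eq_right)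
  qed
qed

section \<open>Sections and their norms in the chart \<open>c0\<close>\<close>

abbreviation X :: "('r tot, 2, 1 + 'r) cmanifold" where "X \<equiv> MM"

abbreviation Lm :: "('r tot, 2) line_bundle" where "Lm \<equiv> bundle_power LL m"

abbreviation "Fib \<equiv> fibre X Lm"

abbreviation hm :: "('r tot, 2) metric" where "hm \<equiv> metric_power hM m"

abbreviation Dom :: "(complex ^ (1 + 'r)) set" where "Dom \<equiv> DD"

abbreviation "vol_om \<equiv> (omM :: ('r tot, 2, 1 + 'r) form11)"

abbreviation Bsp :: "('r tot \<Rightarrow> 2 \<Rightarrow> complex) set" where "Bsp \<equiv> bergman_space X omM LL hM m"

text \<open>The constant monomial has exponent 0 and belongs to \<open>AA\<close>, so its squared
  norm, the total mass of \<open>W\<close>, is finite.\<close>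

lemma W_integrable: "integrable lborel W"
proof (rule integrableI_nonneg)
  have "(\<integral>\<^sup>+z. ennreal (W z) \<partial>lborel) = (\<integral>\<^sup>+z. ennreal ((cmod (zmono (\<lambda>_. 0) z))\<^sup>2 * W z) \<partial>lborel)"
    by (simp add: zmono_def)
  also have "\<dots> < \<infinity>"
    unfolding nn_integral_zmono_W by (simp add: AA_def)
  finally show "(\<integral>\<^sup>+z. ennreal (W z) \<partial>lborel) < \<infinity>" .
qed (simp_all add: W_nonneg)

text \<open>\<open>herm\<close> evaluates in an arbitrarily chosen trivialization; the transition
  factors of the two fibre coordinates cancel against that of the metric.\<close>

lemma herm_eq:
  assumes q: "q \<in> cdom X i" and x: "x \<in> Fib q" and y: "y \<in> Fib q"
  shows "herm X hm q x y = of_real (hM i q ^ m) * x i * cnj (y i)"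
proof -
  define j where "j = (SOME i. q \<in> cdom X i)"
  have qj: "q \<in> cdom X j" unfolding j_def using q by (rule someI)
  have h: "hM j q = (cmod (LL i j q))\<^sup>2 * hM i q"
    using hermitian_metric_hM q qj unfolding hermitian_metric_def by blast
  have e: "x i = LL i j q ^ m * x j" "y i = LL i j q ^ m * y j"
    using x y q qj unfolding fibre_def bundle_power_def by blast+
  have "herm X hm q x y = of_real (hM j q ^ m) * x j * cnj (y j)"
    unfolding herm_def metric_power_def j_def[symmetric] Let_def ..
  also have "of_real (hM j q ^ m) = (LL i j q * cnj (LL i j q)) ^ m * of_real (hM i q ^ m)"
    unfolding h by (simp only: of_real_power of_real_mult power_mult_distrib complex_norm_square[symmetric])
  finally show ?thesis unfolding e by (simp add: power_mult_distrib mult_ac)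
qed

lemma herm_self:
  assumes q: "q \<in> cdom X i" and x: "x \<in> Fib q"
  shows "herm X hm q x x = of_real (hM i q ^ m * (cmod (x i))\<^sup>2)"
  unfolding herm_eq[OF q x x] by (simp only: of_real_mult complex_norm_square mult.assoc)

lemma tot_pt_cdom_MM: "z \<in> Dom \<Longrightarrow> tot_pt k i z \<in> cdom X i"
  using cdom_MM by blast

lemma section_fibre: "holomorphic_section X Lm s \<Longrightarrow> s q \<in> Fib q"
  unfolding holomorphic_section_def by blast

lemma section_holo: "holomorphic_section X Lm s \<Longrightarrow> holo_on (\<lambda>z. s (tot_pt k i z) i) Dom"
  unfolding holomorphic_section_def image_cdom_MM
  by (elim conjE allE[of _ i], rule holo_on_cong[OF open_DD]) (simp_all add: chart_inv_MM)

lemma piece_image: "chart X c0 ` piece X c0 = Dom" "chart X (c0 + 1) ` piece X (c0 + 1) \<subseteq> Dom \<inter> {z. base z = 0}"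
proof -
  have "\<not> x < c0" for x using two_cases[of x c0] c0 by (metis order_less_asym)
  moreover have "x < c0 + 1 \<longleftrightarrow> x = c0" for x using two_cases[of x c0] c0 by auto
  ultimately have a: "{..<c0} = {}" "{..<c0 + 1} = {c0}" by auto
  show "chart X c0 ` piece X c0 = Dom"
    by (simp add: piece_def a image_cdom_MM)
  have c: "c0 + 1 + 1 = c0" using two_cases[of "c0 + 1 + 1" c0] by auto
  show "chart X (c0 + 1) ` piece X (c0 + 1) \<subseteq> Dom \<inter> {z. base z = 0}"
  proof
    fix z assume "z \<in> chart X (c0 + 1) ` piece X (c0 + 1)"
    then obtain v where v: "v \<in> cdom X (c0 + 1)" "v \<notin> cdom X c0" "z = chart X (c0 + 1) v"
      by (auto simp: piece_def a)
    from v(1) obtain w where w: "w \<in> Dom" "v = tot_pt k (c0 + 1) w" using cdom_MM by blast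
    have "z = w" unfolding v(3) w(2) by (rule chart_MM)
    moreover have "base w = 0" using cdom_MM_switch[OF w(1), of "c0 + 1"] v(2) unfolding w(2) c by blast
    ultimately show "z \<in> Dom \<inter> {z. base z = 0}" using w(1) by blast
  qed
qed

definition coord :: "2 \<Rightarrow> ('r tot \<Rightarrow> 2 \<Rightarrow> complex) \<Rightarrow> complex ^ (1 + 'r) \<Rightarrow> complex" where
  "coord i s z = indicator Dom z * s (tot_pt k i z) i"

text \<open>Moving the square root of the weight into the function embeds sections isometrically
  into square integrable functions for plain Lebesgue measure, which is the setting of
  \<open>kernel_independent_of_basis\<close>.\<close>

definition rep :: "('r tot \<Rightarrow> 2 \<Rightarrow> complex) \<Rightarrow> complex ^ (1 + 'r) \<Rightarrow> complex" where
  "rep s z = of_real (sqrt (W z)) * coord c0 s z"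

lemma coord_measurable [measurable]:
  assumes "holomorphic_section X Lm s"
  shows "coord i s \<in> borel_measurable borel"
proof -
  have "(\<lambda>z. indicator Dom z *\<^sub>R s (tot_pt k i z) i) \<in> borel_measurable borel"
    by (intro borel_measurable_continuous_on_indicator holo_on_imp_continuous_on section_holo assms borel_open open_DD)
  then show ?thesis unfolding coord_def[abs_def] by (simp add: scaleR_conv_of_real of_real_indicator)
qed

lemma rep_measurable [measurable]:
  assumes [measurable]: "holomorphic_section X Lm s"
  shows "rep s \<in> borel_measurable borel"
  unfolding rep_def[abs_def] by measurable

lemma cmod_rep: "(cmod (rep s z))\<^sup>2 = (cmod (coord c0 s z))\<^sup>2 * W z"
  unfolding rep_def by (simp add: norm_mult power_mult_distrib W_nonneg)

lemma vol_herm: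
  assumes s: "holomorphic_section X Lm s" and t: "holomorphic_section X Lm t" and z: "z \<in> Dom"
  shows "of_real (vol_density vol_om i (chart_inv X i z)) * herm X hm (chart_inv X i z) (s (chart_inv X i z)) (t (chart_inv X i z))
    = of_real (W z) * coord i s z * cnj (coord i t z)"
proof -
  let ?q = "tot_pt k i z"
  have "herm X hm ?q (s ?q) (t ?q) = of_real (hM i ?q ^ m) * s ?q i * cnj (t ?q i)"
    by (rule herm_eq[OF tot_pt_cdom_MM[OF z] section_fibre[OF s] section_fibre[OF t]])
  then show ?thesis using z unfolding chart_inv_MM[OF z] W_eq[OF z, of i] coord_def by simp
qed

lemma AE_base: "AE z in lborel. z \<notin> chart X (c0 + 1) ` piece X (c0 + 1)"
  using AE_nth_neq_0[of "Inl 1"]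
proof eventually_elim
  fix z :: "complex ^ (1 + 'r)" assume "z $ Inl 1 \<noteq> 0"
  then show "z \<notin> chart X (c0 + 1) ` piece X (c0 + 1)" using piece_image(2) by (auto simp: base_def)
qed

text \<open>The piece in the other chart lies in the null set \<open>base z = 0\<close>, so only
  chart \<open>c0\<close> contributes.\<close>

lemma L2_inner_rep:
  assumes s: "holomorphic_section X Lm s" and t: "holomorphic_section X Lm t"
  shows "L2_inner X omM hm s t = (\<integral>z. rep s z * cnj (rep t z) \<partial>lborel)"
proof -
  let ?g = "\<lambda>i z. of_real (vol_density vol_om i (chart_inv X i z)) * herm X hm (chart_inv X i z) (s (chart_inv X i z)) (t (chart_inv X i z))"
  let ?I = "\<lambda>i. set_lebesgue_integral lborel (chart X i ` piece X i) (?g i)"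
  have "?I (c0 + 1) = 0"
    unfolding set_lebesgue_integral_def
    by (rule integral_eq_zero_AE) (use AE_base in eventually_elim, simp)
  moreover have "?I c0 = (\<integral>z. rep s z * cnj (rep t z) \<partial>lborel)"
    unfolding set_lebesgue_integral_def
  proof (rule Bochner_Integration.integral_cong[OF refl])
    fix z
    show "indicator (chart X c0 ` piece X c0) z *\<^sub>R ?g c0 z = rep s z * cnj (rep t z)"
    proof (cases "z \<in> Dom")
      case True
      have "rep s z * cnj (rep t z) = of_real (sqrt (W z) * sqrt (W z)) * (coord c0 s z * cnj (coord c0 t z))"
        by (simp only: rep_def complex_cnj_mult complex_cnj_complex_of_real of_real_mult mult_ac)
      also have "sqrt (W z) * sqrt (W z) = W z" using W_nonneg by simp
      finally have "of_real (W z) * coord c0 s z * cnj (coord c0 t z) = rep s z * cnj (rep t z)"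
        by (simp only: mult.assoc)
      then show ?thesis using True vol_herm[OF s t True, of c0] by (simp add: piece_image)
    qed (simp add: piece_image rep_def coord_def)
  qed
  moreover have "c0 \<noteq> c0 + 1" using c0 by auto
  ultimately show ?thesis
    unfolding L2_inner_def vol_integral_def two_UNIV[of c0] by simp
qed

lemma bergman_iff: "s \<in> Bsp \<longleftrightarrow> holomorphic_section X Lm s \<and> integrable lborel (\<lambda>z. (cmod (rep s z))\<^sup>2)"
proof (cases "holomorphic_section X Lm s")
  case s: True
  let ?g = "\<lambda>i z. of_real (vol_density vol_om i (chart_inv X i z)) * herm X hm (chart_inv X i z) (s (chart_inv X i z)) (s (chart_inv X i z))"
  let ?P = "\<lambda>i. chart X i ` piece X i"
  have g: "?g i z = of_real (W z * (cmod (coord i s z))\<^sup>2)" if "z \<in> Dom" for i z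
    unfolding vol_herm[OF s s that] by (simp only: of_real_mult complex_norm_square mult.assoc)
  have [measurable]: "Dom \<in> sets borel" by (rule borel_open[OF open_DD])
  have [measurable]: "coord i s \<in> borel_measurable borel" for i by (rule coord_measurable[OF s])
  have "set_integrable lborel (?P c0) (?g c0) \<longleftrightarrow> integrable lborel (\<lambda>z. complex_of_real ((cmod (rep s z))\<^sup>2))"
    unfolding set_integrable_def
  proof (rule Bochner_Integration.integrable_cong[OF refl])
    fix z
    show "indicator (?P c0) z *\<^sub>R ?g c0 z = complex_of_real ((cmod (rep s z))\<^sup>2)"
      using g[of z c0] unfolding cmod_rep piece_image by (cases "z \<in> Dom") (simp_all add: coord_def)
  qed
  then have "set_integrable lborel (?P c0) (?g c0) \<longleftrightarrow> integrable lborel (\<lambda>z. (cmod (rep s z))\<^sup>2)"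
    by (simp only: complex_of_real_integrable_eq)
  moreover have "set_integrable lborel (?P (c0 + 1)) (?g (c0 + 1))"
  proof -
    \<comment> \<open>Integrability over a null piece still includes measurability, so the piece is
      identified exactly and not merely enclosed in a null set.\<close>
    have e: "?P (c0 + 1) = Dom \<inter> {z. base z = 0}"
    proof
      show "Dom \<inter> {z. base z = 0} \<subseteq> ?P (c0 + 1)"
      proof
        fix z assume z: "z \<in> Dom \<inter> {z. base z = 0}"
        have c: "c0 + 1 + 1 = c0" using two_cases[of "c0 + 1 + 1" c0] by auto
        have "x < c0 + 1 \<longleftrightarrow> x = c0" for x using two_cases[of x c0] c0 by auto
        then have "{..<c0 + 1} = {c0}" by auto
        then have "tot_pt k (c0 + 1) z \<in> piece X (c0 + 1)"
          using z tot_pt_cdom_MM[of z "c0 + 1"] cdom_MM_switch[of z "c0 + 1", unfolded c] by (auto simp: piece_def)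
        then show "z \<in> ?P (c0 + 1)" by (rule rev_image_eqI) (simp add: chart_MM)
      qed
    qed (rule piece_image(2))
    have "integrable lborel (\<lambda>z. indicator (Dom \<inter> {z. base z = 0}) z *\<^sub>R complex_of_real (W z * (cmod (coord (c0 + 1) s z))\<^sup>2))"
    proof (rule integrable_cong_AE_imp)
      have "closed {z :: complex ^ (1 + 'r). base z = 0}"
        unfolding base_def by (intro closed_Collect_eq continuous_intros)
      then have [measurable]: "{z :: complex ^ (1 + 'r). base z = 0} \<in> sets borel" by simp
      show "(\<lambda>z. indicator (Dom \<inter> {z. base z = 0}) z *\<^sub>R complex_of_real (W z * (cmod (coord (c0 + 1) s z))\<^sup>2)) \<in> borel_measurable lborel"
        by measurable
      show "AE z in lborel. 0 = indicator (Dom \<inter> {z. base z = 0}) z *\<^sub>R complex_of_real (W z * (cmod (coord (c0 + 1) s z))\<^sup>2)"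
        using AE_nth_neq_0[of "Inl 1"] by eventually_elim (simp add: base_def)
    qed simp
    then show ?thesis
      unfolding set_integrable_def e
      by (rule Bochner_Integration.integrable_cong[OF refl, THEN iffD1, rotated]) (use g in \<open>auto split: split_indicator\<close>)
  qed
  ultimately show ?thesis
    using s unfolding bergman_space_def vol_integrable_def two_all[of _ c0] by simp
qed (simp add: bergman_space_def)

end

lemma nn_integral_count_space_has_sum:
  fixes b :: "'a::countable \<Rightarrow> real"
  assumes b: "(b has_sum s) UNIV" and nn: "\<And>a. 0 \<le> b a"
  shows "(\<integral>\<^sup>+a. ennreal (b a) \<partial>count_space UNIV) = ennreal s"
proof -
  have "(\<lambda>N. \<Sum>a | to_nat a < N. b a) \<longlonglongrightarrow> s" by (rule has_sum_imp_enum_tendsto[OF b])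
  then have "(\<lambda>N. ennreal (\<Sum>a | to_nat a < N. b a)) \<longlonglongrightarrow> ennreal s" by (rule tendsto_ennrealI)
  moreover have "(\<lambda>N. ennreal (\<Sum>a | to_nat a < N. b a)) \<longlonglongrightarrow> (SUP N. ennreal (\<Sum>a | to_nat a < N. b a))"
    by (rule LIMSEQ_SUP) (auto simp: incseq_def intro!: ennreal_leI sum_mono2 finite_to_nat_less nn)
  ultimately have "(SUP N. ennreal (\<Sum>a | to_nat a < N. b a)) = ennreal s"
    by (metis LIMSEQ_unique)
  then show ?thesis
    unfolding nn_integral_count_space_countable by (simp add: sum_ennreal nn)
qed

text \<open>Each term is at most \<open>sqrt (a i) * sqrt (b i)\<close> in modulus; the finite
  Cauchy-Schwarz inequality then passes to the limit over finite subsets.\<close>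

lemma has_sum_cauchy_schwarz:
  fixes x :: "'a \<Rightarrow> complex" and a b :: "'a \<Rightarrow> real"
  assumes x: "(x has_sum l) A" and a: "(a has_sum s) A" and b: "(b has_sum t) A"
    and a0: "\<And>i. i \<in> A \<Longrightarrow> 0 \<le> a i" and b0: "\<And>i. i \<in> A \<Longrightarrow> 0 \<le> b i"
    and xab: "\<And>i. i \<in> A \<Longrightarrow> (cmod (x i))\<^sup>2 = a i * b i"
  shows "(cmod l)\<^sup>2 \<le> s * t"
proof (rule tendsto_upperbound)
  show "((\<lambda>F. (cmod (sum x F))\<^sup>2) \<longlongrightarrow> (cmod l)\<^sup>2) (finite_subsets_at_top A)"
    by (intro tendsto_intros) (use x in \<open>simp add: has_sum_def\<close>)
  show "\<forall>\<^sub>F F in finite_subsets_at_top A. (cmod (sum x F))\<^sup>2 \<le> s * t"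
  proof (rule eventually_finite_subsets_at_top_weakI)
    fix F assume F: "finite F" "F \<subseteq> A"
    have n: "0 \<le> sum a F" "0 \<le> sum b F" using F a0 b0 by (auto intro!: sum_nonneg)
    have le: "sum a F \<le> s" "sum b F \<le> t"
      using F a0 b0 by (auto intro!: has_sum_mono_neutral[OF has_sum_finite[OF F(1)] a] has_sum_mono_neutral[OF has_sum_finite[OF F(1)] b])
    have "cmod (sum x F) \<le> (\<Sum>i\<in>F. sqrt (a i) * sqrt (b i))"
    proof (rule order_trans[OF norm_sum], rule sum_mono)
      fix i assume "i \<in> F"
      then have "(cmod (x i))\<^sup>2 = a i * b i" using F xab by blast
      then show "cmod (x i) \<le> sqrt (a i) * sqrt (b i)"
        by (metis norm_ge_zero order_refl real_sqrt_mult real_sqrt_unique)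
    qed
    then have "(cmod (sum x F))\<^sup>2 \<le> (\<Sum>i\<in>F. sqrt (a i) * sqrt (b i))\<^sup>2" by (rule power_mono) simp
    also have "\<dots> \<le> (\<Sum>i\<in>F. (sqrt (a i))\<^sup>2) * (\<Sum>i\<in>F. (sqrt (b i))\<^sup>2)" by (rule Cauchy_Schwarz_ineq_sum)
    also have "\<dots> = sum a F * sum b F" using F a0 b0 by (auto intro!: arg_cong2[where f = "(*)"] sum.cong)
    also have "\<dots> \<le> s * t" using n le by (intro mult_mono) auto
    finally show "(cmod (sum x F))\<^sup>2 \<le> s * t" .
  qed
qed simp

context bergman
begin

section \<open>Linear combinations of sections, and the monomial sections\<close>

lemma holo_section_diff:
  assumes s: "holomorphic_section X Lm s" and t: "holomorphic_section X Lm t"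
  shows "holomorphic_section X Lm (\<lambda>q i. a * s q i - c * t q i)"
  unfolding holomorphic_section_def
proof (intro conjI allI)
  fix q
  show "(\<lambda>i. a * s q i - c * t q i) \<in> Fib q"
    unfolding fibre_def
  proof (intro CollectI conjI allI impI)
    fix i assume "q \<notin> cdom X i"
    then show "a * s q i - c * t q i = 0"
      using section_fibre[OF s, of q] section_fibre[OF t, of q] by (simp add: fibre_def)
  next
    fix i j assume "q \<in> cdom X i \<inter> cdom X j"
    then have "s q i = Lm i j q * s q j" "t q i = Lm i j q * t q j"
      using section_fibre[OF s, of q] section_fibre[OF t, of q] unfolding fibre_def by blast+
    then show "a * s q i - c * t q i = Lm i j q * (a * s q j - c * t q j)"
      by (simp add: algebra_simps)
  qed
next
  fix i
  show "holo_on (\<lambda>z. a * s (chart_inv X i z) i - c * t (chart_inv X i z) i) (chart X i ` cdom X i)"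
    using s t unfolding holomorphic_section_def by (intro holo_on_diff holo_on_mult holo_on_const) blast+
qed

lemma rep_diff: "rep (\<lambda>q i. a * s q i - c * t q i) z = a * rep s z - c * rep t z"
  by (simp add: rep_def coord_def algebra_simps)

lemma bergman_diff:
  assumes s: "s \<in> Bsp" and t: "t \<in> Bsp"
  shows "(\<lambda>q i. a * s q i - c * t q i) \<in> Bsp"
proof -
  have h: "holomorphic_section X Lm s" "holomorphic_section X Lm t" using s t bergman_iff by blast+
  note hd = holo_section_diff[OF h, of a c]
  have "integrable lborel (\<lambda>z. (cmod (rep (\<lambda>q i. a * s q i - c * t q i) z))\<^sup>2)"
  proof (rule Bochner_Integration.integrable_bound)
    show "integrable lborel (\<lambda>z. 2 * ((cmod a)\<^sup>2 * (cmod (rep s z))\<^sup>2) + 2 * ((cmod c)\<^sup>2 * (cmod (rep t z))\<^sup>2))"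
      using s t bergman_iff by (intro Bochner_Integration.integrable_add integrable_mult_right) blast+
    show "(\<lambda>z. (cmod (rep (\<lambda>q i. a * s q i - c * t q i) z))\<^sup>2) \<in> borel_measurable lborel"
      using rep_measurable[OF hd] by measurable
    show "AE z in lborel. norm ((cmod (rep (\<lambda>q i. a * s q i - c * t q i) z))\<^sup>2)
        \<le> norm (2 * ((cmod a)\<^sup>2 * (cmod (rep s z))\<^sup>2) + 2 * ((cmod c)\<^sup>2 * (cmod (rep t z))\<^sup>2))"
    proof (rule AE_I2)
      fix z
      show "norm ((cmod (rep (\<lambda>q i. a * s q i - c * t q i) z))\<^sup>2)
        \<le> norm (2 * ((cmod a)\<^sup>2 * (cmod (rep s z))\<^sup>2) + 2 * ((cmod c)\<^sup>2 * (cmod (rep t z))\<^sup>2))"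
        using norm_diff_square_le[of 1 "a * rep s z" "c * rep t z"] unfolding rep_diff
        by (simp add: norm_mult power_mult_distrib)
    qed
  qed
  then show ?thesis using hd bergman_iff by blast
qed

lemma bergman_lincomb:
  assumes "finite S" "p \<in> Bsp" "S \<subseteq> Bsp"
  shows "(\<lambda>q i. a * p q i - (\<Sum>s\<in>S. c s * s q i)) \<in> Bsp"
  using assms(1,3)
proof induction
  case empty
  show ?case using bergman_diff[OF assms(2) assms(2), of a 0] by simp
next
  case (insert t S)
  then have "(\<lambda>q i. 1 * (a * p q i - (\<Sum>s\<in>S. c s * s q i)) - c t * t q i) \<in> Bsp"
    by (intro bergman_diff) auto
  also have "(\<lambda>q i. 1 * (a * p q i - (\<Sum>s\<in>S. c s * s q i)) - c t * t q i) = (\<lambda>q i. a * p q i - (\<Sum>s\<in>insert t S. c s * s q i))"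
    using insert.hyps by (simp add: algebra_simps)
  finally show ?case .
qed

lemma rep_lincomb: "rep (\<lambda>q i. a * p q i - (\<Sum>s\<in>S. c s * s q i)) z = a * rep p z - (\<Sum>s\<in>S. c s * rep s z)"
  by (simp add: rep_def coord_def algebra_simps sum_distrib_left)

text \<open>Monomial sections are labelled by their exponent in chart \<open>c0\<close>; in the
  other chart the base exponent \<open>j\<close> becomes \<open>KK \<alpha> - j\<close>, by the
  symmetry of homogeneous polynomials of degree \<open>KK \<alpha>\<close> under exchanging the two
  variables.\<close>

definition flip :: "2 \<Rightarrow> (1 + 'r \<Rightarrow> nat) \<Rightarrow> 1 + 'r \<Rightarrow> nat" where
  "flip i \<alpha> = (if i = c0 then \<alpha> else \<alpha>(Inl 1 := KK \<alpha> - \<alpha> (Inl 1)))"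

lemma KK_flip [simp]: "KK (flip i \<alpha>) = KK \<alpha>" and deg_flip [simp]: "deg (flip i \<alpha>) = deg \<alpha>"
  and flip_Inr [simp]: "flip i \<alpha> (Inr b) = \<alpha> (Inr b)"
  by (simp_all add: flip_def KK_def deg_def)

lemma flip_AA: "\<alpha> \<in> AA \<Longrightarrow> flip i \<alpha> \<in> AA"
  unfolding AA_def mem_Collect_eq KK_flip by (simp add: flip_def)

lemma flip_flip: "\<alpha> \<in> AA \<Longrightarrow> flip i (flip i \<alpha>) = \<alpha>"
proof -
  assume "\<alpha> \<in> AA"
  then have "\<alpha> (Inl 1) \<le> KK \<alpha>" by (simp add: AA_def)
  moreover have "KK (\<alpha>(Inl 1 := n)) = KK \<alpha>" for n by (simp add: KK_def deg_def)
  ultimately show "flip i (flip i \<alpha>) = \<alpha>" by (simp add: flip_def)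
qed

lemma bij_flip: "bij_betw (flip i) AA AA"
  by (rule bij_betwI[where g = "flip i"]) (auto simp: flip_AA flip_flip)

lemma NN_flip: "\<alpha> \<in> AA \<Longrightarrow> NN (flip i \<alpha>) = NN \<alpha>"
  unfolding NN_def KK_flip deg_flip flip_Inr by (auto simp: flip_def AA_def)

lemma zmono_split: "zmono \<alpha> z = base z ^ \<alpha> (Inl 1) * (\<Prod>b\<in>UNIV. z $ Inr b ^ \<alpha> (Inr b))" for z :: "complex ^ (1 + 'r)"
  unfolding zmono_def prod_one_sum base_def ..

text \<open>The fibre coordinates of the switched point supply \<open>k * deg \<alpha>\<close>
  powers of the base coordinate, and the transition function supplies \<open>k * m\<close>; together
  they raise the exponent \<open>- \<alpha> (Inl 1)\<close> to
  \<open>KK \<alpha> - \<alpha> (Inl 1)\<close>. Membership in \<open>AA\<close> makes the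
  subtraction genuine.\<close>

lemma zmono_switch:
  assumes z: "base z \<noteq> 0" and a: "\<alpha> \<in> AA"
  shows "zmono (\<alpha>(Inl 1 := KK \<alpha> - \<alpha> (Inl 1))) z = base z ^ (k * m) * zmono \<alpha> (switch k z)"
proof -
  let ?P = "\<Prod>b\<in>UNIV. z $ Inr b ^ \<alpha> (Inr b)"
  have "(\<Prod>b\<in>UNIV. switch k z $ Inr b ^ \<alpha> (Inr b)) = base z ^ (k * deg \<alpha>) * ?P"
    by (simp add: switch_def mk_pt_def fib_def power_mult_distrib prod.distrib deg_def power_sum sum_distrib_left power_mult)
  then have "base z ^ (k * m) * zmono \<alpha> (switch k z) = base z ^ (k * m) * base z ^ (k * deg \<alpha>) / base z ^ \<alpha> (Inl 1) * ?P"
    unfolding zmono_split by (simp add: switch_def power_one_over)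
  also have "base z ^ (k * m) * base z ^ (k * deg \<alpha>) = base z ^ KK \<alpha>"
    by (simp add: KK_def power_add distrib_left)
  also have "base z ^ KK \<alpha> / base z ^ \<alpha> (Inl 1) = base z ^ (KK \<alpha> - \<alpha> (Inl 1))"
    using z a by (simp add: AA_def power_diff)
  finally show ?thesis unfolding zmono_split by simp
qed

definition esec :: "(1 + 'r \<Rightarrow> nat) \<Rightarrow> 'r tot \<Rightarrow> 2 \<Rightarrow> complex" where
  "esec \<alpha> q i = (if q \<in> cdom X i then of_real (1 / sqrt (NN \<alpha>)) * zmono (flip i \<alpha>) (chart X i q) else 0)"

lemma esec_tot_pt: "z \<in> Dom \<Longrightarrow> esec \<alpha> (tot_pt k i z) i = of_real (1 / sqrt (NN \<alpha>)) * zmono (flip i \<alpha>) z"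
  unfolding esec_def using tot_pt_cdom_MM[of z i] by (simp add: chart_MM)

lemma esec_switch:
  assumes a: "\<alpha> \<in> AA" and z: "z \<in> Dom" "base z \<noteq> 0"
  shows "esec \<alpha> (tot_pt k i z) i = base z ^ (k * m) * esec \<alpha> (tot_pt k i z) (i + 1)"
proof -
  have e: "flip i \<alpha> = (flip (i + 1) \<alpha>)(Inl 1 := KK (flip (i + 1) \<alpha>) - flip (i + 1) \<alpha> (Inl 1))"
  proof -
    have "i + 1 \<noteq> i" using two_all[of "\<lambda>j. j + 1 \<noteq> j" c0] c0 two_cases[of "c0 + 1 + 1" c0] by auto
    moreover have "KK (\<alpha>(Inl 1 := n)) = KK \<alpha>" for n by (simp add: KK_def deg_def)
    moreover have "i = c0 \<or> i + 1 = c0" using two_cases[of c0 i] by auto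
    ultimately show ?thesis using a by (auto simp: flip_def AA_def)
  qed
  have "zmono (flip i \<alpha>) z = base z ^ (k * m) * zmono (flip (i + 1) \<alpha>) (switch k z)"
    unfolding e by (rule zmono_switch[OF z(2) flip_AA[OF a]])
  moreover have "esec \<alpha> (tot_pt k i z) (i + 1) = of_real (1 / sqrt (NN \<alpha>)) * zmono (flip (i + 1) \<alpha>) (switch k z)"
    unfolding tot_pt_switch[OF z(2)] by (rule esec_tot_pt[OF switch_DD[OF z]])
  ultimately show ?thesis
    unfolding esec_tot_pt[OF z(1)] by (simp only: mult_ac)
qed

lemma esec_section:
  assumes a: "\<alpha> \<in> AA"
  shows "holomorphic_section X Lm (esec \<alpha>)"
  unfolding holomorphic_section_def
proof (intro conjI allI)
  fix q
  show "esec \<alpha> q \<in> Fib q"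
    unfolding fibre_def
  proof (intro CollectI conjI allI impI)
    fix i j assume q: "q \<in> cdom X i \<inter> cdom X j"
    then obtain z where z: "z \<in> Dom" "q = tot_pt k i z" using cdom_MM by blast
    show "esec \<alpha> q i = Lm i j q * esec \<alpha> q j"
    proof (cases "i = j")
      case True
      then show ?thesis by (simp add: z bundle_power_def LL_tot_pt)
    next
      case False
      then have j: "j = i + 1" using two_cases[of j i] by auto
      have "base z \<noteq> 0" using cdom_MM_switch[OF z(1), of i] q unfolding z(2) j by blast
      then show ?thesis
        unfolding z(2) j by (subst esec_switch[OF a z(1)]) (simp_all add: bundle_power_def LL_tot_pt power_mult)
    qed
  qed (simp add: esec_def)
next
  fix i
  have "holo_on (\<lambda>z. of_real (1 / sqrt (NN \<alpha>)) * zmono (flip i \<alpha>) z) Dom"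
    by (intro holo_on_mult holo_on_const holo_on_zmono)
  then show "holo_on (\<lambda>z. esec \<alpha> (chart_inv X i z) i) (chart X i ` cdom X i)"
    unfolding image_cdom_MM by (rule holo_on_cong[OF open_DD, rotated]) (simp add: chart_inv_MM esec_tot_pt)
qed

lemma rep_esec: "rep (esec \<alpha>) z = of_real (sqrt (W z) / sqrt (NN \<alpha>)) * zmono \<alpha> z"
  by (cases "z \<in> Dom") (simp_all add: rep_def coord_def esec_tot_pt W_outside flip_def)

lemma rep_esec_inner:
  "rep (esec \<alpha>) z * cnj (rep (esec \<beta>) z) = of_real (1 / (sqrt (NN \<alpha>) * sqrt (NN \<beta>))) * (zmono \<alpha> z * cnj (zmono \<beta> z) * of_real (W z))"
proof -
  have "complex_of_real (sqrt (W z)) * of_real (sqrt (W z)) = of_real (W z)"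
    using W_nonneg by (simp only: of_real_mult[symmetric] real_sqrt_mult_self abs_of_nonneg)
  then show ?thesis unfolding rep_esec by (simp add: mult_ac)
qed

lemma zmono_W_integral:
  assumes "\<alpha> \<in> AA"
  shows "integrable lborel (\<lambda>z. (cmod (zmono \<alpha> z))\<^sup>2 * W z)" "(\<integral>z. (cmod (zmono \<alpha> z))\<^sup>2 * W z \<partial>lborel) = NN \<alpha>"
proof -
  have [measurable]: "zmono \<alpha> \<in> borel_measurable borel"
    by (intro borel_measurable_continuous_onI holo_on_imp_continuous_on holo_on_zmono)
  have i: "(\<integral>\<^sup>+z. ennreal ((cmod (zmono \<alpha> z))\<^sup>2 * W z) \<partial>lborel) = ennreal (NN \<alpha>)"
    using assms by (simp add: nn_integral_zmono_W)
  show "integrable lborel (\<lambda>z. (cmod (zmono \<alpha> z))\<^sup>2 * W z)"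
    by (rule integrableI_nonneg) (simp_all add: i W_nonneg)
  show "(\<integral>z. (cmod (zmono \<alpha> z))\<^sup>2 * W z \<partial>lborel) = NN \<alpha>"
    by (rule integral_eq_nn_integral[THEN trans]) (simp_all add: i W_nonneg less_imp_le[OF NN_pos])
qed

lemma esec_bergman:
  assumes a: "\<alpha> \<in> AA"
  shows "esec \<alpha> \<in> Bsp"
proof -
  have "(cmod (rep (esec \<alpha>) z))\<^sup>2 = 1 / NN \<alpha> * ((cmod (zmono \<alpha> z))\<^sup>2 * W z)" for z
    unfolding rep_esec by (simp add: norm_mult norm_divide power_mult_distrib power_divide W_nonneg less_imp_le[OF NN_pos])
  moreover have "integrable lborel (\<lambda>z. 1 / NN \<alpha> * ((cmod (zmono \<alpha> z))\<^sup>2 * W z))"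
    by (intro integrable_mult_right zmono_W_integral a)
  ultimately show ?thesis using bergman_iff esec_section[OF a] by simp
qed

lemma esec_orthonormal:
  assumes a: "\<alpha> \<in> AA"
  shows "(\<integral>z. rep (esec \<alpha>) z * cnj (rep (esec \<beta>) z) \<partial>lborel) = (if \<alpha> = \<beta> then 1 else 0)"
proof -
  let ?c = "complex_of_real (1 / (sqrt (NN \<alpha>) * sqrt (NN \<beta>)))"
  have "(\<integral>z. rep (esec \<alpha>) z * cnj (rep (esec \<beta>) z) \<partial>lborel) = ?c * (\<integral>z. zmono \<alpha> z * cnj (zmono \<beta> z) * of_real (W z) \<partial>lborel)"
    unfolding rep_esec_inner by simp
  also have "\<dots> = (if \<alpha> = \<beta> then 1 else 0)"
  proof (cases "\<alpha> = \<beta>")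
    case True
    have "(\<integral>z. zmono \<alpha> z * cnj (zmono \<beta> z) * of_real (W z) \<partial>lborel) = (\<integral>z. complex_of_real ((cmod (zmono \<alpha> z))\<^sup>2 * W z) \<partial>lborel)"
      unfolding True by (simp only: of_real_mult complex_norm_square)
    also have "\<dots> = of_real (NN \<alpha>)"
      by (simp only: integral_complex_of_real zmono_W_integral(2)[OF a])
    finally show ?thesis using NN_pos[of \<alpha>] True by (simp flip: of_real_mult add: less_imp_le)
  qed (simp add: integral_zmono_orthogonal[OF W_measurable radial_W])
  finally show ?thesis .
qed

lemma inj_esec: "inj_on esec AA"
proof (rule inj_onI, rule ccontr)
  fix \<alpha> \<beta> assume "\<alpha> \<in> AA" "\<beta> \<in> AA" "esec \<alpha> = esec \<beta>" "\<alpha> \<noteq> \<beta>"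
  then show False using esec_orthonormal[of \<alpha> \<alpha>] esec_orthonormal[of \<alpha> \<beta>] by simp
qed

lemma parseval_section:
  assumes s: "holomorphic_section X Lm s"
    and c: "\<And>z. z \<in> Dom \<Longrightarrow> (\<lambda>\<alpha>. cmod (c \<alpha> * zmono \<alpha> z)) summable_on UNIV"
      "\<And>z. z \<in> Dom \<Longrightarrow> ((\<lambda>\<alpha>. c \<alpha> * zmono \<alpha> z) has_sum s (tot_pt k c0 z) c0) UNIV"
  shows "(\<integral>\<^sup>+z. ennreal ((cmod (rep s z))\<^sup>2) \<partial>lborel)
    = (\<integral>\<^sup>+\<alpha>. ennreal ((cmod (c \<alpha>))\<^sup>2) * (if \<alpha> \<in> AA then ennreal (NN \<alpha>) else \<infinity>) \<partial>count_space UNIV)"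
proof -
  have D: "z \<in> Dom" if "W z \<noteq> 0" for z using that W_outside by blast
  show ?thesis
    unfolding cmod_rep nn_integral_zmono_W[symmetric]
  proof (rule parseval_reinhardt[OF W_measurable W_nonneg radial_W W_integrable coord_measurable[OF s]])
    fix z assume "W z \<noteq> 0"
    note z = D[OF this]
    show "(\<lambda>\<alpha>. cmod (c \<alpha> * zmono \<alpha> z)) summable_on UNIV" by (rule c(1)[OF z])
    show "((\<lambda>\<alpha>. c \<alpha> * zmono \<alpha> z) has_sum coord c0 s z) UNIV" using c(2)[OF z] z by (simp add: coord_def)
  qed
qed

end

lemma has_sum_diff:
  fixes f g :: "'a \<Rightarrow> 'b::real_normed_vector"
  assumes "(f has_sum a) A" "(g has_sum b) A"
  shows "((\<lambda>x. f x - g x) has_sum a - b) A"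
proof -
  have "((\<lambda>x. - g x) has_sum - b) A" using assms(2) by (simp add: has_sum_uminus)
  from has_sum_add[OF assms(1) this] show ?thesis by simp
qed

context bergman
begin

lemma kernel_sum:
  assumes z: "z \<in> Dom"
  shows "((\<lambda>\<alpha>. (cmod (zmono \<alpha> z))\<^sup>2 / NN \<alpha>) has_sum C / real k * exp (real m * Phi z)) AA"
proof -
  let ?T = "range Inr :: (1 + 'r) set"
  define x0 where "x0 = (cmod (base z))\<^sup>2"
  define G where "G = GG z"
  have G: "G = 1 + x0" "0 < G" by (simp_all add: G_def x0_def GG_def base_def GG_pos[unfolded GG_def])
  \<comment> \<open>The squared fibre coordinates, rescaled so that they add up to
    \<open>uu k z\<close>.\<close>
  define y where "y a = (cmod (z $ a))\<^sup>2 * G ^ k" for a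
  \<comment> \<open>The coefficient in \<open>kern\<close> divided by \<open>k\<close>. Its factor
    \<open>k * (m + d) + 1\<close> arises from \<open>fact (KK + 1) = (KK + 1) * fact KK\<close> in
    the Beta part of the norm.\<close>
  define H where "H d = fact (d + CARD('r) - 1) * real (k * (m + d) + 1) / (real k * I d)" for d
  have T: "(\<Sum>a\<in>?T. g a) = (\<Sum>b\<in>UNIV. g (Inr b))" "(\<Prod>a\<in>?T. h a) = (\<Prod>b\<in>UNIV. h (Inr b))"
    for g h :: "1 + 'r \<Rightarrow> 'x::comm_semiring_1"
    by (simp_all add: sum.reindex prod.reindex)
  have u: "(\<Sum>a\<in>?T. y a) = uu k z"
    unfolding T by (simp add: y_def uu_GG G_def sum_distrib_right)
  have H0: "0 \<le> H d" for d unfolding H_def using I_pos[of d] by simp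
  have "((\<lambda>d. 1 / real k * (fact (d + CARD('r) - 1) * real (k * (m + d) + 1) / I d * uu k z ^ d / fact d)) has_sum 1 / real k * (C * exp (real m * f (uu k z)))) UNIV"
    using z by (intro has_sum_cmult_right kern uu_nonneg) (simp add: DD_def)
  then have "((\<lambda>d. H d * (\<Sum>a\<in>?T. y a) ^ d / fact d) has_sum C / real k * exp (real m * f (uu k z))) UNIV"
    unfolding u H_def by (simp add: mult_ac)
  then have "((\<lambda>\<beta>. H (\<Sum>a\<in>?T. \<beta> a) * (\<Prod>a\<in>?T. y a ^ \<beta> a / fact (\<beta> a))) has_sum C / real k * exp (real m * f (uu k z))) (supp_in ?T)"
    by (intro has_sum_multinomial_series H0) (simp_all add: y_def less_imp_le[OF G(2)])
  then have "((\<lambda>\<beta>. G ^ (k * m) * (H (\<Sum>a\<in>?T. \<beta> a) * (\<Prod>a\<in>?T. y a ^ \<beta> a / fact (\<beta> a)))) has_sum G ^ (k * m) * (C / real k * exp (real m * f (uu k z)))) (supp_in ?T)"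
    by (rule has_sum_cmult_right)
  also have "G ^ (k * m) * (C / real k * exp (real m * f (uu k z))) = C / real k * exp (real m * Phi z)"
  proof -
    have "G ^ (k * m) = exp (real (k * m) * ln G)" using G(2) by (simp only: exp_of_nat_mult exp_ln)
    then show ?thesis unfolding Phi_def G_def[symmetric] by (simp add: exp_add distrib_left mult_ac)
  qed
  finally have outer: "((\<lambda>\<beta>. G ^ (k * m) * (H (\<Sum>a\<in>?T. \<beta> a) * (\<Prod>a\<in>?T. y a ^ \<beta> a / fact (\<beta> a)))) has_sum C / real k * exp (real m * Phi z)) (supp_in ?T)" .
  let ?g = "\<lambda>(\<beta>, n). (cmod (zmono (\<beta>(Inl 1 := n)) z))\<^sup>2 / NN (\<beta>(Inl 1 := n))"
  have inner: "((\<lambda>n. ?g (\<beta>, n)) has_sum G ^ (k * m) * (H (\<Sum>a\<in>?T. \<beta> a) * (\<Prod>a\<in>?T. y a ^ \<beta> a / fact (\<beta> a)))) {..KK \<beta>}"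
    if "\<beta> \<in> supp_in ?T" for \<beta>
  proof -
    let ?d = "deg \<beta>" and ?K = "KK \<beta>"
    define P where "P = (\<Prod>b\<in>UNIV. ((cmod (z $ Inr b))\<^sup>2) ^ \<beta> (Inr b) / fact (\<beta> (Inr b)))"
    have KK: "KK (\<beta>(Inl 1 := n)) = ?K" and dd: "deg (\<beta>(Inl 1 := n)) = ?d" for n by (simp_all add: KK_def deg_def)
    \<comment> \<open>Dividing by the Beta part of the norm turns the base powers into terms of a
      binomial sum; the remaining factors do not depend on \<open>n\<close>.\<close>
    have summand: "?g (\<beta>, n) = P * H ?d * (real (?K choose n) * x0 ^ n)" if n: "n \<le> ?K" for n
    proof -
      have "(cmod (zmono (\<beta>(Inl 1 := n)) z))\<^sup>2 = x0 ^ n * (\<Prod>b\<in>UNIV. ((cmod (z $ Inr b))\<^sup>2) ^ \<beta> (Inr b))"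
        unfolding zmono_split x0_def
        by (simp add: norm_mult norm_power prod_norm[symmetric] power_mult_distrib prod_power_distrib power_mult[symmetric] mult.commute)
      also have "\<dots> = x0 ^ n * P * (\<Prod>b\<in>UNIV. fact (\<beta> (Inr b)))"
        unfolding P_def prod_dividef by simp
      finally have num: "(cmod (zmono (\<beta>(Inl 1 := n)) z))\<^sup>2 = x0 ^ n * P * (\<Prod>b\<in>UNIV. fact (\<beta> (Inr b)))" .
      define Q where "Q = (\<Prod>b\<in>UNIV. fact (\<beta> (Inr b)) :: real)"
      have Q: "Q \<noteq> 0" by (simp add: Q_def)
      have K1: "fact (?K + 1) = real (?K + 1) * fact ?K" by simp
      have N: "NN (\<beta>(Inl 1 := n)) = real k * (Q / fact (?d + CARD('r) - 1)) * I ?d * (fact n * fact (?K - n) / (real (?K + 1) * fact ?K))"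
        unfolding NN_def KK dd Q_def K1[symmetric] by simp
      have alg: "x * P * Q / (kk * (Q / a) * i * (n1 * n2 / (q * b))) = P * (a * q / (kk * i)) * (b / (n1 * n2) * x)"
        for x kk a i n1 n2 q b :: real
        using Q by (simp add: mult_ac)
      have "H ?d = fact (?d + CARD('r) - 1) * real (?K + 1) / (real k * I ?d)" by (simp add: H_def KK_def)
      then show ?thesis
        unfolding prod.case num Q_def[symmetric] N binomial_fact[OF n] by (simp only: alg)
    qed
    have "(\<Sum>n\<le>?K. ?g (\<beta>, n)) = P * H ?d * (\<Sum>n\<le>?K. real (?K choose n) * x0 ^ n)"
      unfolding sum_distrib_left by (rule sum.cong) (use summand in auto)
    also have "(\<Sum>n\<le>?K. real (?K choose n) * x0 ^ n) = G ^ ?K"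
      unfolding G(1) using binomial_ring[of x0 1 ?K] by (simp add: add.commute)
    \<comment> \<open>Here \<open>KK \<beta> = k * m + k * deg \<beta>\<close>: the first part will
      cancel the metric, the second rescales the fibre variables to \<open>y\<close>.\<close>
    also have "P * H ?d * G ^ ?K = G ^ (k * m) * (H ?d * (P * G ^ (k * ?d)))"
      by (simp add: KK_def distrib_left power_add)
    also have "P * G ^ (k * ?d) = (\<Prod>a\<in>?T. y a ^ \<beta> a / fact (\<beta> a))"
      unfolding T P_def y_def deg_def
      by (simp add: power_mult_distrib sum_distrib_left power_sum power_mult prod.distrib[symmetric])
    finally have "(\<Sum>n\<le>?K. ?g (\<beta>, n)) = G ^ (k * m) * (H (\<Sum>a\<in>?T. \<beta> a) * (\<Prod>a\<in>?T. y a ^ \<beta> a / fact (\<beta> a)))"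
      unfolding T(1) deg_def .
    then show ?thesis using has_sum_finite[of "{..?K}" "\<lambda>n. ?g (\<beta>, n)"] by simp
  qed
  have total: "(?g has_sum C / real k * exp (real m * Phi z)) (Sigma (supp_in ?T) (\<lambda>\<beta>. {..KK \<beta>}))"
  proof (rule has_sum_SigmaI[OF inner outer])
    show "?g summable_on Sigma (supp_in ?T) (\<lambda>\<beta>. {..KK \<beta>})"
    proof (rule summable_on_SigmaI[OF inner has_sum_imp_summable[OF outer]])
      fix \<beta> n show "0 \<le> ?g (\<beta>, n)" using NN_pos[of "\<beta>(Inl 1 := n)"] by simp
    qed
  qed
  have bij: "bij_betw (\<lambda>(\<beta>, n). \<beta>(Inl 1 := n)) (Sigma (supp_in ?T) (\<lambda>\<beta>. {..KK \<beta>})) AA"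
  proof (rule bij_betwI[where g = "\<lambda>\<alpha>. (\<alpha>(Inl 1 := 0), \<alpha> (Inl 1))"])
    have K: "KK (\<beta>(Inl 1 := n)) = KK \<beta>" for \<beta> n by (simp add: KK_def deg_def)
    show "(\<lambda>(\<beta>, n). \<beta>(Inl 1 := n)) \<in> Sigma (supp_in ?T) (\<lambda>\<beta>. {..KK \<beta>}) \<rightarrow> AA"
      by (auto simp: AA_def K)
    have "a = Inl 1" if "a \<notin> ?T" for a using that UNIV_minus_Inl by blast
    then show "(\<lambda>\<alpha>. (\<alpha>(Inl 1 := 0), \<alpha> (Inl 1))) \<in> AA \<rightarrow> Sigma (supp_in ?T) (\<lambda>\<beta>. {..KK \<beta>})"
      by (auto simp: AA_def K supp_in_def)
  qed (auto simp: supp_in_def fun_eq_iff)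
  have "((\<lambda>p. (cmod (zmono ((\<lambda>(\<beta>, n). \<beta>(Inl 1 := n)) p) z))\<^sup>2 / NN ((\<lambda>(\<beta>, n). \<beta>(Inl 1 := n)) p))
      has_sum C / real k * exp (real m * Phi z)) (Sigma (supp_in ?T) (\<lambda>\<beta>. {..KK \<beta>}))"
    using total
  proof (rule has_sum_cong[THEN iffD1, rotated])
    fix p show "?g p = (cmod (zmono ((\<lambda>(\<beta>, n). \<beta>(Inl 1 := n)) p) z))\<^sup>2 / NN ((\<lambda>(\<beta>, n). \<beta>(Inl 1 := n)) p)"
      by (cases p) (simp only: prod.case)
  qed
  then show ?thesis
    by (rule has_sum_reindex_bij_betw[OF bij, where f = "\<lambda>\<alpha>. (cmod (zmono \<alpha> z))\<^sup>2 / NN \<alpha>", THEN iffD1])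
qed

lemma hM_power: "z \<in> Dom \<Longrightarrow> hM i (tot_pt k i z) ^ m = exp (- (real m * Phi z))"
  by (simp add: hM_tot_pt exp_of_nat_mult[symmetric])

text \<open>Flipping permutes \<open>AA\<close> and preserves the norms, so both charts have the
  same kernel; the metric \<open>exp (- m * Phi)\<close> then cancels it to a constant.\<close>

lemma kernel_sum_esec:
  assumes z: "z \<in> Dom"
  shows "((\<lambda>\<alpha>. hM i (tot_pt k i z) ^ m * (cmod (esec \<alpha> (tot_pt k i z) i))\<^sup>2) has_sum C / real k) AA"
proof -
  have "((\<lambda>\<alpha>. exp (- (real m * Phi z)) * ((cmod (zmono (flip i \<alpha>) z))\<^sup>2 / NN (flip i \<alpha>))) has_sum
      exp (- (real m * Phi z)) * (C / real k * exp (real m * Phi z))) AA"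
    by (intro has_sum_cmult_right has_sum_reindex_bij_betw[OF bij_flip, THEN iffD2] kernel_sum[OF z])
  also have "exp (- (real m * Phi z)) * (C / real k * exp (real m * Phi z)) = C / real k"
    by (simp add: exp_minus)
  finally show ?thesis
  proof (rule has_sum_cong[THEN iffD1, rotated])
    fix \<alpha> assume "\<alpha> \<in> AA"
    have "(cmod (esec \<alpha> (tot_pt k i z) i))\<^sup>2 = (1 / sqrt (NN \<alpha>))\<^sup>2 * (cmod (zmono (flip i \<alpha>) z))\<^sup>2"
      unfolding esec_tot_pt[OF z] by (simp only: norm_mult norm_of_real power_mult_distrib power2_abs)
    also have "(1 / sqrt (NN \<alpha>))\<^sup>2 = 1 / NN (flip i \<alpha>)"
      unfolding NN_flip[OF \<open>\<alpha> \<in> AA\<close>] using NN_pos[of \<alpha>] by (simp add: power_divide)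
    finally show "exp (- (real m * Phi z)) * ((cmod (zmono (flip i \<alpha>) z))\<^sup>2 / NN (flip i \<alpha>))
        = hM i (tot_pt k i z) ^ m * (cmod (esec \<alpha> (tot_pt k i z) i))\<^sup>2"
      unfolding hM_power[OF z] by simp
  qed
qed

lemma bergman_section: "s \<in> Bsp \<Longrightarrow> holomorphic_section X Lm s"
  and bergman_integrable: "s \<in> Bsp \<Longrightarrow> integrable lborel (\<lambda>z. (cmod (rep s z))\<^sup>2)"
  by (simp_all add: bergman_iff)

lemma nn_integral_rep:
  assumes s: "s \<in> Bsp"
  shows "(\<integral>\<^sup>+z. ennreal ((cmod (rep s z))\<^sup>2) \<partial>lborel) = ennreal (\<integral>z. (cmod (rep s z))\<^sup>2 \<partial>lborel)"
  by (rule nn_integral_eq_integral[OF bergman_integrable[OF s]]) (rule AE_I2, rule zero_le_power2)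

text \<open>A nonzero coefficient outside \<open>AA\<close> would contribute infinity to one side of
  Parseval's identity, whose other side is finite for a square integrable section.\<close>

lemma bergman_series:
  assumes s: "s \<in> Bsp"
  obtains c where "\<And>\<alpha>. \<alpha> \<notin> AA \<Longrightarrow> c \<alpha> = 0"
    "\<And>z. z \<in> Dom \<Longrightarrow> (\<lambda>\<alpha>. cmod (c \<alpha> * zmono \<alpha> z)) summable_on UNIV"
    "\<And>z. z \<in> Dom \<Longrightarrow> ((\<lambda>\<alpha>. c \<alpha> * zmono \<alpha> z) has_sum s (tot_pt k c0 z) c0) UNIV"
    "((\<lambda>\<alpha>. (cmod (c \<alpha>))\<^sup>2 * NN \<alpha>) has_sum (\<integral>z. (cmod (rep s z))\<^sup>2 \<partial>lborel)) UNIV"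
proof -
  let ?J = "\<integral>z. (cmod (rep s z))\<^sup>2 \<partial>lborel"
  obtain c where c: "\<And>z. z \<in> Dom \<Longrightarrow> (\<lambda>\<alpha>. cmod (c \<alpha> * zmono \<alpha> z)) summable_on UNIV"
    "\<And>z. z \<in> Dom \<Longrightarrow> ((\<lambda>\<alpha>. c \<alpha> * zmono \<alpha> z) has_sum s (tot_pt k c0 z) c0) UNIV"
    by (rule holo_on_reinhardt_power_series[OF open_DD complete_reinhardt_DD section_holo[OF bergman_section[OF s], of c0]]) (rule that)
  let ?t = "\<lambda>\<alpha>. ennreal ((cmod (c \<alpha>))\<^sup>2) * (if \<alpha> \<in> AA then ennreal (NN \<alpha>) else \<infinity>)"
  have J: "(\<integral>\<^sup>+\<alpha>. ?t \<alpha> \<partial>count_space UNIV) = ennreal ?J"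
    using parseval_section[OF bergman_section[OF s] c] nn_integral_rep[OF s] by simp
  have c0: "c \<alpha> = 0" if "\<alpha> \<notin> AA" for \<alpha>
  proof (rule ccontr)
    assume "c \<alpha> \<noteq> 0"
    then have "?t \<alpha> = \<infinity>" using that by (simp add: ennreal_mult_eq_top_iff)
    moreover have "?t \<alpha> \<le> (\<integral>\<^sup>+\<alpha>. ?t \<alpha> \<partial>count_space UNIV)" by (rule nn_integral_ge_point) simp
    ultimately show False unfolding J by (simp add: top_unique)
  qed
  let ?b = "\<lambda>\<alpha>. (cmod (c \<alpha>))\<^sup>2 * NN \<alpha>"
  have b0: "0 \<le> ?b \<alpha>" for \<alpha> using NN_pos[of \<alpha>] by simp
  have "?t = (\<lambda>\<alpha>. ennreal (?b \<alpha>))"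
    using c0 NN_pos by (auto simp: fun_eq_iff ennreal_mult less_imp_le)
  then have b: "(\<integral>\<^sup>+\<alpha>. ennreal (?b \<alpha>) \<partial>count_space UNIV) = ennreal ?J" using J by simp
  have "integrable (count_space UNIV) ?b"
    by (rule integrableI_nonneg) (simp_all add: b b0)
  then have "?b summable_on UNIV"
    using abs_summable_summable abs_summable_equivalent unfolding abs_summable_on_def by blast
  then have S: "(?b has_sum infsum ?b UNIV) UNIV" by (rule has_sum_infsum)
  have "ennreal (infsum ?b UNIV) = ennreal ?J"
    using nn_integral_count_space_has_sum[OF S b0] b by simp
  then have "infsum ?b UNIV = ?J"
    using infsum_nonneg[of UNIV ?b] b0 by simp
  then show thesis using that[OF c0 c] S by simp
qed

text \<open>Cauchy-Schwarz for the power series, each term being split as \<open>(|c|^2 NN)\<close>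
  times \<open>(|z^\<alpha>|^2 / NN)\<close>: the first factors sum to the squared norm, the second
  to the kernel on the diagonal.\<close>

lemma eval_bound_c0:
  assumes s: "s \<in> Bsp" and z: "z \<in> Dom"
  shows "hM c0 (tot_pt k c0 z) ^ m * (cmod (s (tot_pt k c0 z) c0))\<^sup>2 \<le> C / real k * (\<integral>z. (cmod (rep s z))\<^sup>2 \<partial>lborel)"
proof -
  let ?J = "\<integral>z. (cmod (rep s z))\<^sup>2 \<partial>lborel"
  obtain c where c: "\<And>\<alpha>. \<alpha> \<notin> AA \<Longrightarrow> c \<alpha> = 0"
    "\<And>z. z \<in> Dom \<Longrightarrow> (\<lambda>\<alpha>. cmod (c \<alpha> * zmono \<alpha> z)) summable_on UNIV"
    "\<And>z. z \<in> Dom \<Longrightarrow> ((\<lambda>\<alpha>. c \<alpha> * zmono \<alpha> z) has_sum s (tot_pt k c0 z) c0) UNIV"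
    "((\<lambda>\<alpha>. (cmod (c \<alpha>))\<^sup>2 * NN \<alpha>) has_sum ?J) UNIV"
    by (rule bergman_series[OF s]) (rule that)
  have "((\<lambda>\<alpha>. c \<alpha> * zmono \<alpha> z) has_sum s (tot_pt k c0 z) c0) AA"
    by (rule has_sum_cong_neutral[THEN iffD1, OF _ _ _ c(3)[OF z]]) (auto simp: c(1))
  moreover have "((\<lambda>\<alpha>. (cmod (c \<alpha>))\<^sup>2 * NN \<alpha>) has_sum ?J) AA"
    by (rule has_sum_cong_neutral[THEN iffD1, OF _ _ _ c(4)]) (auto simp: c(1))
  ultimately have "(cmod (s (tot_pt k c0 z) c0))\<^sup>2 \<le> ?J * (C / real k * exp (real m * Phi z))"
  proof (rule has_sum_cauchy_schwarz[OF _ _ kernel_sum[OF z]])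
    fix \<alpha>
    show "0 \<le> (cmod (c \<alpha>))\<^sup>2 * NN \<alpha>" "0 \<le> (cmod (zmono \<alpha> z))\<^sup>2 / NN \<alpha>"
      "(cmod (c \<alpha> * zmono \<alpha> z))\<^sup>2 = (cmod (c \<alpha>))\<^sup>2 * NN \<alpha> * ((cmod (zmono \<alpha> z))\<^sup>2 / NN \<alpha>)"
      using NN_pos[of \<alpha>] by (simp_all add: norm_mult power_mult_distrib)
  qed
  then have "exp (- (real m * Phi z)) * (cmod (s (tot_pt k c0 z) c0))\<^sup>2 \<le> exp (- (real m * Phi z)) * (?J * (C / real k * exp (real m * Phi z)))"
    by (rule mult_left_mono) simp
  then show ?thesis unfolding hM_power[OF z] by (simp add: exp_minus field_simps)
qed

lemma c0_switch: "c0 + 1 + 1 = c0"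
  using two_cases[of "c0 + 1 + 1" c0] by auto

text \<open>Away from \<open>base z = 0\<close> a point of the other chart also lies in chart
  \<open>c0\<close>. Points over \<open>base z = 0\<close> are approached along a real line in the
  base direction, and the bound passes to the limit by continuity.\<close>

lemma eval_bound:
  assumes s: "s \<in> Bsp" and z: "z \<in> Dom"
  shows "hM i (tot_pt k i z) ^ m * (cmod (s (tot_pt k i z) i))\<^sup>2 \<le> C / real k * (\<integral>z. (cmod (rep s z))\<^sup>2 \<partial>lborel)"
proof (cases "i = c0")
  case False
  then have i: "i = c0 + 1" using two_cases[of i c0] by auto
  let ?B = "C / real k * (\<integral>z. (cmod (rep s z))\<^sup>2 \<partial>lborel)"
  let ?g = "\<lambda>w. hM i (tot_pt k i w) ^ m * (cmod (s (tot_pt k i w) i))\<^sup>2"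
  have b: "?g w \<le> ?B" if w: "w \<in> Dom" "base w \<noteq> 0" for w
  proof -
    have q: "tot_pt k i w = tot_pt k c0 (switch k w)" unfolding i tot_pt_switch[OF w(2)] c0_switch ..
    have 1: "tot_pt k i w \<in> cdom X i" by (rule tot_pt_cdom_MM[OF w(1)])
    have 2: "tot_pt k i w \<in> cdom X c0" unfolding q by (rule tot_pt_cdom_MM[OF switch_DD[OF w]])
    note f = section_fibre[OF bergman_section[OF s]]
    have "complex_of_real (?g w) = of_real (hM c0 (tot_pt k i w) ^ m * (cmod (s (tot_pt k i w) c0))\<^sup>2)"
      unfolding herm_self[OF 1 f, symmetric] herm_self[OF 2 f, symmetric] ..
    then have "?g w = hM c0 (tot_pt k i w) ^ m * (cmod (s (tot_pt k i w) c0))\<^sup>2" by (simp only: of_real_eq_iff)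
    then show ?thesis using eval_bound_c0[OF s switch_DD[OF w]] unfolding q by simp
  qed
  let ?p = "\<lambda>t::real. z + t *\<^sub>R axis (Inl 1) 1"
  have bp: "base (?p t) = base z + of_real t" for t by (simp add: base_def axis_def of_real_def)
  show ?thesis
  proof (cases "base z = 0")
    case True
    have "continuous_on Dom (\<lambda>w. exp (- (real m * Phi w)) * (cmod (s (tot_pt k i w) i))\<^sup>2)"
      by (intro continuous_intros smooth_on_imp_continuous_on[OF smooth_on_Phi] holo_on_imp_continuous_on section_holo bergman_section s)
    then have "isCont (\<lambda>w. exp (- (real m * Phi w)) * (cmod (s (tot_pt k i w) i))\<^sup>2) z"
      using continuous_on_eq_continuous_at[OF open_DD] z by blast
    moreover have p: "(?p \<longlongrightarrow> z) (at_right 0)"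
      by (auto intro!: tendsto_eq_intros)
    ultimately have lim: "((\<lambda>t. exp (- (real m * Phi (?p t))) * (cmod (s (tot_pt k i (?p t)) i))\<^sup>2) \<longlongrightarrow> exp (- (real m * Phi z)) * (cmod (s (tot_pt k i z) i))\<^sup>2) (at_right 0)"
      by (rule isCont_tendsto_compose)
    have "\<forall>\<^sub>F t in at_right 0. ?p t \<in> Dom" using p open_DD z by (rule topological_tendstoD)
    then have "\<forall>\<^sub>F t in at_right 0. exp (- (real m * Phi (?p t))) * (cmod (s (tot_pt k i (?p t)) i))\<^sup>2 \<le> ?B"
      using eventually_at_right_less
    proof eventually_elim
      fix t :: real assume t: "?p t \<in> Dom" "0 < t"
      then have "base (?p t) \<noteq> 0" unfolding bp by (simp add: True)
      then show "exp (- (real m * Phi (?p t))) * (cmod (s (tot_pt k i (?p t)) i))\<^sup>2 \<le> ?B"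
        using b[OF t(1)] unfolding hM_power[OF t(1)] by blast
    qed
    then show ?thesis unfolding hM_power[OF z] using lim by (intro tendsto_upperbound) auto
  qed (use b z in blast)
qed (use eval_bound_c0 s z in blast)

text \<open>Truncate the power series: the remainder is again a section, its series is the tail, and
  Parseval's identity evaluates its squared norm as the tail of a convergent sum.\<close>

lemma esec_dense:
  assumes s: "s \<in> Bsp" and e: "0 < e"
  shows "\<exists>S d. finite S \<and> S \<subseteq> esec ` AA \<and>
    (\<integral>z. (cmod (rep (\<lambda>q i. 1 * s q i - (\<Sum>t\<in>S. d t * t q i)) z))\<^sup>2 \<partial>lborel) < e\<^sup>2"
proof -
  let ?J = "\<integral>z. (cmod (rep s z))\<^sup>2 \<partial>lborel"
  obtain c where c: "\<And>\<alpha>. \<alpha> \<notin> AA \<Longrightarrow> c \<alpha> = 0"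
    "\<And>z. z \<in> Dom \<Longrightarrow> (\<lambda>\<alpha>. cmod (c \<alpha> * zmono \<alpha> z)) summable_on UNIV"
    "\<And>z. z \<in> Dom \<Longrightarrow> ((\<lambda>\<alpha>. c \<alpha> * zmono \<alpha> z) has_sum s (tot_pt k c0 z) c0) UNIV"
    "((\<lambda>\<alpha>. (cmod (c \<alpha>))\<^sup>2 * NN \<alpha>) has_sum ?J) UNIV"
    by (rule bergman_series[OF s]) (rule that)
  let ?b = "\<lambda>\<alpha>. (cmod (c \<alpha>))\<^sup>2 * NN \<alpha>"
  obtain P0 where P0: "finite P0" "dist (sum ?b P0) ?J \<le> e\<^sup>2 / 2"
    using has_sum_finite_approximation[OF c(4), of "e\<^sup>2 / 2"] e by auto
  define P where "P = P0 \<inter> AA"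
  have P: "finite P" "P \<subseteq> AA" using P0 by (auto simp: P_def)
  have "sum ?b P = sum ?b P0"
    unfolding P_def by (rule sum.mono_neutral_left) (use P0 c(1) in auto)
  then have close: "?J - sum ?b P \<le> e\<^sup>2 / 2" using P0(2) unfolding dist_real_def by linarith
  \<comment> \<open>Combinations are indexed by sections and not by exponents, hence the inverse of
    \<open>esec\<close>; the factor \<open>sqrt (NN \<alpha>)\<close> undoes the
    normalization.\<close>
  define d where "d t = c (inv_into AA esec t) * of_real (sqrt (NN (inv_into AA esec t)))" for t
  define s' where "s' = (\<lambda>q i. 1 * s q i - (\<Sum>t\<in>esec ` P. d t * t q i))"
  have sub: "esec ` P \<subseteq> esec ` AA" using P by blast
  have s': "s' \<in> Bsp"
    unfolding s'_def using P(1) s by (intro bergman_lincomb) (use P(2) esec_bergman in auto)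
  define c' where "c' \<alpha> = (if \<alpha> \<in> P then 0 else c \<alpha>)" for \<alpha>
  have val: "s' (tot_pt k c0 z) c0 = s (tot_pt k c0 z) c0 - (\<Sum>\<alpha>\<in>P. c \<alpha> * zmono \<alpha> z)" if z: "z \<in> Dom" for z
  proof -
    have "(\<Sum>t\<in>esec ` P. d t * t (tot_pt k c0 z) c0) = (\<Sum>\<alpha>\<in>P. d (esec \<alpha>) * esec \<alpha> (tot_pt k c0 z) c0)"
      by (subst sum.reindex) (use inj_on_subset[OF inj_esec P(2)] in \<open>simp_all add: o_def\<close>)
    also have "\<dots> = (\<Sum>\<alpha>\<in>P. c \<alpha> * zmono \<alpha> z)"
    proof (rule sum.cong[OF refl])
      fix \<alpha> assume "\<alpha> \<in> P"
      then have "inv_into AA esec (esec \<alpha>) = \<alpha>" using P(2) inj_esec by (intro inv_into_f_f) auto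
      then show "d (esec \<alpha>) * esec \<alpha> (tot_pt k c0 z) c0 = c \<alpha> * zmono \<alpha> z"
        using NN_pos[of \<alpha>] by (simp add: d_def esec_tot_pt[OF z] flip_def)
    qed
    finally show ?thesis by (simp add: s'_def)
  qed
  have tail: "((\<lambda>\<alpha>. ?b \<alpha> - (if \<alpha> \<in> P then ?b \<alpha> else 0)) has_sum ?J - sum ?b P) UNIV"
    by (intro has_sum_diff c(4) has_sum_finite_neutralI[OF P(1)]) auto
  have b0: "0 \<le> ?b \<alpha> - (if \<alpha> \<in> P then ?b \<alpha> else 0)" for \<alpha> using NN_pos[of \<alpha>] by simp
  have "(\<integral>\<^sup>+z. ennreal ((cmod (rep s' z))\<^sup>2) \<partial>lborel)
    = (\<integral>\<^sup>+\<alpha>. ennreal ((cmod (c' \<alpha>))\<^sup>2) * (if \<alpha> \<in> AA then ennreal (NN \<alpha>) else \<infinity>) \<partial>count_space UNIV)"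
  proof (rule parseval_section[OF bergman_section[OF s']])
    fix z assume z: "z \<in> Dom"
    show "(\<lambda>\<alpha>. cmod (c' \<alpha> * zmono \<alpha> z)) summable_on UNIV"
      by (rule summable_on_comparison_test[OF c(2)[OF z]]) (simp_all add: c'_def)
    have "((\<lambda>\<alpha>. c \<alpha> * zmono \<alpha> z - (if \<alpha> \<in> P then c \<alpha> * zmono \<alpha> z else 0)) has_sum
        s (tot_pt k c0 z) c0 - (\<Sum>\<alpha>\<in>P. c \<alpha> * zmono \<alpha> z)) UNIV"
      by (intro has_sum_diff c(3)[OF z] has_sum_finite_neutralI[OF P(1)]) auto
    then show "((\<lambda>\<alpha>. c' \<alpha> * zmono \<alpha> z) has_sum s' (tot_pt k c0 z) c0) UNIV"
      unfolding val[OF z] by (rule has_sum_cong[THEN iffD1, rotated]) (simp add: c'_def)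
  qed
  also have "(\<lambda>\<alpha>. ennreal ((cmod (c' \<alpha>))\<^sup>2) * (if \<alpha> \<in> AA then ennreal (NN \<alpha>) else \<infinity>)) = (\<lambda>\<alpha>. ennreal (?b \<alpha> - (if \<alpha> \<in> P then ?b \<alpha> else 0)))"
    using c(1) P(2) NN_pos by (auto simp: fun_eq_iff c'_def ennreal_mult less_imp_le)
  also have "(\<integral>\<^sup>+\<alpha>. ennreal (?b \<alpha> - (if \<alpha> \<in> P then ?b \<alpha> else 0)) \<partial>count_space UNIV) = ennreal (?J - sum ?b P)"
    by (rule nn_integral_count_space_has_sum[OF tail b0])
  finally have "ennreal (\<integral>z. (cmod (rep s' z))\<^sup>2 \<partial>lborel) = ennreal (?J - sum ?b P)"
    unfolding nn_integral_rep[OF s'] .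
  moreover have "0 \<le> ?J - sum ?b P" by (rule has_sum_nonneg[OF tail b0])
  moreover have "0 \<le> (\<integral>z. (cmod (rep s' z))\<^sup>2 \<partial>lborel)" by (rule Bochner_Integration.integral_nonneg) simp
  ultimately have "(\<integral>z. (cmod (rep s' z))\<^sup>2 \<partial>lborel) = ?J - sum ?b P" by (simp only: ennreal_inj)
  moreover have "e\<^sup>2 / 2 < e\<^sup>2" using e by simp
  ultimately have small: "(\<integral>z. (cmod (rep s' z))\<^sup>2 \<partial>lborel) < e\<^sup>2" using close by linarith
  show ?thesis
  proof (intro exI conjI)
    show "finite (esec ` P)" using P(1) by (rule finite_imageI)
    show "esec ` P \<subseteq> esec ` AA" by (rule sub)
    show "(\<integral>z. (cmod (rep (\<lambda>q i. 1 * s q i - (\<Sum>t\<in>esec ` P. d t * t q i)) z))\<^sup>2 \<partial>lborel) < e\<^sup>2"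
      using small unfolding s'_def .
  qed
qed

lemma L2_inner_bergman:
  "s \<in> Bsp \<Longrightarrow> t \<in> Bsp \<Longrightarrow> L2_inner X omM hm s t = (\<integral>z. rep s z * cnj (rep t z) \<partial>lborel)"
  by (intro L2_inner_rep bergman_section)

lemma L2_inner_self: "s \<in> Bsp \<Longrightarrow> L2_inner X omM hm s s = of_real (\<integral>z. (cmod (rep s z))\<^sup>2 \<partial>lborel)"
  unfolding L2_inner_bergman by (simp only: complex_norm_square[symmetric] integral_complex_of_real)

lemma orthonormal_basis_esec: "orthonormal_basis X omM LL hM m (esec ` AA)"
  unfolding orthonormal_basis_def Let_def
proof (intro conjI ballI allI impI)
  show "esec ` AA \<subseteq> Bsp" using esec_bergman by blast
next
  fix s t assume "s \<in> esec ` AA" "t \<in> esec ` AA"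
  then obtain \<alpha> \<beta> where "\<alpha> \<in> AA" "\<beta> \<in> AA" "s = esec \<alpha>" "t = esec \<beta>" by blast
  then show "L2_inner X omM hm s t = (if s = t then 1 else 0)"
    using inj_onD[OF inj_esec, of \<alpha> \<beta>] by (auto simp: L2_inner_bergman esec_bergman esec_orthonormal)
next
  fix s e assume s: "s \<in> Bsp" and e: "0 < (e :: real)"
  obtain S d where S: "finite S" "S \<subseteq> esec ` AA" "(\<integral>z. (cmod (rep (\<lambda>q i. 1 * s q i - (\<Sum>t\<in>S. d t * t q i)) z))\<^sup>2 \<partial>lborel) < e\<^sup>2"
    using esec_dense[OF s e] by (elim exE conjE) (rule that)
  have "(\<lambda>q i. 1 * s q i - (\<Sum>t\<in>S. d t * t q i)) \<in> Bsp"
    by (rule bergman_lincomb[OF S(1) s]) (use S(2) esec_bergman in blast)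
  from L2_inner_self[OF this] S show "\<exists>S d. finite S \<and> S \<subseteq> esec ` AA \<and>
      Re (L2_inner X omM hm (\<lambda>q i. s q i - (\<Sum>t\<in>S. d t * t q i)) (\<lambda>q i. s q i - (\<Sum>t\<in>S. d t * t q i))) < e\<^sup>2"
    by (intro exI[of _ S] exI[of _ d]) simp
qed

text \<open>\<open>kernel_independent_of_basis\<close> for evaluation at one point, scaled by the
  square root of the metric so that the squared modulus of \<open>ev s\<close> is the pointwise
  squared norm.\<close>

lemma kernel_any_basis:
  assumes B: "orthonormal_basis X omM LL hM m B" and z: "z \<in> Dom"
  shows "((\<lambda>s. Re (herm X hm (tot_pt k i z) (s (tot_pt k i z)) (s (tot_pt k i z)))) has_sum C / real k) B"
proof -
  let ?q = "tot_pt k i z"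
  define ev where "ev s = of_real (sqrt (hM i ?q ^ m)) * s ?q i" for s :: "'r tot \<Rightarrow> 2 \<Rightarrow> complex"
  have ev: "(cmod (ev s))\<^sup>2 = hM i ?q ^ m * (cmod (s ?q i))\<^sup>2" for s
    unfolding ev_def hM_power[OF z] by (simp add: norm_mult power_mult_distrib)
  have BV: "B \<subseteq> Bsp" using B by (simp add: orthonormal_basis_def)
  have "((\<lambda>s. (cmod (ev s))\<^sup>2) has_sum C / real k) B"
  proof (rule kernel_independent_of_basis[where M = lborel and rep = rep and V = Bsp and E = "esec ` AA"])
    show "rep s \<in> borel_measurable lborel" if "s \<in> Bsp" for s using rep_measurable[OF bergman_section[OF that]] by simp
    show "integrable lborel (\<lambda>x. (cmod (rep s x))\<^sup>2)" if "s \<in> Bsp" for s by (rule bergman_integrable[OF that])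
    show "(cmod (ev s))\<^sup>2 \<le> C / real k * (\<integral>x. (cmod (rep s x))\<^sup>2 \<partial>lborel)" if "s \<in> Bsp" for s
      unfolding ev by (rule eval_bound[OF that z])
    show "\<exists>g\<in>Bsp. (\<forall>x. rep g x = a * rep p x - (\<Sum>s\<in>S. c s * rep s x)) \<and> ev g = a * ev p - (\<Sum>s\<in>S. c s * ev s)"
      if "p \<in> Bsp" "finite S" "S \<subseteq> Bsp" for p S c a
      by (rule bexI[OF _ bergman_lincomb[OF that(2,1,3), of a c]])
        (simp add: rep_lincomb ev_def right_diff_distrib sum_distrib_left sum_distrib_right mult_ac)
    show "esec ` AA \<subseteq> Bsp" using esec_bergman by blast
    show "(\<integral>x. rep s x * cnj (rep t x) \<partial>lborel) = (if s = t then 1 else 0)" if "s \<in> esec ` AA" "t \<in> esec ` AA" for s t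
      using that inj_onD[OF inj_esec] by (auto simp: esec_orthonormal)
    show "((\<lambda>s. (cmod (ev s))\<^sup>2) has_sum C / real k) (esec ` AA)"
      unfolding has_sum_reindex[OF inj_esec] o_def ev by (rule kernel_sum_esec[OF z])
    show "B \<subseteq> Bsp" by (rule BV)
    show "(\<integral>x. rep s x * cnj (rep t x) \<partial>lborel) = (if s = t then 1 else 0)" if "s \<in> B" "t \<in> B" for s t
    proof -
      have "\<forall>s\<in>B. \<forall>t\<in>B. L2_inner X omM hm s t = (if s = t then 1 else 0)"
        by (rule B[unfolded orthonormal_basis_def, THEN conjunct2, THEN conjunct1])
      from this[rule_format, OF that] show ?thesis
        unfolding L2_inner_bergman[OF subsetD[OF BV that(1)] subsetD[OF BV that(2)]] .
    qed
    show "\<exists>S c. finite S \<and> S \<subseteq> B \<and> (\<integral>x. (cmod (rep p x - (\<Sum>s\<in>S. c s * rep s x)))\<^sup>2 \<partial>lborel) < e\<^sup>2"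
      if p: "p \<in> Bsp" and e: "0 < e" for p e
    proof -
      have "\<forall>f\<in>Bsp. \<forall>e>0. \<exists>S c. finite S \<and> S \<subseteq> B \<and>
          Re (L2_inner X omM hm (\<lambda>q i. f q i - (\<Sum>t\<in>S. c t * t q i)) (\<lambda>q i. f q i - (\<Sum>t\<in>S. c t * t q i))) < e\<^sup>2"
        by (rule B[unfolded orthonormal_basis_def Let_def, THEN conjunct2, THEN conjunct2])
      note density = this[rule_format, OF p e]
      obtain S c where S: "finite S" "S \<subseteq> B"
        "Re (L2_inner X omM hm (\<lambda>q i. p q i - (\<Sum>t\<in>S. c t * t q i)) (\<lambda>q i. p q i - (\<Sum>t\<in>S. c t * t q i))) < e\<^sup>2"
        using density by (elim exE conjE) (rule that)
      have "(\<lambda>q i. 1 * p q i - (\<Sum>t\<in>S. c t * t q i)) \<in> Bsp"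
        by (rule bergman_lincomb[OF S(1) p]) (use S(2) BV in blast)
      from L2_inner_self[OF this] S(3)
      have "(\<integral>x. (cmod (rep (\<lambda>q i. 1 * p q i - (\<Sum>t\<in>S. c t * t q i)) x))\<^sup>2 \<partial>lborel) < e\<^sup>2" by simp
      then show ?thesis unfolding rep_lincomb using S(1,2) by (intro exI[of _ S] exI[of _ c]) simp
    qed
  qed
  then show ?thesis
  proof (rule has_sum_cong[THEN iffD1, rotated])
    fix s assume "s \<in> B"
    then have "s ?q \<in> Fib ?q" using BV by (intro section_fibre bergman_section) blast
    then show "(cmod (ev s))\<^sup>2 = Re (herm X hm ?q (s ?q) (s ?q))"
      unfolding ev by (subst herm_self[OF tot_pt_cdom_MM[OF z]]) simp_all
  qed
qed

theorem balanced_MM: "balanced X omM LL hM m"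
  unfolding balanced_def
proof (intro conjI exI[of _ "C / real k"] ballI)
  have z: "0 \<in> Dom" using R(2) by (simp add: DD_def uu_def)
  have a: "(\<lambda>_. 0) \<in> AA" by (simp add: AA_def)
  have "esec (\<lambda>_. 0) (tot_pt k c0 0) c0 \<noteq> 0"
    using NN_pos[of "\<lambda>_. 0"] by (simp add: esec_tot_pt[OF z] flip_def zmono_def)
  moreover have "tot_pt k c0 0 \<in> points X" unfolding points_MM using tot_pt_cdom_MM[OF z] by blast
  ultimately show "\<exists>s\<in>Bsp. \<exists>q\<in>points X. \<exists>i. s q i \<noteq> 0" using esec_bergman[OF a] by blast
  show "0 < C / real k" using C k by simp
  fix q assume "q \<in> points X"
  then obtain i z where z: "z \<in> Dom" "q = tot_pt k i z" unfolding points_MM using cdom_MM by blast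
  \<comment> \<open>The monomial basis guarantees that the choice in \<open>bergman_function\<close>
    picks an actual orthonormal basis.\<close>
  have "orthonormal_basis X omM LL hM m (SOME B. orthonormal_basis X omM LL hM m B)"
    by (rule someI[of _ "esec ` AA"]) (rule orthonormal_basis_esec)
  from kernel_any_basis[OF this z(1), of i] show "bergman_function X omM LL hM m q = C / real k"
    unfolding bergman_function_def z(2) by (rule infsumI)
qed

end

section \<open>The two potentials\<close>

lemma ball_potential:
  assumes "1 \<le> k" "0 < lam"
  shows "potential_metric k {..<1} (\<lambda>x. - lam * ln (1 - x)) (\<lambda>x. lam / (1 - x)) (\<lambda>x. lam / (1 - x)\<^sup>2) (\<lambda>x. (1 - x) powr lam)"
proof
  have "smooth_on (\<lambda>x::real. 1 + - x) {..<1}"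
    by (intro smooth_on_add smooth_on_const smooth_on_bounded_linear bounded_linear_minus bounded_linear_ident) simp_all
  then have "smooth_on (\<lambda>x::real. ln (1 + - x)) {..<1}"
    by (intro smooth_on_compose_real[OF smooth_on_ln]) auto
  then have "smooth_on (\<lambda>x::real. - lam * ln (1 + - x)) {..<1}"
    by (intro smooth_on_mult smooth_on_const) simp_all
  then show "smooth_on (\<lambda>x::real. - lam * ln (1 - x)) {..<1}" by simp
  fix x :: real assume x: "x \<in> {..<1}"
  show "((\<lambda>x. - lam * ln (1 - x)) has_real_derivative lam / (1 - x)) (at x)"
    using x by (auto intro!: derivative_eq_intros simp: field_simps)
  show "((\<lambda>x. lam / (1 - x)) has_real_derivative lam / (1 - x)\<^sup>2) (at x)"
    using x by (auto intro!: derivative_eq_intros simp: power2_eq_square)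
  show "(1 - x) powr lam = exp (- (- lam * ln (1 - x)))" using x by (simp add: powr_def)
qed (use assms in auto)

text \<open>With \<open>s = 1 - t\<close> the bracket \<open>f1 + t * f2\<close> collapses to
  \<open>lam / s\<^sup>2\<close>, because \<open>s + t = 1\<close>. The powers of \<open>s\<close>
  then add up to \<open>lam * m - 1 - (r - 1) - 2 = q - 1\<close>.\<close>

lemma fib_weight_ball:
  assumes r: "1 \<le> r" and t: "0 < t" "t < 1" and q: "q = lam * real m - real r - 1"
  shows "fib_weight {..<1} (\<lambda>x. - lam * ln (1 - x)) (\<lambda>x. lam / (1 - x)) (\<lambda>x. lam / (1 - x)\<^sup>2) m r t
    = lam ^ r * (((1 - t) + lam * t) * (1 - t) powr (q - 1))"
proof -
  define s where "s = 1 - t"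
  have s: "0 < s" using t by (simp add: s_def)
  obtain n where n: "r = Suc n" using r by (cases r) auto
  have "exp (- (real m * (- lam * ln s))) = s powr ((q - 1) + real (n + 3))"
    using s unfolding q n powr_def by (simp add: algebra_simps)
  also have "\<dots> = s powr (q - 1) * s ^ (n + 3)"
    using s by (simp only: powr_add powr_realpow)
  finally have e: "exp (- (real m * (- lam * ln s))) = s powr (q - 1) * s ^ (n + 3)" .
  have "1 + t * (lam / s) = (s + lam * t) / s" "lam / s + t * (lam / s\<^sup>2) = lam / s\<^sup>2"
    using s by (simp_all add: field_simps power2_eq_square) (simp add: s_def algebra_simps)
  then have "fib_weight {..<1} (\<lambda>x. - lam * ln (1 - x)) (\<lambda>x. lam / (1 - x)) (\<lambda>x. lam / (1 - x)\<^sup>2) m r t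
    = s powr (q - 1) * s ^ (n + 3) * ((s + lam * t) / s) * (lam / s) ^ n * (lam / s\<^sup>2)"
    unfolding fib_weight_def s_def[symmetric] e n using t by simp
  also have "\<dots> = lam ^ r * ((s + lam * t) * s powr (q - 1))"
    using s by (simp add: n power_divide power_add power2_eq_square power3_eq_cube field_simps)
  finally show ?thesis by (simp only: s_def)
qed

text \<open>The weight splits into two Beta integrals with the same argument sum
  \<open>d + lam * m\<close>, hence the same Gamma denominator; adding them produces the linear
  factor \<open>q + lam * (d + r)\<close>.\<close>

lemma ball_moment:
  assumes r: "1 \<le> r" and lam: "0 < lam" and q: "q = lam * real m - real r - 1" "0 < q"
  shows "(\<integral>\<^sup>+t. indicator {0..} t * (ennreal (t ^ (d + r - 1)) *
      ennreal (fib_weight {..<1} (\<lambda>x. - lam * ln (1 - x)) (\<lambda>x. lam / (1 - x)) (\<lambda>x. lam / (1 - x)\<^sup>2) m r t)) \<partial>lborel)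
    = ennreal (lam ^ r * (fact (d + r - 1) * Gamma q * (q + lam * real (d + r)) / Gamma (real d + lam * real m)))"
proof -
  let ?p = "real (d + r)"
  define g where "g t = t powr (?p - 1) * (1 - t) powr ((q + 1) - 1) + lam * (t powr ((?p + 1) - 1) * (1 - t) powr (q - 1))" for t :: real
  have p: "0 < ?p" using r by simp
  have "(g has_integral Beta ?p (q + 1) + lam * Beta (?p + 1) q) {0..1}"
    unfolding g_def using p q(2) by (intro has_integral_add has_integral_mult_right has_integral_Beta_real) simp_all
  then have "((\<lambda>t. lam ^ r * g t) has_integral lam ^ r * (Beta ?p (q + 1) + lam * Beta (?p + 1) q)) {0..1}"
    by (rule has_integral_mult_right)
  then have 1: "(\<integral>\<^sup>+t. ennreal (lam ^ r * g t) * indicator {0..1} t \<partial>lborel) = ennreal (lam ^ r * (Beta ?p (q + 1) + lam * Beta (?p + 1) q))"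
    using lam by (intro nn_integral_has_integral_lebesgue') (simp_all add: g_def)
  have "Gamma ?p = fact (d + r - 1)"
    using r Gamma_fact[of "d + r - 1", where 'a = real] by (simp add: of_nat_diff)
  moreover have "Gamma (q + 1) = q * Gamma q" "Gamma (?p + 1) = ?p * Gamma ?p"
    using q(2) p by (auto intro!: Gamma_plus1 simp: nonpos_Ints_def)
  moreover have "?p + (q + 1) = real d + lam * real m" "?p + 1 + q = real d + lam * real m" by (simp_all add: q(1))
  ultimately have B: "Beta ?p (q + 1) + lam * Beta (?p + 1) q = fact (d + r - 1) * Gamma q * (q + lam * ?p) / Gamma (real d + lam * real m)"
    unfolding Beta_def by (simp only: add_divide_distrib[symmetric] times_divide_eq_right) (simp only: distrib_left mult_ac)
  have "(\<integral>\<^sup>+t. indicator {0..} t * (ennreal (t ^ (d + r - 1)) *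
      ennreal (fib_weight {..<1} (\<lambda>x. - lam * ln (1 - x)) (\<lambda>x. lam / (1 - x)) (\<lambda>x. lam / (1 - x)\<^sup>2) m r t)) \<partial>lborel)
    = (\<integral>\<^sup>+t. ennreal (lam ^ r * g t) * indicator {0..1} t \<partial>lborel)"
  proof (rule nn_integral_cong_AE)
    \<comment> \<open>At \<open>t = 0\<close> the sides can differ, since
      \<open>0 powr 0 = 0\<close> while \<open>0 ^ 0 = 1\<close>; the endpoints are null.\<close>
    show "AE t in lborel. indicator {0..} t * (ennreal (t ^ (d + r - 1)) *
      ennreal (fib_weight {..<1} (\<lambda>x. - lam * ln (1 - x)) (\<lambda>x. lam / (1 - x)) (\<lambda>x. lam / (1 - x)\<^sup>2) m r t))
      = ennreal (lam ^ r * g t) * indicator {0..1} t"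
      using AE_lborel_singleton[of 0] AE_lborel_singleton[of 1]
    proof eventually_elim
      fix t :: real assume t01: "t \<noteq> 0" "t \<noteq> 1"
      show "indicator {0..} t * (ennreal (t ^ (d + r - 1)) *
        ennreal (fib_weight {..<1} (\<lambda>x. - lam * ln (1 - x)) (\<lambda>x. lam / (1 - x)) (\<lambda>x. lam / (1 - x)\<^sup>2) m r t))
        = ennreal (lam ^ r * g t) * indicator {0..1} t"
      proof (cases "0 < t \<and> t < 1")
        case True
        then have t: "0 < t" "t < 1" by auto
        have "t powr (?p - 1) = t ^ (d + r - 1)"
          using t r by (subst powr_realpow[symmetric]) (simp_all add: of_nat_diff)
        moreover have "t powr (?p + 1 - 1) = t powr (?p - 1) * t"
          using t powr_add[of t "?p - 1" 1] by simp
        moreover have "(1 - t) powr (q + 1 - 1) = (1 - t) powr (q - 1) * (1 - t)"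
          using t powr_add[of "1 - t" "q - 1" 1] by simp
        ultimately have e: "lam ^ r * g t = t ^ (d + r - 1) * (lam ^ r * (((1 - t) + lam * t) * (1 - t) powr (q - 1)))"
          unfolding g_def by (simp only:) (simp add: algebra_simps)
        have "0 \<le> t ^ (d + r - 1)" using t by simp
        then show ?thesis
          unfolding fib_weight_ball[OF r t q(1)] e ennreal_mult'[OF \<open>0 \<le> t ^ (d + r - 1)\<close>] using t by simp
      next
        case False
        then show ?thesis using t01 by (auto simp: fib_weight_def split: split_indicator)
      qed
    qed
  qed
  then show ?thesis unfolding 1 B .
qed

text \<open>The binomial series with exponent \<open>- a\<close>: the generalized binomial
  coefficient is a rising factorial up to sign, that is, a quotient of Gamma values. The terms are
  nonnegative, so the series converges unordered.\<close>

lemma has_sum_binomial_series: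
  assumes a: "0 < a" and t: "0 \<le> t" "t < (1::real)"
  shows "((\<lambda>d. Gamma (real d + a) * t ^ d / fact d) has_sum Gamma a * (1 - t) powr (- a)) UNIV"
proof -
  have "(\<lambda>n. ((- a) gchoose n) * (- t) ^ n) sums (1 + - t) powr (- a)"
    using t by (intro gen_binomial_real) simp
  moreover have "((- a) gchoose n) * (- t) ^ n = Gamma (real n + a) / Gamma a * t ^ n / fact n" for n
  proof -
    have "a \<notin> \<int>\<^sub>\<le>\<^sub>0" using a by (auto elim!: nonpos_Ints_cases)
    then have "pochhammer a n = Gamma (real n + a) / Gamma a"
      by (simp add: pochhammer_Gamma add.commute)
    moreover have "(- 1) ^ n * (- t) ^ n = t ^ n" by (simp add: power_mult_distrib[symmetric])
    ultimately show ?thesis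
      unfolding gbinomial_pochhammer minus_minus by (simp add: mult_ac)
  qed
  ultimately have "(\<lambda>n. Gamma (real n + a) / Gamma a * t ^ n / fact n) sums (1 + - t) powr (- a)" by simp
  from sums_mult[OF this, of "Gamma a"]
  have "(\<lambda>n. Gamma (real n + a) * t ^ n / fact n) sums (Gamma a * (1 - t) powr (- a))"
    using Gamma_real_pos[OF a] by simp
  then show ?thesis
    using a t by (intro sums_nonneg_imp_has_sum) (auto intro!: mult_nonneg_nonneg divide_nonneg_nonneg Gamma_real_nonneg)
qed

text \<open>After cancellation the coefficients in \<open>kern\<close> are multiples of
  \<open>Gamma (d + lam * m)\<close>, so the series is the binomial series of
  \<open>(1 - t) powr (- (lam * m))\<close>, which is \<open>exp (m * f t)\<close>.\<close>

lemma ball_bergman: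
  fixes k m :: nat and c0 :: 2
  defines "lam \<equiv> real k * (real CARD('r::finite) + 1) / (real k * real CARD('r) - 1)"
  assumes k: "1 \<le> k" "1 < k * CARD('r)" and m: "CARD('r) \<le> m" and c0: "c0 < c0 + 1"
  shows "\<exists>I C. bergman TYPE('r) k {..<1} (\<lambda>x. - lam * ln (1 - x)) (\<lambda>x. lam / (1 - x)) (\<lambda>x. lam / (1 - x)\<^sup>2) (\<lambda>x. (1 - x) powr lam) m I C c0"
proof -
  let ?r = "CARD('r)"
  define Q where "Q = real k * real ?r - 1"
  have "1 < real (k * ?r)" using k(2) by linarith
  then have Q: "0 < Q" by (simp add: Q_def)
  have r: "1 \<le> ?r" using zero_less_card_finite[where 'a = 'r] by linarith
  have lam: "lam = real k * (real ?r + 1) / Q" by (simp add: lam_def Q_def)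
  have lam0: "0 < lam" unfolding lam using Q k by simp
  define q where "q = lam * real m - real ?r - 1"
  \<comment> \<open>\<open>lam * r\<close> exceeds \<open>r + 1\<close> by
    \<open>(r + 1) / Q\<close>; together with \<open>m \<ge> r\<close> this makes the Beta exponent
    \<open>q\<close> positive, so the moments are finite.\<close>
  have "lam * real ?r = (real ?r + 1) * ((Q + 1) / Q)"
    unfolding lam Q_def by (simp add: field_simps)
  also have "\<dots> = (real ?r + 1) + (real ?r + 1) / Q" using Q by (simp add: field_simps)
  finally have "real ?r + 1 < lam * real ?r" using Q by simp
  also have "\<dots> \<le> lam * real m" using lam0 m by simp
  finally have q0: "0 < q" by (simp add: q_def)
  define A where "A = lam ^ ?r * Gamma q * ((real ?r + 1) / Q)"
  have A: "0 < A" unfolding A_def using lam0 q0 Q by (simp add: Gamma_real_pos)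
  have a: "0 < lam * real m" using q0 by (simp add: q_def)
  define I where "I d = A * (fact (d + ?r - 1) * real (k * (m + d) + 1)) / Gamma (real d + lam * real m)" for d
  have G: "0 < Gamma (real d + lam * real m)" for d using a by (intro Gamma_real_pos) simp
  have I: "lam ^ ?r * (fact (d + ?r - 1) * Gamma q * (q + lam * real (d + ?r)) / Gamma (real d + lam * real m)) = I d" for d
  proof -
    \<comment> \<open>Here the value of \<open>lam\<close> matters: the linear factor of the moment
      becomes a constant multiple of \<open>k * (m + d) + 1\<close>, which cancels in
      \<open>kern\<close>.\<close>
    have "q + lam * real (d + ?r) = lam * (real m + real d + real ?r) - (real ?r + 1)" by (simp add: q_def algebra_simps)
    also have "\<dots> = (real ?r + 1) / Q * (real k * (real m + real d + real ?r) - Q)"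
      unfolding lam using Q by (simp add: field_simps)
    also have "real k * (real m + real d + real ?r) - Q = real (k * (m + d) + 1)" by (simp add: Q_def algebra_simps)
    finally show ?thesis unfolding I_def A_def by simp
  qed
  have "bergman TYPE('r) k {..<1} (\<lambda>x. - lam * ln (1 - x)) (\<lambda>x. lam / (1 - x)) (\<lambda>x. lam / (1 - x)\<^sup>2) (\<lambda>x. (1 - x) powr lam) m I (Gamma (lam * real m) / A) c0"
  proof (intro bergman.intro ball_potential k lam0 bergman_axioms.intro c0)
    show "continuous_on {..<1} (\<lambda>x. lam / (1 - x)\<^sup>2)" by (auto intro!: continuous_intros)
    have "0 < real (k * (m + d) + 1)" for d by (simp only: of_nat_0_less_iff add_gr_0 zero_less_one simp_thms)
    then show "0 < I d" for d unfolding I_def by (intro divide_pos_pos mult_pos_pos A G fact_gt_zero)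
    show "(\<integral>\<^sup>+t. indicator {0..} t * (ennreal (t ^ (d + ?r - 1)) *
      ennreal (fib_weight {..<1} (\<lambda>x. - lam * ln (1 - x)) (\<lambda>x. lam / (1 - x)) (\<lambda>x. lam / (1 - x)\<^sup>2) m ?r t)) \<partial>lborel) = ennreal (I d)" for d
      unfolding I[symmetric] by (rule ball_moment[OF r lam0 q_def q0])
    show "0 < Gamma (lam * real m) / A" using A a by (simp add: Gamma_real_pos)
    fix t :: real assume t: "t \<in> {..<1}" "0 \<le> t"
    have "((\<lambda>d. 1 / A * (Gamma (real d + lam * real m) * t ^ d / fact d)) has_sum 1 / A * (Gamma (lam * real m) * (1 - t) powr (- (lam * real m)))) UNIV"
      using t a by (intro has_sum_cmult_right has_sum_binomial_series) auto
    also have "1 / A * (Gamma (lam * real m) * (1 - t) powr (- (lam * real m))) = Gamma (lam * real m) / A * exp (real m * (- lam * ln (1 - t)))"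
      using t by (simp add: powr_def mult_ac)
    finally show "((\<lambda>d. fact (d + ?r - 1) * real (k * (m + d) + 1) / I d * t ^ d / fact d) has_sum
      Gamma (lam * real m) / A * exp (real m * (- lam * ln (1 - t)))) UNIV"
    proof (rule has_sum_cong[THEN iffD1, rotated])
      fix d
      have alg: "x / (A * x / g) = g / A" if "x \<noteq> 0" for x g :: real using that by simp
      have "fact (d + ?r - 1) * real (k * (m + d) + 1) \<noteq> 0"
        by (simp only: mult_eq_0_iff fact_nonzero of_nat_eq_0_iff) simp
      then have "fact (d + ?r - 1) * real (k * (m + d) + 1) / I d = Gamma (real d + lam * real m) / A"
        unfolding I_def by (rule alg)
      then show "1 / A * (Gamma (real d + lam * real m) * t ^ d / fact d) = fact (d + ?r - 1) * real (k * (m + d) + 1) / I d * t ^ d / fact d"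
        by simp
    qed
  qed
  then show ?thesis by blast
qed

section \<open>The linear potential on the whole total space\<close>

lemma nn_integral_power_exp:
  assumes a: "0 < a"
  shows "(\<integral>\<^sup>+t. indicator {0..} t * ennreal (t ^ n * exp (- (a * t))) \<partial>lborel) = ennreal (fact n / a ^ (n + 1))"
proof -
  let ?g = "\<lambda>t::real. ennreal (t powr (real n + 1 - 1) / exp t) * indicator {0..} t"
  have "((\<lambda>t. t powr (real n + 1 - 1) / exp t) has_integral Gamma (real n + 1)) {0..}"
    by (rule Gamma_integral_real) simp
  then have "(\<integral>\<^sup>+t. ?g t \<partial>lborel) = ennreal (Gamma (real n + 1))"
    by (intro nn_integral_has_integral_lebesgue') simp_all
  also have "Gamma (real n + 1) = fact n" using Gamma_fact[of n, where 'a = real] by (simp add: add.commute)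
  finally have 1: "ennreal (fact n) = ennreal a * (\<integral>\<^sup>+t. ?g (0 + a * t) \<partial>lborel)"
    using nn_integral_real_affine[of ?g a 0] a by simp
  have "(\<integral>\<^sup>+t. ?g (0 + a * t) \<partial>lborel) = (\<integral>\<^sup>+t. ennreal (a ^ n) * (indicator {0..} t * ennreal (t ^ n * exp (- (a * t)))) \<partial>lborel)"
  \<comment> \<open>At \<open>t = 0\<close> the sides differ when \<open>n = 0\<close>, because
    \<open>0 powr 0 = 0\<close>.\<close>
  proof (rule nn_integral_cong_AE)
    show "AE t in lborel. ?g (0 + a * t) = ennreal (a ^ n) * (indicator {0..} t * ennreal (t ^ n * exp (- (a * t))))"
      using AE_lborel_singleton[of 0]
    proof eventually_elim
      fix t :: real assume "t \<noteq> 0"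
      show "?g (0 + a * t) = ennreal (a ^ n) * (indicator {0..} t * ennreal (t ^ n * exp (- (a * t))))"
      proof (cases "0 < t")
        case True
        then have "(a * t) powr real n = a ^ n * t ^ n" using a by (simp add: powr_realpow power_mult_distrib)
        then show ?thesis using True a
          by (simp add: exp_minus inverse_eq_divide ennreal_mult''[symmetric])
      next
        case False
        then have "t < 0" using \<open>t \<noteq> 0\<close> by simp
        then show ?thesis using a by (simp add: mult_less_0_iff not_le indicator_def zero_le_mult_iff)
      qed
    qed
  qed
  also have "\<dots> = ennreal (a ^ n) * (\<integral>\<^sup>+t. indicator {0..} t * ennreal (t ^ n * exp (- (a * t))) \<partial>lborel)"
    by (rule nn_integral_cmult) measurable
  finally have 2: "ennreal (fact n) = ennreal (a ^ (n + 1)) * (\<integral>\<^sup>+t. indicator {0..} t * ennreal (t ^ n * exp (- (a * t))) \<partial>lborel)"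
    unfolding 1 using a by (simp add: ennreal_mult mult_ac)
  have "ennreal (1 / a ^ (n + 1)) * ennreal (a ^ (n + 1)) = 1"
    using a by (simp add: ennreal_mult''[symmetric])
  then have "ennreal (1 / a ^ (n + 1)) * ennreal (fact n) = (\<integral>\<^sup>+t. indicator {0..} t * ennreal (t ^ n * exp (- (a * t))) \<partial>lborel)"
    unfolding 2 mult.assoc[symmetric] by (simp only: mult_1_left)
  moreover have "ennreal (1 / a ^ (n + 1)) * ennreal (fact n) = ennreal (fact n / a ^ (n + 1))"
    using a by (subst ennreal_mult[symmetric]) simp_all
  ultimately show ?thesis by simp
qed

lemma flat_potential:
  assumes "0 < c"
  shows "potential_metric 1 UNIV (\<lambda>x. c * x) (\<lambda>x. c) (\<lambda>x. 0) (\<lambda>x. exp (- c * x))"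
proof
  show "smooth_on (\<lambda>x::real. c * x) UNIV"
    by (intro smooth_on_bounded_linear bounded_linear_mult_right open_UNIV)
qed (use assms in \<open>auto intro!: derivative_eq_intros\<close>)

text \<open>With \<open>r = 1\<close> the weight is \<open>c * (1 + c * t)\<close> times an
  exponential, so a moment is a sum of two Gamma integrals, proportional to \<open>m\<close> and to
  \<open>d + 1\<close>. Together they give the factor \<open>m + d + 1\<close>, which is
  \<open>k * (m + d) + 1\<close> for \<open>k = 1\<close>; after it cancels, \<open>kern\<close> is
  the exponential series.\<close>

lemma flat_bergman:
  fixes m :: nat and c0 :: 2
  assumes r: "CARD('r::finite) = 1" and c: "0 < c" and m: "1 \<le> m" and c0: "c0 < c0 + 1"
  shows "\<exists>I C. bergman TYPE('r) 1 UNIV (\<lambda>x. c * x) (\<lambda>x. c) (\<lambda>x. 0) (\<lambda>x. exp (- c * x)) m I C c0"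
proof -
  define a where "a = real m * c"
  have a: "0 < a" using c m by (simp add: a_def)
  have m0: "0 < real m" using m by simp
  define I where "I d = fact d * real (m + d + 1) / ((real m)\<^sup>2 * a ^ d)" for d
  have "bergman TYPE('r) 1 UNIV (\<lambda>x. c * x) (\<lambda>x. c) (\<lambda>x. 0) (\<lambda>x. exp (- c * x)) m I ((real m)\<^sup>2) c0"
  proof (intro bergman.intro flat_potential c bergman_axioms.intro c0)
    show "0 < I d" for d unfolding I_def using a m0 by (intro divide_pos_pos mult_pos_pos) auto
    show "(\<integral>\<^sup>+t. indicator {0..} t * (ennreal (t ^ (d + CARD('r) - 1)) *
      ennreal (fib_weight UNIV (\<lambda>x. c * x) (\<lambda>x. c) (\<lambda>x. 0) m CARD('r) t)) \<partial>lborel) = ennreal (I d)" for d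
    proof -
      let ?h = "\<lambda>n t. indicator {0..} t * ennreal (t ^ n * exp (- (a * t)))"
      have "(\<integral>\<^sup>+t. indicator {0..} t * (ennreal (t ^ (d + CARD('r) - 1)) *
          ennreal (fib_weight UNIV (\<lambda>x. c * x) (\<lambda>x. c) (\<lambda>x. 0) m CARD('r) t)) \<partial>lborel)
        = (\<integral>\<^sup>+t. ennreal c * ?h d t + ennreal (c\<^sup>2) * ?h (d + 1) t \<partial>lborel)"
      proof (rule nn_integral_cong)
        fix t :: real
        show "indicator {0..} t * (ennreal (t ^ (d + CARD('r) - 1)) * ennreal (fib_weight UNIV (\<lambda>x. c * x) (\<lambda>x. c) (\<lambda>x. 0) m CARD('r) t))
          = ennreal c * ?h d t + ennreal (c\<^sup>2) * ?h (d + 1) t"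
        proof (cases "0 \<le> t")
          case True
          have "t ^ d * fib_weight UNIV (\<lambda>x. c * x) (\<lambda>x. c) (\<lambda>x. 0) m CARD('r) t
            = c * (t ^ d * exp (- (a * t))) + c\<^sup>2 * (t ^ (d + 1) * exp (- (a * t)))"
            by (simp add: fib_weight_def r a_def power2_eq_square algebra_simps)
          moreover have "ennreal (c * x + c\<^sup>2 * y) = ennreal c * ennreal x + ennreal (c\<^sup>2) * ennreal y" if "0 \<le> x" "0 \<le> y" for x y
            using that c by (simp add: ennreal_plus[symmetric] ennreal_mult[symmetric] del: ennreal_plus)
          ultimately show ?thesis
            using True by (simp add: r ennreal_mult'[symmetric])
        qed simp
      qed
      also have "\<dots> = ennreal c * (\<integral>\<^sup>+t. ?h d t \<partial>lborel) + ennreal (c\<^sup>2) * (\<integral>\<^sup>+t. ?h (d + 1) t \<partial>lborel)"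
        by (subst nn_integral_add) (simp_all add: nn_integral_cmult)
      also have "\<dots> = ennreal (c * (fact d / a ^ (d + 1)) + c\<^sup>2 * (fact (d + 1) / a ^ (d + 1 + 1)))"
        unfolding nn_integral_power_exp[OF a] using a c
        by (simp add: ennreal_plus[symmetric] ennreal_mult[symmetric] del: ennreal_plus fact_Suc)
      also have "c * (fact d / a ^ (d + 1)) + c\<^sup>2 * (fact (d + 1) / a ^ (d + 1 + 1)) = I d"
      proof -
        have "c * (fact d / a ^ (d + 1)) = fact d * real m / ((real m)\<^sup>2 * a ^ d)"
          using c m0 by (simp add: a_def power2_eq_square)
        moreover have "c\<^sup>2 * (fact (d + 1) / a ^ (d + 1 + 1)) = fact d * real (d + 1) / ((real m)\<^sup>2 * a ^ d)"
          using c m0 by (simp add: a_def power2_eq_square mult_ac)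
        ultimately show ?thesis unfolding I_def by (simp add: add_divide_distrib[symmetric] algebra_simps)
      qed
      finally show ?thesis .
    qed
    show "0 < (real m)\<^sup>2" using m0 by simp
    fix t :: real
    assume "0 \<le> t"
    have "(\<lambda>d. (real m)\<^sup>2 * ((a * t) ^ d /\<^sub>R fact d)) sums ((real m)\<^sup>2 * exp (a * t))"
      by (intro sums_mult exp_converges)
    then have "((\<lambda>d. (real m)\<^sup>2 * ((a * t) ^ d /\<^sub>R fact d)) has_sum (real m)\<^sup>2 * exp (a * t)) UNIV"
      using a \<open>0 \<le> t\<close> by (intro sums_nonneg_imp_has_sum) auto
    then have "((\<lambda>d. fact (d + CARD('r) - 1) * real (1 * (m + d) + 1) / I d * t ^ d / fact d) has_sum (real m)\<^sup>2 * exp (a * t)) UNIV"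
    proof (rule has_sum_cong[THEN iffD1, rotated])
      fix d
      have "x / (x / (y * z)) = y * z" if "x \<noteq> 0" for x y z :: real using that by simp
      from this[of "fact d * real (m + d + 1)" "(real m)\<^sup>2" "a ^ d"]
      have "fact d * real (m + d + 1) / I d = (real m)\<^sup>2 * a ^ d"
        unfolding I_def by simp
      then show "(real m)\<^sup>2 * ((a * t) ^ d /\<^sub>R fact d) = fact (d + CARD('r) - 1) * real (1 * (m + d) + 1) / I d * t ^ d / fact d"
        by (simp add: r power_mult_distrib field_simps)
    qed
    then show "((\<lambda>d. fact (d + CARD('r) - 1) * real (1 * (m + d) + 1) / I d * t ^ d / fact d) has_sum (real m)\<^sup>2 * exp (real m * (c * t))) UNIV"
      by (simp add: a_def mult.assoc)
  qed simp
  then show ?thesis by blast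
qed

text \<open>The pieces in \<open>vol_integral\<close> depend on the order of the index type, so the
  smaller of the two indices is obtained by cases.\<close>

lemma ordered_chart: obtains c0 :: 2 where "c0 < c0 + 1"
proof (cases "(0::2) < 1")
  case True
  then show ?thesis using that[of 0] by simp
next
  case False
  then have "(1::2) < 0" by (metis linorder_neqE zero_neq_one)
  moreover have "(0::2) = 1 + 1" using two_cases[of 0 1] by (metis zero_neq_one)
  ultimately have "(1::2) < 1 + 1" by (simp only:)
  then show ?thesis by (rule that)
qed

lemma submanifold_UNIV: "submanifold M UNIV = M"
  by (cases M) (simp add: submanifold_def)

theorem corollary1p3:
  fixes k :: nat and c :: real
    and E :: "((complex ^ 2) set \<times> (2 \<Rightarrow> complex ^ 'r::finite), 2, 1 + 'r) cmanifold"
    and L :: "((complex ^ 2) set \<times> (2 \<Rightarrow> complex ^ 'r), 2) line_bundle"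
    and h :: "(complex ^ 2) set \<times> (2 \<Rightarrow> complex ^ 'r) \<Rightarrow> real"
    and pL :: "((complex ^ 2) set \<times> (2 \<Rightarrow> complex ^ 'r), 2) metric"
  defines "E \<equiv> sum_bundle CP1 (\<lambda>_. bundle_dual (bundle_power hyperplane_bundle k))"
    and "h \<equiv> sum_metric CP1 (\<lambda>_. metric_dual (metric_power h_FS k))"
    and "L \<equiv> bundle_pullback fst (bundle_power hyperplane_bundle k)"
    and "pL \<equiv> metric_pullback fst (metric_power h_FS k)"
  assumes "k \<ge> 1"
  shows "(k * CARD('r) > 1 \<longrightarrow>
           (let lam = real k * (real CARD('r) + 1) / (real k * real CARD('r) - 1);
                M = submanifold E {v. h v < 1};
                hF = metric_scale (\<lambda>v. (1 - h v) powr lam) pL;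
                omF = chern_form M hF
            in quantum_line_bundle M omF L hF \<and>
               (\<forall>m\<ge>CARD('r). balanced M omF L hF m)))
       \<and> (c > 0 \<and> k = 1 \<and> CARD('r) = 1 \<longrightarrow>
           (let hF = metric_scale (\<lambda>v. exp (- c * h v)) pL;
                omF = chern_form E hF
            in quantum_line_bundle E omF L hF \<and>
               (\<forall>m\<ge>1. balanced E omF L hF m)))"
proof (intro conjI impI)
  obtain c0 :: 2 where c0: "c0 < c0 + 1" by (rule ordered_chart)
  {
    assume k: "k * CARD('r) > 1"
    define lam where "lam = real k * (real CARD('r) + 1) / (real k * real CARD('r) - 1)"
    have "1 < real (k * CARD('r))" using k by linarith
    then have lam: "0 < lam" using \<open>k \<ge> 1\<close> by (simp add: lam_def)
    interpret ball: potential_metric k "{..<1}" "\<lambda>x. - lam * ln (1 - x)" "\<lambda>x. lam / (1 - x)" "\<lambda>x. lam / (1 - x)\<^sup>2" "\<lambda>x. (1 - x) powr lam"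
      by (rule ball_potential[OF \<open>k \<ge> 1\<close> lam])
    have M: "submanifold E {v. h v < 1} = ball.MM"
      by (simp add: ball.MM_def E_def h_def total_space_def sq_norm_def)
    have hF: "metric_scale (\<lambda>v. (1 - h v) powr lam) pL = ball.hM"
      unfolding ball.hM_def h_def pL_def sq_norm_def ..
    have L: "L = ball.LL" unfolding L_def ball.LL_def ..
    have "balanced (ball.MM :: ('r tot, 2, 1 + 'r) cmanifold) ball.omM ball.LL ball.hM m" if m: "CARD('r) \<le> m" for m
    proof -
      obtain I C where "bergman TYPE('r) k {..<1} (\<lambda>x. - lam * ln (1 - x)) (\<lambda>x. lam / (1 - x)) (\<lambda>x. lam / (1 - x)\<^sup>2) (\<lambda>x. (1 - x) powr lam) m I C c0"
        using ball_bergman[OF \<open>k \<ge> 1\<close> k m c0] unfolding lam_def[symmetric] by blast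
      then interpret bergman k "{..<1}" "\<lambda>x. - lam * ln (1 - x)" "\<lambda>x. lam / (1 - x)" "\<lambda>x. lam / (1 - x)\<^sup>2" "\<lambda>x. (1 - x) powr lam" "TYPE('r)" m I C c0 .
      show ?thesis by (rule balanced_MM)
    qed
    then show "let lam = real k * (real CARD('r) + 1) / (real k * real CARD('r) - 1);
                M = submanifold E {v. h v < 1};
                hF = metric_scale (\<lambda>v. (1 - h v) powr lam) pL;
                omF = chern_form M hF
            in quantum_line_bundle M omF L hF \<and> (\<forall>m\<ge>CARD('r). balanced M omF L hF m)"
      unfolding Let_def lam_def[symmetric] M hF L ball.omM_def[symmetric]
      using ball.quantum_line_bundle_MM by blast
  next
    assume c: "c > 0 \<and> k = 1 \<and> CARD('r) = 1"
    then have c': "0 < c" "k = 1" "CARD('r) = 1" by auto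
    interpret flat: potential_metric 1 UNIV "\<lambda>x. c * x" "\<lambda>x. c" "\<lambda>x. 0" "\<lambda>x. exp (- c * x)"
      by (rule flat_potential[OF c'(1)])
    \<comment> \<open>For \<open>R = UNIV\<close> the condition on the squared norm is empty and the
      submanifold is the whole total space.\<close>
    have M: "E = flat.MM"
      unfolding flat.MM_def E_def total_space_def c'(2) by (simp only: submanifold_UNIV UNIV_I Collect_const simp_thms if_True)
    have hF: "metric_scale (\<lambda>v. exp (- c * h v)) pL = flat.hM"
      unfolding flat.hM_def h_def pL_def sq_norm_def c'(2) ..
    have L: "L = flat.LL" unfolding L_def flat.LL_def c'(2) ..
    have "balanced (flat.MM :: ('r tot, 2, 1 + 'r) cmanifold) flat.omM flat.LL flat.hM m" if m: "1 \<le> m" for m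
    proof -
      obtain I C where "bergman TYPE('r) 1 UNIV (\<lambda>x. c * x) (\<lambda>x. c) (\<lambda>x. 0) (\<lambda>x. exp (- c * x)) m I C c0"
        using flat_bergman[OF c'(3,1) m c0] by blast
      then interpret bergman 1 UNIV "\<lambda>x. c * x" "\<lambda>x. c" "\<lambda>x. 0" "\<lambda>x. exp (- c * x)" "TYPE('r)" m I C c0 .
      show ?thesis by (rule balanced_MM)
    qed
    then show "let hF = metric_scale (\<lambda>v. exp (- c * h v)) pL;
                omF = chern_form E hF
            in quantum_line_bundle E omF L hF \<and> (\<forall>m\<ge>1. balanced E omF L hF m)"
      unfolding Let_def hF L unfolding M flat.omM_def[symmetric]
      using flat.quantum_line_bundle_MM by blast
  }
qed


end
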